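(* Let $w$ be a non-negative integer and $z\in\mathbb{C}$ with $|\operatorname{Re}(z)|<2w+1$. Suppose there exist functions $f(t,z,w)$ and $F(s,z,w)$ such that: (i) $F(s,z,w)=F(1-s,z,w)$; (ii) for $-w\pm\operatorname{Re}(\frac z2)<\operatorname{Re}(s)<1+w\pm\operatorname{Re}(\frac z2)$, the Mellin transform of $f$ is $$\int_0^\infty t^{s-1}f(t,z,w)\,dt=F(s,z,w)\,\zeta\!\left(1-s-\tfrac z2\right)\zeta\!\left(1-s+\tfrac z2\right)\left(\tfrac s2-\tfrac z4\right)_{\frac w2}\left(\tfrac s2+\tfrac z4\right)_{\frac w2}$$ if $w$ is even, and $$\int_0^\infty t^{s-1}f(t,z,w)\,dt=\frac{F(s,z,w)}{2\left(\cos\frac{\pi z}{2}+\cos(\pi s)\right)}\zeta\!\left(1-s-\tfrac z2\right)\zeta\!\left(1-s+\tfrac z2\right)\left(\tfrac s2-\tfrac z4+\tfrac12\right)_{\frac{w-1}2}\left(\tfrac s2+\tfrac z4+\tfrac12\right)_{\frac{w-1}2}$$ if $w$ is odd; (iii) this Mellin transform $M[f;s]$, $s=c+it$, satisfies $t\mapsto M[f;1-c-it]\in L^1(-\infty,\infty)$. Then for $x>0$, $$f(x,z,w)=2\pi\int_0^\infty f(t,z,w)\,\mathscr{G}_{\frac z2}(4\pi^2xt,w)\,dt.$$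
   Context: $\zeta$ is the Riemann zeta function, $(a)_n=\Gamma(a+n)/\Gamma(a)$. The notation $A\pm B<C<D\pm E$ means both inequalities hold for each choice of sign. For $x>0$, $\nu\in\mathbb{C}\setminus(\mathbb{Z}\setminus\{0\})$, $w\in\mathbb{C}$, $$\mathscr{G}_{\nu}(x,w):=\frac{\pi}{\sin(\nu\pi)}\left(\frac{x}{4}\right)^w\Bigg[\left(\frac{x}{4}\right)^{-\nu}\frac{{}_0F_3\!\left(-;1-\nu,w+\tfrac12,w+\tfrac12-\nu;\tfrac{x^2}{16}\right)}{\Gamma(1-\nu)\Gamma(w+\frac12)\Gamma(w+\frac12-\nu)}-\left(\frac{x}{4}\right)^{\nu}\frac{{}_0F_3\!\left(-;1+\nu,w+\tfrac12,w+\tfrac12+\nu;\tfrac{x^2}{16}\right)}{\Gamma(1+\nu)\Gamma(w+\frac12)\Gamma(w+\frac12+\nu)}\Bigg],$$ each quotient understood as the entire function of the parameters, and $\mathscr{G}_0(x,w):=\lim_{\nu\to0}\mathscr{G}_\nu(x,w)$.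
   Formalization: Since changing f at a single point leaves (i)-(iii) intact but breaks the formula there, the identity is asserted at every x>0 where f is continuous and for almost every x>0; the integral converges for every x>0; (iii) is assumed for every c in the strip. *)

theory Defs
  imports "HOL-Complex_Analysis.Complex_Analysis"
begin

text \<open>
  The Riemann zeta function as the analytic continuation of its Dirichlet series to the
  punctured plane. The value at the pole is fixed (to 0) only to make the description unique.
\<close>
definition riemann_zeta :: "complex \<Rightarrow> complex" where
  "riemann_zeta =
     (THE f. f holomorphic_on (- {1}) \<and>
             (\<forall>s. Re s > 1 \<longrightarrow> f s = (\<Sum>n. 1 / of_nat (Suc n) powr s)) \<and>
             f 1 = 0)"

definition hypergeo_0F3 :: "complex \<Rightarrow> complex \<Rightarrow> complex \<Rightarrow> complex \<Rightarrow> complex" where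
  "hypergeo_0F3 a b c y =
     (\<Sum>k. y ^ k / (pochhammer a k * pochhammer b k * pochhammer c k * fact k))"

text \<open>
  The quotient of \<open>hypergeo_0F3 a b c y\<close> by \<open>Gamma a * Gamma b * Gamma c\<close>, as an entire function
  of the parameters: \<open>rGamma\<close> is the entire reciprocal Gamma function.
\<close>
definition hypergeo_0F3_reg :: "complex \<Rightarrow> complex \<Rightarrow> complex \<Rightarrow> complex \<Rightarrow> complex" where
  "hypergeo_0F3_reg a b c y =
     (\<Sum>k. y ^ k * rGamma (a + of_nat k) * rGamma (b + of_nat k) * rGamma (c + of_nat k) / fact k)"

lemma rGamma_plus_nat:
  fixes a :: complex
  assumes "a \<notin> \<int>\<^sub>\<le>\<^sub>0"
  shows "rGamma (a + of_nat k) = 1 / (pochhammer a k * Gamma a)"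
  using assms pochhammer_rGamma[of a k]
  by (auto simp: field_simps rGamma_inverse_Gamma pochhammer_Gamma Gamma_eq_zero_iff)

lemma summable_hypergeo_0F3:
  "summable (\<lambda>k. y ^ k / (pochhammer a k * pochhammer b k * pochhammer c k * fact k) :: complex)"
proof -
  have large: "norm (a + of_nat k) \<ge> 1" if "real k \<ge> norm a + 1" for a :: complex and k
    using that norm_triangle_ineq4[of "a + of_nat k" a] by simp
  define N where "N = nat \<lceil>norm a + norm b + norm c + 2 * norm y + 1\<rceil>"
  have "norm (y ^ Suc k / (pochhammer a (Suc k) * pochhammer b (Suc k) * pochhammer c (Suc k) * fact (Suc k)))
      \<le> 1 / 2 * norm (y ^ k / (pochhammer a k * pochhammer b k * pochhammer c k * fact k))"
    (is "norm (?u (Suc k)) \<le> _ * norm (?u k)") if "k \<ge> N" for k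
  proof -
    have k: "real k \<ge> norm a + norm b + norm c + 2 * norm y + 1"
      using that unfolding N_def by linarith
    have la: "norm (a + of_nat k) \<ge> 1" and lb: "norm (b + of_nat k) \<ge> 1"
      and lc: "norm (c + of_nat k) \<ge> 1"
      using k by (intro large; smt (verit) norm_ge_zero)+
    have "1 * 1 \<le> norm (a + of_nat k) * norm (b + of_nat k)"
      by (intro mult_mono la lb) simp_all
    then have "1 * 1 \<le> norm (a + of_nat k) * norm (b + of_nat k) * norm (c + of_nat k)"
      using lc by (intro mult_mono) simp_all
    moreover have k1: "2 * norm y + 1 \<le> real (Suc k)"
    proof -
      have "0 \<le> norm a + norm b + norm c" by simp
      then show ?thesis using k unfolding of_nat_Suc by linarith
    qed
    ultimately have "1 * (2 * norm y + 1) \<le>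
        norm (a + of_nat k) * norm (b + of_nat k) * norm (c + of_nat k) * real (Suc k)"
      by (intro mult_mono) simp_all
    then have d: "2 * norm y + 1 \<le>
        norm ((a + of_nat k) * (b + of_nat k) * (c + of_nat k) * of_nat (Suc k))"
      (is "_ \<le> norm ?d")
      by (simp add: norm_mult del: of_nat_Suc)
    have pos: "norm ?d > 0" using d norm_ge_zero[of y] by linarith
    have "norm y / norm ?d \<le> 1 / 2"
      using d pos by (simp add: divide_simps del: of_nat_Suc)
    moreover have "?u (Suc k) = y / ?d * ?u k"
      by (simp add: pochhammer_Suc mult_ac del: of_nat_Suc)
    ultimately show ?thesis
      by (simp only: norm_mult norm_divide mult_right_mono norm_ge_zero zero_le_divide_iff
            zero_le_mult_iff simp_thms)
  qed
  then show ?thesis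
    by (intro summable_ratio_test[of "1 / 2" N]) auto
qed

lemma hypergeo_0F3_reg_eq:
  assumes "a \<notin> \<int>\<^sub>\<le>\<^sub>0" "b \<notin> \<int>\<^sub>\<le>\<^sub>0" "c \<notin> \<int>\<^sub>\<le>\<^sub>0"
  shows "hypergeo_0F3_reg a b c y = hypergeo_0F3 a b c y / (Gamma a * Gamma b * Gamma c)"
proof -
  have nz: "Gamma a * Gamma b * Gamma c \<noteq> 0"
    using assms by (simp add: Gamma_eq_zero_iff)
  have eq: "y ^ k * rGamma (a + of_nat k) * rGamma (b + of_nat k) * rGamma (c + of_nat k) / fact k
      = inverse (Gamma a * Gamma b * Gamma c) *
        (y ^ k / (pochhammer a k * pochhammer b k * pochhammer c k * fact k))" for k
    using assms by (simp add: rGamma_plus_nat divide_simps)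
  have "summable (\<lambda>k. y ^ k / (pochhammer a k * pochhammer b k * pochhammer c k * fact k))"
    by (rule summable_hypergeo_0F3)
  then show ?thesis
    unfolding hypergeo_0F3_reg_def hypergeo_0F3_def eq
    by (subst suminf_mult) (simp_all add: field_simps)
qed

definition G_kernel_generic :: "complex \<Rightarrow> real \<Rightarrow> complex \<Rightarrow> complex" where
  "G_kernel_generic \<nu> x w =
     of_real pi / sin (\<nu> * of_real pi) * of_real (x / 4) powr w *
     (of_real (x / 4) powr (- \<nu>) *
        hypergeo_0F3_reg (1 - \<nu>) (w + 1/2) (w + 1/2 - \<nu>) (of_real (x\<^sup>2 / 16))
      - of_real (x / 4) powr \<nu> *
        hypergeo_0F3_reg (1 + \<nu>) (w + 1/2) (w + 1/2 + \<nu>) (of_real (x\<^sup>2 / 16)))"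

text \<open>
  The formula is undefined (its denominator vanishes) exactly at the integers. There the
  function is the limit, not only at \<open>\<nu> = 0\<close> but at every integer, all of which are removable
  singularities.
\<close>
definition G_kernel :: "complex \<Rightarrow> real \<Rightarrow> complex \<Rightarrow> complex" where
  "G_kernel \<nu> x w =
     (if \<nu> \<in> \<int> then Lim (at \<nu>) (\<lambda>\<mu>. G_kernel_generic \<mu> x w) else G_kernel_generic \<nu> x w)"

text \<open>
  Integrals over the half-line are Henstock-Kurzweil integrals; they include the absolutely
  convergent Lebesgue integrals and the conditionally convergent improper ones.
\<close>
definition mellin_integrand :: "(real \<Rightarrow> complex) \<Rightarrow> complex \<Rightarrow> real \<Rightarrow> complex" where
  "mellin_integrand f s t = of_real t powr (s - 1) * f t"

definition mellin :: "(real \<Rightarrow> complex) \<Rightarrow> complex \<Rightarrow> complex" where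
  "mellin f s = integral {0<..} (mellin_integrand f s)"

definition mellin_strip :: "nat \<Rightarrow> complex \<Rightarrow> complex set" where
  "mellin_strip w z =
     {s. - real w + Re (z / 2) < Re s \<and> - real w - Re (z / 2) < Re s \<and>
         Re s < 1 + real w + Re (z / 2) \<and> Re s < 1 + real w - Re (z / 2)}"

end

(*
  On the Mellin side the theorem is the functional equation
    M(s) = pi^(1 - 2 s) K(s / 2) M(1 - s),
  K(S) = Gamma(S + p) Gamma(S + q) / (Gamma(1/2 + p - S) Gamma(1/2 + q - S)) with p = (w - nu) / 2,
  q = (w + nu) / 2 and nu = z / 2, which follows from the functional equation of zeta and the
  reflection formula. The kernel X -> G_nu(4 X, w) is the sum of the residues of K(S) X^(-2 S) to the
  left of the contour, so its Mellin integral over (0, T) at s equals K(s / 2) / 2 up to an error that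
  tends to 0 as T grows, uniformly on a vertical line with Re s < 1/2. Inserting the Mellin inversion
  formula for f on the line 1 - Re s, Fubini on (0, b) and letting b tend to infinity give f again.

  As f is only gauge integrable, Mellin inversion is applied not to f but to the primitive P of
  t^(c - 1) f(t): integration by parts turns M(s) / (c - s) into the Fourier transform of an
  absolutely integrable continuous function, and f is recovered from P by differentiation.
*)

theory Submission
  imports Defs "HOL-Probability.Characteristic_Functions"
begin

section \<open>Complex powers of a positive base and Mellin integrals\<close>

text \<open>The condition Re s < 1/2 reflects the growth of K: on Re S = \<sigma> it is bounded by a
  multiple of (1 + |t|)^(-(1 - 4 \<sigma>)), which decays for \<sigma> < 1/4; divided by S0 - S it
  is then integrable, uniformly in Im S0. The bound on Re z leaves room for such a line, because the
  strip is symmetric about 1/2 and its left edge is |Re \<nu>| - w. For integral \<nu> the two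
  sequences of poles of K overlap and the kernel is defined by a limit. No double poles are
  computed: the estimates are proved for non-integral orders with constants uniform near \<nu>, and
  integral orders follow by the maximum modulus principle and dominated convergence. Only quotients
  of Gamma values have to be estimated. Conjugating one argument makes the difference of the two
  arguments bounded on a vertical line, and Euler's product then gives explicit bounds. As
  \<open>riemann_zeta\<close> is a definite description, the continued function is constructed, from
  the Mellin transform of 1 / (e^x - 1), whose Laurent terms at 0 and partial fractions yield the
  continuation and the functional equation.\<close>

definition cpow :: "real \<Rightarrow> complex \<Rightarrow> complex" where
  "cpow x s = exp (s * of_real (ln x))"

lemma cpow_eq_powr: "x > 0 \<Longrightarrow> of_real x powr s = cpow x s"
  by (simp add: cpow_def powr_def Ln_of_real mult.commute)

lemma norm_cpow: "x > 0 \<Longrightarrow> norm (cpow x s) = x powr Re s"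
  by (simp add: cpow_def powr_def)

text \<open>\<open>cpow\<close> is an exponential of the real logarithm, so it is total, never zero
  and entire in the exponent. Laws in the exponent hold for every real base; only laws in the base,
  such as \<open>cpow_mult\<close>, need positivity.\<close>

lemma cpow_add: "cpow x (s + t) = cpow x s * cpow x t"
  by (simp add: cpow_def exp_add distrib_right)

lemma cpow_mult: "x > 0 \<Longrightarrow> y > 0 \<Longrightarrow> cpow (x * y) s = cpow x s * cpow y s"
  by (simp add: cpow_def ln_mult exp_add distrib_left)

lemma cpow_inverse: "cpow x (- s) = inverse (cpow x s)"
  by (simp add: cpow_def exp_minus)

lemma cpow_inverse_base: "x > 0 \<Longrightarrow> cpow (1 / x) s = cpow x (- s)"
  by (simp add: cpow_def ln_div)

lemma cpow_0 [simp]: "cpow x 0 = 1"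
  by (simp add: cpow_def)

lemma cpow_1 [simp]: "x > 0 \<Longrightarrow> cpow x 1 = of_real x"
  by (simp add: cpow_def exp_of_real)

lemma cpow_one_left [simp]: "cpow 1 s = 1"
  by (simp add: cpow_def)

lemma cpow_nz [simp]: "cpow x s \<noteq> 0"
  by (simp add: cpow_def)

lemma cpow_of_real: "x > 0 \<Longrightarrow> cpow x (of_real a) = of_real (x powr a)"
  by (simp add: cpow_def powr_def flip: exp_of_real)

lemma cpow_of_nat: "x > 0 \<Longrightarrow> cpow x (of_nat n) = of_real (x ^ n)"
  using cpow_of_real[of x "real n"] by (simp add: powr_realpow)

lemma cpow_minus_1: "x > 0 \<Longrightarrow> of_real x * cpow x (s - 1) = cpow x s"
  using cpow_add[of x 1 "s - 1"] by simp

lemma cpow_power: "x > 0 \<Longrightarrow> cpow (x ^ n) s = cpow x (of_nat n * s)"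
  by (simp add: cpow_def ln_realpow mult_ac)

lemma cpow_measurable [measurable]:
  assumes [measurable]: "f \<in> borel_measurable M" "g \<in> borel_measurable M"
  shows "(\<lambda>x. cpow (f x) (g x)) \<in> borel_measurable M"
  unfolding cpow_def by measurable

lemma cpow_holomorphic [holomorphic_intros]:
  assumes "f holomorphic_on A"
  shows "(\<lambda>s. cpow x (f s)) holomorphic_on A"
  unfolding cpow_def by (intro holomorphic_intros assms)

lemma continuous_cpow [continuous_intros]:
  assumes "continuous_on A f" "continuous_on A g" "\<And>x. x \<in> A \<Longrightarrow> f x > 0"
  shows "continuous_on A (\<lambda>x. cpow (f x) (g x))"
  unfolding cpow_def using assms(1,2) by (intro continuous_intros) (auto dest: assms(3))

lemma cpow_has_vector_derivative:
  assumes "x > 0"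
  shows "((\<lambda>x. cpow x s) has_vector_derivative s * cpow x (s - 1)) (at x within A)"
proof -
  have "((\<lambda>x. s * of_real (ln x)) has_vector_derivative s * of_real (1 / x)) (at x)"
    by (intro derivative_eq_intros has_vector_derivative_mult_right has_vector_derivative_of_real)
       (use assms in \<open>auto simp flip: has_real_derivative_iff_has_vector_derivative intro!: derivative_eq_intros\<close>)
  then have "((\<lambda>x. exp (s * of_real (ln x))) has_vector_derivative (s * of_real (1 / x)) * exp (s * of_real (ln x))) (at x)"
    using field_vector_diff_chain_at[where g = exp, OF _ DERIV_exp] by (fastforce simp: o_def)
  moreover have "(s * of_real (1 / x)) * exp (s * of_real (ln x)) = s * cpow x (s - 1)"
    using cpow_minus_1[of x s] assms unfolding cpow_def by (simp add: field_simps)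
  ultimately show ?thesis unfolding cpow_def by (metis has_vector_derivative_at_within)
qed

lemma set_integrable_mellin_scale:
  assumes "a > 0"
    and "set_integrable lborel {0<..} (\<lambda>x. cpow x (s - 1) * \<psi> x)"
  shows "set_integrable lborel {0<..} (\<lambda>x. cpow x (s - 1) * \<psi> (a * x))"
    and "(LBINT x:{0<..}. cpow x (s - 1) * \<psi> (a * x)) = cpow a (- s) * (LBINT x:{0<..}. cpow x (s - 1) * \<psi> x)"
proof -
  define g where "g x = indicator {0<..} x *\<^sub>R (cpow x (s - 1) * \<psi> x)" for x
  have g: "integrable lborel g" using assms(2) unfolding set_integrable_def g_def .
  have eq: "indicator {0<..} x *\<^sub>R (cpow x (s - 1) * \<psi> (a * x)) = cpow a (1 - s) * g (0 + a * x)" for x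
    using assms(1) cpow_inverse[of a "s - 1"]
    by (auto simp: g_def indicator_def zero_less_mult_iff cpow_mult)
  show "set_integrable lborel {0<..} (\<lambda>x. cpow x (s - 1) * \<psi> (a * x))"
    unfolding set_integrable_def eq using assms(1)
    by (intro integrable_mult_right lborel_integrable_real_affine g) auto
  have "(LBINT x:{0<..}. cpow x (s - 1) * \<psi> (a * x)) = cpow a (1 - s) * (LINT x|lborel. g (0 + a * x))"
    unfolding set_lebesgue_integral_def eq by simp
  also have "(LINT x|lborel. g (0 + a * x)) = (1 / a) *\<^sub>R (LINT x|lborel. g x)"
    using lborel_integral_real_affine[of a g 0] assms(1) by simp
  also have "cpow a (1 - s) * ((1 / a) *\<^sub>R (LINT x|lborel. g x)) = cpow a (- s) * (LINT x|lborel. g x)"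
    using cpow_add[of a 1 "- s"] assms(1) by (simp add: scaleR_conv_of_real)
  finally show "(LBINT x:{0<..}. cpow x (s - 1) * \<psi> (a * x)) = cpow a (- s) * (LBINT x:{0<..}. cpow x (s - 1) * \<psi> x)"
    unfolding set_lebesgue_integral_def g_def .
qed

text \<open>\<open>norm (cpow x s)\<close> depends on Re s alone, so absolute convergence of a
  Mellin integral is a question about real exponents.\<close>

lemma set_integrable_mellin_iff_norm:
  assumes [measurable]: "\<psi> \<in> borel_measurable borel"
  shows "set_integrable lborel {0<..} (\<lambda>x. cpow x s * \<psi> x) \<longleftrightarrow>
         set_integrable lborel {0<..} (\<lambda>x. x powr Re s * norm (\<psi> x))"
  (is "?A \<longleftrightarrow> ?B")
proof -
  have n: "norm (indicat_real {0<..} x *\<^sub>R (cpow x s * \<psi> x)) = norm (indicat_real {0<..} x *\<^sub>R (x powr Re s * norm (\<psi> x)))" for x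
    by (auto simp: indicator_def norm_mult norm_cpow)
  show ?thesis
    unfolding set_integrable_def
    by (intro iffI; erule Bochner_Integration.integrable_bound) (simp_all only: n order_refl AE_I2, measurable)
qed

text \<open>Expanding x^w as the series of (w ln x)^n / n! under the integral at s = z + w exhibits
  the transform as a power series on a disc around each point z.\<close>

lemma mellin_transform_holomorphic:
  fixes \<psi> :: "real \<Rightarrow> complex"
  assumes [measurable]: "\<psi> \<in> borel_measurable borel"
    and int: "\<And>\<sigma>. a < \<sigma> \<Longrightarrow> \<sigma> < b \<Longrightarrow> set_integrable lborel {0<..} (\<lambda>x. x powr (\<sigma> - 1) * norm (\<psi> x))"
  shows "(\<lambda>s. LBINT x:{0<..}. cpow x (s - 1) * \<psi> x) holomorphic_on {s. a < Re s \<and> Re s < b}"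
proof -
  define M where "M s = (LBINT x:{0<..}. cpow x (s - 1) * \<psi> x)" for s
  have "\<exists>e>0. M holomorphic_on ball z e" if z: "a < Re z" "Re z < b" for z
  proof -
    \<comment> \<open>Half the distance to the edges, so that Re z + r and Re z - r both stay inside
      the strip.\<close>
    define r where "r = min (Re z - a) (b - Re z) / 2"
    have r: "r > 0" "a < Re z - r" "Re z + r < b" using z unfolding r_def by (auto simp: min_def field_simps)
    define f where "f n x = indicator {0<..} x *\<^sub>R (cpow x (z - 1) * \<psi> x * of_real (ln x) ^ n / fact n)" for n x
    have [measurable]: "f n \<in> borel_measurable borel" for n unfolding f_def by measurable
    \<comment> \<open>\<open>G\<close> dominates every partial sum: the absolute series adds up to
      at most e^(r |ln x|), which is one of the two powers x^r and x^(-r).\<close>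
    define G where "G x = indicator {0<..} x *\<^sub>R (x powr (Re z + r - 1) * norm (\<psi> x)) + indicator {0<..} x *\<^sub>R (x powr (Re z - r - 1) * norm (\<psi> x))" for x
    have G: "integrable lborel G"
      unfolding G_def using int[of "Re z + r"] int[of "Re z - r"] r z
      by (intro Bochner_Integration.integrable_add) (auto simp: set_integrable_def)
    have bd: "(\<Sum>n<N. norm (f n x * w ^ n)) \<le> G x" if w: "norm w < r" for w x N
    proof (cases "x > 0")
      case True
      have "(\<Sum>n<N. norm (f n x * w ^ n)) = x powr (Re z - 1) * norm (\<psi> x) * (\<Sum>n<N. (norm w * \<bar>ln x\<bar>) ^ n / fact n)"
        using True by (simp add: f_def norm_mult norm_divide norm_power norm_cpow sum_distrib_left power_mult_distrib mult_ac)
      also have "(\<Sum>n<N. (norm w * \<bar>ln x\<bar>) ^ n / fact n) \<le> exp (norm w * \<bar>ln x\<bar>)"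
        unfolding exp_def using summable_exp[of "norm w * \<bar>ln x\<bar>"]
        by (auto simp: divide_inverse mult.commute intro!: sum_le_suminf)
      also have "\<dots> \<le> exp (r * \<bar>ln x\<bar>)" using w by (simp add: mult_right_mono)
      also have "\<dots> \<le> x powr r + x powr (- r)"
        using True by (cases "ln x \<ge> 0") (simp_all add: powr_def)
      also have "x powr (Re z - 1) * norm (\<psi> x) * (x powr r + x powr (- r)) = G x"
        using True by (simp add: G_def algebra_simps flip: powr_add)
      finally show ?thesis by (simp add: mult_left_mono)
    qed (simp add: f_def G_def)
    have sums: "(\<lambda>n. f n x * w ^ n) sums (indicator {0<..} x *\<^sub>R (cpow x (z + w - 1) * \<psi> x))" for x w
    proof -
      have "(\<lambda>n. (w * of_real (ln x)) ^ n /\<^sub>R fact n) sums exp (w * of_real (ln x))" by (rule exp_converges)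
      then have "(\<lambda>n. indicator {0<..} x *\<^sub>R (cpow x (z - 1) * \<psi> x) * ((w * of_real (ln x)) ^ n /\<^sub>R fact n)) sums
         (indicator {0<..} x *\<^sub>R (cpow x (z - 1) * \<psi> x) * exp (w * of_real (ln x)))" by (rule sums_mult)
      moreover have "indicator {0<..} x *\<^sub>R (cpow x (z - 1) * \<psi> x) * exp (w * of_real (ln x)) =
         indicator {0<..} x *\<^sub>R (cpow x (z + w - 1) * \<psi> x)"
        using cpow_add[of x "z - 1" w] by (simp add: cpow_def algebra_simps)
      moreover have "indicator {0<..} x *\<^sub>R (cpow x (z - 1) * \<psi> x) * ((w * of_real (ln x)) ^ n /\<^sub>R fact n) = f n x * w ^ n" for n
        by (simp add: f_def power_mult_distrib scaleR_conv_of_real divide_inverse mult_ac)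
      ultimately show ?thesis by (simp only:)
    qed
    have "((\<lambda>n. (LINT x|lborel. f n x) * (s - z) ^ n) sums M s)" if s: "s \<in> ball z r" for s
    proof -
      define w where "w = s - z"
      have w: "norm w < r" using s by (simp add: w_def dist_norm norm_minus_commute)
      have int1: "integrable lborel (\<lambda>x. f n x * w ^ n)" for n
      proof (rule Bochner_Integration.integrable_bound[OF G])
        show "AE x in lborel. norm (f n x * w ^ n) \<le> norm (G x)"
        proof (rule AE_I2)
          fix x
          have "norm (f n x * w ^ n) \<le> (\<Sum>n<Suc n. norm (f n x * w ^ n))" by (simp add: sum_nonneg)
          also have "\<dots> \<le> G x" by (rule bd[OF w])
          finally show "norm (f n x * w ^ n) \<le> norm (G x)" by simp
        qed
      qed measurable
      have "(\<lambda>N. LINT x|lborel. (\<Sum>n<N. f n x * w ^ n)) \<longlonglongrightarrow> (LINT x|lborel. indicator {0<..} x *\<^sub>R (cpow x (z + w - 1) * \<psi> x))"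
      proof (rule integral_dominated_convergence[where w = G])
        show "AE x in lborel. (\<lambda>N. \<Sum>n<N. f n x * w ^ n) \<longlonglongrightarrow> indicator {0<..} x *\<^sub>R (cpow x (z + w - 1) * \<psi> x)"
          using sums by (auto simp: sums_def)
        show "AE x in lborel. norm (\<Sum>n<N. f n x * w ^ n) \<le> G x" for N
          using bd[OF w] by (intro AE_I2 order.trans[OF norm_sum])
      qed (use G in measurable)
      moreover have "(LINT x|lborel. (\<Sum>n<N. f n x * w ^ n)) = (\<Sum>n<N. (LINT x|lborel. f n x) * w ^ n)" for N
        by (subst Bochner_Integration.integral_sum[OF int1]) simp
      moreover have "(LINT x|lborel. indicator {0<..} x *\<^sub>R (cpow x (z + w - 1) * \<psi> x)) = M s"
        by (simp add: M_def set_lebesgue_integral_def w_def)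
      ultimately show ?thesis by (simp add: sums_def w_def)
    qed
    then have "M holomorphic_on ball z r"
      by (intro power_series_holomorphic)
    with r show ?thesis by auto
  qed
  then have "M analytic_on {s. a < Re s \<and> Re s < b}"
    by (auto simp: analytic_on_def)
  then show ?thesis unfolding M_def by (rule analytic_imp_holomorphic)
qed

lemma Gamma_mellin_integral:
  assumes "Re s > 0"
  shows "set_integrable lborel {0<..} (\<lambda>t. cpow t (s - 1) * of_real (exp (- t)))"
    and "(LBINT t:{0<..}. cpow t (s - 1) * of_real (exp (- t))) = Gamma s"
proof -
  have eq: "of_real t powr (s - 1) / of_real (exp t) = cpow t (s - 1) * of_real (exp (- t))" if "t > 0" for t
    using that by (simp add: cpow_eq_powr exp_minus divide_inverse)
  have "set_integrable lebesgue {0<..} (\<lambda>t. cpow t (s - 1) * of_real (exp (- t)))"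
    using absolutely_integrable_Gamma_integral'[OF assms] eq
    by (subst set_integrable_cong[of _ lebesgue "{0<..}" _ _ "\<lambda>t. of_real t powr (s - 1) / of_real (exp t)"]) auto
  then show i: "set_integrable lborel {0<..} (\<lambda>t. cpow t (s - 1) * of_real (exp (- t)))"
    unfolding set_integrable_def by (subst (asm) integrable_completion) auto
  have "((\<lambda>t. cpow t (s - 1) * of_real (exp (- t))) has_integral Gamma s) {0<..}"
    using Gamma_integral_complex'[OF assms] by (rule has_integral_eq[rotated]) (simp add: eq)
  then show "(LBINT t:{0<..}. cpow t (s - 1) * of_real (exp (- t))) = Gamma s"
    using set_borel_integral_eq_integral(2)[OF i] by (simp add: integral_unique)
qed

lemma Gamma_mellin_integral_scaled:
  assumes "Re s > 0" "a > 0"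
  shows "set_integrable lborel {0<..} (\<lambda>t. cpow t (s - 1) * of_real (exp (- (a * t))))"
    and "(LBINT t:{0<..}. cpow t (s - 1) * of_real (exp (- (a * t)))) = cpow a (- s) * Gamma s"
  using set_integrable_mellin_scale[OF assms(2) Gamma_mellin_integral(1)[OF assms(1)]]
  by (simp_all add: Gamma_mellin_integral(2)[OF assms(1)])

section \<open>The functional equation of the zeta function\<close>

lemma set_integrable_square_substitution:
  fixes h :: "real \<Rightarrow> complex"
  assumes [measurable]: "h \<in> borel_measurable borel"
    and h: "set_integrable lborel {0<..} h"
  shows "set_integrable lborel {0<..} (\<lambda>x. of_real (2 * x) * h (x\<^sup>2))"
    and "(LBINT x:{0<..}. of_real (2 * x) * h (x\<^sup>2)) = (LBINT x:{0<..}. h x)"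
proof -
  have img: "(\<lambda>x::real. x\<^sup>2) ` {0<..} = {0<..}"
  proof (intro equalityI subsetI)
    fix y :: real assume "y \<in> {0<..}"
    then have "y = (sqrt y)\<^sup>2" "sqrt y \<in> {0<..}" by auto
    then show "y \<in> (\<lambda>x::real. x\<^sup>2) ` {0<..}" by blast
  qed auto
  have inj: "inj_on (\<lambda>x::real. x\<^sup>2) {0<..}"
    by (intro inj_onI) (auto simp: power2_eq_iff)
  have sub: "set_integrable lborel {0<..} (\<lambda>x. 2 * x * g (x\<^sup>2)) \<and>
      (LBINT x:{0<..}. 2 * x * g (x\<^sup>2)) = (LBINT x:{0<..}. g x)"
    if [measurable]: "g \<in> borel_measurable borel" and g: "set_integrable lborel {0<..} g" for g :: "real \<Rightarrow> real"
  proof -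
    have *: "set_integrable lebesgue {0<..} k \<longleftrightarrow> set_integrable lborel {0<..} k"
      if [measurable]: "k \<in> borel_measurable borel" for k :: "real \<Rightarrow> real"
      unfolding set_integrable_def by (rule integrable_completion) measurable
    have "(\<lambda>x. \<bar>2 * x\<bar> * g (x\<^sup>2)) absolutely_integrable_on {0<..} \<and>
           integral {0<..} (\<lambda>x. \<bar>2 * x\<bar> * g (x\<^sup>2)) = integral {0<..} g"
    proof -
      have "((\<lambda>x. x\<^sup>2) has_real_derivative 2 * x) (at x within {0<..})" for x :: real
        by (auto intro!: derivative_eq_intros)
      then show ?thesis
        using has_absolute_integral_change_of_variables_1'[of "{0<..}" "\<lambda>x. x\<^sup>2" "\<lambda>x. 2 * x" g "integral {0<..} g"]
          g inj unfolding img by (auto simp: *)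
    qed
    moreover have "set_integrable lborel {0<..} (\<lambda>x. \<bar>2 * x\<bar> * g (x\<^sup>2)) = set_integrable lborel {0<..} (\<lambda>x. 2 * x * g (x\<^sup>2))"
      by (intro set_integrable_cong) auto
    moreover have "integral {0<..} (\<lambda>x. \<bar>2 * x\<bar> * g (x\<^sup>2)) = integral {0<..} (\<lambda>x. 2 * x * g (x\<^sup>2))"
      by (intro Henstock_Kurzweil_Integration.integral_cong) auto
    ultimately have i: "set_integrable lborel {0<..} (\<lambda>x. 2 * x * g (x\<^sup>2))"
      and e: "integral {0<..} (\<lambda>x. 2 * x * g (x\<^sup>2)) = integral {0<..} g"
      by (simp_all add: *)
    then show ?thesis
      using set_borel_integral_eq_integral(2)[OF i] set_borel_integral_eq_integral(2)[OF g] by simp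
  qed
  have gR: "set_integrable lborel {0<..} (\<lambda>x. Re (h x))" and gI: "set_integrable lborel {0<..} (\<lambda>x. Im (h x))"
    using integrable_Re[OF h[unfolded set_integrable_def]] integrable_Im[OF h[unfolded set_integrable_def]]
    by (simp_all add: set_integrable_def)
  have R: "set_integrable lborel {0<..} (\<lambda>x. 2 * x * Re (h (x\<^sup>2)))"
      "(LBINT x:{0<..}. 2 * x * Re (h (x\<^sup>2))) = (LBINT x:{0<..}. Re (h x))"
    using sub[OF _ gR] by simp_all
  have I: "set_integrable lborel {0<..} (\<lambda>x. 2 * x * Im (h (x\<^sup>2)))"
      "(LBINT x:{0<..}. 2 * x * Im (h (x\<^sup>2))) = (LBINT x:{0<..}. Im (h x))"
    using sub[OF _ gI] by simp_all
  show i: "set_integrable lborel {0<..} (\<lambda>x. of_real (2 * x) * h (x\<^sup>2))"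
  proof -
    have "integrable lborel (\<lambda>x. complex_of_real (indicator {0<..} x *\<^sub>R (2 * x * Re (h (x\<^sup>2)))) + \<i> * complex_of_real (indicator {0<..} x *\<^sub>R (2 * x * Im (h (x\<^sup>2)))))"
      using R(1) I(1) unfolding set_integrable_def
      by (intro Bochner_Integration.integrable_add integrable_mult_right integrable_of_real)
    moreover have "complex_of_real (indicator {0<..} x *\<^sub>R (2 * x * Re (h (x\<^sup>2)))) + \<i> * complex_of_real (indicator {0<..} x *\<^sub>R (2 * x * Im (h (x\<^sup>2))))
      = indicator {0<..} x *\<^sub>R (of_real (2 * x) * h (x\<^sup>2))" for x
      by (simp add: complex_eq_iff)
    ultimately show ?thesis unfolding set_integrable_def by simp
  qed
  have "Re (LBINT x:{0<..}. of_real (2 * x) * h (x\<^sup>2)) = (LBINT x:{0<..}. 2 * x * Re (h (x\<^sup>2)))"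
    "Im (LBINT x:{0<..}. of_real (2 * x) * h (x\<^sup>2)) = (LBINT x:{0<..}. 2 * x * Im (h (x\<^sup>2)))"
    using i unfolding set_integrable_def set_lebesgue_integral_def
    by (simp_all flip: integral_Re integral_Im)
  moreover have "Re (LBINT x:{0<..}. h x) = (LBINT x:{0<..}. Re (h x))" "Im (LBINT x:{0<..}. h x) = (LBINT x:{0<..}. Im (h x))"
    using h unfolding set_integrable_def set_lebesgue_integral_def
    by (simp_all flip: integral_Re integral_Im)
  ultimately show "(LBINT x:{0<..}. of_real (2 * x) * h (x\<^sup>2)) = (LBINT x:{0<..}. h x)"
    using R I by (simp add: complex_eq_iff)
qed

text \<open>Write 1 / (1 + y) as the integral of e^(-v (1 + y)) over v > 0 and exchange the order.
  The integral in y is v^(-a) Gamma a times e^(-v), and what remains in v is the integral for Gamma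
  (1 - a).\<close>

lemma mellin_one_over_one_plus:
  assumes "0 < Re a" "Re a < 1"
  shows "set_integrable lborel {0<..} (\<lambda>y. cpow y (a - 1) * of_real (1 / (1 + y)))"
    and "(LBINT y:{0<..}. cpow y (a - 1) * of_real (1 / (1 + y))) = Gamma a * Gamma (1 - a)"
proof -
  define f where "f v y = indicator {0<..} v *\<^sub>R (indicator {0<..} y *\<^sub>R (cpow y (a - 1) * of_real (exp (- (v * (1 + y))))))" for v y :: real
  have inner_y: "indicator {0<..} v *\<^sub>R (LINT y|lborel. indicator {0<..} y *\<^sub>R (cpow y (s - 1) * of_real (exp (- (v * (1 + y)))))) =
      indicator {0<..} v *\<^sub>R (cpow v ((1 - s) - 1) * of_real (exp (- v)) * Gamma s)" 
    "v > 0 \<Longrightarrow> integrable lborel (\<lambda>y. indicator {0<..} y *\<^sub>R (cpow y (s - 1) * of_real (exp (- (v * (1 + y))))))"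
    if s: "Re s > 0" for v :: real and s
  proof -
    have eq: "indicator {0<..} y *\<^sub>R (cpow y (s - 1) * of_real (exp (- (v * (1 + y))))) =
       of_real (exp (- v)) * (indicator {0<..} y *\<^sub>R (cpow y (s - 1) * of_real (exp (- (v * y)))))" for y
    proof -
      have "exp (- (v * (1 + y))) = exp (- v) * exp (- (v * y))" by (simp add: algebra_simps flip: exp_add)
      then show ?thesis by (simp add: indicator_def mult_ac)
    qed
    show "indicator {0<..} v *\<^sub>R (LINT y|lborel. indicator {0<..} y *\<^sub>R (cpow y (s - 1) * of_real (exp (- (v * (1 + y)))))) =
      indicator {0<..} v *\<^sub>R (cpow v ((1 - s) - 1) * of_real (exp (- v)) * Gamma s)"
    proof (cases "v > 0")
      case True
      have "(LINT y|lborel. indicator {0<..} y *\<^sub>R (cpow y (s - 1) * of_real (exp (- (v * (1 + y)))))) =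
        of_real (exp (- v)) * (LBINT y:{0<..}. cpow y (s - 1) * of_real (exp (- (v * y))))"
        unfolding eq set_lebesgue_integral_def by (rule integral_mult_right_zero)
      then show ?thesis using True Gamma_mellin_integral_scaled(2)[OF s True] by (simp add: mult_ac)
    qed simp
    show "integrable lborel (\<lambda>y. indicator {0<..} y *\<^sub>R (cpow y (s - 1) * of_real (exp (- (v * (1 + y))))))" if "v > 0"
      unfolding eq using Gamma_mellin_integral_scaled(1)[OF s that] unfolding set_integrable_def
      by (rule integrable_mult_right)
  qed
  \<comment> \<open>The absolute value is the same integrand with \<open>a\<close> replaced by Re a,
    so the iterated absolute integral is again evaluated by \<open>inner_y\<close>.\<close>
  have int: "integrable (lborel \<Otimes>\<^sub>M lborel) (\<lambda>(v, y). f v y)"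
  proof (rule lborel_pair.Fubini_integrable)
    have n: "norm (f v y) = norm (indicator {0<..} v *\<^sub>R (indicator {0<..} y *\<^sub>R (cpow y (of_real (Re a) - 1) * of_real (exp (- (v * (1 + y)))))))" for v y
      by (auto simp: f_def indicator_def norm_mult norm_cpow)
    have n': "norm (f v y) = Re (indicator {0<..} v *\<^sub>R (indicator {0<..} y *\<^sub>R (cpow y (of_real (Re a) - 1) * of_real (exp (- (v * (1 + y)))))))" for v y
      using cpow_of_real[of y "Re a - 1"] by (auto simp: n indicator_def norm_mult)
    have i: "integrable lborel (\<lambda>y. indicator {0<..} v *\<^sub>R (indicator {0<..} y *\<^sub>R (cpow y (of_real (Re a) - 1) * of_real (exp (- (v * (1 + y)))))))" for v
      using inner_y(2)[of "of_real (Re a)" v] assms by (cases "v > 0") auto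
    have "(\<lambda>v. LINT y|lborel. norm (f v y)) = (\<lambda>v. Re (indicator {0<..} v *\<^sub>R (cpow v ((1 - of_real (Re a)) - 1) * of_real (exp (- v)) * Gamma (of_real (Re a)))))"
    proof
      fix v
      have "(LINT y|lborel. norm (f v y)) = Re (LINT y|lborel. indicator {0<..} v *\<^sub>R (indicator {0<..} y *\<^sub>R (cpow y (of_real (Re a) - 1) * of_real (exp (- (v * (1 + y)))))))"
        unfolding n' by (rule integral_Re[OF i])
      also have "(LINT y|lborel. indicator {0<..} v *\<^sub>R (indicator {0<..} y *\<^sub>R (cpow y (of_real (Re a) - 1) * of_real (exp (- (v * (1 + y))))))) =
        indicator {0<..} v *\<^sub>R (LINT y|lborel. (indicator {0<..} y *\<^sub>R (cpow y (of_real (Re a) - 1) * of_real (exp (- (v * (1 + y)))))))"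
        by (rule integral_scaleR_right)
      also have "\<dots> = indicator {0<..} v *\<^sub>R (cpow v ((1 - of_real (Re a)) - 1) * of_real (exp (- v)) * Gamma (of_real (Re a)))"
        by (rule inner_y(1)) (use assms in simp)
      finally show "(LINT y|lborel. norm (f v y)) = Re (indicator {0<..} v *\<^sub>R (cpow v ((1 - of_real (Re a)) - 1) * of_real (exp (- v)) * Gamma (of_real (Re a))))" .
    qed
    moreover have "integrable lborel (\<lambda>v. Re (indicator {0<..} v *\<^sub>R (cpow v ((1 - of_real (Re a)) - 1) * of_real (exp (- v)) * Gamma (of_real (Re a)))))"
    proof -
      have "integrable lborel (\<lambda>v. indicator {0<..} v *\<^sub>R (cpow v ((1 - of_real (Re a)) - 1) * of_real (exp (- v))) * Gamma (of_real (Re a)))"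
        using Gamma_mellin_integral(1)[of "1 - of_real (Re a)"] assms unfolding set_integrable_def
        by (intro integrable_mult_left) simp
      then show ?thesis by (intro integrable_Re) simp
    qed
    ultimately show "integrable lborel (\<lambda>x. LINT y|lborel. norm (case (x, y) of (v, y) \<Rightarrow> f v y))" by simp
    show "AE x in lborel. integrable lborel (\<lambda>y. case (x, y) of (v, y) \<Rightarrow> f v y)"
      using inner_y(2)[of a] assms by (intro AE_I2) (auto simp: f_def indicator_def)
    show "(\<lambda>(v, y). f v y) \<in> borel_measurable (lborel \<Otimes>\<^sub>M lborel)" unfolding f_def by measurable
  qed
  have inner_v: "(LINT v|lborel. f v y) = indicator {0<..} y *\<^sub>R (cpow y (a - 1) * of_real (1 / (1 + y)))" for y
  proof (cases "y > 0")
    case True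
    have eq: "f v y = cpow y (a - 1) * (indicator {0<..} v *\<^sub>R (cpow v (1 - 1) * of_real (exp (- ((1 + y) * v)))))" for v
      using True by (simp add: f_def mult.commute indicator_def)
    have "(LINT v|lborel. f v y) = cpow y (a - 1) * (LBINT v:{0<..}. cpow v (1 - 1) * of_real (exp (- ((1 + y) * v))))"
      unfolding eq set_lebesgue_integral_def by (rule integral_mult_right_zero)
    also have "(LBINT v:{0<..}. cpow v (1 - 1) * of_real (exp (- ((1 + y) * v)))) = of_real (1 / (1 + y))"
      using Gamma_mellin_integral_scaled(2)[of 1 "1 + y"] True cpow_inverse[of "1 + y" 1] by (simp add: inverse_eq_divide)
    finally show ?thesis using True by simp
  qed (simp add: f_def)
  have swap: "(LINT v|lborel. LINT y|lborel. f v y) = (LINT y|lborel. LINT v|lborel. f v y)"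
    using lborel_pair.Fubini_integral[OF int] by simp
  show "set_integrable lborel {0<..} (\<lambda>y. cpow y (a - 1) * of_real (1 / (1 + y)))"
    using lborel_pair.integrable_snd[OF int] unfolding set_integrable_def inner_v .
  have "(LBINT y:{0<..}. cpow y (a - 1) * of_real (1 / (1 + y))) = (LINT v|lborel. LINT y|lborel. f v y)"
    unfolding swap inner_v set_lebesgue_integral_def ..
  also have "\<dots> = (LINT v|lborel. indicator {0<..} v *\<^sub>R (cpow v ((1 - a) - 1) * of_real (exp (- v))) * Gamma a)"
  proof (intro Bochner_Integration.integral_cong refl)
    fix v
    have "(LINT y|lborel. f v y) = indicator {0<..} v *\<^sub>R (LINT y|lborel. indicator {0<..} y *\<^sub>R (cpow y (a - 1) * of_real (exp (- (v * (1 + y))))))"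
      unfolding f_def by (rule integral_scaleR_right)
    also have "\<dots> = indicator {0<..} v *\<^sub>R (cpow v ((1 - a) - 1) * of_real (exp (- v)) * Gamma a)"
      by (rule inner_y(1)) (use assms in simp)
    finally show "(LINT y|lborel. f v y) = indicator {0<..} v *\<^sub>R (cpow v ((1 - a) - 1) * of_real (exp (- v))) * Gamma a"
      by simp
  qed
  also have "\<dots> = (LBINT v:{0<..}. cpow v ((1 - a) - 1) * of_real (exp (- v))) * Gamma a"
    unfolding set_lebesgue_integral_def by (rule integral_mult_left_zero)
  also have "\<dots> = Gamma a * Gamma (1 - a)"
    using Gamma_mellin_integral(2)[of "1 - a"] assms by simp
  finally show "(LBINT y:{0<..}. cpow y (a - 1) * of_real (1 / (1 + y))) = Gamma a * Gamma (1 - a)" .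
qed

text \<open>Squaring the variable reduces this to the transform of 1 / (1 + y) at a = (s + 1) / 2,
  and the reflection formula evaluates it because sin (pi a) = cos (pi s / 2).\<close>

lemma mellin_x_over_one_plus_square:
  assumes "-1 < Re s" "Re s < 1"
  shows "set_integrable lborel {0<..} (\<lambda>x. cpow x (s - 1) * of_real (2 * x / (1 + x\<^sup>2)))"
    and "(LBINT x:{0<..}. cpow x (s - 1) * of_real (2 * x / (1 + x\<^sup>2))) = of_real pi / cos (of_real pi * s / 2)"
proof -
  define a where "a = (s + 1) / 2"
  have a: "0 < Re a" "Re a < 1" using assms by (simp_all add: a_def)
  have eq: "of_real (2 * x) * (cpow (x\<^sup>2) (a - 1) * of_real (1 / (1 + x\<^sup>2))) = cpow x (s - 1) * of_real (2 * x / (1 + x\<^sup>2))" if "x > 0" for x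
  proof -
    have "of_nat 2 * (a - 1) = s - 1" by (simp add: a_def)
    then have "cpow (x\<^sup>2) (a - 1) = cpow x (s - 1)" using that cpow_power[of x 2 "a - 1"] by simp
    then show ?thesis by simp
  qed
  note S = set_integrable_square_substitution[OF _ mellin_one_over_one_plus(1)[OF a]]
  show "set_integrable lborel {0<..} (\<lambda>x. cpow x (s - 1) * of_real (2 * x / (1 + x\<^sup>2)))"
    using S(1) by (subst set_integrable_cong[OF refl refl eq[symmetric]]) auto
  have "(LBINT x:{0<..}. cpow x (s - 1) * of_real (2 * x / (1 + x\<^sup>2))) = Gamma a * Gamma (1 - a)"
  proof -
    have "(LBINT x:{0<..}. cpow x (s - 1) * of_real (2 * x / (1 + x\<^sup>2))) =
      (LBINT x:{0<..}. of_real (2 * x) * (cpow (x\<^sup>2) (a - 1) * of_real (1 / (1 + x\<^sup>2))))"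
      by (intro set_lebesgue_integral_cong allI impI eq[symmetric]) auto
    then show ?thesis using S(2) unfolding mellin_one_over_one_plus(2)[OF a] by simp
  qed
  also have "\<dots> = of_real pi / sin (of_real pi * a)" by (rule Gamma_reflection_complex)
  also have "sin (of_real pi * a) = cos (of_real pi * s / 2)"
    using sin_cos_eq[of "of_real pi * s / 2 + of_real pi / 2"] by (simp add: a_def sin_cos_eq field_simps flip: cos_minus[of "of_real pi * s / 2"])
  finally show "(LBINT x:{0<..}. cpow x (s - 1) * of_real (2 * x / (1 + x\<^sup>2))) = of_real pi / cos (of_real pi * s / 2)" .
qed

text \<open>These are the partial fractions of pi cot (pi z) on the imaginary axis. The logarithmic
  derivative of the reflection formula gives Digamma (1 - z) - Digamma z, and the Digamma series
  supplies the terms.\<close>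

lemma bose_partial_fractions:
  fixes x :: real
  assumes "x > 0"
  shows "(\<lambda>n. 2 * x / (x\<^sup>2 + (2 * pi * real (Suc n))\<^sup>2)) sums (1 / (exp x - 1) - 1 / x + 1 / 2)"
proof -
  \<comment> \<open>The choice z = i x / (2 pi) gives e^(2 pi i z) = e^(-x), so the cotangent
    becomes a rational function of e^x.\<close>
  define y where "y = x / (2 * pi)"
  define z where "z = \<i> * of_real y"
  have y: "y > 0" using assms by (simp add: y_def)
  have nonint: "w \<notin> \<int>\<^sub>\<le>\<^sub>0" if "Im w \<noteq> 0" for w :: complex
    using that by (auto elim!: nonpos_Ints_cases)
  have z: "z \<notin> \<int>\<^sub>\<le>\<^sub>0" "1 - z \<notin> \<int>\<^sub>\<le>\<^sub>0" "1 + z \<noteq> 0" "1 - z \<noteq> 0" "z \<noteq> 0"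
    using nonint[of z] nonint[of "1 - z"] y by (auto simp: z_def complex_eq_iff)
  have "((\<lambda>w. rGamma w * rGamma (1 - w)) has_field_derivative
     (rGamma z * rGamma (1 - z) * (Digamma (1 - z) - Digamma z))) (at z)"
    using z by (auto intro!: derivative_eq_intros simp: algebra_simps)
  then have "((\<lambda>w. sin (of_real pi * w) / of_real pi) has_field_derivative
     (rGamma z * rGamma (1 - z) * (Digamma (1 - z) - Digamma z))) (at z)"
    by (simp add: rGamma_reflection_complex)
  moreover have "((\<lambda>w. sin (of_real pi * w) / of_real pi) has_field_derivative cos (of_real pi * z)) (at z)"
    by (auto intro!: derivative_eq_intros)
  ultimately have "sin (of_real pi * z) / of_real pi * (Digamma (1 - z) - Digamma z) = cos (of_real pi * z)"
    using DERIV_unique by (metis rGamma_reflection_complex)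
  \<comment> \<open>Passing from z to 1 + z lets the two series run over the conjugate terms 1 + z +
    k and 1 - z + k, whose product is y^2 + (k + 1)^2.\<close>
  then have sc: "sin (of_real pi * z) * (Digamma (1 - z) - (Digamma (1 + z) - 1 / z)) = of_real pi * cos (of_real pi * z)"
    using Digamma_plus1[OF z(5)] by (simp add: field_simps)
  have "(\<lambda>k. (inverse (of_nat (Suc k)) - inverse (1 - z + of_nat k)) - (inverse (of_nat (Suc k)) - inverse (1 + z + of_nat k)))
     sums ((Digamma (1 - z) + euler_mascheroni) - (Digamma (1 + z) + euler_mascheroni))"
    using summable_Digamma[OF z(3)] summable_Digamma[OF z(4)]
    by (intro sums_diff) (simp_all add: Digamma_def summable_sums)
  then have s1: "(\<lambda>k. inverse (1 + z + of_nat k) - inverse (1 - z + of_nat k)) sums (Digamma (1 - z) - Digamma (1 + z))"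
    by simp
  have t: "inverse (1 + z + of_nat k) - inverse (1 - z + of_nat k) = - \<i> * of_real (2 * y / (y\<^sup>2 + (real (Suc k))\<^sup>2))" for k
  proof -
    have nz: "1 + z + of_nat k \<noteq> 0" "1 - z + of_nat k \<noteq> 0"
      using y by (auto simp: z_def complex_eq_iff)
    have p: "(1 + z + of_nat k) * (1 - z + of_nat k) = of_real (y\<^sup>2 + (real (Suc k))\<^sup>2)"
      by (simp add: z_def algebra_simps power2_eq_square)
    have "inverse (1 + z + of_nat k) - inverse (1 - z + of_nat k) = - 2 * z / ((1 + z + of_nat k) * (1 - z + of_nat k))"
      using nz by (simp add: field_simps)
    then show ?thesis unfolding p by (simp add: z_def)
  qed
  define L where "L = (Digamma (1 - z) - Digamma (1 + z))"
  have "(\<lambda>k. \<i> * (- \<i> * of_real (2 * y / (y\<^sup>2 + (real (Suc k))\<^sup>2)))) sums (\<i> * L)"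
    using s1 unfolding t L_def by (rule sums_mult)
  then have s2: "(\<lambda>k. complex_of_real (2 * y / (y\<^sup>2 + (real (Suc k))\<^sup>2))) sums (\<i> * L)"
    by (simp add: mult.assoc[symmetric])
  have ex: "exp (\<i> * (of_real pi * z)) = of_real (exp (- (x / 2)))" "exp (- (\<i> * (of_real pi * z))) = of_real (exp (x / 2))"
    by (simp_all add: z_def y_def mult_ac flip: exp_of_real)
  define e where "e = exp (x / 2)"
  have e: "e > 1" "exp (- (x / 2)) = 1 / e" "exp x = e * e"
    using assms by (simp_all add: e_def exp_minus inverse_eq_divide flip: exp_add)
  have sin: "sin (of_real pi * z) = \<i> * of_real ((e - 1 / e) / 2)"
    unfolding sin_exp_eq ex by (simp add: e_def[symmetric] e(2)[unfolded e_def[symmetric]] field_simps)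
  have cos: "cos (of_real pi * z) = of_real ((e + 1 / e) / 2)"
    unfolding cos_exp_eq ex by (simp add: e_def[symmetric] e(2)[unfolded e_def[symmetric]] add.commute)
  have zi: "1 / z = - \<i> / of_real y" using y by (simp add: z_def field_simps)
  have "\<i> * of_real ((e - 1 / e) / 2) * (L + 1 / z) = of_real pi * of_real ((e + 1 / e) / 2)"
    using sc unfolding sin cos L_def by (simp add: algebra_simps)
  then have "of_real ((e - 1 / e) / 2) * (\<i> * L + of_real (1 / y)) = of_real (pi * ((e + 1 / e) / 2))"
    unfolding zi by (simp add: algebra_simps)
  moreover have e0: "(e - 1 / e) / 2 \<noteq> 0" using e(1) less_1_mult[of e e] by (simp add: field_simps)
  moreover have solve: "w = of_real (C / A - B)" if "of_real A * (w + of_real B) = of_real C" "A \<noteq> 0" for A B C :: real and w :: complex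
    using that by (simp add: field_simps)
  ultimately have "\<i> * L = of_real (pi * ((e + 1 / e) / 2) / ((e - 1 / e) / 2) - 1 / y)"
    by blast
  then have "(\<lambda>k. 2 * y / (y\<^sup>2 + (real (Suc k))\<^sup>2)) sums (pi * ((e + 1 / e) / 2) / ((e - 1 / e) / 2) - 1 / y)"
    using s2 by (simp only: sums_of_real_iff)
  then have "(\<lambda>k. 1 / (2 * pi) * (2 * y / (y\<^sup>2 + (real (Suc k))\<^sup>2))) sums (1 / (2 * pi) * (pi * ((e + 1 / e) / 2) / ((e - 1 / e) / 2) - 1 / y))"
    by (rule sums_mult)
  moreover have "1 / (2 * pi) * (2 * y / (y\<^sup>2 + (real (Suc k))\<^sup>2)) = 2 * x / (x\<^sup>2 + (2 * pi * real (Suc k))\<^sup>2)" for k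
  proof -
    have "x\<^sup>2 + (2 * pi * real (Suc k))\<^sup>2 = (2 * pi)\<^sup>2 * (y\<^sup>2 + (real (Suc k))\<^sup>2)"
      by (simp add: y_def power_divide power_mult_distrib field_simps del: of_nat_Suc)
    then show ?thesis by (simp add: y_def power2_eq_square del: of_nat_Suc)
  qed
  moreover have "1 / (2 * pi) * (pi * ((e + 1 / e) / 2) / ((e - 1 / e) / 2) - 1 / y) = 1 / (exp x - 1) - 1 / x + 1 / 2"
  proof -
    have "e * e > 1" using e(1) less_1_mult by blast
    then have "((e + 1 / e) / 2) / ((e - 1 / e) / 2) = 1 + 2 / (e * e - 1)"
      using e(1) by (simp add: divide_simps)
    then have "1 / (2 * pi) * (pi * ((e + 1 / e) / 2) / ((e - 1 / e) / 2) - 1 / y) =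
      1 / (2 * pi) * (pi * (1 + 2 / (e * e - 1)) - 2 * pi / x)"
      by (simp only: times_divide_eq_right[symmetric]) (simp add: y_def)
    also have "\<dots> = 1 / (e * e - 1) - 1 / x + 1 / 2"
      by (simp add: right_diff_distrib distrib_left)
    finally show ?thesis by (simp only: e(3))
  qed
  ultimately show ?thesis by (simp only:)
qed

text \<open>For nonnegative summands the norm of the n-th integrand at s is the integrand at Re s.
  Absolute convergence of the sum of integrals is therefore the summability of the values
  \<open>V n\<close> on the real axis.\<close>

lemma mellin_sums:
  fixes \<psi> :: "nat \<Rightarrow> real \<Rightarrow> real" and \<Psi> :: "real \<Rightarrow> real"
  assumes [measurable]: "\<And>n. \<psi> n \<in> borel_measurable borel"
    and nonneg: "\<And>n x. x > 0 \<Longrightarrow> \<psi> n x \<ge> 0"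
    and sums: "\<And>x. x > 0 \<Longrightarrow> (\<lambda>n. \<psi> n x) sums \<Psi> x"
    and int: "\<And>n. set_integrable lborel {0<..} (\<lambda>x. cpow x (s - 1) * of_real (\<psi> n x))"
    and val: "\<And>n. (LBINT x:{0<..}. cpow x (of_real (Re s) - 1) * of_real (\<psi> n x)) = V n"
    and summable: "summable (\<lambda>n. Re (V n))"
  shows "set_integrable lborel {0<..} (\<lambda>x. cpow x (s - 1) * of_real (\<Psi> x))"
    and "(\<lambda>n. LBINT x:{0<..}. cpow x (s - 1) * of_real (\<psi> n x)) sums (LBINT x:{0<..}. cpow x (s - 1) * of_real (\<Psi> x))"
proof -
  define f where "f n x = indicator {0<..} x *\<^sub>R (cpow x (s - 1) * of_real (\<psi> n x))" for n x
  define f0 where "f0 n x = indicator {0<..} x *\<^sub>R (cpow x (of_real (Re s) - 1) * of_real (\<psi> n x))" for n x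
  have [measurable]: "f n \<in> borel_measurable borel" "f0 n \<in> borel_measurable borel" for n
    unfolding f_def f0_def by measurable
  have i: "integrable lborel (f n)" for n using int unfolding f_def set_integrable_def .
  have n: "norm (f n x) = Re (f0 n x)" for n x
    using cpow_of_real[of x "Re s - 1"] nonneg[of x n]
    by (auto simp: f_def f0_def indicator_def norm_mult norm_cpow)
  have n0: "norm (f n x) = norm (f0 n x)" for n x
    by (auto simp: f_def f0_def indicator_def norm_mult norm_cpow)
  have i0: "integrable lborel (f0 n)" for n
    by (rule Bochner_Integration.integrable_bound[OF i[of n]]) (auto simp: n0)
  have "(LINT x|lborel. norm (f n x)) = Re (V n)" for n
    unfolding n integral_Re[OF i0] using val[of n] by (simp add: set_lebesgue_integral_def f0_def[abs_def])
  then have summ: "summable (\<lambda>n. LINT x|lborel. norm (f n x))" using summable by simp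
  have ae: "AE x in lborel. summable (\<lambda>n. norm (f n x))"
  proof (rule AE_I2)
    fix x
    have "summable (\<lambda>n. indicator {0<..} x * x powr (Re s - 1) * \<psi> n x)"
      by (cases "x > 0") (use sums sums_summable in \<open>auto intro!: summable_mult\<close>)
    moreover have "(\<lambda>n. norm (f n x)) = (\<lambda>n. indicator {0<..} x * x powr (Re s - 1) * \<psi> n x)"
      using nonneg[of x] by (auto simp: f_def indicator_def norm_mult norm_cpow)
    ultimately show "summable (\<lambda>n. norm (f n x))" by simp
  qed
  have F: "(\<Sum>n. f n x) = indicator {0<..} x *\<^sub>R (cpow x (s - 1) * of_real (\<Psi> x))" for x
  proof (cases "x > 0")
    case True
    have "(\<lambda>n. cpow x (s - 1) * of_real (\<psi> n x)) sums (cpow x (s - 1) * of_real (\<Psi> x))"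
      by (intro sums_mult sums_of_real sums True)
    then show ?thesis using True by (simp add: f_def sums_iff)
  qed (simp add: f_def)
  show "set_integrable lborel {0<..} (\<lambda>x. cpow x (s - 1) * of_real (\<Psi> x))"
    using integrable_suminf[OF i ae summ] unfolding F set_integrable_def .
  show "(\<lambda>n. LBINT x:{0<..}. cpow x (s - 1) * of_real (\<psi> n x)) sums (LBINT x:{0<..}. cpow x (s - 1) * of_real (\<Psi> x))"
    using sums_integral[OF i ae summ] unfolding F unfolding set_lebesgue_integral_def f_def .
qed

section \<open>The function 1 / (e^x - 1) and its Mellin transform on both sides of the pole\<close>

definition zeta_series :: "complex \<Rightarrow> complex" where
  "zeta_series s = (\<Sum>n. cpow (real (Suc n)) (- s))"

lemma zeta_series_sums:
  assumes "Re s > 1"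
  shows "(\<lambda>n. cpow (real (Suc n)) (- s)) sums zeta_series s"
proof -
  have "summable (\<lambda>n. real (Suc n) powr (- Re s))"
    using assms by (subst summable_Suc_iff) (simp add: summable_real_powr_iff)
  then have "summable (\<lambda>n. cpow (real (Suc n)) (- s))"
    by (intro summable_norm_cancel[of "\<lambda>n. cpow (real (Suc n)) (- s)"]) (simp add: norm_cpow del: of_nat_Suc)
  then show ?thesis unfolding zeta_series_def by (rule summable_sums)
qed

definition bose :: "real \<Rightarrow> real" where "bose x = 1 / (exp x - 1)"

text \<open>The Laurent expansion of \<open>bose\<close> at 0 begins 1 / x - 1 / 2. Without these
  terms the function is O(x) at 0 but tends to 1 / 2 at infinity, so its transform lives on -1 < Re
  s < 0.\<close>

definition bose_reg :: "real \<Rightarrow> real" where "bose_reg x = bose x - 1 / x + 1 / 2"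

text \<open>Removing the Laurent terms only for x < 1 keeps the exponential decay at infinity. The
  transform then converges for Re s > -1, which covers both the region of the Dirichlet series and
  the strip of \<open>bose_reg\<close>.\<close>

definition bose_cut :: "real \<Rightarrow> real" where
  "bose_cut x = (if x < 1 then bose_reg x else bose x)"

lemma bose_measurable [measurable]: "bose \<in> borel_measurable borel" "bose_reg \<in> borel_measurable borel"
    "bose_cut \<in> borel_measurable borel"
  unfolding bose_cut_def[abs_def] bose_reg_def[abs_def] bose_def[abs_def] by measurable

lemma bose_mellin:
  assumes "Re s > 1"
  shows "set_integrable lborel {0<..} (\<lambda>x. cpow x (s - 1) * of_real (bose x))"
    and "(LBINT x:{0<..}. cpow x (s - 1) * of_real (bose x)) = Gamma s * zeta_series s"
proof -
  define \<psi> where "\<psi> n x = exp (- (real (Suc n) * x))" for n and x :: real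
  have s0: "Re s > 0" "0 < Re (of_real (Re s) :: complex)" using assms by auto
  have sums: "(\<lambda>n. \<psi> n x) sums bose x" if "x > 0" for x
  proof -
    have "(\<lambda>n. exp (- x) * exp (- x) ^ n) sums (exp (- x) * (1 / (1 - exp (- x))))"
      using that by (intro sums_mult geometric_sums) simp
    moreover have "exp (- x) * exp (- x) ^ n = \<psi> n x" for n
      by (simp add: \<psi>_def algebra_simps flip: exp_of_nat_mult exp_add)
    moreover have "exp (- x) * (1 / (1 - exp (- x))) = bose x"
      using that by (simp add: bose_def exp_minus field_simps)
    ultimately show ?thesis by simp
  qed
  have "summable (\<lambda>n. Re (cpow (real (Suc n)) (- of_real (Re s)) * Gamma (of_real (Re s))))"
  proof (rule summable_Re, rule summable_mult2)
    show "summable (\<lambda>n. cpow (real (Suc n)) (- of_real (Re s)))"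
      using zeta_series_sums[of "of_real (Re s)"] assms by (simp add: sums_iff)
  qed
  note M = mellin_sums[of \<psi> bose s "\<lambda>n. cpow (real (Suc n)) (- of_real (Re s)) * Gamma (of_real (Re s))", OF _ _ sums _ _ this]
  have i: "set_integrable lborel {0<..} (\<lambda>x. cpow x (s - 1) * of_real (\<psi> n x))" for n
    unfolding \<psi>_def using Gamma_mellin_integral_scaled(1)[OF s0(1), of "real (Suc n)"] by simp
  have v: "(LBINT x:{0<..}. cpow x (of_real (Re s) - 1) * of_real (\<psi> n x)) = cpow (real (Suc n)) (- of_real (Re s)) * Gamma (of_real (Re s))" for n
    unfolding \<psi>_def using Gamma_mellin_integral_scaled(2)[OF s0(2), of "real (Suc n)"] by simp
  have m: "\<psi> n \<in> borel_measurable borel" "\<psi> n x \<ge> 0" for n x unfolding \<psi>_def by auto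
  show "set_integrable lborel {0<..} (\<lambda>x. cpow x (s - 1) * of_real (bose x))"
    by (rule M(1)) (use m i v in auto)
  have "(\<lambda>n. LBINT x:{0<..}. cpow x (s - 1) * of_real (\<psi> n x)) sums (LBINT x:{0<..}. cpow x (s - 1) * of_real (bose x))"
    by (rule M(2)) (use m i v in auto)
  moreover have "(LBINT x:{0<..}. cpow x (s - 1) * of_real (\<psi> n x)) = cpow (real (Suc n)) (- s) * Gamma s" for n
    unfolding \<psi>_def using Gamma_mellin_integral_scaled(2)[OF s0(1), of "real (Suc n)"] by simp
  ultimately have "(\<lambda>n. cpow (real (Suc n)) (- s) * Gamma s) sums (LBINT x:{0<..}. cpow x (s - 1) * of_real (bose x))"
    by simp
  moreover have "(\<lambda>n. cpow (real (Suc n)) (- s) * Gamma s) sums (zeta_series s * Gamma s)"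
    by (intro sums_mult2 zeta_series_sums assms)
  ultimately show "(LBINT x:{0<..}. cpow x (s - 1) * of_real (bose x)) = Gamma s * zeta_series s"
    using sums_unique2 by (metis mult.commute)
qed

text \<open>The partial fraction series is integrated termwise. Rescaling the n-th term by 2 pi (n +
  1) produces (n + 1)^(s - 1), and these powers add up to zeta at 1 - s; this is where the
  reflection of s enters.\<close>

lemma bose_reg_mellin:
  assumes "-1 < Re s" "Re s < 0"
  shows "set_integrable lborel {0<..} (\<lambda>x. cpow x (s - 1) * of_real (bose_reg x))"
    and "(LBINT x:{0<..}. cpow x (s - 1) * of_real (bose_reg x)) =
           cpow (2 * pi) (s - 1) * (of_real pi / cos (of_real pi * s / 2)) * zeta_series (1 - s)"
proof -
  define c where "c n = 2 * pi * real (Suc n)" for n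
  have c: "c n > 0" for n by (simp add: c_def)
  define \<psi> where "\<psi> n x = 2 * x / (x\<^sup>2 + (c n)\<^sup>2)" for n and x :: real
  have sums: "(\<lambda>n. \<psi> n x) sums bose_reg x" if "x > 0" for x
    using bose_partial_fractions[OF that] by (simp add: \<psi>_def c_def bose_reg_def bose_def)
  have trm: "set_integrable lborel {0<..} (\<lambda>x. cpow x (s - 1) * of_real (\<psi> n x)) \<and>
      (LBINT x:{0<..}. cpow x (s - 1) * of_real (\<psi> n x)) = cpow (c n) (s - 1) * (of_real pi / cos (of_real pi * s / 2))"
    if "-1 < Re s" "Re s < 0" for n s
  proof -
    have eq: "cpow x (s - 1) * of_real (\<psi> n x) = of_real (1 / c n) * (cpow x (s - 1) * of_real (2 * (1 / c n * x) / (1 + (1 / c n * x)\<^sup>2)))" for x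
    proof -
      have "\<psi> n x = 1 / c n * (2 * (1 / c n * x) / (1 + (1 / c n * x)\<^sup>2))"
        using c[of n] by (simp add: \<psi>_def divide_simps power2_eq_square)
      then show ?thesis by (metis mult.left_commute of_real_mult)
    qed
    have b: "Re s < 1" using that by simp
    note S = set_integrable_mellin_scale[where a = "1 / c n" and s = s, OF _ mellin_x_over_one_plus_square(1)[OF that(1) b]]
    have i: "set_integrable lborel {0<..} (\<lambda>x. cpow x (s - 1) * of_real (\<psi> n x))"
      unfolding eq using S(1) c[of n] by (intro set_integrable_mult_right) auto
    have "(LBINT x:{0<..}. cpow x (s - 1) * of_real (\<psi> n x)) = of_real (1 / c n) * (cpow (1 / c n) (- s) * (of_real pi / cos (of_real pi * s / 2)))"
      unfolding eq set_integral_mult_right using S(2) c[of n] mellin_x_over_one_plus_square(2)[OF that(1) b] by simp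
    also have "\<dots> = (of_real (1 / c n) * cpow (c n) s) * (of_real pi / cos (of_real pi * s / 2))"
      using c[of n] by (simp add: cpow_inverse_base)
    also have "of_real (1 / c n) * cpow (c n) s = cpow (c n) (s - 1)"
      using c[of n] cpow_minus_1[of "c n" s] by (simp add: field_simps)
    finally show ?thesis using i by simp
  qed
  have cp: "cpow (c n) w = cpow (2 * pi) w * cpow (real (Suc n)) w" for n w
    unfolding c_def by (rule cpow_mult) auto
  have zs: "(\<lambda>n. cpow (real (Suc n)) (s - 1)) sums zeta_series (1 - s)" if "Re s < 0" for s
    using zeta_series_sums[of "1 - s"] that by simp
  have s0: "-1 < Re (of_real (Re s) :: complex)" "Re (of_real (Re s) :: complex) < 0" using assms by auto
  define V where "V n = cpow (c n) (of_real (Re s) - 1) * (of_real pi / cos (of_real pi * of_real (Re s) / 2))" for n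
  have "summable (\<lambda>n. Re (V n))"
    unfolding V_def cp
    by (intro summable_Re summable_mult2 summable_mult) (use zs[OF s0(2)] in \<open>simp add: sums_iff\<close>)
  note M = mellin_sums[of \<psi> bose_reg s V, OF _ _ sums _ _ this]
  have m: "\<psi> n \<in> borel_measurable borel" "x > 0 \<Longrightarrow> \<psi> n x \<ge> 0" for n x unfolding \<psi>_def by auto
  show "set_integrable lborel {0<..} (\<lambda>x. cpow x (s - 1) * of_real (bose_reg x))"
    by (rule M(1)) (use m trm[OF assms] trm[OF s0] in \<open>auto simp: V_def\<close>)
  have "(\<lambda>n. LBINT x:{0<..}. cpow x (s - 1) * of_real (\<psi> n x)) sums (LBINT x:{0<..}. cpow x (s - 1) * of_real (bose_reg x))"
    by (rule M(2)) (use m trm[OF assms] trm[OF s0] in \<open>auto simp: V_def\<close>)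
  then have "(\<lambda>n. cpow (c n) (s - 1) * (of_real pi / cos (of_real pi * s / 2))) sums (LBINT x:{0<..}. cpow x (s - 1) * of_real (bose_reg x))"
    using trm[OF assms] by simp
  moreover have "(\<lambda>n. cpow (c n) (s - 1) * (of_real pi / cos (of_real pi * s / 2))) sums
    (cpow (2 * pi) (s - 1) * zeta_series (1 - s) * (of_real pi / cos (of_real pi * s / 2)))"
    unfolding cp by (intro sums_mult2 sums_mult zs assms)
  ultimately show "(LBINT x:{0<..}. cpow x (s - 1) * of_real (bose_reg x)) =
           cpow (2 * pi) (s - 1) * (of_real pi / cos (of_real pi * s / 2)) * zeta_series (1 - s)"
    using sums_unique2 by (metis (no_types, lifting) mult.assoc mult.commute)
qed

lemma cpow_tendsto_0_at_right: "Re a > 0 \<Longrightarrow> ((\<lambda>x. cpow x a) \<longlongrightarrow> 0) (at_right 0)"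
proof (rule tendsto_norm_zero_cancel)
  assume a: "Re a > 0"
  have "((\<lambda>x. x powr Re a) \<longlongrightarrow> 0) (at_right 0)"
    using a by (intro tendsto_zero_powrI[of _ _ _ "Re a"]) (auto intro: eventually_at_right_less tendsto_ident_at eventually_mono[OF eventually_at_right_less])
  then show "((\<lambda>x. norm (cpow x a)) \<longlongrightarrow> 0) (at_right 0)"
    by (rule Lim_transform_eventually) (auto intro: eventually_mono[OF eventually_at_right_less[of 0]] simp: norm_cpow)
qed

lemma cpow_tendsto_0_at_top: "Re a < 0 \<Longrightarrow> ((\<lambda>x. cpow x a) \<longlongrightarrow> 0) at_top"
proof (rule tendsto_norm_zero_cancel)
  assume a: "Re a < 0"
  have "((\<lambda>x::real. x powr Re a) \<longlongrightarrow> 0) at_top"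
    using a by (intro tendsto_neg_powr filterlim_ident)
  then show "((\<lambda>x. norm (cpow x a)) \<longlongrightarrow> 0) at_top"
    by (rule Lim_transform_eventually) (auto intro: eventually_mono[OF eventually_gt_at_top[of 0]] simp: norm_cpow)
qed

lemma powr_tendsto_of_cpow:
  "((\<lambda>x. cpow x (of_real a)) \<longlongrightarrow> 0) F \<Longrightarrow> (\<forall>\<^sub>F x in F. x > 0) \<Longrightarrow> ((\<lambda>x. x powr a / a) \<longlongrightarrow> 0) F"
proof -
  assume *: "((\<lambda>x. cpow x (of_real a)) \<longlongrightarrow> 0) F" "\<forall>\<^sub>F x in F. x > 0"
  have "((\<lambda>x. norm (cpow x (of_real a)) / a) \<longlongrightarrow> norm (0::complex) / a) F"
    unfolding divide_inverse by (intro tendsto_intros *)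
  moreover have "\<forall>\<^sub>F x in F. norm (cpow x (of_real a)) / a = x powr a / a"
    using *(2) by eventually_elim (simp add: norm_cpow)
  ultimately show "((\<lambda>x. x powr a / a) \<longlongrightarrow> 0) F"
    by (simp add: filterlim_cong)
qed

text \<open>The limits \<open>A'\<close> and \<open>B'\<close> concern the absolute value x^(Re a -
  1): the fundamental theorem for nonnegative integrands turns them into integrability, and then the
  complex antiderivative with limits \<open>A\<close> and \<open>B\<close> gives the value.\<close>

lemma cpow_FTC:
  fixes u v :: ereal
  assumes "0 \<le> u" "u < v" "a \<noteq> 0" "Re a \<noteq> 0"
    and A: "(((\<lambda>x. cpow x a / a) \<circ> real_of_ereal) \<longlongrightarrow> A) (at_right u)"
    and B: "(((\<lambda>x. cpow x a / a) \<circ> real_of_ereal) \<longlongrightarrow> B) (at_left v)"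
    and A': "(((\<lambda>x. x powr Re a / Re a) \<circ> real_of_ereal) \<longlongrightarrow> A') (at_right u)"
    and B': "(((\<lambda>x. x powr Re a / Re a) \<circ> real_of_ereal) \<longlongrightarrow> B') (at_left v)"
  shows "set_integrable lborel (einterval u v) (\<lambda>x. cpow x (a - 1))"
    and "(LBINT x:einterval u v. cpow x (a - 1)) = B - A"
proof -
  have pos: "x > 0" if "u < ereal x" for x
  proof -
    have "(0::ereal) < ereal x" using assms(1) that by (rule le_less_trans)
    then show ?thesis by simp
  qed
  have "set_integrable lborel (einterval u v) (\<lambda>x. x powr (Re a - 1))"
  proof (rule interval_integral_FTC_nonneg[OF assms(2) _ _ _ A' B'])
    fix x assume "u < ereal x"
    then have "x > 0" by (rule pos)
    then show "((\<lambda>x. x powr Re a / Re a) has_real_derivative x powr (Re a - 1)) (at x)"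
      using assms(4) by (auto intro!: derivative_eq_intros)
    show "isCont (\<lambda>x. x powr (Re a - 1)) x" using \<open>x > 0\<close> by (auto intro!: continuous_intros)
  qed auto
  then show i: "set_integrable lborel (einterval u v) (\<lambda>x. cpow x (a - 1))"
    unfolding set_integrable_def
    by (rule Bochner_Integration.integrable_bound) (auto simp: indicator_def norm_cpow[OF pos] einterval_def)
  have "(LBINT x=u..v. cpow x (a - 1)) = B - A"
  proof (rule interval_integral_FTC_integrable[OF assms(2) _ _ i A B])
    fix x assume "u < ereal x"
    then have "x > 0" by (rule pos)
    have "((\<lambda>x. cpow x a * (1 / a)) has_vector_derivative (a * cpow x (a - 1)) * (1 / a)) (at x)"
      by (intro has_vector_derivative_mult_left cpow_has_vector_derivative \<open>x > 0\<close>)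
    then show "((\<lambda>x. cpow x a / a) has_vector_derivative cpow x (a - 1)) (at x)"
      using assms(3) by simp
    show "isCont (\<lambda>x. cpow x (a - 1)) x"
      unfolding cpow_def using \<open>x > 0\<close> by (auto intro!: continuous_intros)
  qed
  then show "(LBINT x:einterval u v. cpow x (a - 1)) = B - A"
    using assms(2) by (simp add: interval_lebesgue_integral_def less_imp_le)
qed

lemma cpow_integral_0_1:
  assumes "Re a > 0"
  shows "set_integrable lborel {0<..<1} (\<lambda>x. cpow x (a - 1))"
    and "(LBINT x:{0<..<1}. cpow x (a - 1)) = 1 / a"
proof -
  have e: "einterval 0 1 = {0<..<1::real}" by (auto simp: einterval_def)
  have a: "a \<noteq> 0" "Re a \<noteq> 0" using assms by auto
  have "((\<lambda>x. cpow x a / a) \<longlongrightarrow> 0 / a) (at_right 0)"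
    by (intro tendsto_intros cpow_tendsto_0_at_right assms a)
  then have A: "(((\<lambda>x. cpow x a / a) \<circ> real_of_ereal) \<longlongrightarrow> 0) (at_right 0)"
    by (simp add: zero_ereal_def ereal_tendsto_simps1)
  have A': "(((\<lambda>x. x powr Re a / Re a) \<circ> real_of_ereal) \<longlongrightarrow> 0) (at_right 0)"
    using powr_tendsto_of_cpow[OF cpow_tendsto_0_at_right[of "of_real (Re a)"]] assms
    by (simp add: zero_ereal_def ereal_tendsto_simps1 eventually_at_right_less)
  have "isCont (\<lambda>x. cpow x a / a) 1" "isCont (\<lambda>x. x powr Re a / Re a) 1"
    unfolding cpow_def using a by (auto intro!: continuous_intros)
  then have "((\<lambda>x. cpow x a / a) \<longlongrightarrow> 1 / a) (at_left 1)" "((\<lambda>x. x powr Re a / Re a) \<longlongrightarrow> 1 / Re a) (at_left 1)"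
    by (auto simp: isCont_def filterlim_at_split)
  then have B: "(((\<lambda>x. cpow x a / a) \<circ> real_of_ereal) \<longlongrightarrow> 1 / a) (at_left 1)"
    and B': "(((\<lambda>x. x powr Re a / Re a) \<circ> real_of_ereal) \<longlongrightarrow> 1 / Re a) (at_left 1)"
    by (simp_all add: one_ereal_def ereal_tendsto_simps1)
  show "set_integrable lborel {0<..<1} (\<lambda>x. cpow x (a - 1))" "(LBINT x:{0<..<1}. cpow x (a - 1)) = 1 / a"
    using cpow_FTC[OF _ _ a A B A' B'] unfolding e by simp_all
qed

lemma cpow_integral_1_inf:
  assumes "Re a < 0"
  shows "set_integrable lborel {1<..} (\<lambda>x. cpow x (a - 1))"
    and "(LBINT x:{1<..}. cpow x (a - 1)) = - 1 / a"
proof -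
  have e: "einterval 1 \<infinity> = ({1<..} :: real set)" by (auto simp: einterval_def)
  have a: "a \<noteq> 0" "Re a \<noteq> 0" using assms by auto
  have "((\<lambda>x. cpow x a / a) \<longlongrightarrow> 0 / a) at_top"
    by (intro tendsto_intros cpow_tendsto_0_at_top assms a)
  then have A: "(((\<lambda>x. cpow x a / a) \<circ> real_of_ereal) \<longlongrightarrow> 0) (at_left \<infinity>)"
    by (simp add: ereal_tendsto_simps1)
  have A': "(((\<lambda>x. x powr Re a / Re a) \<circ> real_of_ereal) \<longlongrightarrow> 0) (at_left \<infinity>)"
    using powr_tendsto_of_cpow[OF cpow_tendsto_0_at_top[of "of_real (Re a)"]] assms
    by (simp add: ereal_tendsto_simps1 eventually_gt_at_top)
  have "isCont (\<lambda>x. cpow x a / a) 1" "isCont (\<lambda>x. x powr Re a / Re a) 1"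
    unfolding cpow_def using a by (auto intro!: continuous_intros)
  then have "((\<lambda>x. cpow x a / a) \<longlongrightarrow> 1 / a) (at_right 1)" "((\<lambda>x. x powr Re a / Re a) \<longlongrightarrow> 1 / Re a) (at_right 1)"
    by (auto simp: isCont_def filterlim_at_split)
  then have B: "(((\<lambda>x. cpow x a / a) \<circ> real_of_ereal) \<longlongrightarrow> 1 / a) (at_right 1)"
    and B': "(((\<lambda>x. x powr Re a / Re a) \<circ> real_of_ereal) \<longlongrightarrow> 1 / Re a) (at_right 1)"
    by (simp_all add: one_ereal_def ereal_tendsto_simps1)
  show "set_integrable lborel {1<..} (\<lambda>x. cpow x (a - 1))" "(LBINT x:{1<..}. cpow x (a - 1)) = - 1 / a"
    using cpow_FTC[OF _ _ a B A B' A'] unfolding e by simp_all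
qed

text \<open>The terms of the partial fraction series are positive and at most x times 2 / (2 pi
  n)^2, which is summable.\<close>

lemma bose_reg_bounds:
  obtains c where "c \<ge> 0" "\<And>x. x > 0 \<Longrightarrow> \<bar>bose_reg x\<bar> \<le> c * x"
proof -
  have summ: "summable (\<lambda>n. 2 / (2 * pi * real (Suc n))\<^sup>2)"
  proof -
    have "summable (\<lambda>n. 2 / (2 * pi)\<^sup>2 * (1 / (real (Suc n))\<^sup>2))"
      using inverse_squares_sums by (intro summable_mult) (simp add: sums_iff)
    then show ?thesis by (simp add: power_mult_distrib mult.assoc del: of_nat_Suc)
  qed
  define c where "c = (\<Sum>n. 2 / (2 * pi * real (Suc n))\<^sup>2)"
  have "\<bar>bose_reg x\<bar> \<le> c * x" if x: "x > 0" for x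
  proof -
    have s: "(\<lambda>n. 2 * x / (x\<^sup>2 + (2 * pi * real (Suc n))\<^sup>2)) sums bose_reg x"
      using bose_partial_fractions[OF x] by (simp add: bose_reg_def bose_def)
    have s': "(\<lambda>n. 2 / (2 * pi * real (Suc n))\<^sup>2 * x) sums (c * x)"
      unfolding c_def by (intro sums_mult2 summable_sums summ)
    have "bose_reg x \<le> c * x"
    proof (rule sums_le[OF _ s s'])
      fix n
      have "2 * x / (x\<^sup>2 + (2 * pi * real (Suc n))\<^sup>2) \<le> 2 * x / (2 * pi * real (Suc n))\<^sup>2"
        using x by (intro divide_left_mono) (auto simp del: of_nat_Suc intro!: mult_pos_pos add_nonneg_pos)
      then show "2 * x / (x\<^sup>2 + (2 * pi * real (Suc n))\<^sup>2) \<le> 2 / (2 * pi * real (Suc n))\<^sup>2 * x" by simp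
    qed
    moreover have "0 \<le> bose_reg x"
      by (rule sums_le[OF _ sums_zero s]) (use x in auto)
    ultimately show ?thesis by simp
  qed
  moreover have "c \<ge> 0" unfolding c_def by (intro suminf_nonneg summ) auto
  ultimately show ?thesis using that by blast
qed

lemma set_integrable_powr_exp:
  fixes \<sigma> :: real
  assumes "\<sigma> > 0"
  shows "set_integrable lborel {0<..} (\<lambda>x. x powr (\<sigma> - 1) * exp (- x))"
proof -
  have "set_integrable lborel {0<..} (\<lambda>x. x powr (Re (of_real \<sigma> - 1)) * norm (complex_of_real (exp (- x))))"
    using Gamma_mellin_integral(1)[of "of_real \<sigma>"] assms
    by (subst set_integrable_mellin_iff_norm[symmetric]) auto
  then show ?thesis by simp
qed

lemma bose_cut_mellin_integrable:
  assumes "\<sigma> > -1"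
  shows "set_integrable lborel {0<..} (\<lambda>x. x powr (\<sigma> - 1) * norm (complex_of_real (bose_cut x)))"
proof -
  obtain c where c: "c \<ge> 0" "\<And>x. x > 0 \<Longrightarrow> \<bar>bose_reg x\<bar> \<le> c * x" using bose_reg_bounds by blast
  \<comment> \<open>For x >= 1 the exponent may be raised; a value of at least 1 keeps the Gamma
    integral convergent when \<sigma> is negative.\<close>
  define \<tau> where "\<tau> = max \<sigma> 1"
  define G where "G x = c * exp 1 * (x powr ((\<sigma> + 1) - 1) * exp (- x)) + 2 * (x powr (\<tau> - 1) * exp (- x))" for x
  have G: "set_integrable lborel {0<..} G"
    unfolding G_def using assms
    by (intro set_integral_add(1) set_integrable_mult_right set_integrable_powr_exp) (auto simp: \<tau>_def)
  have b: "x powr (\<sigma> - 1) * \<bar>bose_cut x\<bar> \<le> G x" if x: "x > 0" for x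
  proof (cases "x < 1")
    case True
    have "x powr (\<sigma> - 1) * \<bar>bose_cut x\<bar> \<le> x powr (\<sigma> - 1) * (c * x)"
      using True c(2)[OF x] by (intro mult_left_mono) (auto simp: bose_cut_def)
    also have "\<dots> = c * x powr \<sigma>" using x by (simp add: powr_diff)
    also have "\<dots> \<le> c * (exp 1 * (x powr \<sigma> * exp (- x)))"
    proof (intro mult_left_mono c(1))
      have "1 \<le> exp (1 - x)" using True by simp
      then have "x powr \<sigma> * 1 \<le> x powr \<sigma> * exp (1 - x)" by (intro mult_left_mono) auto
      then show "x powr \<sigma> \<le> exp 1 * (x powr \<sigma> * exp (- x))" by (simp add: exp_diff exp_minus field_simps)
    qed
    also have "\<dots> \<le> G x" unfolding G_def by (simp add: mult.assoc)
    finally show ?thesis .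
  next
    case False
    then have e: "exp x \<ge> 2" using exp_ge_add_one_self[of x] by linarith
    have "1 / (E - 1) \<le> 2 * inverse E" "1 / (E - 1) \<ge> 0" if "E \<ge> 2" for E :: real
      using that by (simp_all add: divide_simps)
    from this[OF e] have "bose x \<le> 2 * exp (- x)" "bose x \<ge> 0"
      by (auto simp: bose_def exp_minus)
    then have "\<bar>bose_cut x\<bar> \<le> 2 * exp (- x)" using False by (simp add: bose_cut_def)
    moreover have "x powr (\<sigma> - 1) \<le> x powr (\<tau> - 1)" using False by (intro powr_mono) (auto simp: \<tau>_def)
    ultimately have "x powr (\<sigma> - 1) * \<bar>bose_cut x\<bar> \<le> x powr (\<tau> - 1) * (2 * exp (- x))"
      by (intro mult_mono) auto
    also have "\<dots> \<le> G x" using c(1) unfolding G_def by simp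
    finally show ?thesis .
  qed
  show ?thesis
    using G unfolding set_integrable_def
    by (rule Bochner_Integration.integrable_bound)
       (use b order.trans[OF b abs_ge_self] in \<open>auto intro!: AE_I2 simp: indicator_def\<close>)
qed

lemma bose_cut_mellin_integrable_complex:
  assumes "Re s > -1"
  shows "set_integrable lborel {0<..} (\<lambda>x. cpow x (s - 1) * of_real (bose_cut x))"
proof -
  have "(\<lambda>x. complex_of_real (bose_cut x)) \<in> borel_measurable borel" by measurable
  from set_integrable_mellin_iff_norm[OF this, of "s - 1"] show ?thesis
    using bose_cut_mellin_integrable[OF assms] by simp
qed

section \<open>Continuation of zeta and its symmetry\<close>

definition bose_cut_mellin :: "complex \<Rightarrow> complex" where
  "bose_cut_mellin s = (LBINT x:{0<..}. cpow x (s - 1) * of_real (bose_cut x))"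

text \<open>The difference of \<open>bose\<close> and \<open>bose_cut\<close> is 1 / x - 1 / 2 on
  (0, 1), and the transform of that is 1 / (s - 1) - 1 / (2 s) when Re s > 1.\<close>

lemma bose_mellin_cut:
  assumes "Re s > 1"
  shows "Gamma s * zeta_series s = bose_cut_mellin s + 1 / (s - 1) - 1 / (2 * s)"
proof -
  note I1 = cpow_integral_0_1[of "s - 1"] and I2 = cpow_integral_0_1[of s]
  have i': "integrable lborel (\<lambda>x. indicator {0<..} x *\<^sub>R (cpow x (s - 1) * of_real (bose_cut x)))"
    "integrable lborel (\<lambda>x. indicator {0<..<1} x *\<^sub>R cpow x (s - 1 - 1))"
    "integrable lborel (\<lambda>x. indicator {0<..<1} x *\<^sub>R cpow x (s - 1))"
    using bose_cut_mellin_integrable_complex[of s] I1(1) I2(1) assms unfolding set_integrable_def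
    by auto
  have "integrable lborel (\<lambda>x. (1/2) *\<^sub>R (indicator {0<..<1} x *\<^sub>R cpow x (s - 1)))"
    by (intro integrable_scaleR_right i')
  note i = i'(1,2) this
  have "Gamma s * zeta_series s = (LBINT x:{0<..}. cpow x (s - 1) * of_real (bose x))"
    using bose_mellin(2)[OF assms] by simp
  also have "\<dots> = (LINT x|lborel. indicator {0<..} x *\<^sub>R (cpow x (s - 1) * of_real (bose_cut x)) +
     indicator {0<..<1} x *\<^sub>R cpow x (s - 1 - 1) - (1/2) *\<^sub>R (indicator {0<..<1} x *\<^sub>R cpow x (s - 1)))"
    unfolding set_lebesgue_integral_def
  proof (intro Bochner_Integration.integral_cong refl)
    fix x :: real
    have "cpow x (s - 1 - 1) = cpow x (s - 1) * of_real (1 / x)" if "x > 0"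
      using cpow_minus_1[OF that, of "s - 1"] that by (simp add: field_simps)
    then show "indicator {0<..} x *\<^sub>R (cpow x (s - 1) * of_real (bose x)) =
      indicator {0<..} x *\<^sub>R (cpow x (s - 1) * of_real (bose_cut x)) +
     indicator {0<..<1} x *\<^sub>R cpow x (s - 1 - 1) - (1/2) *\<^sub>R (indicator {0<..<1} x *\<^sub>R cpow x (s - 1))"
      by (auto simp: indicator_def bose_cut_def bose_reg_def scaleR_conv_of_real algebra_simps)
  qed
  also have "\<dots> = bose_cut_mellin s + (LBINT x:{0<..<1}. cpow x (s - 1 - 1)) - (1/2) *\<^sub>R (LBINT x:{0<..<1}. cpow x (s - 1))"
    unfolding bose_cut_mellin_def set_lebesgue_integral_def
    by (subst Bochner_Integration.integral_diff[OF Bochner_Integration.integrable_add[OF i(1,2)] i(3)],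
        subst Bochner_Integration.integral_add[OF i(1,2)], subst integral_scaleR_right) simp
  also have "\<dots> = bose_cut_mellin s + 1 / (s - 1) - 1 / (2 * s)"
    using I1(2) I2(2) assms by (simp add: scaleR_conv_of_real)
  finally show ?thesis .
qed

text \<open>Now the Laurent terms are compared on (1, \<infinity>), where Re s < 0 makes their
  integrals converge. They produce the same rational function as for Re s > 1, so one meromorphic
  expression describes both transforms.\<close>

lemma bose_reg_mellin_cut:
  assumes "-1 < Re s" "Re s < 0"
  shows "(LBINT x:{0<..}. cpow x (s - 1) * of_real (bose_reg x)) = bose_cut_mellin s + 1 / (s - 1) - 1 / (2 * s)"
proof -
  note I1 = cpow_integral_1_inf[of "s - 1"] and I2 = cpow_integral_1_inf[of s]
  have i': "integrable lborel (\<lambda>x. indicator {0<..} x *\<^sub>R (cpow x (s - 1) * of_real (bose_cut x)))"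
    "integrable lborel (\<lambda>x. indicator {1<..} x *\<^sub>R cpow x (s - 1 - 1))"
    "integrable lborel (\<lambda>x. indicator {1<..} x *\<^sub>R cpow x (s - 1))"
    using bose_cut_mellin_integrable_complex[of s] I1(1) I2(1) assms unfolding set_integrable_def
    by auto
  have "integrable lborel (\<lambda>x. (1/2) *\<^sub>R (indicator {1<..} x *\<^sub>R cpow x (s - 1)))"
    by (intro integrable_scaleR_right i')
  note i = i'(1,2) this
  have "(LBINT x:{0<..}. cpow x (s - 1) * of_real (bose_reg x)) = (LINT x|lborel. indicator {0<..} x *\<^sub>R (cpow x (s - 1) * of_real (bose_cut x)) -
     indicator {1<..} x *\<^sub>R cpow x (s - 1 - 1) + (1/2) *\<^sub>R (indicator {1<..} x *\<^sub>R cpow x (s - 1)))"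
    unfolding set_lebesgue_integral_def
  \<comment> \<open>At x = 1 the value of \<open>bose_cut\<close> does not match the open interval,
    so the two integrands agree only off that point.\<close>
  proof (rule integral_cong_AE)
    have "indicator {0<..} x *\<^sub>R (cpow x (s - 1) * of_real (bose_reg x)) =
      indicator {0<..} x *\<^sub>R (cpow x (s - 1) * of_real (bose_cut x)) -
     indicator {1<..} x *\<^sub>R cpow x (s - 1 - 1) + (1/2) *\<^sub>R (indicator {1<..} x *\<^sub>R cpow x (s - 1))" if "x \<noteq> 1" for x
    proof -
      have "cpow x (s - 1 - 1) = cpow x (s - 1) * of_real (1 / x)" if "x > 0"
        using cpow_minus_1[OF that, of "s - 1"] that by (simp add: field_simps)
      then show ?thesis using that
        by (auto simp: indicator_def bose_cut_def bose_reg_def scaleR_conv_of_real algebra_simps)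
    qed
    then show "AE x in lborel. indicator {0<..} x *\<^sub>R (cpow x (s - 1) * of_real (bose_reg x)) =
      indicator {0<..} x *\<^sub>R (cpow x (s - 1) * of_real (bose_cut x)) -
     indicator {1<..} x *\<^sub>R cpow x (s - 1 - 1) + (1/2) *\<^sub>R (indicator {1<..} x *\<^sub>R cpow x (s - 1))"
      using AE_lborel_singleton[of 1] by (auto elim: AE_mp)
  qed measurable
  also have "\<dots> = bose_cut_mellin s - (LBINT x:{1<..}. cpow x (s - 1 - 1)) + (1/2) *\<^sub>R (LBINT x:{1<..}. cpow x (s - 1))"
    unfolding bose_cut_mellin_def set_lebesgue_integral_def
    by (subst Bochner_Integration.integral_add[OF Bochner_Integration.integrable_diff[OF i(1,2)] i(3)],
        subst Bochner_Integration.integral_diff[OF i(1,2)], subst integral_scaleR_right) simp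
  also have "\<dots> = bose_cut_mellin s + 1 / (s - 1) - 1 / (2 * s)"
    using I1(2) I2(2) assms by (simp add: scaleR_conv_of_real)
  finally show ?thesis .
qed

text \<open>The term 1 / (2 s) is merged with its Gamma factor: \<open>rGamma (s + 1) / 2\<close>
  equals \<open>rGamma s / (2 * s)\<close> off 0 and is regular at 0, so s = 1 is the only point of
  Re s > -1 to be excluded.\<close>

definition zeta_right :: "complex \<Rightarrow> complex" where
  "zeta_right s = rGamma s * (bose_cut_mellin s + 1 / (s - 1)) - rGamma (s + 1) / 2"

lemma zeta_right_altdef:
  assumes "s \<noteq> 0"
  shows "zeta_right s = rGamma s * (bose_cut_mellin s + 1 / (s - 1) - 1 / (2 * s))"
proof -
  have "rGamma (s + 1) = rGamma s / s" using rGamma_plus1[of s] assms by (simp add: field_simps)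
  then show ?thesis unfolding zeta_right_def by (simp add: algebra_simps)
qed

lemma zeta_right_holomorphic: "zeta_right holomorphic_on ({s. Re s > -1} - {1})"
proof -
  have "bose_cut_mellin holomorphic_on {s. Re s > -1}"
  proof -
    have "bose_cut_mellin holomorphic_on {s. -1 < Re s \<and> Re s < B}" for B
      unfolding bose_cut_mellin_def[abs_def]
      by (rule mellin_transform_holomorphic) (use bose_cut_mellin_integrable in auto)
    then have "bose_cut_mellin holomorphic_on (\<Union>B. {s. -1 < Re s \<and> Re s < B})"
      by (intro holomorphic_on_UN_open) (auto intro!: open_Collect_conj open_halfspace_Re_gt open_halfspace_Re_lt)
    also have "(\<Union>B. {s. -1 < Re s \<and> Re s < B}) = {s. Re s > -1}" using gt_ex by auto
    finally show ?thesis .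
  qed
  then show ?thesis
    unfolding zeta_right_def[abs_def] by (auto intro!: holomorphic_intros intro: holomorphic_on_subset)
qed

lemma zeta_right_eq_series: "Re s > 1 \<Longrightarrow> zeta_right s = zeta_series s"
proof -
  assume s: "Re s > 1"
  then have "s \<notin> \<int>\<^sub>\<le>\<^sub>0" "s \<noteq> 0" by (auto elim!: nonpos_Ints_cases)
  then show ?thesis
    using bose_mellin_cut[OF s] by (simp add: zeta_right_altdef rGamma_inverse_Gamma Gamma_eq_zero_iff field_simps)
qed

text \<open>This brings the factor between zeta at s and at 1 - s into symmetric shape. Duplication
  splits \<open>rGamma s\<close> into values at s / 2 and (s + 1) / 2, and reflection combines the
  latter with \<open>rGamma ((1 - s) / 2)\<close> into the cosine.\<close>

lemma rGamma_functional_factor: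
  "rGamma s * cpow (2 * pi) (s - 1) * of_real pi * (rGamma ((1 - s) / 2) * cpow pi ((1 - s) / 2)) =
   cos (of_real pi * s / 2) * (rGamma (s / 2) * cpow pi (s / 2))"
proof -
  \<comment> \<open>If s / 2 or (s + 1) / 2 is a pole of Gamma, then so is s, and both sides
    vanish.\<close>
  have dup: "rGamma s = 2 * cpow 2 (- s) * of_real (sqrt pi) * (rGamma (s / 2) * rGamma ((s + 1) / 2))"
  proof (cases "s / 2 \<in> \<int>\<^sub>\<le>\<^sub>0 \<or> s / 2 + 1 / 2 \<in> \<int>\<^sub>\<le>\<^sub>0")
    case True
    then have "s \<in> \<int>\<^sub>\<le>\<^sub>0"
    proof
      assume "s / 2 \<in> \<int>\<^sub>\<le>\<^sub>0"
      then obtain n where "s / 2 = of_int n" "n \<le> 0" by (elim nonpos_Ints_cases)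
      then have "s = of_int (2 * n)" "2 * n \<le> 0" by (auto simp: field_simps)
      then show ?thesis by (metis nonpos_Ints_of_int)
    next
      assume "s / 2 + 1 / 2 \<in> \<int>\<^sub>\<le>\<^sub>0"
      then obtain n where "s / 2 + 1 / 2 = of_int n" "n \<le> 0" by (elim nonpos_Ints_cases)
      then have "s = of_int (2 * n - 1)" "2 * n - 1 \<le> 0" by (auto simp: field_simps)
      then show ?thesis by (metis nonpos_Ints_of_int)
    qed
    then show ?thesis using True by (auto simp: rGamma_nonpos_Int add_divide_distrib)
  next
    case False
    have "Gamma (s / 2) * Gamma (s / 2 + 1 / 2) = exp ((1 - 2 * (s / 2)) * of_real (ln 2)) * of_real (sqrt pi) * Gamma (2 * (s / 2))"
      using False by (intro Gamma_legendre_duplication) auto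
    also have "exp ((1 - 2 * (s / 2)) * of_real (ln 2)) = 2 * cpow 2 (- s)"
    proof -
      have "exp ((1 - 2 * (s / 2)) * of_real (ln 2)) = cpow 2 (1 + - s)" by (simp add: cpow_def)
      also have "\<dots> = 2 * cpow 2 (- s)" unfolding cpow_add by simp
      finally show ?thesis .
    qed
    finally have G: "Gamma (s / 2) * Gamma ((s + 1) / 2) = 2 * cpow 2 (- s) * of_real (sqrt pi) * Gamma s"
      by (simp add: add_divide_distrib)
    have nz: "Gamma (s / 2) \<noteq> 0" "Gamma ((s + 1) / 2) \<noteq> 0" using False by (auto simp: Gamma_eq_zero_iff add_divide_distrib)
    then have "Gamma s \<noteq> 0" using G by auto
    then show ?thesis using nz G by (simp add: rGamma_inverse_Gamma field_simps)
  qed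
  have refl: "rGamma ((s + 1) / 2) * rGamma ((1 - s) / 2) = cos (of_real pi * s / 2) / of_real pi"
  proof -
    have A: "1 - (s + 1) / 2 = (1 - s) / 2" by (simp add: field_simps)
    have B: "sin (of_real pi * ((s + 1) / 2)) = cos (of_real pi * s / 2)"
      using sin_cos_eq[of "of_real pi * ((s + 1) / 2)"] cos_minus[of "of_real pi * s / 2"]
      by (simp add: field_simps)
    show ?thesis using rGamma_reflection_complex[of "(s + 1) / 2"] unfolding A B .
  qed
  have cp: "cpow (2 * pi) (s - 1) = cpow 2 (s - 1) * cpow pi (s - 1)" by (rule cpow_mult) auto
  have c2: "cpow 2 (- s) * cpow 2 (s - 1) = 1 / 2"
    using cpow_add[of 2 "- s" "s - 1"] cpow_inverse[of 2 1] by (simp add: inverse_eq_divide)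
  have sq: "of_real (sqrt pi) = cpow pi (1/2)"
    using cpow_of_real[of pi "1/2"] by (simp add: powr_half_sqrt)
  have cpi: "cpow pi (1/2) * cpow pi (s - 1) * cpow pi ((1 - s) / 2) = cpow pi (s / 2)"
  proof -
    have "1/2 + (s - 1) + (1 - s) / 2 = s / 2" by (simp add: field_simps)
    then show ?thesis by (metis cpow_add)
  qed
  have "rGamma s * cpow (2 * pi) (s - 1) * of_real pi * (rGamma ((1 - s) / 2) * cpow pi ((1 - s) / 2)) =
     2 * (cpow 2 (- s) * cpow 2 (s - 1)) * (cpow pi (1/2) * cpow pi (s - 1) * cpow pi ((1 - s) / 2)) * of_real pi *
     (rGamma ((s + 1) / 2) * rGamma ((1 - s) / 2)) * rGamma (s / 2)"
    unfolding dup cp sq by (simp only: mult_ac)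
  also have "\<dots> = cos (of_real pi * s / 2) * (rGamma (s / 2) * cpow pi (s / 2))"
    unfolding c2 cpi refl by simp
  finally show ?thesis .
qed

text \<open>In this strip the transform of \<open>bose_reg\<close> is known twice: by continuation
  it is Gamma s times zeta at s, by partial fractions a multiple of the series for zeta at 1 -
  s.\<close>

lemma zeta_right_functional:
  assumes "-1 < Re s" "Re s < 0"
  shows "zeta_right s * (rGamma ((1 - s) / 2) * cpow pi ((1 - s) / 2)) =
         zeta_right (1 - s) * (rGamma (s / 2) * cpow pi (s / 2))"
proof -
  \<comment> \<open>A zero of the cosine would make s an odd integer, which -1 < Re s < 0
    excludes.\<close>
  have "cos (of_real pi * s / 2) \<noteq> 0"
  proof
    assume "cos (of_real pi * s / 2) = 0"
    then obtain n where "of_real pi * s / 2 = of_int n * of_real pi + of_real pi / 2"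
      by (auto simp: cos_eq_0)
    then have "of_real pi * s = of_real pi * of_int (2 * n + 1)" by (simp add: field_simps)
    then have "s = of_int (2 * n + 1)" by (subst (asm) mult_cancel_left) simp
    then have "Re s = of_int (2 * n + 1)" by simp
    then have "-1 < 2 * n + 1" "2 * n + 1 < 0" using assms by linarith+
    then show False by presburger
  qed
  moreover have "s \<noteq> 0" using assms by auto
  moreover have "zeta_right s = rGamma s * (cpow (2 * pi) (s - 1) * (of_real pi / cos (of_real pi * s / 2)) * zeta_right (1 - s))"
    using zeta_right_eq_series[of "1 - s"] zeta_right_altdef[OF \<open>s \<noteq> 0\<close>] assms
      bose_reg_mellin_cut[OF assms] bose_reg_mellin(2)[OF assms] by simp
  ultimately show ?thesis
  proof -
    assume C: "cos (of_real pi * s / 2) \<noteq> 0"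
      and Z: "zeta_right s = rGamma s * (cpow (2 * pi) (s - 1) * (of_real pi / cos (of_real pi * s / 2)) * zeta_right (1 - s))"
    have "zeta_right s * (rGamma ((1 - s) / 2) * cpow pi ((1 - s) / 2)) = zeta_right (1 - s) *
      (rGamma s * cpow (2 * pi) (s - 1) * of_real pi * (rGamma ((1 - s) / 2) * cpow pi ((1 - s) / 2))) / cos (of_real pi * s / 2)"
      unfolding Z by simp
    also have "\<dots> = zeta_right (1 - s) * (rGamma (s / 2) * cpow pi (s / 2))"
      unfolding rGamma_functional_factor using C by simp
    finally show ?thesis .
  qed
qed

text \<open>The functional equation solved for zeta at s. For Re s < 0 the argument (1 - s) / 2
  avoids the poles of Gamma, and 1 - s lies in the region of the Dirichlet series.\<close>

definition zeta_left :: "complex \<Rightarrow> complex" where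
  "zeta_left s = zeta_right (1 - s) * (rGamma (s / 2) * cpow pi (s / 2)) *
     (Gamma ((1 - s) / 2) * cpow pi (- ((1 - s) / 2)))"

lemma Gamma_half_left: "Re s < 0 \<Longrightarrow> (1 - s) / 2 \<notin> \<int>\<^sub>\<le>\<^sub>0"
proof
  assume "Re s < 0" "(1 - s) / 2 \<in> \<int>\<^sub>\<le>\<^sub>0"
  then obtain n where "(1 - s) / 2 = of_int n" "n \<le> 0" by (elim nonpos_Ints_cases)
  then have "Re ((1 - s) / 2) = of_int n" by simp
  then show False using \<open>Re s < 0\<close> \<open>n \<le> 0\<close> by simp
qed

lemma zeta_left_functional:
  assumes "Re s < 0"
  shows "zeta_left s * (rGamma ((1 - s) / 2) * cpow pi ((1 - s) / 2)) =
         zeta_right (1 - s) * (rGamma (s / 2) * cpow pi (s / 2))"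
  using Gamma_half_left[OF assms]
  by (simp add: zeta_left_def cpow_inverse rGamma_inverse_Gamma Gamma_eq_zero_iff field_simps)

lemma zeta_left_holomorphic: "zeta_left holomorphic_on {s. Re s < 0}"
proof -
  have "(zeta_right \<circ> (\<lambda>s. 1 - s)) holomorphic_on {s. Re s < 0}"
    by (rule holomorphic_on_compose_gen[OF _ zeta_right_holomorphic]) (auto intro!: holomorphic_intros)
  then show ?thesis
    unfolding zeta_left_def[abs_def] o_def
    using Gamma_half_left by (auto intro!: holomorphic_intros)
qed

lemma zeta_left_eq_right:
  assumes "-1 < Re s" "Re s < 0"
  shows "zeta_left s = zeta_right s"
proof -
  have "rGamma ((1 - s) / 2) * cpow pi ((1 - s) / 2) \<noteq> 0"
    using Gamma_half_left[OF assms(2)] by (simp add: rGamma_eq_zero_iff)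
  then show ?thesis
    using zeta_left_functional[OF assms(2)] zeta_right_functional[OF assms] by (metis mult_right_cancel)
qed

text \<open>The two branches agree on -1 < Re s < 0, so the seam at Re s = -1 does no harm. The
  value at 1 follows the normalisation of \<open>riemann_zeta\<close>.\<close>

definition zeta_glued :: "complex \<Rightarrow> complex" where
  "zeta_glued s = (if s = 1 then 0 else if Re s > -1 then zeta_right s else zeta_left s)"

lemma zeta_glued_holomorphic: "zeta_glued holomorphic_on (- {1})"
proof -
  have "zeta_glued holomorphic_on ({s. Re s > -1} - {1})"
    using zeta_right_holomorphic by (rule holomorphic_transform) (auto simp: zeta_glued_def)
  moreover have "zeta_glued holomorphic_on {s. Re s < 0}"
    using zeta_left_holomorphic by (rule holomorphic_transform) (auto simp: zeta_glued_def zeta_left_eq_right)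
  ultimately have "zeta_glued holomorphic_on (({s. Re s > -1} - {1}) \<union> {s. Re s < 0})"
    by (intro holomorphic_on_Un) (auto intro!: open_Diff open_halfspace_Re_gt open_halfspace_Re_lt)
  moreover have "({s. Re s > -1} - {1}) \<union> {s. Re s < 0} = - {1}" by auto
  ultimately show ?thesis by simp
qed

lemma zeta_term: "1 / of_nat (Suc n) powr s = cpow (real (Suc n)) (- s)"
  using cpow_eq_powr[of "real (Suc n)" s] by (simp add: cpow_inverse inverse_eq_divide del: of_nat_Suc)

text \<open>Existence for the definite description is \<open>zeta_glued\<close>; uniqueness is the
  identity theorem on the punctured plane, which is connected, starting from Re s > 1.\<close>

lemma riemann_zeta_eq_glued: "riemann_zeta = zeta_glued"
  unfolding riemann_zeta_def
proof (rule the_equality)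
  show "zeta_glued holomorphic_on - {1} \<and>
    (\<forall>s. 1 < Re s \<longrightarrow> zeta_glued s = (\<Sum>n. 1 / of_nat (Suc n) powr s)) \<and> zeta_glued 1 = 0"
    using zeta_glued_holomorphic
    by (auto simp: zeta_glued_def zeta_right_eq_series zeta_series_def zeta_term simp del: of_nat_Suc)
next
  fix f assume f: "f holomorphic_on - {1} \<and>
    (\<forall>s. 1 < Re s \<longrightarrow> f s = (\<Sum>n. 1 / of_nat (Suc n) powr s)) \<and> f 1 = 0"
  have "f s = zeta_glued s" if "s \<noteq> 1" for s
  proof (rule analytic_continuation_open[where s = "{s. Re s > 1}" and s' = "- {1}" and f = f and g = zeta_glued])
    show "connected (- {1::complex})" by (intro connected_punctured_universe) simp
    show "{s. Re s > 1} \<noteq> {}" by (auto intro: exI[of _ 2])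
    show "open {s. Re s > 1}" by (rule open_halfspace_Re_gt)
    show "f z = zeta_glued z" if "z \<in> {s. Re s > 1}" for z
      using that f by (auto simp: zeta_glued_def zeta_right_eq_series zeta_series_def zeta_term simp del: of_nat_Suc)
  qed (use f that zeta_glued_holomorphic in auto)
  then show "f = zeta_glued" using f by (auto simp: fun_eq_iff zeta_glued_def)
qed

text \<open>In this division-free form all factors other than zeta are entire, so the identity known
  for Re s < 0 spreads by the identity theorem over the plane without 0 and 1.\<close>

theorem riemann_zeta_functional_equation:
  assumes "s \<noteq> 0" "s \<noteq> 1"
  shows "riemann_zeta s * (rGamma ((1 - s) / 2) * cpow pi ((1 - s) / 2)) =
         riemann_zeta (1 - s) * (rGamma (s / 2) * cpow pi (s / 2))"
  unfolding riemann_zeta_eq_glued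
proof (rule analytic_continuation_open[where s = "{s. Re s < 0}" and s' = "- {0, 1}"
      and f = "\<lambda>s. zeta_glued s * (rGamma ((1 - s) / 2) * cpow pi ((1 - s) / 2))"
      and g = "\<lambda>s. zeta_glued (1 - s) * (rGamma (s / 2) * cpow pi (s / 2))"])
  have "connected (UNIV - {0, 1::complex})" by (intro connected_open_diff_countable) auto
  then show "connected (- {0, 1::complex})" by (simp add: Compl_eq_Diff_UNIV)
  show "{s. Re s < 0} \<noteq> {}" by (auto intro: exI[of _ "-1"])
  show "open {s. Re s < 0}" by (rule open_halfspace_Re_lt)
  have "(zeta_glued \<circ> (\<lambda>s. 1 - s)) holomorphic_on - {0, 1}"
    by (rule holomorphic_on_compose_gen[OF _ zeta_glued_holomorphic]) (auto intro!: holomorphic_intros)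
  then show "(\<lambda>s. zeta_glued (1 - s) * (rGamma (s / 2) * cpow pi (s / 2))) holomorphic_on - {0, 1}"
    unfolding o_def by (auto intro!: holomorphic_intros)
  show "(\<lambda>s. zeta_glued s * (rGamma ((1 - s) / 2) * cpow pi ((1 - s) / 2))) holomorphic_on - {0, 1}"
    by (auto intro!: holomorphic_intros holomorphic_on_subset[OF zeta_glued_holomorphic])
  show "zeta_glued z * (rGamma ((1 - z) / 2) * cpow pi ((1 - z) / 2)) =
         zeta_glued (1 - z) * (rGamma (z / 2) * cpow pi (z / 2))" if "z \<in> {s. Re s < 0}" for z
    using that zeta_left_functional[of z] zeta_left_eq_right[of z]
    by (auto simp: zeta_glued_def)
qed (use assms in auto)

section \<open>Bounds for quotients of Gamma functions\<close>

lemma abs_ln_one_plus_minus_self: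
  fixes x :: real
  assumes "x \<ge> -1/2"
  shows "\<bar>ln (1 + x) - x\<bar> \<le> 2 * x\<^sup>2"
proof (cases "x \<le> 1/2")
  case True
  then show ?thesis using assms abs_ln_one_plus_x_minus_x_bound[of x] by auto
next
  case False
  then have "ln (1 + x) \<ge> 0" "ln (1 + x) \<le> x" using ln_add_one_self_le_self[of x] by auto
  moreover have "x \<le> 2 * x\<^sup>2" using False by (simp add: power2_eq_square)
  ultimately show ?thesis by auto
qed

text \<open>With X = 2 Re u + |u|^2 one has |1 + u|^2 = 1 + X, so the logarithm is half of ln (1 +
  X), which differs from X by a quadratic quantity. Either alternative on \<open>u\<close> keeps X
  >= -1/2, away from the singularity.\<close>

lemma abs_ln_norm_one_plus_minus_Re:
  fixes u :: complex
  assumes "norm u \<le> U" "Re u \<ge> 0 \<or> norm u \<le> 1/4"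
  shows "\<bar>ln (norm (1 + u)) - Re u\<bar> \<le> ((2 + U)\<^sup>2 + 1) * (norm u)\<^sup>2" "norm (1 + u) > 0"
proof -
  define X where "X = 2 * Re u + (norm u)\<^sup>2"
  have sq: "(norm (1 + u))\<^sup>2 = 1 + X"
    unfolding X_def cmod_power2 by (simp add: power2_eq_square algebra_simps)
  have ru: "\<bar>Re u\<bar> \<le> norm u" by (rule abs_Re_le_cmod)
  have X: "X \<ge> -1/2"
  proof -
    have "Re u \<ge> -1/4" using assms(2) ru by linarith
    then show ?thesis using zero_le_power2[of "norm u"] unfolding X_def by linarith
  qed
  then show pos: "norm (1 + u) > 0" using sq by (cases "1 + u = 0") auto
  have "ln (norm (1 + u)) = ln (1 + X) / 2"
    using pos by (simp flip: sq add: ln_realpow)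
  then have "\<bar>ln (norm (1 + u)) - Re u\<bar> \<le> \<bar>ln (1 + X) - X\<bar> / 2 + (norm u)\<^sup>2 / 2"
  proof -
    have "\<bar>l / 2 - r\<bar> \<le> \<bar>l - (2 * r + n)\<bar> / 2 + n / 2" if "n \<ge> 0" for l r n :: real
    proof -
      have "l / 2 - r = (l - (2 * r + n)) / 2 + n / 2" by (simp add: field_simps)
      then have "\<bar>l / 2 - r\<bar> \<le> \<bar>(l - (2 * r + n)) / 2\<bar> + \<bar>n / 2\<bar>" by (metis abs_triangle_ineq)
      then show ?thesis using that by simp
    qed
    from this[of "(norm u)\<^sup>2" "ln (1 + X)" "Re u"] show ?thesis
      using \<open>ln (norm (1 + u)) = ln (1 + X) / 2\<close> by (simp add: X_def)
  qed
  also have "\<dots> \<le> X\<^sup>2 + (norm u)\<^sup>2 / 2"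
    using abs_ln_one_plus_minus_self[OF X] by simp
  also have "\<bar>X\<bar> \<le> (2 + U) * norm u"
  proof -
    have "\<bar>X\<bar> \<le> 2 * norm u + norm u * norm u"
      unfolding X_def power2_eq_square using ru by (smt (verit) mult_nonneg_nonneg norm_ge_zero)
    also have "\<dots> \<le> 2 * norm u + U * norm u" using assms(1) by (simp add: mult_right_mono)
    finally show ?thesis by (simp add: algebra_simps)
  qed
  then have "X\<^sup>2 \<le> ((2 + U) * norm u)\<^sup>2"
    using abs_le_square_iff[of X "(2 + U) * norm u"] assms(1) norm_ge_zero[of u]
    by (smt (verit) mult_nonneg_nonneg)
  finally have "\<bar>ln (norm (1 + u)) - Re u\<bar> \<le> (2 + U)\<^sup>2 * (norm u)\<^sup>2 + (norm u)\<^sup>2 / 2"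
    by (simp add: power_mult_distrib)
  then show "\<bar>ln (norm (1 + u)) - Re u\<bar> \<le> ((2 + U)\<^sup>2 + 1) * (norm u)\<^sup>2"
    unfolding distrib_right using zero_le_power2[of "norm u"] by linarith
qed

lemma norm_one_plus_le_exp: "norm (1 + v :: complex) \<le> exp (Re v + (norm v)\<^sup>2 / 2)"
proof -
  have "(norm (1 + v))\<^sup>2 = 1 + (2 * Re v + (norm v)\<^sup>2)"
    unfolding cmod_power2 by (simp add: power2_eq_square algebra_simps)
  also have "\<dots> \<le> exp (2 * Re v + (norm v)\<^sup>2)" by (rule exp_ge_add_one_self)
  also have "\<dots> = (exp (Re v + (norm v)\<^sup>2 / 2))\<^sup>2"
    by (simp flip: exp_of_nat_mult exp_double add: power2_eq_square algebra_simps flip: exp_add)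
  finally show ?thesis by (rule power2_le_imp_le) simp
qed

text \<open>Both sides agree to first order in 1 / a. In Re (d / a) = Re d Re (1 / a) - Im d Im (1 /
  a) the first term matches Re d times ln |1 + 1 / a|, and Im (1 / a) = - Im a |1 / a|^2 is already
  quadratic apart from the factor Im a. Hence the weight 1 + |Im a| in the error.\<close>

lemma norm_one_plus_mult_le:
  fixes a d :: complex
  assumes "a \<noteq> 0" "norm (1 / a) \<le> U" "Re a \<ge> 0 \<or> norm (1 / a) \<le> 1/4" "norm d \<le> D"
  shows "norm (1 + d / a) \<le> norm (1 + 1 / a) powr Re d *
           exp ((D\<^sup>2 + D + D * ((2 + U)\<^sup>2 + 1)) * ((1 + \<bar>Im a\<bar>) * (norm (1 / a))\<^sup>2))"
proof -
  define u where "u = 1 / a"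
  have "Re a \<ge> 0 \<Longrightarrow> Re u \<ge> 0" by (simp add: u_def Re_divide)
  then have u: "\<bar>ln (norm (1 + u)) - Re u\<bar> \<le> ((2 + U)\<^sup>2 + 1) * (norm u)\<^sup>2" "norm (1 + u) > 0"
    using abs_ln_norm_one_plus_minus_Re[of u U] assms unfolding u_def by auto
  have D0: "D \<ge> 0" using assms(4) norm_ge_zero[of d] by linarith
  have ReD: "\<bar>Re d\<bar> \<le> D" and ImD: "\<bar>Im d\<bar> \<le> D"
    using abs_Re_le_cmod[of d] abs_Im_le_cmod[of d] assms(4) by linarith+
  have Imu: "Im u = - Im a * (norm u)\<^sup>2"
    using assms(1) unfolding u_def
    by (simp add: Im_divide norm_divide power_divide cmod_power2)
  have "norm (1 + d * u) \<le> exp (Re (d * u) + (norm (d * u))\<^sup>2 / 2)" by (rule norm_one_plus_le_exp)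
  also have "Re (d * u) + (norm (d * u))\<^sup>2 / 2 \<le> Re d * ln (norm (1 + u)) +
      (D\<^sup>2 + D + D * ((2 + U)\<^sup>2 + 1)) * ((1 + \<bar>Im a\<bar>) * (norm u)\<^sup>2)"
  proof -
    have 1: "Re d * Re u \<le> Re d * ln (norm (1 + u)) + D * ((2 + U)\<^sup>2 + 1) * (norm u)\<^sup>2"
    proof -
      have "Re d * Re u - Re d * ln (norm (1 + u)) \<le> \<bar>Re d\<bar> * \<bar>ln (norm (1 + u)) - Re u\<bar>"
        by (metis abs_ge_self abs_minus_commute abs_mult right_diff_distrib)
      also have "\<dots> \<le> D * (((2 + U)\<^sup>2 + 1) * (norm u)\<^sup>2)"
        by (intro mult_mono ReD u) (use D0 in auto)
      finally show ?thesis by simp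
    qed
    have 2: "- Im d * Im u \<le> D * (\<bar>Im a\<bar> * (norm u)\<^sup>2)"
    proof -
      have "- Im d * Im u \<le> \<bar>Im d\<bar> * (\<bar>Im a\<bar> * (norm u)\<^sup>2)"
      proof -
        have "Im d * Im a \<le> \<bar>Im d\<bar> * \<bar>Im a\<bar>" by (metis abs_ge_self abs_mult)
        from mult_right_mono[OF this, of "(norm u)\<^sup>2"] show ?thesis
          unfolding Imu by (simp add: mult.assoc)
      qed
      also have "\<dots> \<le> D * (\<bar>Im a\<bar> * (norm u)\<^sup>2)" by (intro mult_right_mono ImD) auto
      finally show ?thesis .
    qed
    have 3: "(norm (d * u))\<^sup>2 / 2 \<le> D\<^sup>2 * (norm u)\<^sup>2"
    proof -
      have "(norm d)\<^sup>2 \<le> D\<^sup>2" by (intro power_mono assms) auto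
      then have "(norm d)\<^sup>2 * (norm u)\<^sup>2 \<le> D\<^sup>2 * (norm u)\<^sup>2" by (intro mult_right_mono) auto
      moreover have "0 \<le> (norm d)\<^sup>2 * (norm u)\<^sup>2" by simp
      ultimately show ?thesis unfolding norm_mult power_mult_distrib by linarith
    qed
    have 4: "A * (norm u)\<^sup>2 + D * (\<bar>Im a\<bar> * (norm u)\<^sup>2) \<le> (A + D) * ((1 + \<bar>Im a\<bar>) * (norm u)\<^sup>2)"
      if "A \<ge> 0" for A
    proof -
      have "0 \<le> A * (\<bar>Im a\<bar> * (norm u)\<^sup>2)" "0 \<le> D * (norm u)\<^sup>2"
        using that D0 by auto
      then show ?thesis by (simp add: algebra_simps)
    qed
    have "Re (d * u) + (norm (d * u))\<^sup>2 / 2 \<le> Re d * ln (norm (1 + u)) +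
        ((D\<^sup>2 + D * ((2 + U)\<^sup>2 + 1)) * (norm u)\<^sup>2 + D * (\<bar>Im a\<bar> * (norm u)\<^sup>2))"
      using 1 2 3 by (simp add: algebra_simps)
    also have "\<dots> \<le> Re d * ln (norm (1 + u)) +
      ((D\<^sup>2 + D * ((2 + U)\<^sup>2 + 1) + D) * ((1 + \<bar>Im a\<bar>) * (norm u)\<^sup>2))"
      using 4[of "D\<^sup>2 + D * ((2 + U)\<^sup>2 + 1)"] D0 by simp
    finally show ?thesis by (simp add: algebra_simps)
  qed
  also have "exp (Re d * ln (norm (1 + u)) + (D\<^sup>2 + D + D * ((2 + U)\<^sup>2 + 1)) * ((1 + \<bar>Im a\<bar>) * (norm u)\<^sup>2))
     = norm (1 + u) powr Re d * exp ((D\<^sup>2 + D + D * ((2 + U)\<^sup>2 + 1)) * ((1 + \<bar>Im a\<bar>) * (norm u)\<^sup>2))"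
    using u(2) by (simp add: powr_def exp_add)
  finally show ?thesis by (simp add: u_def)
qed

text \<open>Euler's limit writes Gamma a / Gamma (a + d) as the limit of n^(-d) times a product of
  (a + d + k) / (a + k). By the previous estimate the main parts telescope to a power of |a + n| /
  |a|, and the exponentials collect the sum bounded by \<open>B\<close>.\<close>

lemma norm_Gamma_quotient_le_aux:
  fixes a d :: complex
  assumes a: "\<And>k::nat. a + of_nat k \<noteq> 0" "\<And>k::nat. norm (1 / (a + of_nat k)) \<le> U"
    "\<And>k::nat. Re (a + of_nat k) \<ge> 0 \<or> norm (1 / (a + of_nat k)) \<le> 1/4"
    and d: "norm d \<le> D"
    and B: "\<And>n. (\<Sum>k<n. (1 + \<bar>Im a\<bar>) * (norm (1 / (a + of_nat k)))\<^sup>2) \<le> B"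
  shows "norm (Gamma a * rGamma (a + d)) \<le>
    exp ((D\<^sup>2 + D + D * ((2 + U)\<^sup>2 + 1)) * B) * norm a powr (- Re d)"
proof -
  define E where "E = D\<^sup>2 + D + D * ((2 + U)\<^sup>2 + 1)"
  have D0: "D \<ge> 0" using d norm_ge_zero[of d] by linarith
  have E: "E \<ge> 0" unfolding E_def using D0 by simp
  have fac: "norm ((a + d + of_nat k) / (a + of_nat k)) \<le>
     (norm (a + of_nat (Suc k)) powr Re d / norm (a + of_nat k) powr Re d) *
       exp (E * ((1 + \<bar>Im a\<bar>) * (norm (1 / (a + of_nat k)))\<^sup>2))" for k
  proof -
    have "(a + d + of_nat k) / (a + of_nat k) = 1 + d / (a + of_nat k)"
      "norm (1 + 1 / (a + of_nat k)) = norm (a + of_nat (Suc k)) / norm (a + of_nat k)"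
      using a(1)[of k] by (simp_all add: field_simps flip: norm_divide)
    then show ?thesis
      using norm_one_plus_mult_le[of "a + of_nat k" U d D] a(1,2,3)[of k] d
      by (simp add: E_def powr_divide)
  qed
  have prod: "norm (\<Prod>k<n. (a + d + of_nat k) / (a + of_nat k)) \<le>
     (norm (a + of_nat n) powr Re d / norm a powr Re d) *
       exp (E * (\<Sum>k<n. (1 + \<bar>Im a\<bar>) * (norm (1 / (a + of_nat k)))\<^sup>2))" for n
  proof (induction n)
    case 0
    then show ?case using a(1)[of 0] by simp
  next
    case (Suc n)
    have nz: "norm (a + of_nat n) powr Re d \<noteq> 0" using a(1)[of n] by simp
    have "norm (\<Prod>k<Suc n. (a + d + of_nat k) / (a + of_nat k)) \<le>
      ((norm (a + of_nat n) powr Re d / norm a powr Re d) *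
       exp (E * (\<Sum>k<n. (1 + \<bar>Im a\<bar>) * (norm (1 / (a + of_nat k)))\<^sup>2))) *
      ((norm (a + of_nat (Suc n)) powr Re d / norm (a + of_nat n) powr Re d) *
       exp (E * ((1 + \<bar>Im a\<bar>) * (norm (1 / (a + of_nat n)))\<^sup>2)))"
      unfolding prod.lessThan_Suc norm_mult by (intro mult_mono Suc.IH fac) auto
    also have "\<dots> = (norm (a + of_nat (Suc n)) powr Re d / norm a powr Re d) *
       exp (E * (\<Sum>k<Suc n. (1 + \<bar>Im a\<bar>) * (norm (1 / (a + of_nat k)))\<^sup>2))"
      using nz by (simp add: ring_distribs exp_add del: of_nat_Suc)
    finally show ?case .
  qed
  have bd: "norm (Gamma_series a n * rGamma_series (a + d) n) \<le>
    exp (E * B) * norm a powr (- Re d) * (norm (a + of_nat (Suc n)) / real n) powr Re d" if "n > 0" for n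
  proof -
    have poch: "pochhammer (a + d) (Suc n) / pochhammer a (Suc n) = (\<Prod>k<Suc n. (a + d + of_nat k) / (a + of_nat k))"
      unfolding pochhammer_prod prod_dividef by (simp add: atLeast0LessThan)
    have "Gamma_series a n * rGamma_series (a + d) n =
       exp (- d * of_real (ln (real n))) * (pochhammer (a + d) (Suc n) / pochhammer a (Suc n))"
    proof -
      have e: "exp (a * of_real (ln (real n))) * exp (- ((a + d) * of_real (ln (real n)))) = exp (- d * of_real (ln (real n)))"
        by (simp add: algebra_simps flip: exp_add)
      show ?thesis
      proof -
        have g: "f * x / p * (q / (f * y)) = x * inverse y * (q / p)" if "f \<noteq> 0" for f x p q y :: complex
          using that by (simp add: divide_inverse mult_ac)
        show ?thesis
          unfolding Gamma_series_def rGamma_series_def e[symmetric] exp_minus Suc_eq_plus1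
          by (rule g) simp
      qed
    qed
    then have "norm (Gamma_series a n * rGamma_series (a + d) n) =
       real n powr (- Re d) * norm (\<Prod>k<Suc n. (a + d + of_nat k) / (a + of_nat k))"
    proof -
      have "norm (exp (- d * of_real (ln (real n)))) = real n powr (- Re d)"
        using that by (simp add: powr_def)
      then show ?thesis
        unfolding \<open>Gamma_series a n * _ = _\<close> poch norm_mult by simp
    qed
    also have "\<dots> \<le> real n powr (- Re d) * ((norm (a + of_nat (Suc n)) powr Re d / norm a powr Re d) * exp (E * B))"
    proof -
      have "E * (\<Sum>k<Suc n. (1 + \<bar>Im a\<bar>) * (norm (1 / (a + of_nat k)))\<^sup>2) \<le> E * B"
        by (rule mult_left_mono[OF B E])
      then have "norm (\<Prod>k<Suc n. (a + d + of_nat k) / (a + of_nat k)) \<le>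
        (norm (a + of_nat (Suc n)) powr Re d / norm a powr Re d) * exp (E * B)"
        by (intro order.trans[OF prod] mult_left_mono) (simp_all only: exp_le_cancel_iff divide_nonneg_nonneg powr_ge_zero)
      then show ?thesis by (rule mult_left_mono) simp
    qed
    also have "\<dots> = exp (E * B) * norm a powr (- Re d) * (norm (a + of_nat (Suc n)) / real n) powr Re d"
      by (simp add: powr_minus powr_divide divide_simps del: of_nat_Suc)
    finally show ?thesis by simp
  qed
  have lim1: "(\<lambda>n. norm (a + of_nat (Suc n)) / real n) \<longlonglongrightarrow> 1"
  proof -
    have "(\<lambda>n. (a + 1) / of_nat n + 1) \<longlonglongrightarrow> 0 + 1"
      by (intro tendsto_intros lim_const_over_n)
    then have "(\<lambda>n. norm ((a + 1) / of_nat n + 1)) \<longlonglongrightarrow> norm (0 + 1 :: complex)"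
      by (rule tendsto_norm)
    moreover have "\<forall>\<^sub>F n in sequentially. norm ((a + 1) / of_nat n + 1) = norm (a + of_nat (Suc n)) / real n"
    proof (rule eventually_sequentiallyI[of 1])
      fix n :: nat assume "1 \<le> n"
      then have "(a + 1) / of_nat n + 1 = (a + of_nat (Suc n)) / of_nat n" by (simp add: field_simps)
      then show "norm ((a + 1) / of_nat n + 1) = norm (a + of_nat (Suc n)) / real n"
        by (simp add: norm_divide del: of_nat_Suc)
    qed
    ultimately show ?thesis by (simp add: filterlim_cong)
  qed
  have L1: "(\<lambda>n. exp (E * B) * norm a powr (- Re d) * (norm (a + of_nat (Suc n)) / real n) powr Re d)
     \<longlonglongrightarrow> exp (E * B) * norm a powr (- Re d) * 1 powr Re d"
    by (intro tendsto_intros lim1) auto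
  have L2: "(\<lambda>n. norm (Gamma_series a n * rGamma_series (a + d) n)) \<longlonglongrightarrow> norm (Gamma a * rGamma (a + d))"
    by (intro tendsto_norm tendsto_mult Gamma_series_LIMSEQ rGamma_series_LIMSEQ)
  have "norm (Gamma a * rGamma (a + d)) \<le> exp (E * B) * norm a powr (- Re d) * 1 powr Re d"
    by (rule LIMSEQ_le[OF L2 L1]) (use bd in \<open>auto intro!: exI[of _ 1]\<close>)
  then show ?thesis by (simp add: E_def)
qed

text \<open>Since (x + k)^2 + y^2 is at least half the square of x + k + y, the sum of reciprocals
  is compared with a telescoping sum of size 1 / (\<alpha> + y). The factor 1 + y cancels this
  decay, so the bound is independent of x and y.\<close>

lemma sum_inverse_square_le:
  fixes x y \<alpha> :: real
  assumes "0 < \<alpha>" "\<alpha> \<le> x" "0 \<le> y"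
  shows "(\<Sum>k<n. (1 + y) / ((x + real k)\<^sup>2 + y\<^sup>2)) \<le> 2 * (1 + 1/\<alpha>)\<^sup>2"
proof -
  define X where "X k = x + real k + y" for k
  have X: "X k \<ge> \<alpha> + y" "X k > 0" for k using assms unfolding X_def by auto
  have t: "1 / ((x + real k)\<^sup>2 + y\<^sup>2) \<le> 2 * (1 + 1/\<alpha>) * (1 / X k - 1 / X (Suc k))" for k
  proof -
    have "1 / ((x + real k)\<^sup>2 + y\<^sup>2) \<le> 2 / (X k)\<^sup>2"
    proof -
      have "(X k)\<^sup>2 \<le> 2 * ((x + real k)\<^sup>2 + y\<^sup>2)"
        using sum_squares_ge_zero[of "x + real k - y" 0] unfolding X_def
        by (simp add: power2_eq_square algebra_simps)
      moreover have "(x + real k)\<^sup>2 + y\<^sup>2 > 0" using assms by (intro add_pos_nonneg) auto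
      ultimately show ?thesis using X(2)[of k] by (simp add: field_simps)
    qed
    also have "2 / (X k)\<^sup>2 \<le> 2 * (1 + 1/\<alpha>) * (1 / (X k * X (Suc k)))"
    proof -
      have "X (Suc k) / X k \<le> 1 + 1/\<alpha>"
      proof -
        have "X (Suc k) / X k = 1 + 1 / X k" using X(2)[of k] by (simp add: X_def field_simps)
        also have "1 / X k \<le> 1 / \<alpha>" using X(1)[of k] assms by (intro divide_left_mono) auto
        finally show ?thesis by simp
      qed
      then have "X (Suc k) / X k * (2 / (X k * X (Suc k))) \<le> (1 + 1/\<alpha>) * (2 / (X k * X (Suc k)))"
        using X(2)[of k] X(2)[of "Suc k"] by (intro mult_right_mono) auto
      then show ?thesis using X(2)[of k] X(2)[of "Suc k"] by (simp add: power2_eq_square)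
    qed
    also have "1 / (X k * X (Suc k)) = 1 / X k - 1 / X (Suc k)"
      using X(2)[of k] X(2)[of "Suc k"] by (simp add: field_simps) (simp add: X_def)
    finally show ?thesis .
  qed
  have "(\<Sum>k<n. 1 / ((x + real k)\<^sup>2 + y\<^sup>2)) \<le> (\<Sum>k<n. 2 * (1 + 1/\<alpha>) * (1 / X k - 1 / X (Suc k)))"
    by (intro sum_mono t)
  also have "\<dots> = 2 * (1 + 1/\<alpha>) * (1 / X 0 - 1 / X n)"
    by (subst sum_distrib_left[symmetric], subst sum_lessThan_telescope') simp
  also have "\<dots> \<le> 2 * (1 + 1/\<alpha>) * (1 / (\<alpha> + y))"
  proof (intro mult_left_mono)
    have "1 / X 0 \<le> 1 / (\<alpha> + y)" using X(1)[of 0] assms by (intro divide_left_mono) (auto simp: X)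
    moreover have "1 / X n \<ge> 0" using X(2)[of n] by simp
    ultimately show "1 / X 0 - 1 / X n \<le> 1 / (\<alpha> + y)" by linarith
  qed (use assms in auto)
  finally have "(1 + y) * (\<Sum>k<n. 1 / ((x + real k)\<^sup>2 + y\<^sup>2)) \<le> (1 + y) * (2 * (1 + 1/\<alpha>) * (1 / (\<alpha> + y)))"
    using assms by (intro mult_left_mono) auto
  also have "\<dots> = 2 * (1 + 1/\<alpha>) * ((1 + y) / (\<alpha> + y))" by simp
  also have "\<dots> \<le> 2 * (1 + 1/\<alpha>) * (1 + 1/\<alpha>)"
  proof (intro mult_left_mono)
    show "(1 + y) / (\<alpha> + y) \<le> 1 + 1 / \<alpha>" using assms by (simp add: field_simps)
  qed (use assms in auto)
  finally have "(1 + y) * (\<Sum>k<n. 1 / ((x + real k)\<^sup>2 + y\<^sup>2)) \<le> 2 * (1 + 1/\<alpha>) * (1 + 1/\<alpha>)" .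
  then show ?thesis by (simp only: sum_distrib_left power2_eq_square mult.assoc times_divide_eq_right mult_1_right)
qed

lemma norm_Gamma_quotient_le_right:
  assumes "\<alpha> > 0" "D \<ge> 0"
  shows "\<exists>C>0. \<forall>a d. \<alpha> \<le> Re a \<longrightarrow> norm d \<le> D \<longrightarrow>
    norm (Gamma a * rGamma (a + d)) \<le> C * norm (a::complex) powr (- Re d)"
proof (intro exI conjI allI impI)
  fix a d :: complex assume a: "\<alpha> \<le> Re a" and d: "norm d \<le> D"
  show "norm (Gamma a * rGamma (a + d)) \<le>
    exp ((D\<^sup>2 + D + D * ((2 + 1/\<alpha>)\<^sup>2 + 1)) * (2 * (1 + 1/\<alpha>)\<^sup>2)) * norm a powr (- Re d)"
  proof (rule norm_Gamma_quotient_le_aux)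
    fix k :: nat
    have r: "\<alpha> \<le> Re (a + of_nat k)" using a by simp
    then show nz: "a + of_nat k \<noteq> 0" using assms(1) by (metis not_le zero_complex.sel(1))
    have "\<alpha> \<le> norm (a + of_nat k)" using r complex_Re_le_cmod order.trans by blast
    then show "norm (1 / (a + of_nat k)) \<le> 1/\<alpha>" using assms(1) nz by (simp add: norm_divide frac_le)
    show "0 \<le> Re (a + of_nat k) \<or> norm (1 / (a + of_nat k)) \<le> 1 / 4" using r assms by simp
  next
    fix n
    have "(\<Sum>k<n. (1 + \<bar>Im a\<bar>) * (norm (1 / (a + of_nat k)))\<^sup>2) =
      (\<Sum>k<n. (1 + \<bar>Im a\<bar>) / ((Re a + real k)\<^sup>2 + \<bar>Im a\<bar>\<^sup>2))"
      by (simp add: norm_divide power_divide cmod_power2)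
    also have "\<dots> \<le> 2 * (1 + 1/\<alpha>)\<^sup>2" using assms a by (intro sum_inverse_square_le) auto
    finally show "(\<Sum>k<n. (1 + \<bar>Im a\<bar>) * (norm (1 / (a + of_nat k)))\<^sup>2) \<le> 2 * (1 + 1/\<alpha>)\<^sup>2" .
  qed (use d in auto)
qed auto

text \<open>Here Re a may be negative; |Im a| >= 4 alone keeps |1 / (a + k)| <= 1/4. The error sum
  is reduced to the former one by moving the real part to the right by m + 1.\<close>

lemma norm_Gamma_quotient_le_Im:
  assumes "m \<ge> 0" "D \<ge> 0"
  shows "\<exists>C>0. \<forall>a d. - m \<le> Re a \<longrightarrow> 4 \<le> \<bar>Im a\<bar> \<longrightarrow> norm d \<le> D \<longrightarrow>
    norm (Gamma a * rGamma (a + d)) \<le> C * norm (a::complex) powr (- Re d)"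
proof (intro exI conjI allI impI)
  fix a d :: complex assume a: "- m \<le> Re a" "4 \<le> \<bar>Im a\<bar>" and d: "norm d \<le> D"
  show "norm (Gamma a * rGamma (a + d)) \<le>
    exp ((D\<^sup>2 + D + D * ((2 + 1)\<^sup>2 + 1)) * ((3 + 2 * (m+1)\<^sup>2) * (2 * (1 + 1/1)\<^sup>2))) * norm a powr (- Re d)"
  proof (rule norm_Gamma_quotient_le_aux)
    fix k :: nat
    have r: "4 \<le> \<bar>Im (a + of_nat k)\<bar>" using a by simp
    then show nz: "a + of_nat k \<noteq> 0" by (metis abs_zero not_numeral_le_zero zero_complex.sel(2))
    have "4 \<le> norm (a + of_nat k)" using r abs_Im_le_cmod order.trans by blast
    then have 4: "norm (1 / (a + of_nat k)) \<le> 1/4" using nz by (simp add: norm_divide frac_le)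
    then show "norm (1 / (a + of_nat k)) \<le> 1" by simp
    show "0 \<le> Re (a + of_nat k) \<or> norm (1 / (a + of_nat k)) \<le> 1 / 4" using 4 by simp
  next
    fix n
    define y where "y = \<bar>Im a\<bar>"
    have "(\<Sum>k<n. (1 + \<bar>Im a\<bar>) * (norm (1 / (a + of_nat k)))\<^sup>2) =
      (\<Sum>k<n. (1 + y) / ((Re a + real k)\<^sup>2 + y\<^sup>2))"
      by (simp add: norm_divide power_divide cmod_power2 y_def)
    \<comment> \<open>After the shift the real part is at least 1. The factor 3 + 2 (m + 1)^2 pays
      for it, by (x + m + 1)^2 <= 2 x^2 + 2 (m + 1)^2 and y >= 1.\<close>
    also have "\<dots> \<le> (\<Sum>k<n. (3 + 2 * (m+1)\<^sup>2) * ((1 + y) / ((Re a + (m+1) + real k)\<^sup>2 + y\<^sup>2)))"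
    proof (intro sum_mono)
      fix k
      define x where "x = Re a + real k"
      have "(x + (m+1))\<^sup>2 \<le> 2 * x\<^sup>2 + 2 * (m+1)\<^sup>2"
        using sum_squares_ge_zero[of "x - (m+1)" 0] by (simp add: power2_eq_square algebra_simps)
      moreover have "(m+1)\<^sup>2 * 1 \<le> (m+1)\<^sup>2 * y\<^sup>2"
        using a(2) one_le_power[of y 2] unfolding y_def by (intro mult_left_mono) simp_all
      moreover have "0 \<le> (m+1)\<^sup>2 * x\<^sup>2" by simp
      ultimately have "(x + (m+1))\<^sup>2 + y\<^sup>2 \<le> (3 + 2 * (m+1)\<^sup>2) * (x\<^sup>2 + y\<^sup>2)"
      proof -
        have "(3 + 2 * M) * (x\<^sup>2 + y\<^sup>2) = 3 * x\<^sup>2 + 3 * y\<^sup>2 + 2 * (M * x\<^sup>2) + 2 * (M * y\<^sup>2)" for M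
          by (simp add: algebra_simps)
        from this[of "(m+1)\<^sup>2"] show ?thesis
          using zero_le_power2[of x] zero_le_power2[of y] \<open>(x + (m+1))\<^sup>2 \<le> _\<close>
            \<open>(m+1)\<^sup>2 * 1 \<le> _\<close> \<open>0 \<le> (m+1)\<^sup>2 * x\<^sup>2\<close> by linarith
      qed
      moreover have "x\<^sup>2 + y\<^sup>2 > 0" "(x + (m+1))\<^sup>2 + y\<^sup>2 > 0" "1 + y \<ge> 0"
        using a(2) zero_le_power2[of x] zero_le_power2[of "x + (m+1)"] unfolding y_def
        by (smt (verit) zero_less_power)+
      ultimately have "1 / (x\<^sup>2 + y\<^sup>2) \<le> (3 + 2 * (m+1)\<^sup>2) / ((x + (m+1))\<^sup>2 + y\<^sup>2)"
        by (simp add: field_simps)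
      from mult_left_mono[OF this \<open>1 + y \<ge> 0\<close>]
      show "(1 + y) / ((Re a + real k)\<^sup>2 + y\<^sup>2) \<le> (3 + 2 * (m+1)\<^sup>2) * ((1 + y) / ((Re a + (m+1) + real k)\<^sup>2 + y\<^sup>2))"
        by (simp add: x_def algebra_simps)
    qed
    also have "\<dots> \<le> (3 + 2 * (m+1)\<^sup>2) * (2 * (1 + 1/1)\<^sup>2)"
      unfolding sum_distrib_left[symmetric]
      using a by (intro mult_left_mono sum_inverse_square_le) (auto simp: y_def)
    finally show "(\<Sum>k<n. (1 + \<bar>Im a\<bar>) * (norm (1 / (a + of_nat k)))\<^sup>2) \<le> (3 + 2 * (m+1)\<^sup>2) * (2 * (1 + 1/1)\<^sup>2)" .
  qed (use d in auto)
qed auto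

section \<open>The Mellin symbol of the kernel\<close>

lemma integrable_one_plus_abs_powr:
  fixes r :: real
  assumes "r > 1"
  shows "integrable lborel (\<lambda>x. (1 + \<bar>x\<bar>) powr (- r))"
proof -
  define g where "g x = indicator {1<..} x *\<^sub>R x powr (- r)" for x :: real
  have "integrable lborel (\<lambda>x. norm (indicator {1<..} x *\<^sub>R cpow x (of_real (1 - r) - 1)))"
    using cpow_integral_1_inf(1)[of "of_real (1 - r)"] assms unfolding set_integrable_def
    by (intro integrable_norm) simp
  moreover have "(\<lambda>x. norm (indicator {1<..} x *\<^sub>R cpow x (of_real (1 - r) - 1))) = g"
    by (auto simp: g_def indicator_def norm_cpow)
  ultimately have g: "integrable lborel g" by simp
  have "integrable lborel (\<lambda>x. g (1 + 1 * x) + g (1 + (- 1) * x))"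
    by (intro Bochner_Integration.integrable_add lborel_integrable_real_affine g) auto
  then show ?thesis
  proof (rule Bochner_Integration.integrable_bound)
    have "norm ((1 + \<bar>x\<bar>) powr (- r)) \<le> norm (g (1 + 1 * x) + g (1 + (- 1) * x))" if "x \<noteq> 0" for x
      using that by (auto simp: g_def indicator_def)
    then show "AE x in lborel. norm ((1 + \<bar>x\<bar>) powr (- r)) \<le> norm (g (1 + 1 * x) + g (1 + (- 1) * x))"
      using AE_lborel_singleton[of 0] by (auto elim: AE_mp)
  qed measurable
qed

text \<open>Young's inequality with exponent P = 2 / \<eta> separates the factors into (1 +
  |t|)^(-2) and (1 + |t - t0|)^(-Q) with Q > 1. The integral of the second does not depend on t0, by
  translation.\<close>

lemma one_plus_abs_convolution_bound:
  fixes \<eta> :: real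
  assumes "0 < \<eta>" "\<eta> \<le> 1"
  obtains B where "B \<ge> 0"
    "\<And>t0. integrable lborel (\<lambda>t. (1 + \<bar>t\<bar>) powr (- \<eta>) * (1 / (1 + \<bar>t - t0\<bar>)))"
    "\<And>t0. (LINT t|lborel. (1 + \<bar>t\<bar>) powr (- \<eta>) * (1 / (1 + \<bar>t - t0\<bar>))) \<le> B"
proof -
  define P where "P = 2 / \<eta>"
  define Q where "Q = P / (P - 1)"
  have P: "P \<ge> 2" using assms by (simp add: P_def field_simps)
  have Q: "Q > 1" "1 / P + 1 / Q = 1" using P by (simp_all add: Q_def field_simps)
  define h where "h r x = (1 + \<bar>x\<bar>) powr (- r)" for r x :: real
  have [measurable]: "h r \<in> borel_measurable borel" for r unfolding h_def by measurable
  have h: "integrable lborel (h r)" if "r > 1" for r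
    unfolding h_def using integrable_one_plus_abs_powr[OF that] .
  have i: "integrable lborel (\<lambda>t. h 2 t + h Q (- t0 + 1 * t))" for t0
    by (intro Bochner_Integration.integrable_add lborel_integrable_real_affine h Q) auto
  have "(LINT t|lborel. h 2 t + h Q (- t0 + 1 * t)) = (LINT t|lborel. h 2 t) + (LINT t|lborel. h Q (- t0 + 1 * t))" for t0
    by (intro Bochner_Integration.integral_add lborel_integrable_real_affine h Q) auto
  moreover have "(LINT t|lborel. h Q (- t0 + 1 * t)) = (LINT t|lborel. h Q t)" for t0
    using lborel_integral_real_affine[of 1 "h Q" "- t0"] by simp
  ultimately have v: "(LINT t|lborel. h 2 t + h Q (- t0 + 1 * t)) = (LINT t|lborel. h 2 t) + (LINT t|lborel. h Q t)" for t0
    by simp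
  have bd: "(1 + \<bar>t\<bar>) powr (- \<eta>) * (1 / (1 + \<bar>t - t0\<bar>)) \<le> h 2 t + h Q (- t0 + 1 * t)" for t t0
  proof -
    have "(1 + \<bar>t\<bar>) powr (- \<eta>) * (1 / (1 + \<bar>t - t0\<bar>)) \<le>
      ((1 + \<bar>t\<bar>) powr (- \<eta>)) powr P / P + (1 / (1 + \<bar>t - t0\<bar>)) powr Q / Q"
      using P Q by (intro Youngs_inequality) auto
    also have "((1 + \<bar>t\<bar>) powr (- \<eta>)) powr P = h 2 t"
      using assms by (simp add: h_def powr_powr P_def)
    also have "(1 / (1 + \<bar>t - t0\<bar>)) powr Q = h Q (- t0 + 1 * t)"
      by (simp add: h_def powr_minus powr_divide inverse_eq_divide)
    also have "h 2 t / P + h Q (- t0 + 1 * t) / Q \<le> h 2 t + h Q (- t0 + 1 * t)"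
    proof -
      have "a / c \<le> a" if "a \<ge> 0" "c \<ge> 1" for a c :: real
        using that divide_left_mono[of 1 c a] by simp
      then show ?thesis using P Q by (intro add_mono) (auto simp: h_def)
    qed
    finally show ?thesis .
  qed
  have int: "integrable lborel (\<lambda>t. (1 + \<bar>t\<bar>) powr (- \<eta>) * (1 / (1 + \<bar>t - t0\<bar>)))" for t0
    by (rule Bochner_Integration.integrable_bound[OF i[of t0]])
       (use bd order.trans[OF bd abs_ge_self] in \<open>auto intro!: AE_I2\<close>)
  show ?thesis
  proof
    show "0 \<le> (LINT t|lborel. h 2 t) + (LINT t|lborel. h Q t)"
      by (intro add_nonneg_nonneg integral_nonneg_AE AE_I2) (auto simp: h_def)
    show "(LINT t|lborel. (1 + \<bar>t\<bar>) powr (- \<eta>) * (1 / (1 + \<bar>t - t0\<bar>))) \<le> (LINT t|lborel. h 2 t) + (LINT t|lborel. h Q t)" for t0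
      using integral_mono[OF int i bd] unfolding v .
  qed (rule int)
qed

text \<open>K(S) with \<open>p\<close> and \<open>q\<close> as free parameters. The denominators
  enter through the entire \<open>rGamma\<close>, so only the two numerator factors have
  poles.\<close>

definition mellin_symbol :: "complex \<Rightarrow> complex \<Rightarrow> complex \<Rightarrow> complex" where
  "mellin_symbol p q S = Gamma (S + p) * Gamma (S + q) * rGamma (1/2 + p - S) * rGamma (1/2 + q - S)"

text \<open>The two arguments run in opposite directions along a vertical line. Conjugating the
  second leaves the norm unchanged and puts it at an offset from the first that is independent of Im
  S, so the quotient bounds apply with a bounded \<open>d\<close>.\<close>

lemma norm_Gamma_rGamma_reflect:
  "norm (Gamma (S + p) * rGamma (1/2 + p - S)) =
   norm (Gamma (S + p) * rGamma ((S + p) + Complex (1/2 - 2 * Re S) (- 2 * Im p)))"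
proof -
  have "(S + p) + Complex (1/2 - 2 * Re S) (- 2 * Im p) = cnj (1/2 + p - S)"
    by (simp add: complex_eq_iff)
  moreover have "norm (rGamma (cnj (1/2 + p - S))) = norm (rGamma (1/2 + p - S))"
    by (metis cnj_rGamma complex_mod_cnj)
  ultimately show ?thesis by (simp only: norm_mult)
qed

lemma norm_Complex_le: "norm (Complex a b) \<le> \<bar>a\<bar> + \<bar>b\<bar>"
  using cmod_le[of "Complex a b"] by simp

lemma Gamma_pair_line_bound:
  assumes "\<sigma> + \<rho> > 0" "\<sigma> \<le> 1/4" "D \<ge> 0"
  shows "\<exists>C>0. \<forall>p t. \<rho> \<le> Re p \<longrightarrow> \<bar>Im p\<bar> \<le> D \<longrightarrow>
    norm (Gamma (Complex \<sigma> t + p) * rGamma (1/2 + p - Complex \<sigma> t)) \<le> C * (1 + \<bar>t\<bar>) powr (- (1/2 - 2 * \<sigma>))"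
proof -
  define \<alpha> where "\<alpha> = \<sigma> + \<rho>"
  have \<alpha>: "\<alpha> > 0" using assms by (simp add: \<alpha>_def)
  have "\<bar>1/2 - 2 * \<sigma>\<bar> + 2 * D \<ge> 0" using assms by simp
  then obtain C where C: "C > 0" "\<And>a d. \<alpha> \<le> Re a \<Longrightarrow> norm d \<le> \<bar>1/2 - 2 * \<sigma>\<bar> + 2 * D \<Longrightarrow>
      norm (Gamma a * rGamma (a + d)) \<le> C * norm (a::complex) powr (- Re d)"
    using norm_Gamma_quotient_le_right[OF \<alpha>, of "\<bar>1/2 - 2 * \<sigma>\<bar> + 2 * D"] by auto
  \<comment> \<open>Chosen so that 1 + |t| <= E |a|: the constant part 1 + D is absorbed by |a| >=
    \<alpha>.\<close>
  define E where "E = (1 + D) / \<alpha> + 1"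
  have E: "E > 0" using \<alpha> assms by (simp add: E_def add_nonneg_pos)
  have "norm (Gamma (Complex \<sigma> t + p) * rGamma (1/2 + p - Complex \<sigma> t)) \<le>
    C * E powr (1/2 - 2 * \<sigma>) * (1 + \<bar>t\<bar>) powr (- (1/2 - 2 * \<sigma>))" if p: "\<rho> \<le> Re p" "\<bar>Im p\<bar> \<le> D" for p t
  proof -
    define a where "a = Complex \<sigma> t + p"
    have a: "\<alpha> \<le> Re a" using p by (simp add: a_def \<alpha>_def)
    have na: "\<alpha> \<le> norm a" using a complex_Re_le_cmod order.trans by blast
    have "1 + \<bar>t\<bar> \<le> 1 + D + \<bar>Im a\<bar>" using p by (simp add: a_def)
    also have "\<dots> \<le> (1 + D) / \<alpha> * norm a + norm a"
    proof (intro add_mono abs_Im_le_cmod)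
      have "(1 + D) / \<alpha> * \<alpha> \<le> (1 + D) / \<alpha> * norm a" using \<alpha> assms na by (intro mult_left_mono) auto
      then show "1 + D \<le> (1 + D) / \<alpha> * norm a" using \<alpha> by simp
    qed
    also have "\<dots> = E * norm a" by (simp add: E_def algebra_simps)
    finally have t: "1 + \<bar>t\<bar> \<le> E * norm a" .
    have "norm (Gamma a * rGamma (1/2 + p - Complex \<sigma> t)) = norm (Gamma a * rGamma (a + Complex (1/2 - 2 * \<sigma>) (- 2 * Im p)))"
      unfolding a_def using norm_Gamma_rGamma_reflect[of "Complex \<sigma> t" p] by simp
    also have "\<dots> \<le> C * norm a powr (- Re (Complex (1/2 - 2 * \<sigma>) (- 2 * Im p)))"
      by (intro C(2) a order.trans[OF norm_Complex_le]) (use p in simp)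
    also have "\<dots> = C * (1 / norm a) powr (1/2 - 2 * \<sigma>)"
    proof -
      have "x powr (- e) = (1 / x) powr e" if "x \<ge> 0" for x e :: real
        using that by (simp add: powr_minus powr_divide inverse_eq_divide)
      then show ?thesis by (metis complex.sel(1) norm_ge_zero)
    qed
    \<comment> \<open>Monotonicity in the base needs a nonnegative exponent, that is \<sigma> <=
      1/4.\<close>
    also have "\<dots> \<le> C * (E / (1 + \<bar>t\<bar>)) powr (1/2 - 2 * \<sigma>)"
    proof (intro mult_left_mono powr_mono2)
      have "norm a > 0" using na \<alpha> by linarith
      then have "(1 + \<bar>t\<bar>) / norm a \<le> E" using t by (simp add: divide_le_eq)
      then show "1 / norm a \<le> E / (1 + \<bar>t\<bar>)" by (simp add: pos_le_divide_eq)
    qed (use assms C in auto)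
    also have "\<dots> = C * E powr (1/2 - 2 * \<sigma>) * (1 + \<bar>t\<bar>) powr (- (1/2 - 2 * \<sigma>))"
    proof -
      have "(E / x) powr e = E powr e * x powr (- e)" if "x > 0" for x e :: real
        using that E by (simp add: powr_divide powr_minus_divide)
      from this[of "1 + \<bar>t\<bar>"] show ?thesis by (simp only: mult.assoc zero_less_one add_pos_nonneg abs_ge_zero)
    qed
    finally show ?thesis unfolding a_def .
  qed
  moreover have "C * E powr (1/2 - 2 * \<sigma>) > 0" using C E by simp
  ultimately show ?thesis by blast
qed

lemma mellin_symbol_line_bound:
  assumes "\<sigma> + \<rho> > 0" "\<sigma> \<le> 1/4" "D \<ge> 0"
  shows "\<exists>C>0. \<forall>p q t. \<rho> \<le> Re p \<longrightarrow> \<rho> \<le> Re q \<longrightarrow> \<bar>Im p\<bar> \<le> D \<longrightarrow> \<bar>Im q\<bar> \<le> D \<longrightarrow>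
    norm (mellin_symbol p q (Complex \<sigma> t)) \<le> C * (1 + \<bar>t\<bar>) powr (- (1 - 4 * \<sigma>))"
proof -
  obtain C where C: "C > 0" "\<And>p t. \<rho> \<le> Re p \<Longrightarrow> \<bar>Im p\<bar> \<le> D \<Longrightarrow>
    norm (Gamma (Complex \<sigma> t + p) * rGamma (1/2 + p - Complex \<sigma> t)) \<le> C * (1 + \<bar>t\<bar>) powr (- (1/2 - 2 * \<sigma>))"
    using Gamma_pair_line_bound[OF assms] by blast
  have "norm (mellin_symbol p q (Complex \<sigma> t)) \<le> C * C * (1 + \<bar>t\<bar>) powr (- (1 - 4 * \<sigma>))"
    if "\<rho> \<le> Re p" "\<rho> \<le> Re q" "\<bar>Im p\<bar> \<le> D" "\<bar>Im q\<bar> \<le> D" for p q t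
  proof -
    have "norm (mellin_symbol p q (Complex \<sigma> t)) =
      norm (Gamma (Complex \<sigma> t + p) * rGamma (1/2 + p - Complex \<sigma> t)) * norm (Gamma (Complex \<sigma> t + q) * rGamma (1/2 + q - Complex \<sigma> t))"
      by (simp add: mellin_symbol_def norm_mult)
    also have "\<dots> \<le> (C * (1 + \<bar>t\<bar>) powr (- (1/2 - 2 * \<sigma>))) * (C * (1 + \<bar>t\<bar>) powr (- (1/2 - 2 * \<sigma>)))"
      using C that by (intro mult_mono) auto
    also have "\<dots> = C * C * ((1 + \<bar>t\<bar>) powr (- (1/2 - 2 * \<sigma>)) * (1 + \<bar>t\<bar>) powr (- (1/2 - 2 * \<sigma>)))" by simp
    also have "(1 + \<bar>t\<bar>) powr (- (1/2 - 2 * \<sigma>)) * (1 + \<bar>t\<bar>) powr (- (1/2 - 2 * \<sigma>)) = (1 + \<bar>t\<bar>) powr (- (1 - 4 * \<sigma>))"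
      by (simp flip: powr_add)
    finally show ?thesis .
  qed
  moreover have "C * C > 0" using C by simp
  ultimately show ?thesis by blast
qed

text \<open>Boundedness is enough on horizontal segments, because the symbol will occur there over
  S0 - S, which supplies the decay.\<close>

lemma mellin_symbol_horizontal_bound:
  fixes p q :: complex
  obtains C H where "C \<ge> 0" "\<And>S. b \<le> Re S \<Longrightarrow> Re S \<le> 1/4 \<Longrightarrow> H \<le> \<bar>Im S\<bar> \<Longrightarrow> norm (mellin_symbol p q S) \<le> C"
proof -
  have *: "\<exists>C>0. \<forall>S. b \<le> Re S \<longrightarrow> Re S \<le> 1/4 \<longrightarrow> 4 + \<bar>Im p\<bar> \<le> \<bar>Im S\<bar> \<longrightarrow> norm (Gamma (S + p) * rGamma (1/2 + p - S)) \<le> C" for p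
  proof -
    define m where "m = \<bar>b\<bar> + \<bar>Re p\<bar>"
    define D where "D = 1 + 2 * \<bar>b\<bar> + 2 * \<bar>Im p\<bar>"
    have "m \<ge> 0" "D \<ge> 0" by (auto simp: m_def D_def)
    then obtain C where C: "C > 0" "\<And>a d. - m \<le> Re a \<Longrightarrow> 4 \<le> \<bar>Im a\<bar> \<Longrightarrow> norm d \<le> D \<Longrightarrow>
      norm (Gamma a * rGamma (a + d)) \<le> C * norm (a::complex) powr (- Re d)"
      using norm_Gamma_quotient_le_Im by metis
    have "norm (Gamma (S + p) * rGamma (1/2 + p - S)) \<le> C"
      if S: "b \<le> Re S" "Re S \<le> 1/4" "4 + \<bar>Im p\<bar> \<le> \<bar>Im S\<bar>" for S
    proof -
      have im: "4 \<le> \<bar>Im (S + p)\<bar>" using S by (simp add: abs_if split: if_splits)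
      have "norm (Gamma (S + p) * rGamma (1/2 + p - S)) \<le> C * norm (S + p) powr (- Re (Complex (1/2 - 2 * Re S) (- 2 * Im p)))"
        unfolding norm_Gamma_rGamma_reflect
        by (intro C(2) im order.trans[OF norm_Complex_le]) (use S in \<open>auto simp: m_def D_def\<close>)
      also have "\<dots> \<le> C * 1"
      proof (intro mult_left_mono)
        have "norm (S + p) \<ge> 4" using im abs_Im_le_cmod order.trans by blast
        then show "norm (S + p) powr (- Re (Complex (1/2 - 2 * Re S) (- 2 * Im p))) \<le> 1"
          using S powr_mono[of "- Re (Complex (1/2 - 2 * Re S) (- 2 * Im p))" 0 "norm (S + p)"]
          by (auto split: if_splits)
      qed (use C in auto)
      finally show ?thesis by simp
    qed
    then show ?thesis using C(1) by blast
  qed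
  obtain C1 where C1: "C1 > 0" "\<And>S. b \<le> Re S \<Longrightarrow> Re S \<le> 1/4 \<Longrightarrow> 4 + \<bar>Im p\<bar> \<le> \<bar>Im S\<bar> \<Longrightarrow> norm (Gamma (S + p) * rGamma (1/2 + p - S)) \<le> C1"
    using *[of p] by blast
  obtain C2 where C2: "C2 > 0" "\<And>S. b \<le> Re S \<Longrightarrow> Re S \<le> 1/4 \<Longrightarrow> 4 + \<bar>Im q\<bar> \<le> \<bar>Im S\<bar> \<Longrightarrow> norm (Gamma (S + q) * rGamma (1/2 + q - S)) \<le> C2"
    using *[of q] by blast
  show ?thesis
  proof (rule that[of "C1 * C2" "4 + \<bar>Im p\<bar> + \<bar>Im q\<bar>"])
    fix S assume S: "b \<le> Re S" "Re S \<le> 1/4" "4 + \<bar>Im p\<bar> + \<bar>Im q\<bar> \<le> \<bar>Im S\<bar>"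
    have "norm (mellin_symbol p q S) = norm (Gamma (S + p) * rGamma (1/2 + p - S)) * norm (Gamma (S + q) * rGamma (1/2 + q - S))"
      by (simp add: mellin_symbol_def norm_mult)
    also have "\<dots> \<le> C1 * C2" using S C1 C2 by (intro mult_mono) auto
    finally show "norm (mellin_symbol p q S) \<le> C1 * C2" .
  qed (use C1 C2 in auto)
qed

lemma inverse_norm_Complex_le:
  assumes "\<epsilon> > 0" "\<epsilon> \<le> \<bar>u\<bar>"
  shows "1 / norm (Complex u x) \<le> (1 + 1 / \<epsilon>) * (1 / (1 + \<bar>x\<bar>))"
proof -
  have n: "\<epsilon> \<le> norm (Complex u x)" "\<bar>x\<bar> \<le> norm (Complex u x)"
    using abs_Re_le_cmod[of "Complex u x"] abs_Im_le_cmod[of "Complex u x"] assms by auto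
  have "1 \<le> norm (Complex u x) / \<epsilon>" using n assms by simp
  then have "1 + \<bar>x\<bar> \<le> (1 + 1 / \<epsilon>) * norm (Complex u x)" using n by (simp add: distrib_right)
  moreover have "norm (Complex u x) > 0" using n assms by linarith
  ultimately show ?thesis by (simp add: field_simps)
qed

lemma mellin_symbol_measurable_line:
  assumes "\<And>t. Complex x t + p \<notin> \<int>\<^sub>\<le>\<^sub>0" "\<And>t. Complex x t + q \<notin> \<int>\<^sub>\<le>\<^sub>0"
  shows "(\<lambda>t. mellin_symbol p q (Complex x t)) \<in> borel_measurable borel"
proof -
  have "continuous_on UNIV (\<lambda>t. mellin_symbol p q (Complex x t))"
    unfolding mellin_symbol_def using assms
    by (intro continuous_on_mult continuous_on_compose2[OF continuous_on_Gamma[of "- \<int>\<^sub>\<le>\<^sub>0"]]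
          continuous_on_compose2[OF continuous_on_rGamma[of UNIV]])
       (auto intro!: continuous_intros simp: Complex_eq)
  then show ?thesis by (rule borel_measurable_continuous_onI)
qed

lemma not_nonpos_Ints_right: "Re z > 0 \<Longrightarrow> (z::complex) \<notin> \<int>\<^sub>\<le>\<^sub>0"
  by (auto elim!: nonpos_Ints_cases)

text \<open>\<open>B\<close> depends on \<open>p\<close> and \<open>q\<close> only through \<rho>
  and D, and on \<open>S0\<close> only through a lower bound for its distance to the line. This
  serves the limit to integral orders and all points of a line Re s = c0 at once.\<close>

lemma mellin_symbol_line_integral_bound:
  assumes "\<sigma> + \<rho> > 0" "\<sigma> < 1/4" "D \<ge> 0" "\<epsilon> > 0"
  obtains B where "B \<ge> 0"
   "\<And>p q S0. \<rho> \<le> Re p \<Longrightarrow> \<rho> \<le> Re q \<Longrightarrow> \<bar>Im p\<bar> \<le> D \<Longrightarrow> \<bar>Im q\<bar> \<le> D \<Longrightarrow> \<epsilon> \<le> \<bar>Re S0 - \<sigma>\<bar> \<Longrightarrow>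
      integrable lborel (\<lambda>t. mellin_symbol p q (Complex \<sigma> t) / (S0 - Complex \<sigma> t))"
   "\<And>p q S0. \<rho> \<le> Re p \<Longrightarrow> \<rho> \<le> Re q \<Longrightarrow> \<bar>Im p\<bar> \<le> D \<Longrightarrow> \<bar>Im q\<bar> \<le> D \<Longrightarrow> \<epsilon> \<le> \<bar>Re S0 - \<sigma>\<bar> \<Longrightarrow>
      (LINT t|lborel. norm (mellin_symbol p q (Complex \<sigma> t) / (S0 - Complex \<sigma> t))) \<le> B"
proof -
  \<comment> \<open>The symbol decays with exponent 1 - 4 \<sigma>; the convolution bound asks for
    an exponent in (0, 1].\<close>
  define \<eta> where "\<eta> = min 1 (1 - 4 * \<sigma>)"
  have \<eta>: "0 < \<eta>" "\<eta> \<le> 1" using assms by (auto simp: \<eta>_def)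
  obtain B where B: "B \<ge> 0"
    "\<And>t0. integrable lborel (\<lambda>t. (1 + \<bar>t\<bar>) powr (- \<eta>) * (1 / (1 + \<bar>t - t0\<bar>)))"
    "\<And>t0. (LINT t|lborel. (1 + \<bar>t\<bar>) powr (- \<eta>) * (1 / (1 + \<bar>t - t0\<bar>))) \<le> B"
    using one_plus_abs_convolution_bound[OF \<eta>] by blast
  have "\<sigma> \<le> 1/4" using assms by simp
  then obtain C where C: "C > 0" "\<And>p q t. \<rho> \<le> Re p \<Longrightarrow> \<rho> \<le> Re q \<Longrightarrow> \<bar>Im p\<bar> \<le> D \<Longrightarrow> \<bar>Im q\<bar> \<le> D \<Longrightarrow>
    norm (mellin_symbol p q (Complex \<sigma> t)) \<le> C * (1 + \<bar>t\<bar>) powr (- (1 - 4 * \<sigma>))"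
    using mellin_symbol_line_bound[OF assms(1) _ assms(3)] by blast
  define K where "K = C * (1 + 1 / \<epsilon>)"
  have K: "K \<ge> 0" using C assms by (simp add: K_def)
  {
    fix p q S0 assume pq: "\<rho> \<le> Re p" "\<rho> \<le> Re q" "\<bar>Im p\<bar> \<le> D" "\<bar>Im q\<bar> \<le> D" and S0: "\<epsilon> \<le> \<bar>Re S0 - \<sigma>\<bar>"
    define F where "F t = mellin_symbol p q (Complex \<sigma> t) / (S0 - Complex \<sigma> t)" for t
    define G where "G t = K * ((1 + \<bar>t\<bar>) powr (- \<eta>) * (1 / (1 + \<bar>t - Im S0\<bar>)))" for t
    have G: "integrable lborel G" unfolding G_def by (intro integrable_mult_right B)
    have bd: "norm (F t) \<le> G t" for t
    proof -
      have "norm (F t) = norm (mellin_symbol p q (Complex \<sigma> t)) * (1 / norm (Complex (Re S0 - \<sigma>) (Im S0 - t)))"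
        by (simp add: F_def norm_divide minus_complex.code[symmetric]) (simp add: complex_eq_iff minus_complex.code)
      also have "\<dots> \<le> (C * (1 + \<bar>t\<bar>) powr (- (1 - 4 * \<sigma>))) * ((1 + 1 / \<epsilon>) * (1 / (1 + \<bar>Im S0 - t\<bar>)))"
        by (intro mult_mono C(2) pq inverse_norm_Complex_le assms S0) (use C assms in auto)
      also have "\<dots> \<le> (C * (1 + \<bar>t\<bar>) powr (- \<eta>)) * ((1 + 1 / \<epsilon>) * (1 / (1 + \<bar>Im S0 - t\<bar>)))"
        using C assms by (intro mult_right_mono mult_left_mono powr_mono) (auto simp: \<eta>_def)
      also have "\<dots> = G t" by (simp add: G_def K_def abs_minus_commute)
      finally show ?thesis .
    qed
    have Fm: "F \<in> borel_measurable borel"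
      unfolding F_def
      by (intro borel_measurable_divide mellin_symbol_measurable_line not_nonpos_Ints_right)
         (use pq assms in \<open>auto simp: Complex_eq\<close>)
    have iF: "integrable lborel F"
      by (rule Bochner_Integration.integrable_bound[OF G]) (use bd order.trans[OF bd abs_ge_self] Fm in \<open>auto intro!: AE_I2\<close>)
    moreover have "(LINT t|lborel. norm (F t)) \<le> (LINT t|lborel. G t)"
      by (intro integral_mono integrable_norm iF G bd)
    moreover have "(LINT t|lborel. G t) \<le> K * B"
      unfolding G_def integral_mult_right_zero by (intro mult_left_mono B K)
    ultimately have "integrable lborel F" "(LINT t|lborel. norm (F t)) \<le> K * B" by auto
    note this[unfolded F_def]
  }
  then show ?thesis using that[of "K * B"] K B(1) by auto
qed

section \<open>Residues on vertical lines\<close>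

lemma interval_avoid_countable:
  fixes a b :: real
  assumes "a < b" "countable X"
  obtains x where "a < x" "x < b" "x \<notin> X"
proof -
  have "\<not> {a<..<b} \<subseteq> X"
    using assms uncountable_open_interval[of a b] countable_subset by blast
  then obtain x where "x \<in> {a<..<b}" "x \<notin> X" by blast
  then show ?thesis using that[of x] by simp
qed

lemma countable_add_in_Ints: "countable {x::real. x + c \<in> \<int>}"
proof -
  have "{x::real. x + c \<in> \<int>} = (\<lambda>n. n - c) ` \<int>"
    by (force simp: image_iff)
  moreover have "countable (\<int> :: real set)" unfolding Ints_def by (intro countable_image) auto
  ultimately show ?thesis by (metis countable_image)
qed

lemma vertical_line_integral_limit:
  fixes g :: "real \<Rightarrow> complex"
  assumes "integrable lborel g"
  shows "(\<lambda>n. integral {- real n..real n} g) \<longlonglongrightarrow> (LINT t|lborel. g t)"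
proof -
  have [measurable]: "g \<in> borel_measurable borel" using assms by (auto dest: borel_measurable_integrable)
  have "(\<lambda>n. LINT t|lborel. indicator {- real n..real n} t *\<^sub>R g t) \<longlonglongrightarrow> (LINT t|lborel. g t)"
  proof (rule integral_dominated_convergence[where w = "\<lambda>t. norm (g t)"])
    show "AE t in lborel. (\<lambda>n. indicator {- real n..real n} t *\<^sub>R g t) \<longlonglongrightarrow> g t"
    proof (rule AE_I2, rule tendsto_eventually)
      fix t
      show "\<forall>\<^sub>F n in sequentially. indicator {- real n..real n} t *\<^sub>R g t = g t"
        using eventually_ge_at_top[of "nat \<lceil>\<bar>t\<bar>\<rceil>"]
      proof eventually_elim
        case (elim n)
        then have "\<bar>t\<bar> \<le> real n" by linarith
        then show ?case by (auto simp: indicator_def abs_le_iff)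
      qed
    qed
    show "AE t in lborel. norm (indicator {- real n..real n} t *\<^sub>R g t) \<le> norm (g t)" for n
      by (intro AE_I2) (auto simp: indicator_def)
  qed (use assms in auto)
  moreover have "(LINT t|lborel. indicator {- real n..real n} t *\<^sub>R g t) = integral {- real n..real n} g" for n
  proof -
    have "set_integrable lborel {- real n..real n} g"
      unfolding set_integrable_def by (rule integrable_mult_indicator[OF _ assms]) auto
    then show ?thesis
      using set_borel_integral_eq_integral(2) unfolding set_lebesgue_integral_def by blast
  qed
  ultimately show ?thesis by simp
qed

text \<open>The residue theorem is applied to rectangles with vertical sides on the two lines; as
  the height grows, \<open>hor\<close> makes the horizontal sides negligible.\<close>

lemma vertical_lines_residue_theorem:
  fixes f :: "complex \<Rightarrow> complex"
  assumes L: "L < \<sigma>" and fin: "finite pts"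
    and holo: "f holomorphic_on {S. Re S > L - 1} - pts"
    and pts: "\<And>x. x \<in> pts \<Longrightarrow> Re x \<noteq> L \<and> Re x \<noteq> \<sigma>"
    and int: "integrable lborel (\<lambda>t. f (Complex L t))" "integrable lborel (\<lambda>t. f (Complex \<sigma> t))"
    and hor: "\<And>e. e > 0 \<Longrightarrow> \<exists>H. \<forall>S. L \<le> Re S \<longrightarrow> Re S \<le> \<sigma> \<longrightarrow> H \<le> \<bar>Im S\<bar> \<longrightarrow> norm (f S) \<le> e"
  shows "(LINT t|lborel. f (Complex \<sigma> t)) - (LINT t|lborel. f (Complex L t)) =
         2 * pi * (\<Sum>x | x \<in> pts \<and> L < Re x \<and> Re x < \<sigma>. residue f x)"
proof -
  define D where "D = {S. Re S > L - 1}"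
  define a where "a R = Complex L (- R)" for R
  define a2 where "a2 R = Complex \<sigma> (- R)" for R
  define b where "b R = Complex \<sigma> R" for R
  define a4 where "a4 R = Complex L R" for R
  define E where "E R = contour_integral (linepath (a R) (a2 R)) f + contour_integral (linepath (b R) (a4 R)) f" for R
  \<comment> \<open>Dominates |Im x| for all points of \<open>pts\<close>, so for R > h the
    horizontal sides miss them.\<close>
  define h where "h = (\<Sum>x\<in>pts. \<bar>Im x\<bar>)"
  have h: "\<bar>Im x\<bar> \<le> h" if "x \<in> pts" for x
    unfolding h_def using that fin by (intro member_le_sum) auto
  have main: "integral {- R..R} (\<lambda>t. f (Complex \<sigma> t)) - integral {- R..R} (\<lambda>t. f (Complex L t)) =
      2 * pi * (\<Sum>x | x \<in> pts \<and> L < Re x \<and> Re x < \<sigma>. residue f x) + \<i> * E R" if R: "R > h" "R > 0" for R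
  proof -
    have rect: "Re (a R) \<le> Re (b R)" "Im (a R) \<le> Im (b R)" using L R by (auto simp: a_def b_def)
    have img: "path_image (rectpath (a R) (b R)) \<subseteq> D - pts"
    proof
      fix z assume "z \<in> path_image (rectpath (a R) (b R))"
      then have z: "(Re z = L \<or> Re z = \<sigma>) \<and> - R \<le> Im z \<and> Im z \<le> R \<or> (Im z = - R \<or> Im z = R) \<and> L \<le> Re z \<and> Re z \<le> \<sigma>"
        using path_image_rectpath[OF rect] by (auto simp: a_def b_def)
      then have "z \<in> D" using L by (auto simp: D_def)
      moreover have "z \<notin> pts" using z pts[of z] h[of z] R by auto
      ultimately show "z \<in> D - pts" by simp
    qed
    have cont: "continuous_on (path_image (rectpath (a R) (b R))) f"
      using holomorphic_on_imp_continuous_on[OF holo] img unfolding D_def by (rule continuous_on_subset)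
    have segs: "path_image (rectpath (a R) (b R)) = closed_segment (a R) (a2 R) \<union> closed_segment (a2 R) (b R) \<union> closed_segment (b R) (a4 R) \<union> closed_segment (a4 R) (a R)"
      by (auto simp: rectpath_def Let_def path_image_join a_def b_def a2_def a4_def)
    have ci: "f contour_integrable_on (linepath (a R) (a2 R))" "f contour_integrable_on (linepath (a2 R) (b R))"
       "f contour_integrable_on (linepath (b R) (a4 R))" "f contour_integrable_on (linepath (a4 R) (a R))"
       "continuous_on (closed_segment (a4 R) (a R)) f"
      using cont unfolding segs by (auto intro!: contour_integrable_continuous_linepath elim!: continuous_on_subset)
    have rp: "rectpath (a R) (b R) = linepath (a R) (a2 R) +++ linepath (a2 R) (b R) +++ linepath (b R) (a4 R) +++ linepath (a4 R) (a R)"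
      by (simp add: rectpath_def Let_def a_def b_def a2_def a4_def)
    have "contour_integral (rectpath (a R) (b R)) f = contour_integral (linepath (a R) (a2 R)) f +
       (contour_integral (linepath (a2 R) (b R)) f + (contour_integral (linepath (b R) (a4 R)) f + contour_integral (linepath (a4 R) (a R)) f))"
      unfolding rp using ci by (simp add: contour_integral_join contour_integrable_joinI)
    also have "contour_integral (linepath (a4 R) (a R)) f = - contour_integral (linepath (a R) (a4 R)) f"
      using ci(5) by (rule contour_integral_reverse_linepath)
    finally have split: "contour_integral (rectpath (a R) (b R)) f =
      contour_integral (linepath (a2 R) (b R)) f - contour_integral (linepath (a R) (a4 R)) f + E R"
      by (simp add: E_def)
    have line: "contour_integral (linepath (Complex c (- R)) (Complex c R)) f = \<i> * integral {- R..R} (\<lambda>t. f (Complex c t))"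
      if "f contour_integrable_on (linepath (Complex c (- R)) (Complex c R))" for c
    proof -
      have "(f has_contour_integral contour_integral (linepath (Complex c (- R)) (Complex c R)) f) (linepath (Complex c (- R)) (Complex c R))"
        using that by (rule has_contour_integral_integral)
      then have "((\<lambda>x. f (Complex c x)) has_integral (- \<i> * contour_integral (linepath (Complex c (- R)) (Complex c R)) f)) {- R..R}"
        using R by (subst (asm) has_contour_integral_linepath_same_Re_iff) auto
      then show ?thesis by (simp add: integral_unique)
    qed
    have l1: "contour_integral (linepath (a2 R) (b R)) f = \<i> * integral {- R..R} (\<lambda>t. f (Complex \<sigma> t))"
      using line[of \<sigma>] ci(2) by (simp add: a2_def b_def)
    have l2: "contour_integral (linepath (a R) (a4 R)) f = \<i> * integral {- R..R} (\<lambda>t. f (Complex L t))"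
    proof -
      have "f contour_integrable_on (linepath (a R) (a4 R))"
        using ci(5) by (simp add: closed_segment_commute contour_integrable_continuous_linepath)
      then show ?thesis using line[of L] by (simp add: a_def a4_def)
    qed
    have "contour_integral (rectpath (a R) (b R)) f = 2 * pi * \<i> * (\<Sum>p\<in>pts. winding_number (rectpath (a R) (b R)) p * residue f p)"
    proof (rule Residue_theorem[OF _ _ fin, of D])
      show "open D" unfolding D_def by (rule open_halfspace_Re_gt)
      show "connected D" unfolding D_def by (intro convex_connected convex_halfspace_Re_gt)
      show "f holomorphic_on D - pts" using holo unfolding D_def .
      show "\<forall>z. z \<notin> D \<longrightarrow> winding_number (rectpath (a R) (b R)) z = 0"
      proof (intro allI impI winding_number_rectpath_outside[OF rect])
        fix z assume "z \<notin> D"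
        then show "z \<notin> cbox (a R) (b R)" by (auto simp: D_def in_cbox_complex_iff a_def)
      qed
    qed (use img in auto)
    also have "(\<Sum>p\<in>pts. winding_number (rectpath (a R) (b R)) p * residue f p) =
        (\<Sum>p\<in>pts. if L < Re p \<and> Re p < \<sigma> then residue f p else 0)"
    proof (rule sum.cong[OF refl])
      fix x assume x: "x \<in> pts"
      have i: "- R < Im x" "Im x < R" using h[OF x] R by auto
      show "winding_number (rectpath (a R) (b R)) x * residue f x = (if L < Re x \<and> Re x < \<sigma> then residue f x else 0)"
      proof (cases "L < Re x \<and> Re x < \<sigma>")
        case True
        then have "x \<in> box (a R) (b R)" using i by (auto simp: in_box_complex_iff a_def b_def)
        then show ?thesis using True by (simp add: winding_number_rectpath)
      next
        case False
        then have "x \<notin> cbox (a R) (b R)" using pts[OF x] by (auto simp: in_cbox_complex_iff a_def b_def)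
        then have "winding_number (rectpath (a R) (b R)) x = 0" by (rule winding_number_rectpath_outside[OF rect])
        then show ?thesis by (simp only: if_not_P[OF False] mult_zero_left)
      qed
    qed
    also have "\<dots> = (\<Sum>x | x \<in> pts \<and> L < Re x \<and> Re x < \<sigma>. residue f x)"
      using fin by (rule sum.inter_filter[symmetric])
    finally have "\<i> * (integral {- R..R} (\<lambda>t. f (Complex \<sigma> t)) - integral {- R..R} (\<lambda>t. f (Complex L t))) =
      \<i> * (2 * pi * (\<Sum>x | x \<in> pts \<and> L < Re x \<and> Re x < \<sigma>. residue f x) + \<i> * E R)"
      unfolding split l1 l2 by (simp add: algebra_simps)
    then show ?thesis by (subst (asm) mult_cancel_left) simp
  qed
  have E0: "(\<lambda>n. E (real n)) \<longlonglongrightarrow> 0"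
  proof (rule LIMSEQ_I)
    fix e :: real assume e: "e > 0"
    \<comment> \<open>Each horizontal side has length \<sigma> - L and hence contributes at most e /
      4.\<close>
    define e' where "e' = e / (4 * (\<sigma> - L))"
    have e': "e' > 0" using e L by (simp add: e'_def)
    obtain H where H: "\<And>S. L \<le> Re S \<Longrightarrow> Re S \<le> \<sigma> \<Longrightarrow> H \<le> \<bar>Im S\<bar> \<Longrightarrow> norm (f S) \<le> e'"
      using hor[OF e'] by blast
    have "norm (E (real n) - 0) < e" if n: "n \<ge> nat \<lceil>max H (h + 1)\<rceil>" for n
    proof -
      define R where "R = real n"
      have R: "R \<ge> H" "R > h" "R \<ge> 0" using n unfolding R_def by linarith+
      have seg: "norm (contour_integral (linepath (Complex u y) (Complex v y)) f) \<le> e' * (\<sigma> - L)"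
        if uv: "u = L \<and> v = \<sigma> \<or> u = \<sigma> \<and> v = L" and y: "\<bar>y\<bar> = R" for u v y
      proof -
        have im: "L \<le> Re z \<and> Re z \<le> \<sigma> \<and> Im z = y" if "z \<in> closed_segment (Complex u y) (Complex v y)" for z
          using that uv L by (auto simp: closed_segment_same_Im closed_segment_eq_real_ivl split: if_splits)
        have "continuous_on (closed_segment (Complex u y) (Complex v y)) f"
        proof (rule continuous_on_subset[OF holomorphic_on_imp_continuous_on[OF holo]], rule subsetI)
          fix z assume "z \<in> closed_segment (Complex u y) (Complex v y)"
          then show "z \<in> {S. Re S > L - 1} - pts" using im[of z] h[of z] R y by auto
        qed
        then have "norm (contour_integral (linepath (Complex u y) (Complex v y)) f) \<le> e' * norm (Complex v y - Complex u y)"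
          using e' H im R y by (intro contour_integral_bound_linepath contour_integrable_continuous_linepath) auto
        also have "norm (Complex v y - Complex u y) = \<sigma> - L"
          using uv L by (auto simp: complex_diff cmod_eq_Re)
        finally show ?thesis .
      qed
      have "norm (E R) \<le> e' * (\<sigma> - L) + e' * (\<sigma> - L)"
        unfolding E_def a_def a2_def b_def a4_def
        by (intro order.trans[OF norm_triangle_ineq] add_mono seg) (use R in auto)
      also have "e' * (\<sigma> - L) = e / 4"
      proof -
        have "e / (4 * d) * d = e / 4" if "d \<noteq> 0" for d :: real using that by simp
        from this[of "\<sigma> - L"] L show ?thesis unfolding e'_def by simp
      qed
      also have "e / 4 + e / 4 < e" using e by simp
      finally show ?thesis by (simp add: R_def)
    qed
    then show "\<exists>no. \<forall>n\<ge>no. norm (E (real n) - 0) < e" by blast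
  qed
  have "(\<lambda>n. 2 * pi * (\<Sum>x | x \<in> pts \<and> L < Re x \<and> Re x < \<sigma>. residue f x) + \<i> * E (real n)) \<longlonglongrightarrow>
     2 * pi * (\<Sum>x | x \<in> pts \<and> L < Re x \<and> Re x < \<sigma>. residue f x) + \<i> * 0"
    by (intro tendsto_intros E0)
  moreover have "\<forall>\<^sub>F n in sequentially. 2 * pi * (\<Sum>x | x \<in> pts \<and> L < Re x \<and> Re x < \<sigma>. residue f x) + \<i> * E (real n)
      = integral {- real n..real n} (\<lambda>t. f (Complex \<sigma> t)) - integral {- real n..real n} (\<lambda>t. f (Complex L t))"
    using eventually_gt_at_top[of "nat \<lceil>\<bar>h\<bar>\<rceil>"]
  proof eventually_elim
    case (elim n)
    then have "real n > h" "real n > 0" by linarith+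
    then show ?case by (simp add: main)
  qed
  ultimately have "(\<lambda>n. integral {- real n..real n} (\<lambda>t. f (Complex \<sigma> t)) - integral {- real n..real n} (\<lambda>t. f (Complex L t)))
     \<longlonglongrightarrow> 2 * pi * (\<Sum>x | x \<in> pts \<and> L < Re x \<and> Re x < \<sigma>. residue f x) + \<i> * 0"
    by (rule Lim_transform_eventually)
  moreover have "(\<lambda>n. integral {- real n..real n} (\<lambda>t. f (Complex \<sigma> t)) - integral {- real n..real n} (\<lambda>t. f (Complex L t)))
     \<longlonglongrightarrow> (LINT t|lborel. f (Complex \<sigma> t)) - (LINT t|lborel. f (Complex L t))"
    by (intro tendsto_diff vertical_line_integral_limit int)
  ultimately show ?thesis using LIMSEQ_unique by fastforce
qed

section \<open>Residues of the symbol and the shift of the line to the far left\<close>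

lemma mellin_symbol_commute: "mellin_symbol p q = mellin_symbol q p"
  by (simp add: mellin_symbol_def fun_eq_iff mult_ac)

lemma mellin_symbol_holomorphic:
  assumes "\<And>S. S \<in> A \<Longrightarrow> S + p \<notin> \<int>\<^sub>\<le>\<^sub>0 \<and> S + q \<notin> \<int>\<^sub>\<le>\<^sub>0"
  shows "mellin_symbol p q holomorphic_on A"
  unfolding mellin_symbol_def[abs_def] using assms by (auto intro!: holomorphic_intros)

text \<open>The residue of \<open>mellin_symbol p q\<close> at S = - p - k when p - q is not an
  integer: (-1)^k / k! comes from Gamma (S + p), the rest is the value of the other three
  factors.\<close>

definition residue_coeff :: "complex \<Rightarrow> complex \<Rightarrow> nat \<Rightarrow> complex" where
  "residue_coeff p q k = (-1) ^ k / fact k * Gamma (q - p - of_nat k) *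
     rGamma (1/2 + 2 * p + of_nat k) * rGamma (1/2 + p + q + of_nat k)"

text \<open>Integrating X^(2 S0 - 1) X^(-2 S) over 0 < X < sqrt T gives T^(S0 - S) / (2 (S0 - S))
  for Re S < Re S0; up to T^S0 / 2 this is what multiplies the symbol here. The pole at S0 separates
  the complete transform from the truncation error.\<close>

definition barnes_integrand :: "complex \<Rightarrow> complex \<Rightarrow> real \<Rightarrow> complex \<Rightarrow> complex \<Rightarrow> complex" where
  "barnes_integrand p q T S0 S = mellin_symbol p q S * cpow T (- S) / (S0 - S)"

lemma residue_barnes_integrand_simple:
  assumes "- Re p < Re S0" "- Re q < Re S0"
  shows "residue (barnes_integrand p q T S0) S0 = - (mellin_symbol p q S0 * cpow T (- S0))"
proof -
  define A where "A = {S. Re S > - Re p} \<inter> {S. Re S > - Re q}"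
  have A: "open A" "S0 \<in> A" using assms by (auto simp: A_def open_Int open_halfspace_Re_gt)
  have "(\<lambda>S. - (mellin_symbol p q S * cpow T (- S))) holomorphic_on A"
    by (intro holomorphic_intros mellin_symbol_holomorphic conjI not_nonpos_Ints_right) (auto simp: A_def)
  from residue_simple[OF A this]
  have "residue (\<lambda>S. - (mellin_symbol p q S * cpow T (- S)) / (S - S0)) S0 = - (mellin_symbol p q S0 * cpow T (- S0))" .
  moreover have "(\<lambda>S. - (mellin_symbol p q S * cpow T (- S)) / (S - S0)) = barnes_integrand p q T S0"
    by (simp add: fun_eq_iff barnes_integrand_def divide_simps) (auto simp: algebra_simps)
  ultimately show ?thesis by simp
qed

text \<open>Poles of Gamma (S + p) are one apart, so the unit disc around - p - k contains no other
  one, and Gamma (S + q) is regular at its centre because p - q is not an integer.\<close>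

lemma residue_barnes_integrand_left:
  assumes pq: "p - q \<notin> \<int>" and S0: "- Re p < Re S0"
  shows "residue (barnes_integrand p q T S0) (- p - of_nat k) =
         residue_coeff p q k * cpow T (p + of_nat k) / (S0 + p + of_nat k)"
proof -
  define z where "z = - p - of_nat k"
  define h where "h S = Gamma (S + q) * rGamma (1/2 + p - S) * rGamma (1/2 + q - S) * cpow T (- S) / (S0 - S)" for S
  define A where "A = ball z 1 \<inter> ((\<lambda>S. S + q) -` (- \<int>\<^sub>\<le>\<^sub>0)) \<inter> - {S0}"
  have zq: "z + q \<notin> \<int>"
  proof
    assume "z + q \<in> \<int>"
    then have "- (z + q) - of_nat k \<in> \<int>" by (intro Ints_diff Ints_minus Ints_of_nat)
    then show False using pq by (simp add: z_def)
  qed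
  have S0z: "S0 \<noteq> z" using S0 by (auto simp: z_def)
  have "open ((\<lambda>S. S + q) -` (- \<int>\<^sub>\<le>\<^sub>0))"
    by (intro open_vimage continuous_intros) (auto simp: open_Compl)
  then have A: "open A" "z \<in> A"
    using zq S0z nonpos_Ints_subset_Ints by (auto simp: A_def)
  have Sp: "S + p \<notin> \<int>\<^sub>\<le>\<^sub>0" if "S \<in> A - {z}" for S
  proof
    assume "S + p \<in> \<int>\<^sub>\<le>\<^sub>0"
    then obtain n :: int where n: "S + p = of_int n" by (auto elim!: nonpos_Ints_cases)
    have "S - z = of_int (n + int k)" using n by (simp add: z_def algebra_simps)
    moreover have "norm (S - z) < 1" using that by (auto simp: A_def dist_norm norm_minus_commute)
    ultimately have "real_of_int \<bar>n + int k\<bar> < 1" by (simp only: norm_of_int of_int_abs)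
    then have "n + int k = 0" by linarith
    then have "S - z = 0" using \<open>S - z = _\<close> by simp
    then show False using that by simp
  qed
  have hh: "h holomorphic_on A"
    unfolding h_def by (intro holomorphic_intros) (auto simp: A_def)
  have "residue (barnes_integrand p q T S0) z = (-1) ^ k / fact k * h z"
  proof (rule residue_simple'[OF A])
    have "(\<lambda>S. Gamma (S + p) * h S) holomorphic_on A - {z}"
      using Sp hh by (intro holomorphic_intros) (auto intro: holomorphic_on_subset)
    then show "barnes_integrand p q T S0 holomorphic_on A - {z}"
      by (rule holomorphic_transform) (simp add: barnes_integrand_def mellin_symbol_def h_def)
    have "isCont h z"
      using hh A by (meson continuous_on_eq_continuous_at holomorphic_on_imp_continuous_on)
    then have "(h \<longlongrightarrow> h z) (at z)" by (simp add: isCont_def)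
    moreover have "((\<lambda>S. Gamma (S + p) * (S + p + of_nat k)) \<longlongrightarrow> (-1) ^ k / fact k) (at z)"
    proof -
      have "((\<lambda>S. Gamma (S + p) * ((S + p) + of_nat k)) \<longlongrightarrow> (-1) ^ k / fact k) (at z)"
      proof (rule filterlim_compose[OF Gamma_residues])
        have "((\<lambda>S. S + p) \<longlongrightarrow> z + p) (at z)" by (intro tendsto_intros)
        then show "filterlim (\<lambda>S. S + p) (at (- of_nat k)) (at z)"
        proof -
          assume "((\<lambda>S. S + p) \<longlongrightarrow> z + p) (at z)"
          moreover have "\<forall>\<^sub>F S in at z. S + p \<noteq> - of_nat k"
          proof -
            have "S = z" if "S + p = - of_nat k" for S
              using arg_cong[OF that, of "\<lambda>x. x - p"] by (simp add: z_def)
            then show ?thesis unfolding eventually_at_filter by (intro always_eventually) auto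
          qed
          ultimately show ?thesis by (simp add: filterlim_at z_def)
        qed
      qed
      then show ?thesis .
    qed
    ultimately have "((\<lambda>S. (Gamma (S + p) * (S + p + of_nat k)) * h S) \<longlongrightarrow> (-1) ^ k / fact k * h z) (at z)"
      by (intro tendsto_mult)
    moreover have "(\<lambda>S. (Gamma (S + p) * (S + p + of_nat k)) * h S) = (\<lambda>S. barnes_integrand p q T S0 S * (S - z))"
      by (simp add: fun_eq_iff barnes_integrand_def mellin_symbol_def h_def z_def)
    ultimately show "((\<lambda>S. barnes_integrand p q T S0 S * (S - z)) \<longlongrightarrow> (-1) ^ k / fact k * h z) (at z)" by simp
  qed
  also have "h z = Gamma (q - p - of_nat k) * rGamma (1/2 + 2 * p + of_nat k) * rGamma (1/2 + p + q + of_nat k) * cpow T (p + of_nat k) / (S0 + p + of_nat k)"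
    by (simp add: h_def z_def algebra_simps)
  finally show ?thesis by (simp add: z_def residue_coeff_def)
qed

lemma mellin_symbol_shift_left:
  assumes "S + p - 1 \<notin> \<int>\<^sub>\<le>\<^sub>0" "S + q - 1 \<notin> \<int>\<^sub>\<le>\<^sub>0" "1/2 + p - S \<noteq> 0" "1/2 + q - S \<noteq> 0"
  shows "mellin_symbol p q (S - 1) = mellin_symbol p q S /
     ((S + p - 1) * (S + q - 1) * (1/2 + p - S) * (1/2 + q - S))"
proof -
  have G: "Gamma (S - 1 + r) = Gamma (S + r) / (S + r - 1)" if "S + r - 1 \<notin> \<int>\<^sub>\<le>\<^sub>0" for r
  proof -
    have "Gamma (S + r) = (S + r - 1) * Gamma (S + r - 1)" using Gamma_plus1[OF that] by simp
    moreover have "S + r - 1 \<noteq> 0" using that by auto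
    moreover have "S - 1 + r = S + r - 1" by simp
    ultimately show ?thesis by (metis nonzero_mult_div_cancel_left)
  qed
  have R: "rGamma (1/2 + r - (S - 1)) = rGamma (1/2 + r - S) / (1/2 + r - S)" if "1/2 + r - S \<noteq> 0" for r
  proof -
    have "1/2 + r - (S - 1) = (1/2 + r - S) + 1" by simp
    then show ?thesis using rGamma_plus1[of "1/2 + r - S"] that by (simp only:) (simp add: eq_divide_eq mult.commute)
  qed
  show ?thesis unfolding mellin_symbol_def G[OF assms(1)] G[OF assms(2)] R[OF assms(3)] R[OF assms(4)] by simp
qed

text \<open>Each unit step to the left divides the symbol by four linear factors of size about N. On
  Re S = \<mu> - N it is therefore smaller than on Re S = \<mu> by roughly (N!)^4, which beats every
  T^N.\<close>

lemma mellin_symbol_far_left: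
  assumes nonint: "\<mu> + Re p \<notin> \<int>" "\<mu> + Re q \<notin> \<int>" and bnd: "\<mu> < 1/2 + Re p" "\<mu> < 1/2 + Re q" and T: "T > (0::real)"
  obtains c where "(\<lambda>N. c N * T ^ N) \<longlonglongrightarrow> 0" "\<And>N. c N \<ge> 0"
    "\<And>N t. norm (mellin_symbol p q (Complex (\<mu> - real N) t)) \<le> c N * norm (mellin_symbol p q (Complex \<mu> t))"
proof -
  \<comment> \<open>Real parts bound the four factors from below, uniformly in t;
    \<open>nonint\<close> keeps the first two away from 0 and \<open>bnd\<close> makes the last two
    positive.\<close>
  define d where "d N = \<bar>\<mu> - real N + Re p - 1\<bar> * \<bar>\<mu> - real N + Re q - 1\<bar> * (1/2 + Re p - \<mu> + real N) * (1/2 + Re q - \<mu> + real N)" for N :: nat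
  have nz: "\<mu> - real N + Re r - 1 \<noteq> 0" if "\<mu> + Re r \<notin> \<int>" for N r
  proof
    assume "\<mu> - real N + Re r - 1 = 0"
    then have "\<mu> + Re r = of_nat (N + 1)" by simp
    then show False using that by (metis Ints_of_nat)
  qed
  have d: "d N > 0" for N unfolding d_def using nz nonint bnd by (intro mult_pos_pos) auto
  define c where "c N = (\<Prod>j<N. 1 / d j)" for N
  have c: "c N > 0" for N unfolding c_def using d by (intro prod_pos) auto
  have "norm (mellin_symbol p q (Complex (\<mu> - real N) t)) \<le> c N * norm (mellin_symbol p q (Complex \<mu> t))" for N t
  proof (induction N)
    case 0
    then show ?case by (simp add: c_def)
  next
    case (Suc N)
    define S where "S = Complex (\<mu> - real N) t"
    have S1: "Complex (\<mu> - real (Suc N)) t = S - 1" by (simp add: S_def complex_eq_iff)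
    have ni: "S + r - 1 \<notin> \<int>\<^sub>\<le>\<^sub>0" if "\<mu> + Re r \<notin> \<int>" for r
    proof
      assume "S + r - 1 \<in> \<int>\<^sub>\<le>\<^sub>0"
      then obtain n where "S + r - 1 = of_int n" by (auto elim!: nonpos_Ints_cases)
      then have "Re (S + r - 1) = of_int n" by simp
      then have "\<mu> + Re r = of_int (n + int N + 1)" by (simp add: S_def)
      then show False using that by (metis Ints_of_int)
    qed
    have nz2: "1/2 + r - S \<noteq> 0" if "\<mu> < 1/2 + Re r" for r
    proof
      assume "1/2 + r - S = 0"
      then have "Re (1/2 + r - S) = 0" by simp
      then show False using that by (simp add: S_def)
    qed
    have dS: "d N \<le> norm ((S + p - 1) * (S + q - 1) * (1/2 + p - S) * (1/2 + q - S))"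
      unfolding d_def norm_mult
      using abs_Re_le_cmod[of "S + p - 1"] abs_Re_le_cmod[of "S + q - 1"] complex_Re_le_cmod[of "1/2 + p - S"] complex_Re_le_cmod[of "1/2 + q - S"] bnd
      by (intro mult_mono) (auto simp: S_def algebra_simps)
    have "norm (mellin_symbol p q (S - 1)) = norm (mellin_symbol p q S) / norm ((S + p - 1) * (S + q - 1) * (1/2 + p - S) * (1/2 + q - S))"
      unfolding mellin_symbol_shift_left[OF ni[OF nonint(1)] ni[OF nonint(2)] nz2[OF bnd(1)] nz2[OF bnd(2)]] by (rule norm_divide)
    also have "\<dots> \<le> norm (mellin_symbol p q S) / d N"
      using dS d[of N] by (intro divide_left_mono) (auto intro!: mult_pos_pos simp: order.strict_trans2[OF d dS])
    also have "\<dots> \<le> c N * norm (mellin_symbol p q (Complex \<mu> t)) / d N"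
      using Suc.IH d[of N] by (intro divide_right_mono) (auto simp: S_def)
    also have "\<dots> = c (Suc N) * norm (mellin_symbol p q (Complex \<mu> t))" by (simp add: c_def)
    finally show ?case unfolding S1 .
  qed
  moreover have "(\<lambda>N. c N * T ^ N) \<longlonglongrightarrow> 0"
  proof (rule summable_LIMSEQ_zero, rule summable_ratio_test)
    \<comment> \<open>From this index on the first factor of \<open>d N\<close> is at least 2 T and
      the others are at least 1, which gives the ratio 1/2.\<close>
    define M where "M = \<lceil>\<bar>\<mu>\<bar> + \<bar>Re p\<bar> + \<bar>Re q\<bar> + 2 * T + 2\<rceil>"
    show "(1/2::real) < 1" by simp
    fix N assume N: "N \<ge> nat M"
    then have N': "real N \<ge> \<bar>\<mu>\<bar> + \<bar>Re p\<bar> + \<bar>Re q\<bar> + 2 * T + 2" unfolding M_def by linarith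
    have "(2 * T) * 1 * 1 * 1 \<le> d N"
      unfolding d_def by (intro mult_mono) (use N' T bnd in auto)
    then have "T / d N \<le> 1/2" using d[of N] by (simp add: field_simps)
    then have "c N * T ^ N * (T / d N) \<le> c N * T ^ N * (1/2)" using c[of N] T by (intro mult_left_mono) auto
    then show "norm (c (Suc N) * T ^ Suc N) \<le> 1/2 * norm (c N * T ^ N)"
      using c[of N] c[of "Suc N"] T d[of N] by (simp add: c_def abs_mult) (simp add: mult_ac)
  qed
  ultimately show ?thesis using that[of c] c less_imp_le by blast
qed

text \<open>With x = \<mu> + Re p the poles - p - k to the right of Re S = \<mu> - N are those with
  k below the ceiling of N - x; hence this form of partial sums.\<close>

lemma sums_imp_partial_limit:
  fixes f :: "nat \<Rightarrow> complex" and x :: real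
  assumes "f sums A"
  shows "(\<lambda>N. \<Sum>k<nat \<lceil>real N - x\<rceil>. f k) \<longlonglongrightarrow> A"
proof -
  have "filterlim (\<lambda>N. nat \<lceil>real N - x\<rceil>) sequentially sequentially"
    unfolding filterlim_at_top
  proof (intro allI)
    fix Z
    show "\<forall>\<^sub>F N in sequentially. Z \<le> nat \<lceil>real N - x\<rceil>"
      using eventually_ge_at_top[of "nat \<lceil>real Z + x\<rceil>"] by eventually_elim linarith
  qed
  then show ?thesis using assms unfolding sums_def by (rule filterlim_compose[rotated])
qed

text \<open>The line is moved from \<sigma> to \<mu> - N and N tends to infinity. The two sequences
  of poles give \<open>A\<close> and \<open>B\<close>; the pole at S0 gives the symbol with a minus
  sign, since the denominator is S0 - S.\<close>

theorem barnes_integral_residue_expansion: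
  assumes T: "T > 0" and pq: "p - q \<notin> \<int>"
    and S0: "- Re p < Re S0" "- Re q < Re S0" "Re S0 < \<sigma>" and \<sigma>: "\<sigma> < 1/4"
    and A: "(\<lambda>k. residue_coeff p q k * cpow T (p + of_nat k) / (S0 + p + of_nat k)) sums A"
    and B: "(\<lambda>k. residue_coeff q p k * cpow T (q + of_nat k) / (S0 + q + of_nat k)) sums B"
  shows "A + B - mellin_symbol p q S0 * cpow T (- S0) =
    1 / (2 * pi) * (LINT t|lborel. barnes_integrand p q T S0 (Complex \<sigma> t))"
proof -
  define \<Phi> where "\<Phi> = barnes_integrand p q T S0"
  define \<rho> where "\<rho> = min (Re p) (Re q)"
  define D where "D = \<bar>Im p\<bar> + \<bar>Im q\<bar>"
  have \<rho>: "\<rho> \<le> Re p" "\<rho> \<le> Re q" "\<bar>Im p\<bar> \<le> D" "\<bar>Im q\<bar> \<le> D" "D \<ge> 0" "- \<rho> < Re S0" using S0 by (auto simp: \<rho>_def D_def)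
  \<comment> \<open>One suitable \<mu> keeps all the lines Re S = \<mu> - N off the poles, as these
    repeat with period 1. It lies to the right of every pole of the symbol and to the left of
    S0.\<close>
  have "countable ({x. x + Re p \<in> \<int>} \<union> {x. x + Re q \<in> \<int>})" by (intro countable_Un countable_add_in_Ints)
  from interval_avoid_countable[OF \<rho>(6) this]
  obtain \<mu> where \<mu>: "- \<rho> < \<mu>" "\<mu> < Re S0" "\<mu> + Re p \<notin> \<int>" "\<mu> + Re q \<notin> \<int>" by auto
  have \<mu>b: "\<mu> < 1/2 + Re p" "\<mu> < 1/2 + Re q" using \<mu> \<rho> S0 \<sigma> by linarith+
  obtain c where c: "(\<lambda>N. c N * T ^ N) \<longlonglongrightarrow> 0" "\<And>N. c N \<ge> 0"
    "\<And>N t. norm (mellin_symbol p q (Complex (\<mu> - real N) t)) \<le> c N * norm (mellin_symbol p q (Complex \<mu> t))"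
    using mellin_symbol_far_left[OF \<mu>(3,4) \<mu>b T] by blast
  have line: "integrable lborel (\<lambda>t. mellin_symbol p q (Complex x t) / (S0 - Complex x t))"
    if "- \<rho> < x" "x < 1/4" "x \<noteq> Re S0" for x
  proof -
    have "x + \<rho> > 0" "\<bar>Re S0 - x\<bar> > 0" using that by auto
    from mellin_symbol_line_integral_bound[OF this(1) that(2) \<rho>(5) this(2)] show ?thesis using \<rho> by (metis order_refl)
  qed
  define J where "J = (LINT t|lborel. norm (mellin_symbol p q (Complex \<mu> t) / (S0 - Complex \<mu> t)))"
  have int_\<mu>: "integrable lborel (\<lambda>t. mellin_symbol p q (Complex \<mu> t) / (S0 - Complex \<mu> t))"
    using line[of \<mu>] \<mu> S0 \<sigma> by auto
  have int_\<sigma>: "integrable lborel (\<lambda>t. \<Phi> (Complex \<sigma> t))"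
  proof -
    have i: "integrable lborel (\<lambda>t. T powr (- \<sigma>) * norm (mellin_symbol p q (Complex \<sigma> t) / (S0 - Complex \<sigma> t)))"
      using line[of \<sigma>] \<rho> S0 \<sigma> by (intro integrable_mult_right integrable_norm) auto
    show ?thesis
    proof (rule Bochner_Integration.integrable_bound[OF i])
      have "(\<lambda>t. mellin_symbol p q (Complex \<sigma> t)) \<in> borel_measurable borel"
        by (rule mellin_symbol_measurable_line; rule not_nonpos_Ints_right) (use \<rho> S0 in auto)
      then show "(\<lambda>t. \<Phi> (Complex \<sigma> t)) \<in> borel_measurable lborel"
        unfolding \<Phi>_def barnes_integrand_def measurable_lborel1
        by (intro borel_measurable_divide borel_measurable_times) (auto simp: Complex_eq)
    qed (auto simp: \<Phi>_def barnes_integrand_def norm_mult norm_divide norm_cpow[OF T] mult_ac)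
  qed
  have nonpole: "Complex (\<mu> - real N) t + r \<notin> \<int>\<^sub>\<le>\<^sub>0" if "\<mu> + Re r \<notin> \<int>" for N t r
  proof
    assume "Complex (\<mu> - real N) t + r \<in> \<int>\<^sub>\<le>\<^sub>0"
    then obtain n where "Complex (\<mu> - real N) t + r = of_int n" by (auto elim!: nonpos_Ints_cases)
    then have "Re (Complex (\<mu> - real N) t + r) = of_int n" by simp
    then have "\<mu> + Re r = of_int (n + int N)" by simp
    then show False using that by (metis Ints_of_int)
  qed
  have left: "integrable lborel (\<lambda>t. \<Phi> (Complex (\<mu> - real N) t))"
    "norm (LINT t|lborel. \<Phi> (Complex (\<mu> - real N) t)) \<le> c N * T ^ N * (T powr (- \<mu>) * J)" for N
  proof -
    define g where "g t = c N * T ^ N * T powr (- \<mu>) * norm (mellin_symbol p q (Complex \<mu> t) / (S0 - Complex \<mu> t))" for t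
    have g: "integrable lborel g" unfolding g_def by (intro integrable_mult_right integrable_norm int_\<mu>)
    have bd: "norm (\<Phi> (Complex (\<mu> - real N) t)) \<le> g t" for t
    proof -
      \<comment> \<open>Moving left only increases the distance to S0, since \<mu> < Re S0.\<close>
      have n: "norm (S0 - Complex \<mu> t) \<le> norm (S0 - Complex (\<mu> - real N) t)"
        using \<mu>(2) by (auto simp: cmod_def intro!: real_sqrt_le_mono power_mono)
      have n0: "norm (S0 - Complex \<mu> t) > 0" using \<mu>(2) by (auto simp: complex_eq_iff)
      have "norm (\<Phi> (Complex (\<mu> - real N) t)) = norm (mellin_symbol p q (Complex (\<mu> - real N) t)) * T powr (real N - \<mu>) / norm (S0 - Complex (\<mu> - real N) t)"
        by (simp add: \<Phi>_def barnes_integrand_def norm_mult norm_divide norm_cpow[OF T])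
      also have "\<dots> \<le> (c N * norm (mellin_symbol p q (Complex \<mu> t))) * T powr (real N - \<mu>) / norm (S0 - Complex \<mu> t)"
        using n n0 c by (intro frac_le mult_right_mono) auto
      also have "T powr (real N - \<mu>) = T ^ N * T powr (- \<mu>)"
        using T by (simp add: powr_diff powr_minus powr_realpow divide_inverse)
      finally show ?thesis by (simp add: g_def norm_divide mult_ac)
    qed
    show i: "integrable lborel (\<lambda>t. \<Phi> (Complex (\<mu> - real N) t))"
    proof (rule Bochner_Integration.integrable_bound[OF g])
      have "(\<lambda>t. mellin_symbol p q (Complex (\<mu> - real N) t)) \<in> borel_measurable borel"
        by (intro mellin_symbol_measurable_line nonpole \<mu>)
      then show "(\<lambda>t. \<Phi> (Complex (\<mu> - real N) t)) \<in> borel_measurable lborel"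
        unfolding \<Phi>_def barnes_integrand_def measurable_lborel1
        by (intro borel_measurable_divide borel_measurable_times) (auto simp: Complex_eq)
    qed (use bd order.trans[OF bd abs_ge_self] in \<open>auto intro!: AE_I2\<close>)
    have "norm (LINT t|lborel. \<Phi> (Complex (\<mu> - real N) t)) \<le> (LINT t|lborel. g t)"
      by (rule order.trans[OF integral_norm_bound integral_mono[OF integrable_norm[OF i] g bd]])
    also have "\<dots> = c N * T ^ N * (T powr (- \<mu>) * J)"
      unfolding g_def integral_mult_right_zero J_def by simp
    finally show "norm (LINT t|lborel. \<Phi> (Complex (\<mu> - real N) t)) \<le> c N * T ^ N * (T powr (- \<mu>) * J)" .
  qed
  define a where "a k = residue_coeff p q k * cpow T (p + of_nat k) / (S0 + p + of_nat k)" for k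
  define b where "b k = residue_coeff q p k * cpow T (q + of_nat k) / (S0 + q + of_nat k)" for k
  have res_p: "residue \<Phi> (- p - of_nat k) = a k" for k
    unfolding \<Phi>_def a_def using residue_barnes_integrand_left[OF pq S0(1)] .
  have qp: "q - p \<notin> \<int>" using pq Ints_minus by fastforce
  have res_q: "residue \<Phi> (- q - of_nat k) = b k" for k
    unfolding \<Phi>_def b_def using residue_barnes_integrand_left[OF qp S0(2)]
    unfolding barnes_integrand_def mellin_symbol_commute[of q p] .
  have res_0: "residue \<Phi> S0 = - (mellin_symbol p q S0 * cpow T (- S0))"
    unfolding \<Phi>_def using residue_barnes_integrand_simple[OF S0(1,2)] .
  have eq: "(LINT t|lborel. \<Phi> (Complex \<sigma> t)) - (LINT t|lborel. \<Phi> (Complex (\<mu> - real N) t)) =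
     2 * pi * ((\<Sum>k<nat \<lceil>real N - (\<mu> + Re p)\<rceil>. a k) + (\<Sum>k<nat \<lceil>real N - (\<mu> + Re q)\<rceil>. b k) - mellin_symbol p q S0 * cpow T (- S0))" for N
  proof -
    define L where "L = \<mu> - real N"
    \<comment> \<open>Enough indices to cover every pole with Re S > L - 1, the half-plane in which
      the residue theorem is applied.\<close>
    define M where "M = nat \<lceil>1 - L + \<bar>Re p\<bar> + \<bar>Re q\<bar>\<rceil>"
    define P where "P r = (\<lambda>k. - r - of_nat k :: complex)" for r
    define pts where "pts = insert S0 (P p ` {..<M} \<union> P q ` {..<M})"
    have inj: "inj (P r)" for r by (auto simp: P_def inj_def)
    have inP: "S \<in> P r ` {..<M}" if Sr: "S + r \<in> \<int>\<^sub>\<le>\<^sub>0" "Re S > L - 1" "r = p \<or> r = q" for S r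
    proof -
      obtain n :: int where n: "S + r = of_int n" "n \<le> 0" using Sr(1) by (elim nonpos_Ints_cases)
      have "S = P r (nat (- n))" using n by (simp add: P_def algebra_simps)
      moreover have "nat (- n) < M"
      proof -
        have "Re S = of_int n - Re r" using arg_cong[OF n(1), of Re] by simp
        then have "- of_int n < 1 - L + \<bar>Re p\<bar> + \<bar>Re q\<bar>" using Sr(2,3) by auto
        then show ?thesis unfolding M_def using n(2) by linarith
      qed
      ultimately show ?thesis by blast
    qed
    have "(LINT t|lborel. \<Phi> (Complex \<sigma> t)) - (LINT t|lborel. \<Phi> (Complex L t)) =
         2 * pi * (\<Sum>x | x \<in> pts \<and> L < Re x \<and> Re x < \<sigma>. residue \<Phi> x)"
    proof (rule vertical_lines_residue_theorem)
      show "L < \<sigma>" using \<mu> S0 by (simp add: L_def)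
      show "finite pts" by (simp add: pts_def)
      show "\<Phi> holomorphic_on {S. L - 1 < Re S} - pts"
        unfolding \<Phi>_def barnes_integrand_def[abs_def]
        by (intro holomorphic_intros mellin_symbol_holomorphic) (use inP in \<open>auto simp: pts_def\<close>)
      show "Re x \<noteq> L \<and> Re x \<noteq> \<sigma>" if "x \<in> pts" for x
      proof -
        have "Re (P r k) \<noteq> L" if "\<mu> + Re r \<notin> \<int>" for r k
        proof
          assume "Re (P r k) = L"
          then have "\<mu> + Re r = of_int (int N - int k)" by (simp add: P_def L_def)
          then show False using that by (metis Ints_of_int)
        qed
        then show ?thesis using that \<mu> S0 by (auto simp: pts_def P_def L_def)
      qed
      show "integrable lborel (\<lambda>t. \<Phi> (Complex L t))" unfolding L_def by (rule left(1))
      show "integrable lborel (\<lambda>t. \<Phi> (Complex \<sigma> t))" by (rule int_\<sigma>)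
      fix e :: real assume e: "e > 0"
      obtain C H where CH: "C \<ge> 0" "\<And>S. L \<le> Re S \<Longrightarrow> Re S \<le> 1/4 \<Longrightarrow> H \<le> \<bar>Im S\<bar> \<Longrightarrow> norm (mellin_symbol p q S) \<le> C"
        using mellin_symbol_horizontal_bound[of L p q] by blast
      \<comment> \<open>T^(-x) is monotone in x, so on [L, \<sigma>] it is largest at one of the
        ends; which one depends on whether T >= 1.\<close>
      define K where "K = T powr (- L) + T powr (- \<sigma>)"
      have K: "K \<ge> 0" by (simp add: K_def)
      have Tb: "T powr (- x) \<le> K" if "L \<le> x" "x \<le> \<sigma>" for x
      proof (cases "T \<ge> 1")
        case True
        then have "T powr (- x) \<le> T powr (- L)" using that by (intro powr_mono) auto
        then show ?thesis by (simp add: K_def add_increasing2)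
      next
        case False
        then have "T powr (- x) \<le> T powr (- \<sigma>)" using that T by (intro powr_mono') auto
        then show ?thesis by (simp add: K_def add_increasing)
      qed
      \<comment> \<open>Beyond this height |S0 - S| >= (C K + 1) / e; the added 1 keeps that
        quantity positive.\<close>
      define H' where "H' = max H (\<bar>Im S0\<bar> + (C * K + 1) / e)"
      show "\<exists>H. \<forall>S. L \<le> Re S \<longrightarrow> Re S \<le> \<sigma> \<longrightarrow> H \<le> \<bar>Im S\<bar> \<longrightarrow> norm (\<Phi> S) \<le> e"
      proof (intro exI[of _ H'] allI impI)
        fix S assume S: "L \<le> Re S" "Re S \<le> \<sigma>" "H' \<le> \<bar>Im S\<bar>"
        have d: "(C * K + 1) / e \<le> norm (S0 - S)"
        proof -
          have "(C * K + 1) / e \<le> \<bar>Im (S0 - S)\<bar>" using S(3) by (simp add: H'_def abs_if split: if_splits)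
          then show ?thesis using abs_Im_le_cmod order.trans by blast
        qed
        have pos: "(C * K + 1) / e > 0" using CH K e by (intro divide_pos_pos add_nonneg_pos) auto
        have "norm (\<Phi> S) = norm (mellin_symbol p q S) * T powr (- Re S) / norm (S0 - S)"
          by (simp add: \<Phi>_def barnes_integrand_def norm_mult norm_divide norm_cpow[OF T])
        also have "\<dots> \<le> (C * K + 1) / ((C * K + 1) / e)"
        proof (rule frac_le)
          have "norm (mellin_symbol p q S) * T powr (- Re S) \<le> C * K"
            using CH S Tb \<sigma> by (intro mult_mono) (auto simp: H'_def)
          then show "norm (mellin_symbol p q S) * T powr (- Re S) \<le> C * K + 1" by simp
        qed (use CH K pos d in auto)
        also have "\<dots> = e" using pos e by (auto simp: field_simps)
        finally show "norm (\<Phi> S) \<le> e" .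
      qed
    qed
    also have "{x. x \<in> pts \<and> L < Re x \<and> Re x < \<sigma>} =
      insert S0 (P p ` {..<nat \<lceil>real N - (\<mu> + Re p)\<rceil>} \<union> P q ` {..<nat \<lceil>real N - (\<mu> + Re q)\<rceil>})"
    proof -
      have mem: "(L < Re (P r k) \<and> Re (P r k) < \<sigma> \<and> k < M) \<longleftrightarrow> k < nat \<lceil>real N - (\<mu> + Re r)\<rceil>"
        if r: "r = p \<or> r = q" for r k
      proof -
        have "Re (P r k) < \<sigma>" using r S0 by (auto simp: P_def)
        moreover have "L < Re (P r k) \<longleftrightarrow> real k < real N - (\<mu> + Re r)" by (auto simp: P_def L_def)
        moreover have "real k < real N - (\<mu> + Re r) \<longleftrightarrow> k < nat \<lceil>real N - (\<mu> + Re r)\<rceil>" by linarith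
        moreover have "real k < real N - (\<mu> + Re r) \<Longrightarrow> k < M"
        proof -
          assume "real k < real N - (\<mu> + Re r)"
          moreover have "- Re r \<le> \<bar>Re p\<bar> + \<bar>Re q\<bar>" using r by auto
          ultimately show ?thesis unfolding M_def L_def by linarith
        qed
        ultimately show ?thesis by blast
      qed
      have "L < Re S0 \<and> Re S0 < \<sigma>" using \<mu> S0 by (auto simp: L_def)
      then show ?thesis using mem[of p] mem[of q] unfolding pts_def by (auto simp: image_iff)
    qed
    also have "(\<Sum>x\<in>insert S0 (P p ` {..<nat \<lceil>real N - (\<mu> + Re p)\<rceil>} \<union> P q ` {..<nat \<lceil>real N - (\<mu> + Re q)\<rceil>}). residue \<Phi> x) =
       residue \<Phi> S0 + ((\<Sum>k<nat \<lceil>real N - (\<mu> + Re p)\<rceil>. a k) + (\<Sum>k<nat \<lceil>real N - (\<mu> + Re q)\<rceil>. b k))"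
    proof -
      have notin: "S0 \<notin> P p ` {..<nat \<lceil>real N - (\<mu> + Re p)\<rceil>} \<union> P q ` {..<nat \<lceil>real N - (\<mu> + Re q)\<rceil>}"
        using S0 by (auto simp: P_def)
      have "P p j \<noteq> P q k" for j k
      proof
        assume "P p j = P q k"
        then have "p - q = of_int (int k - int j)" by (simp add: P_def algebra_simps)
        then show False using pq by (metis Ints_of_int)
      qed
      then have disj: "P p ` {..<nat \<lceil>real N - (\<mu> + Re p)\<rceil>} \<inter> P q ` {..<nat \<lceil>real N - (\<mu> + Re q)\<rceil>} = {}" by blast
      have "(\<Sum>x\<in>P p ` {..<m}. residue \<Phi> x) = (\<Sum>k<m. a k)" "(\<Sum>x\<in>P q ` {..<m}. residue \<Phi> x) = (\<Sum>k<m. b k)" for m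
        by (subst sum.reindex[OF inj_on_subset[OF inj subset_UNIV]], simp add: P_def res_p res_q)+
      then show ?thesis using notin disj by (simp add: sum.union_disjoint)
    qed
    finally show ?thesis by (simp add: L_def res_0 algebra_simps)
  qed
  have "(\<lambda>N. LINT t|lborel. \<Phi> (Complex (\<mu> - real N) t)) \<longlonglongrightarrow> 0"
  proof (rule Lim_null_comparison)
    show "\<forall>\<^sub>F N in sequentially. norm (LINT t|lborel. \<Phi> (Complex (\<mu> - real N) t)) \<le> c N * T ^ N * (T powr (- \<mu>) * J)"
      using left(2) by simp
    show "(\<lambda>N. c N * T ^ N * (T powr (- \<mu>) * J)) \<longlonglongrightarrow> 0" by (rule tendsto_mult_left_zero[OF c(1)])
  qed
  then have "(\<lambda>N. (LINT t|lborel. \<Phi> (Complex \<sigma> t)) - (LINT t|lborel. \<Phi> (Complex (\<mu> - real N) t))) \<longlonglongrightarrow> (LINT t|lborel. \<Phi> (Complex \<sigma> t)) - 0"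
    by (intro tendsto_intros)
  moreover have "(\<lambda>N. (LINT t|lborel. \<Phi> (Complex \<sigma> t)) - (LINT t|lborel. \<Phi> (Complex (\<mu> - real N) t))) \<longlonglongrightarrow>
     2 * pi * (A + B - mellin_symbol p q S0 * cpow T (- S0))"
    unfolding eq using A B unfolding a_def[symmetric] b_def[symmetric]
    by (intro tendsto_intros sums_imp_partial_limit)
  ultimately have "(LINT t|lborel. \<Phi> (Complex \<sigma> t)) - 0 = 2 * pi * (A + B - mellin_symbol p q S0 * cpow T (- S0))"
    by (rule LIMSEQ_unique)
  then show ?thesis by (simp add: \<Phi>_def)
qed

section \<open>The kernel as a sum of residues\<close>

text \<open>On a large disc \<open>rGamma\<close> is bounded by compactness. Once |a + k| >= 1, the
  recurrence rGamma (a + k + 1) = rGamma (a + k) / (a + k) cannot increase the norm.\<close>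

lemma rGamma_shift_bound:
  fixes R :: real
  obtains C where "C \<ge> 0" "\<And>a k. norm (a::complex) \<le> R \<Longrightarrow> norm (rGamma (a + of_nat k)) \<le> C"
proof -
  define M where "M = nat \<lceil>\<bar>R\<bar>\<rceil> + 1"
  have "compact (rGamma ` cball (0::complex) (\<bar>R\<bar> + real M))"
    by (intro compact_continuous_image continuous_intros) auto
  then have "bounded (rGamma ` cball (0::complex) (\<bar>R\<bar> + real M))" by (rule compact_imp_bounded)
  then obtain C where "\<forall>x\<in>rGamma ` cball (0::complex) (\<bar>R\<bar> + real M). norm x \<le> C" unfolding bounded_iff by blast
  then have C: "\<And>z. norm z \<le> \<bar>R\<bar> + real M \<Longrightarrow> norm (rGamma (z::complex)) \<le> C" by auto
  have "norm (rGamma (a + of_nat k)) \<le> C" if a: "norm a \<le> R" for a :: complex and k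
  proof (cases "k \<le> M")
    case True
    have "norm (a + of_nat k) \<le> norm a + real k" using norm_triangle_ineq[of a "of_nat k"] by simp
    then show ?thesis using True a by (intro C) auto
  next
    case False
    then have "M \<le> k" by simp
    then show ?thesis
    proof (induction k rule: dec_induct)
      case base
      have "norm (a + of_nat M) \<le> norm a + real M" using norm_triangle_ineq[of a "of_nat M"] by simp
      then show ?case using a by (intro C) auto
    next
      case (step k)
      have "real k \<ge> \<bar>R\<bar> + 1" using step(1) unfolding M_def by linarith
      moreover have "real k \<le> norm (a + of_nat k) + norm a" using norm_triangle_ineq4[of "a + of_nat k" a] by simp
      ultimately have n: "norm (a + of_nat k) \<ge> 1" using a by linarith
      have "norm (a + of_nat k) * norm (rGamma (a + of_nat (Suc k))) = norm (rGamma (a + of_nat k))"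
        using rGamma_plus1[of "a + of_nat k"] by (simp add: add_ac flip: norm_mult)
      moreover have "1 * norm (rGamma (a + of_nat (Suc k))) \<le> norm (a + of_nat k) * norm (rGamma (a + of_nat (Suc k)))"
        using n by (intro mult_right_mono) auto
      ultimately show ?case using step.IH by linarith
    qed
  qed
  moreover have "C \<ge> 0" using order.trans[OF norm_ge_zero C[of 0]] by simp
  ultimately show ?thesis using that by blast
qed

text \<open>The k-th coefficient of the regularised 0F3 in the kernel, with w = p + q and \<nu> = q
  - p, the parameters in which the residues are expressed.\<close>

definition kernel_term :: "complex \<Rightarrow> complex \<Rightarrow> nat \<Rightarrow> complex" where
  "kernel_term p q k = rGamma (1 + p - q + of_nat k) * rGamma (1/2 + p + q + of_nat k) *
     rGamma (1/2 + 2 * p + of_nat k) / fact k"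

definition kernel_series :: "complex \<Rightarrow> complex \<Rightarrow> real \<Rightarrow> complex" where
  "kernel_series p q X = (\<Sum>k. kernel_term p q k * cpow X (2 * p + of_nat (2 * k)))"

lemma kernel_term_bound:
  fixes R :: real
  obtains C where "C \<ge> 0" "\<And>p q k. norm p \<le> R \<Longrightarrow> norm q \<le> R \<Longrightarrow> norm (kernel_term p q k) \<le> C / fact k"
proof -
  obtain C where C: "C \<ge> 0" "\<And>a k. norm (a::complex) \<le> 1 + 2 * R \<Longrightarrow> norm (rGamma (a + of_nat k)) \<le> C"
    using rGamma_shift_bound by blast
  have "norm (kernel_term p q k) \<le> C * C * C / fact k" if "norm p \<le> R" "norm q \<le> R" for p q k
  proof -
    have n: "norm (1 + p - q) \<le> 1 + 2 * R" "norm (1/2 + p + q) \<le> 1 + 2 * R" "norm (1/2 + 2 * p) \<le> 1 + 2 * R"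
    proof -
      have "norm (1 + p - q) \<le> norm (1 + p) + norm q" by (rule norm_triangle_ineq4)
      then show "norm (1 + p - q) \<le> 1 + 2 * R" using norm_triangle_ineq[of 1 p] that by simp
      have h: "norm (1/2::complex) = 1/2" by (simp add: norm_divide)
      have "norm (1/2 + p + q) \<le> norm (1/2 + p) + norm q" by (rule norm_triangle_ineq)
      then show "norm (1/2 + p + q) \<le> 1 + 2 * R" using norm_triangle_ineq[of "1/2" p] that h by linarith
      have "norm (1/2 + 2 * p) \<le> norm (1/2::complex) + norm (2 * p)" by (rule norm_triangle_ineq)
      then show "norm (1/2 + 2 * p) \<le> 1 + 2 * R" using that h by (simp add: norm_mult)
    qed
    show ?thesis
      unfolding kernel_term_def norm_divide norm_mult
      using C n by (intro frac_le mult_mono) auto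
  qed
  then show ?thesis using that[of "C * C * C"] C(1) by simp
qed

lemma kernel_series_bounds:
  fixes R :: real
  obtains C where "C \<ge> 0"
    "\<And>p q k X. norm p \<le> R \<Longrightarrow> norm q \<le> R \<Longrightarrow> X > 0 \<Longrightarrow>
       norm (kernel_term p q k * cpow X (2 * p + of_nat (2 * k))) \<le> C * X powr (2 * Re p) * ((X\<^sup>2) ^ k / fact k)"
    "\<And>p q X. norm p \<le> R \<Longrightarrow> norm q \<le> R \<Longrightarrow> X > 0 \<Longrightarrow>
       norm (kernel_series p q X) \<le> C * X powr (2 * Re p) * exp (X\<^sup>2)"
proof -
  obtain C where C: "C \<ge> 0" "\<And>p q k. norm p \<le> R \<Longrightarrow> norm q \<le> R \<Longrightarrow> norm (kernel_term p q k) \<le> C / fact k"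
    using kernel_term_bound by blast
  have t: "norm (kernel_term p q k * cpow X (2 * p + of_nat (2 * k))) \<le> C * X powr (2 * Re p) * ((X\<^sup>2) ^ k / fact k)"
    if "norm p \<le> R" "norm q \<le> R" "X > 0" for p q k X
  proof -
    have "norm (cpow X (2 * p + of_nat (2 * k))) = X powr (2 * Re p) * (X\<^sup>2) ^ k"
    proof -
      have "norm (cpow X (2 * p + of_nat (2 * k))) = X powr (2 * Re p + real (2 * k))"
        using that(3) by (simp add: norm_cpow)
      also have "\<dots> = X powr (2 * Re p) * X ^ (2 * k)" by (simp only: powr_add powr_realpow[OF that(3)])
      finally show ?thesis by (simp add: power_mult)
    qed
    then show ?thesis
      using mult_right_mono[OF C(2)[OF that(1,2), of k], of "X powr (2 * Re p) * (X\<^sup>2) ^ k"] that(3)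
      by (simp add: norm_mult mult_ac)
  qed
  have "norm (kernel_series p q X) \<le> C * X powr (2 * Re p) * exp (X\<^sup>2)"
    if "norm p \<le> R" "norm q \<le> R" "X > 0" for p q X
  proof -
    have s: "(\<lambda>k. C * X powr (2 * Re p) * ((X\<^sup>2) ^ k / fact k)) sums (C * X powr (2 * Re p) * exp (X\<^sup>2))"
      using exp_converges[of "X\<^sup>2"] by (intro sums_mult) (simp add: divide_inverse mult.commute)
    show ?thesis
    proof -
      have sn: "summable (\<lambda>k. norm (kernel_term p q k * cpow X (2 * p + of_nat (2 * k))))"
        by (rule summable_comparison_test'[OF sums_summable[OF s], where N = 0]) (simp only: real_norm_def abs_norm_cancel t[OF that])
      have "norm (kernel_series p q X) \<le> (\<Sum>k. norm (kernel_term p q k * cpow X (2 * p + of_nat (2 * k))))"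
        unfolding kernel_series_def by (rule summable_norm[OF sn])
      also have "\<dots> \<le> C * X powr (2 * Re p) * exp (X\<^sup>2)"
        by (rule sums_le[OF _ summable_sums[OF sn] s]) (rule t[OF that])
      finally show ?thesis .
    qed
  qed
  then show ?thesis using that[of C] C(1) t by blast
qed

lemma kernel_series_term_bound:
  obtains C where "C \<ge> 0"
    "\<And>k X. X > 0 \<Longrightarrow> norm (kernel_term p q k * cpow X (2 * p + of_nat (2 * k))) \<le> C * X powr (2 * Re p) * ((X\<^sup>2) ^ k / fact k)"
proof (rule kernel_series_bounds[of "norm p + norm q"])
  fix C assume "C \<ge> 0" and *: "\<And>p' q' k X. norm p' \<le> norm p + norm q \<Longrightarrow> norm q' \<le> norm p + norm q \<Longrightarrow> X > 0 \<Longrightarrow>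
       norm (kernel_term p' q' k * cpow X (2 * p' + of_nat (2 * k))) \<le> C * X powr (2 * Re p') * ((X\<^sup>2) ^ k / fact k)"
  show thesis by (rule that[OF \<open>C \<ge> 0\<close>]) (rule *, auto)
qed

lemma kernel_series_summable:
  assumes "X > 0"
  shows "summable (\<lambda>k. kernel_term p q k * cpow X (2 * p + of_nat (2 * k)))"
proof -
  obtain C where C: "C \<ge> 0" "\<And>k X. X > 0 \<Longrightarrow>
       norm (kernel_term p q k * cpow X (2 * p + of_nat (2 * k))) \<le> C * X powr (2 * Re p) * ((X\<^sup>2) ^ k / fact k)"
    using kernel_series_term_bound by blast
  have "summable (\<lambda>k. C * X powr (2 * Re p) * ((X\<^sup>2) ^ k / fact k))"
    using summable_exp[of "X\<^sup>2"] by (intro summable_mult) (simp add: divide_inverse mult.commute)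
  then show ?thesis
    by (rule summable_comparison_test'[where N = 0]) (simp only: C(2)[OF assms])
qed

lemma kernel_series_measurable [measurable]: "kernel_series p q \<in> borel_measurable borel"
  unfolding kernel_series_def[abs_def] by measurable

text \<open>At x = 4 X the prefactor becomes a plain power of X and x^2 / 16 becomes X^2, so each
  half of the bracket is a \<open>kernel_series\<close>; the second half is the first with \<nu>
  negated.\<close>

lemma G_kernel_generic_eq:
  assumes "X > 0"
  shows "G_kernel_generic \<nu> (4 * X) w = of_real pi / sin (\<nu> * of_real pi) *
    (kernel_series ((w - \<nu>) / 2) ((w + \<nu>) / 2) X - kernel_series ((w + \<nu>) / 2) ((w - \<nu>) / 2) X)"
proof -
  have y: "(4 * X)\<^sup>2 / 16 = X\<^sup>2" by (simp add: power2_eq_square)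
  have *: "of_real X powr w * (of_real X powr (- \<mu>) * hypergeo_0F3_reg (1 - \<mu>) (w + 1/2) (w + 1/2 - \<mu>) (of_real (X\<^sup>2)))
     = kernel_series ((w - \<mu>) / 2) ((w + \<mu>) / 2) X" for \<mu>
  proof -
    define p where "p = (w - \<mu>) / 2"
    define q where "q = (w + \<mu>) / 2"
    have pq: "w = p + q" "\<mu> = q - p" by (auto simp: p_def q_def field_simps)
    have pw: "of_real X powr w * of_real X powr (- \<mu>) = cpow X (2 * p)"
      using assms cpow_add[of X w "- \<mu>"] by (simp add: cpow_eq_powr pq)
    have t: "of_real (X\<^sup>2) ^ k * rGamma (1 - \<mu> + of_nat k) * rGamma (w + 1/2 + of_nat k) * rGamma (w + 1/2 - \<mu> + of_nat k) / fact k * cpow X (2 * p) =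
      kernel_term p q k * cpow X (2 * p + of_nat (2 * k))" for k
    proof -
      have a: "cpow X (of_nat (2 * k)) = of_real (X\<^sup>2) ^ k"
        using cpow_of_nat[OF assms, of "2 * k"] by (simp add: power_mult)
      have b: "1 - \<mu> + of_nat k = 1 + p - q + of_nat k" "w + 1/2 + of_nat k = 1/2 + p + q + of_nat k" "w + 1/2 - \<mu> + of_nat k = 1/2 + 2 * p + of_nat k"
        by (auto simp: pq)
      show ?thesis unfolding b cpow_add a kernel_term_def by simp
    qed
    have "summable (\<lambda>k. cpow X (2 * p) * (of_real (X\<^sup>2) ^ k * rGamma (1 - \<mu> + of_nat k) * rGamma (w + 1/2 + of_nat k) * rGamma (w + 1/2 - \<mu> + of_nat k) / fact k))"
      unfolding mult.commute[of "cpow X (2 * p)"] t by (rule kernel_series_summable[OF assms])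
    then have summ: "summable (\<lambda>k. of_real (X\<^sup>2) ^ k * rGamma (1 - \<mu> + of_nat k) * rGamma (w + 1/2 + of_nat k) * rGamma (w + 1/2 - \<mu> + of_nat k) / fact k)"
      by (simp only: summable_cmult_iff cpow_nz simp_thms)
    have "hypergeo_0F3_reg (1 - \<mu>) (w + 1/2) (w + 1/2 - \<mu>) (of_real (X\<^sup>2)) * cpow X (2 * p) = kernel_series p q X"
      unfolding hypergeo_0F3_reg_def suminf_mult2[OF summ] kernel_series_def t ..
    then show ?thesis unfolding p_def[symmetric] q_def[symmetric] by (simp add: mult.assoc[symmetric] pw mult.commute)
  qed
  have "G_kernel_generic \<nu> (4 * X) w = of_real pi / sin (\<nu> * of_real pi) *
     (of_real X powr w * (of_real X powr (- \<nu>) * hypergeo_0F3_reg (1 - \<nu>) (w + 1/2) (w + 1/2 - \<nu>) (of_real (X\<^sup>2))) -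
      of_real X powr w * (of_real X powr (- (- \<nu>)) * hypergeo_0F3_reg (1 - (- \<nu>)) (w + 1/2) (w + 1/2 - (- \<nu>)) (of_real (X\<^sup>2))))"
    unfolding G_kernel_generic_def y by (simp add: algebra_simps)
  then show ?thesis unfolding * by simp
qed

text \<open>Reflection turns Gamma (q - p - k) into \<open>rGamma (1 + p - q + of_nat k)\<close>
  over a sine, whose sign (-1)^k cancels the sign of the residue. Residues and kernel coefficients
  thus differ by a factor independent of k.\<close>

lemma residue_coeff_eq:
  assumes "p - q \<notin> \<int>"
  shows "residue_coeff p q k = of_real pi / sin ((q - p) * of_real pi) * kernel_term p q k"
proof -
  have s: "sin (of_real pi * (q - p - of_nat k)) = (-1) ^ k * sin ((q - p) * of_real pi)"
  proof (induction k)
    case (Suc k)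
    have "of_real pi * (q - p - of_nat (Suc k)) = of_real pi * (q - p - of_nat k) - of_real pi" by (simp add: algebra_simps)
    moreover have "sin (z - of_real pi) = - sin z" for z :: complex by (simp add: sin_diff)
    ultimately show ?case using Suc by simp
  qed (simp add: mult.commute)
  have ni: "q - p - of_nat k \<notin> \<int>\<^sub>\<le>\<^sub>0" "1 - (q - p - of_nat k) \<notin> \<int>\<^sub>\<le>\<^sub>0"
  proof -
    have *: "z \<notin> \<int>\<^sub>\<le>\<^sub>0" if "z \<notin> \<int>" for z :: complex using that nonpos_Ints_subset_Ints by auto
    have "p - q \<in> \<int>" if "q - p - of_nat k \<in> \<int>"
      using Ints_minus[OF Ints_add[OF that Ints_of_nat[of k]]] by simp
    then show "q - p - of_nat k \<notin> \<int>\<^sub>\<le>\<^sub>0" using assms * by blast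
    have "p - q \<in> \<int>" if "1 - (q - p - of_nat k) \<in> \<int>"
      using Ints_diff[OF that Ints_of_nat[of "Suc k"]] by simp
    then show "1 - (q - p - of_nat k) \<notin> \<int>\<^sub>\<le>\<^sub>0" using assms * by blast
  qed
  have "Gamma (q - p - of_nat k) = of_real pi / ((-1) ^ k * sin ((q - p) * of_real pi)) * rGamma (1 - (q - p - of_nat k))"
  proof -
    have "x = y * inverse g" if "x * g = y" "g \<noteq> 0" for x y g :: complex
      using that by (simp add: field_simps)
    from this[OF Gamma_reflection_complex[of "q - p - of_nat k", unfolded s] Gamma_nonzero[OF ni(2)]]
    show ?thesis unfolding rGamma_inverse_Gamma .
  qed
  moreover have "1 - (q - p - of_nat k) = 1 + p - q + of_nat k" by simp
  moreover have "(-1) ^ k * (x / ((-1) ^ k * y)) = x / y" for x y :: complex by (cases "even k") auto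
  ultimately show ?thesis unfolding residue_coeff_def kernel_term_def by (simp add: mult_ac)
qed

lemma cpow_integral_0_T:
  assumes "Re a > 0" "T > 0"
  shows "set_integrable lborel {0<..<T} (\<lambda>x. cpow x (a - 1))"
    and "(LBINT x:{0<..<T}. cpow x (a - 1)) = cpow T a / a"
proof -
  have e: "einterval 0 (ereal T) = {0<..<T::real}" by (auto simp: einterval_def)
  have a: "a \<noteq> 0" "Re a \<noteq> 0" using assms by auto
  have "((\<lambda>x. cpow x a / a) \<longlongrightarrow> 0 / a) (at_right 0)"
    by (intro tendsto_intros cpow_tendsto_0_at_right assms a)
  then have A: "(((\<lambda>x. cpow x a / a) \<circ> real_of_ereal) \<longlongrightarrow> 0) (at_right 0)"
    by (simp add: zero_ereal_def ereal_tendsto_simps1)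
  have A': "(((\<lambda>x. x powr Re a / Re a) \<circ> real_of_ereal) \<longlongrightarrow> 0) (at_right 0)"
    using powr_tendsto_of_cpow[OF cpow_tendsto_0_at_right[of "of_real (Re a)"]] assms
    by (simp add: zero_ereal_def ereal_tendsto_simps1 eventually_at_right_less)
  have "isCont (\<lambda>x. cpow x a / a) T" "isCont (\<lambda>x. x powr Re a / Re a) T"
    unfolding cpow_def using a assms by (auto intro!: continuous_intros)
  then have "((\<lambda>x. cpow x a / a) \<longlongrightarrow> cpow T a / a) (at_left T)" "((\<lambda>x. x powr Re a / Re a) \<longlongrightarrow> T powr Re a / Re a) (at_left T)"
    by (auto simp: isCont_def filterlim_at_split)
  then have B: "(((\<lambda>x. cpow x a / a) \<circ> real_of_ereal) \<longlongrightarrow> cpow T a / a) (at_left (ereal T))"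
    and B': "(((\<lambda>x. x powr Re a / Re a) \<circ> real_of_ereal) \<longlongrightarrow> T powr Re a / Re a) (at_left (ereal T))"
    by (simp_all add: ereal_tendsto_simps1)
  show "set_integrable lborel {0<..<T} (\<lambda>x. cpow x (a - 1))" "(LBINT x:{0<..<T}. cpow x (a - 1)) = cpow T a / a"
    using cpow_FTC[OF _ _ a A B A' B'] assms unfolding e by simp_all
qed

text \<open>Termwise integration on a bounded interval; Re (S0 + p) > 0 makes even the lowest power
  integrable at 0.\<close>

lemma kernel_series_truncated_mellin:
  assumes "T > 0" "Re (S0 + p) > 0"
  shows "set_integrable lborel {0<..<T} (\<lambda>X. cpow X (2 * S0 - 1) * kernel_series p q X)"
    and "(\<lambda>k. kernel_term p q k * cpow T (2 * (S0 + p + of_nat k)) / (2 * (S0 + p + of_nat k))) sums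
           (LBINT X:{0<..<T}. cpow X (2 * S0 - 1) * kernel_series p q X)"
proof -
  define a where "a k = 2 * (S0 + p + of_nat k)" for k :: nat
  have a: "Re (a k) > 0" "Re (a k) \<ge> 2 * Re (S0 + p)" for k using assms by (auto simp: a_def)
  define f where "f k X = indicator {0<..<T} X *\<^sub>R (kernel_term p q k * cpow X (a k - 1))" for k X
  have fi: "integrable lborel (f k)" "(LINT X|lborel. f k X) = kernel_term p q k * cpow T (a k) / a k" for k
  proof -
    have e: "f k = (\<lambda>X. kernel_term p q k * (indicator {0<..<T} X *\<^sub>R cpow X (a k - 1)))" by (auto simp: f_def)
    show "integrable lborel (f k)" unfolding e
      using cpow_integral_0_T(1)[OF a(1) assms(1)] unfolding set_integrable_def by (intro integrable_mult_right)
    show "(LINT X|lborel. f k X) = kernel_term p q k * cpow T (a k) / a k" unfolding e integral_mult_right_zero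
      using cpow_integral_0_T(2)[OF a(1) assms(1)] unfolding set_lebesgue_integral_def by simp
  qed
  obtain C where C: "C \<ge> 0" "\<And>p' q' k. norm p' \<le> norm p + norm q \<Longrightarrow> norm q' \<le> norm p + norm q \<Longrightarrow> norm (kernel_term p' q' k) \<le> C / fact k"
    using kernel_term_bound[of "norm p + norm q"] by blast
  have split: "cpow X (a k - 1) * kernel_term p q k = cpow X (2 * S0 - 1) * (kernel_term p q k * cpow X (2 * p + of_nat (2 * k)))" for X k
  proof -
    have "a k - 1 = (2 * S0 - 1) + (2 * p + of_nat (2 * k))" by (simp add: a_def)
    then show ?thesis unfolding \<open>a k - 1 = _\<close> cpow_add by (simp only: mult_ac)
  qed
  have summ: "summable (\<lambda>k. LINT X|lborel. norm (f k X))"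
  proof (rule summable_comparison_test'[where N = 0])
    \<comment> \<open>The smallest of the exponents Re (a k), hence a common lower bound for the
      denominators.\<close>
    define r where "r = 2 * Re (S0 + p)"
    show "summable (\<lambda>k. C * T powr r / r * ((T\<^sup>2) ^ k / fact k))"
      using summable_exp[of "T\<^sup>2"] by (intro summable_mult) (simp add: divide_inverse mult.commute)
    fix k
    have r: "r > 0" using assms by (simp add: r_def)
    have rk: "Re (of_real (Re (a k))) > 0" using a by simp
    have "(LINT X|lborel. norm (f k X)) = (LINT X|lborel. norm (kernel_term p q k) * Re (indicator {0<..<T} X *\<^sub>R cpow X (of_real (Re (a k)) - 1)))"
      using cpow_of_real[of _ "Re (a k) - 1"]
      by (intro Bochner_Integration.integral_cong) (auto simp: f_def indicator_def norm_mult norm_cpow)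
    also have "\<dots> = norm (kernel_term p q k) * Re (LBINT X:{0<..<T}. cpow X (of_real (Re (a k)) - 1))"
      using cpow_integral_0_T(1)[OF rk assms(1)] unfolding set_integrable_def set_lebesgue_integral_def
      by (subst integral_mult_right_zero, subst integral_Re) auto
    also have "\<dots> = norm (kernel_term p q k) * (T powr Re (a k) / Re (a k))"
      using cpow_integral_0_T(2)[OF rk assms(1)] cpow_of_real[OF assms(1), of "Re (a k)"] by simp
    also have "\<dots> \<le> C / fact k * (T powr Re (a k) / r)"
      using C a[of k] r by (intro mult_mono divide_left_mono) (auto simp: r_def)
    also have "T powr Re (a k) = T powr r * (T\<^sup>2) ^ k"
    proof -
      have "Re (a k) = r + real (2 * k)" by (simp add: a_def r_def)
      then have "T powr Re (a k) = T powr r * T ^ (2 * k)" using assms(1) by (simp only: powr_add powr_realpow)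
      then show ?thesis by (simp add: power_mult)
    qed
    finally show "norm (LINT X|lborel. norm (f k X)) \<le> C * T powr r / r * ((T\<^sup>2) ^ k / fact k)"
      by (simp add: mult_ac)
  qed
  have F: "(\<lambda>k. f k X) sums (indicator {0<..<T} X *\<^sub>R (cpow X (2 * S0 - 1) * kernel_series p q X))" for X
  proof (cases "0 < X \<and> X < T")
    case True
    then have "(\<lambda>k. cpow X (2 * S0 - 1) * (kernel_term p q k * cpow X (2 * p + of_nat (2 * k)))) sums (cpow X (2 * S0 - 1) * kernel_series p q X)"
      unfolding kernel_series_def by (intro sums_mult summable_sums kernel_series_summable) auto
    moreover have "f k X = cpow X (a k - 1) * kernel_term p q k" for k using True by (simp add: f_def mult.commute)
    ultimately show ?thesis unfolding split using True by simp
  qed (auto simp: f_def)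
  have ae: "AE X in lborel. summable (\<lambda>k. norm (f k X))"
  proof (rule AE_I2)
    fix X
    show "summable (\<lambda>k. norm (f k X))"
    proof (cases "0 < X \<and> X < T")
      case True
      obtain C where C: "C \<ge> 0" "\<And>k X. X > 0 \<Longrightarrow>
         norm (kernel_term p q k * cpow X (2 * p + of_nat (2 * k))) \<le> C * X powr (2 * Re p) * ((X\<^sup>2) ^ k / fact k)"
        using kernel_series_term_bound by blast
      have "summable (\<lambda>k. norm (cpow X (2 * S0 - 1)) * (C * X powr (2 * Re p) * ((X\<^sup>2) ^ k / fact k)))"
        using summable_exp[of "X\<^sup>2"] by (intro summable_mult) (simp add: divide_inverse mult.commute)
      then show ?thesis
      proof (rule summable_comparison_test'[where N = 0])
        fix k
        have "norm (f k X) = norm (cpow X (2 * S0 - 1)) * norm (kernel_term p q k * cpow X (2 * p + of_nat (2 * k)))"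
        proof -
          have "f k X = cpow X (a k - 1) * kernel_term p q k" using True by (simp add: f_def mult.commute)
          then show ?thesis unfolding split by (simp only: norm_mult)
        qed
        also have "\<dots> \<le> norm (cpow X (2 * S0 - 1)) * (C * X powr (2 * Re p) * ((X\<^sup>2) ^ k / fact k))"
          using C(2)[of X k] True by (intro mult_left_mono) auto
        finally show "norm (norm (f k X)) \<le> norm (cpow X (2 * S0 - 1)) * (C * X powr (2 * Re p) * ((X\<^sup>2) ^ k / fact k))" by simp
      qed
    qed (auto simp: f_def)
  qed
  have F': "(\<Sum>k. f k X) = indicator {0<..<T} X *\<^sub>R (cpow X (2 * S0 - 1) * kernel_series p q X)" for X
    using F[of X] by (simp add: sums_iff)
  show "set_integrable lborel {0<..<T} (\<lambda>X. cpow X (2 * S0 - 1) * kernel_series p q X)"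
    using integrable_suminf[OF fi(1) ae summ] unfolding F' set_integrable_def .
  show "(\<lambda>k. kernel_term p q k * cpow T (2 * (S0 + p + of_nat k)) / (2 * (S0 + p + of_nat k))) sums
           (LBINT X:{0<..<T}. cpow X (2 * S0 - 1) * kernel_series p q X)"
    using sums_integral[OF fi(1) ae summ] unfolding F' fi(2) unfolding set_lebesgue_integral_def a_def .
qed

lemma kernel_series_holomorphic:
  assumes "X > 0"
  shows "(\<lambda>\<mu>. kernel_series ((w - \<mu>) / 2) ((w + \<mu>) / 2) X) holomorphic_on UNIV"
proof (rule holomorphic_uniform_sequence)
  fix n
  show "(\<lambda>\<mu>. \<Sum>k<n. kernel_term ((w - \<mu>) / 2) ((w + \<mu>) / 2) k * cpow X (2 * ((w - \<mu>) / 2) + of_nat (2 * k))) holomorphic_on UNIV"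
    unfolding kernel_term_def by (intro holomorphic_intros) auto
next
  fix z :: complex
  define R where "R = norm w + norm z + 1"
  obtain C where C: "C \<ge> 0"
    "\<And>p q k X. norm p \<le> R \<Longrightarrow> norm q \<le> R \<Longrightarrow> X > 0 \<Longrightarrow>
       norm (kernel_term p q k * cpow X (2 * p + of_nat (2 * k))) \<le> C * X powr (2 * Re p) * ((X\<^sup>2) ^ k / fact k)"
    using kernel_series_bounds[of R] by metis
  \<comment> \<open>Bounds X^(2 Re p) for |Re p| <= R, whether X lies below or above 1.\<close>
  define K where "K = (max X (1 / X)) powr (2 * R)"
  have "uniform_limit (cball z 1) (\<lambda>n \<mu>. \<Sum>k<n. kernel_term ((w - \<mu>) / 2) ((w + \<mu>) / 2) k * cpow X (2 * ((w - \<mu>) / 2) + of_nat (2 * k)))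
     (\<lambda>\<mu>. kernel_series ((w - \<mu>) / 2) ((w + \<mu>) / 2) X) sequentially"
    unfolding kernel_series_def
  proof (rule Weierstrass_m_test)
    show "summable (\<lambda>k. C * K * ((X\<^sup>2) ^ k / fact k))"
      using summable_exp[of "X\<^sup>2"] by (intro summable_mult) (simp add: divide_inverse mult.commute)
    fix k \<mu> assume "\<mu> \<in> cball z 1"
    then have "norm \<mu> \<le> norm z + 1" using norm_triangle_sub[of \<mu> z] by (simp add: dist_norm norm_minus_commute)
    then have n: "norm ((w - \<mu>) / 2) \<le> R" "norm ((w + \<mu>) / 2) \<le> R"
      using norm_triangle_ineq4[of w \<mu>] norm_triangle_ineq[of w \<mu>] norm_ge_zero[of w] norm_ge_zero[of z]
      unfolding norm_divide norm_numeral R_def by linarith+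
    have "X powr (2 * Re ((w - \<mu>) / 2)) \<le> K"
    proof -
      define e where "e = 2 * Re ((w - \<mu>) / 2)"
      have e: "\<bar>e\<bar> \<le> 2 * R" using n(1) abs_Re_le_cmod[of "(w - \<mu>) / 2"] by (simp add: e_def)
      have m: "max X (1 / X) \<ge> 1" using assms by (cases "X \<ge> 1") (auto simp: le_max_iff_disj)
      have "X powr e \<le> (max X (1 / X)) powr \<bar>e\<bar>"
      proof (cases "e \<ge> 0")
        case True
        then show ?thesis using assms by (simp add: powr_mono2)
      next
        case False
        then have "X powr e = (1 / X) powr \<bar>e\<bar>" using assms by (simp add: powr_divide powr_minus_divide[symmetric])
        also have "\<dots> \<le> (max X (1 / X)) powr \<bar>e\<bar>" using assms by (intro powr_mono2) auto
        finally show ?thesis .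
      qed
      also have "\<dots> \<le> K" unfolding K_def using e m by (intro powr_mono) auto
      finally show ?thesis by (simp add: e_def)
    qed
    then have "C * X powr (2 * Re ((w - \<mu>) / 2)) * ((X\<^sup>2) ^ k / fact k) \<le> C * K * ((X\<^sup>2) ^ k / fact k)"
      using C(1) by (intro mult_right_mono mult_left_mono) auto
    then show "norm (kernel_term ((w - \<mu>) / 2) ((w + \<mu>) / 2) k * cpow X (2 * ((w - \<mu>) / 2) + of_nat (2 * k))) \<le> C * K * ((X\<^sup>2) ^ k / fact k)"
      by (rule order.trans[OF C(2)[OF n assms]])
  qed
  then show "\<exists>d>0. cball z d \<subseteq> UNIV \<and> uniform_limit (cball z d) (\<lambda>n \<mu>. \<Sum>k<n. kernel_term ((w - \<mu>) / 2) ((w + \<mu>) / 2) k * cpow X (2 * ((w - \<mu>) / 2) + of_nat (2 * k)))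
     (\<lambda>\<mu>. kernel_series ((w - \<mu>) / 2) ((w + \<mu>) / 2) X) sequentially"
    by (intro exI[of _ 1]) auto
qed auto

section \<open>Integral orders as removable singularities\<close>

definition kernel_numerator :: "complex \<Rightarrow> real \<Rightarrow> complex \<Rightarrow> complex" where
  "kernel_numerator w X \<mu> = kernel_series ((w - \<mu>) / 2) ((w + \<mu>) / 2) X - kernel_series ((w + \<mu>) / 2) ((w - \<mu>) / 2) X"

lemma kernel_numerator_holomorphic: "X > 0 \<Longrightarrow> kernel_numerator w X holomorphic_on UNIV"
proof -
  assume X: "X > 0"
  have "((\<lambda>\<mu>. kernel_series ((w - \<mu>) / 2) ((w + \<mu>) / 2) X) \<circ> uminus) holomorphic_on UNIV"
    by (rule holomorphic_on_compose_gen[OF _ kernel_series_holomorphic[OF X]]) (auto intro!: holomorphic_intros)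
  then show ?thesis
    unfolding kernel_numerator_def[abs_def] o_def
    by (intro holomorphic_intros kernel_series_holomorphic[OF X]) simp
qed

text \<open>At order n the factor \<open>rGamma (1 + p - q + of_nat k)\<close> kills the first n
  terms of one series, and the remaining terms, shifted by n, coincide with those of the
  other.\<close>

lemma kernel_numerator_nat: "X > 0 \<Longrightarrow> kernel_numerator w X (of_nat n) = 0"
proof -
  assume X: "X > 0"
  define p where "p = (w - of_nat n) / 2"
  define q where "q = (w + of_nat n) / 2"
  have pq: "q = p + of_nat n" "1 + p - q = 1 - of_nat n" "1 + q - p = 1 + of_nat n" by (simp_all add: p_def q_def field_simps)
  have z: "kernel_term p q k = 0" if "k < n" for k
  proof -
    have "1 + p - q + of_nat k = of_int (1 - int n + int k)" by (simp add: pq(2))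
    moreover have "1 - int n + int k \<le> 0" using that by linarith
    ultimately have "1 + p - q + of_nat k \<in> \<int>\<^sub>\<le>\<^sub>0" by (metis nonpos_Ints_of_int)
    then show ?thesis unfolding kernel_term_def by (simp add: rGamma_nonpos_Int)
  qed
  have f: "rGamma (1 + of_nat m :: complex) = 1 / fact m" for m
    using Gamma_fact[of m, where 'a = complex] by (simp add: rGamma_inverse_Gamma inverse_eq_divide)
  have s: "kernel_term p q (j + n) * cpow X (2 * p + of_nat (2 * (j + n))) = kernel_term q p j * cpow X (2 * q + of_nat (2 * j))" for j
  proof -
    have e: "2 * p + of_nat (2 * (j + n)) = 2 * q + of_nat (2 * j)" by (simp add: pq(1))
    have a: "1 + p - q + of_nat (j + n) = 1 + of_nat j" "1 + q - p + of_nat j = 1 + of_nat (j + n)"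
      "1/2 + p + q + of_nat (j + n) = 1/2 + 2 * q + of_nat j" "1/2 + 2 * p + of_nat (j + n) = 1/2 + q + p + of_nat j"
      by (simp_all add: pq(1))
    show ?thesis unfolding e kernel_term_def a f by (simp add: mult_ac)
  qed
  have "kernel_series p q X = (\<Sum>j. kernel_term p q (j + n) * cpow X (2 * p + of_nat (2 * (j + n)))) + (\<Sum>k<n. kernel_term p q k * cpow X (2 * p + of_nat (2 * k)))"
    unfolding kernel_series_def by (rule suminf_split_initial_segment[OF kernel_series_summable[OF X]])
  also have "\<dots> = kernel_series q p X" unfolding s kernel_series_def by (simp add: z)
  finally show ?thesis by (simp add: kernel_numerator_def p_def q_def)
qed

lemma kernel_numerator_Ints: "X > 0 \<Longrightarrow> \<nu> \<in> \<int> \<Longrightarrow> kernel_numerator w X \<nu> = 0"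
proof -
  assume X: "X > 0" and "\<nu> \<in> \<int>"
  then obtain n where n: "\<nu> = of_int n" by (elim Ints_cases)
  show ?thesis
  proof (cases "n \<ge> 0")
    case True
    then have "\<nu> = of_nat (nat n)" using n by simp
    then show ?thesis using kernel_numerator_nat[OF X] by simp
  next
    case False
    then have "\<nu> = - of_nat (nat (- n))" using n by simp
    moreover have "kernel_numerator w X (- \<mu>) = - kernel_numerator w X \<mu>" for \<mu> by (simp add: kernel_numerator_def)
    ultimately show ?thesis using kernel_numerator_nat[OF X] by simp
  qed
qed

lemma sin_pi_nonzero: "\<mu> \<notin> \<int> \<Longrightarrow> sin (\<mu> * of_real pi) \<noteq> (0::complex)"
proof
  assume "\<mu> \<notin> \<int>" "sin (\<mu> * of_real pi) = 0"
  then obtain n where "\<mu> * of_real pi = of_int n * of_real pi" by (auto simp: sin_eq_0)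
  then have "\<mu> = of_int n" by simp
  then show False using \<open>\<mu> \<notin> \<int>\<close> by simp
qed

lemma G_kernel_eq:
  "X > 0 \<Longrightarrow> \<mu> \<notin> \<int> \<Longrightarrow> G_kernel \<mu> (4 * X) w = of_real pi / sin (\<mu> * of_real pi) * kernel_numerator w X \<mu>"
  by (simp add: G_kernel_def G_kernel_generic_eq kernel_numerator_def)

text \<open>Numerator and sine both vanish at \<nu>, the sine simply. The quotient of their
  difference quotients converges, so the \<open>Lim\<close> in the definition of
  \<open>G_kernel\<close> is a genuine limit.\<close>

lemma G_kernel_isCont_Ints:
  assumes "X > 0" "\<nu> \<in> \<int>"
  shows "isCont (\<lambda>\<mu>. G_kernel \<mu> (4 * X) w) \<nu>"
proof -
  define N where "N = kernel_numerator w X"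
  obtain N' where "(N has_field_derivative N') (at \<nu>)"
    using kernel_numerator_holomorphic[OF assms(1), of w] unfolding N_def holomorphic_on_def field_differentiable_def by auto
  then have 1: "((\<lambda>\<mu>. N \<mu> / (\<mu> - \<nu>)) \<longlongrightarrow> N') (at \<nu>)"
    using kernel_numerator_Ints[OF assms] by (simp add: has_field_derivative_iff N_def)
  obtain n where n: "\<nu> = of_int n" using assms(2) by (elim Ints_cases)
  have s0: "sin (\<nu> * of_real pi) = 0" using n by (auto simp: sin_eq_0)
  have c0: "cos (\<nu> * of_real pi) * of_real pi \<noteq> (0::complex)"
  proof
    assume "cos (\<nu> * of_real pi) * of_real pi = (0::complex)"
    then show False using s0 sin_cos_squared_add[of "\<nu> * of_real pi"] by simp
  qed
  have "((\<lambda>\<mu>. sin (\<mu> * of_real pi)) has_field_derivative cos (\<nu> * of_real pi) * of_real pi) (at \<nu>)"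
    by (auto intro!: derivative_eq_intros)
  then have 2: "((\<lambda>\<mu>. sin (\<mu> * of_real pi) / (\<mu> - \<nu>)) \<longlongrightarrow> cos (\<nu> * of_real pi) * of_real pi) (at \<nu>)"
    using s0 by (simp add: has_field_derivative_iff)
  define l where "l = of_real pi * (N' / (cos (\<nu> * of_real pi) * of_real pi))"
  have "((\<lambda>\<mu>. of_real pi * ((N \<mu> / (\<mu> - \<nu>)) / (sin (\<mu> * of_real pi) / (\<mu> - \<nu>)))) \<longlongrightarrow> l) (at \<nu>)"
    unfolding l_def by (intro tendsto_intros 1 2 c0)
  moreover have "\<forall>\<^sub>F \<mu> in at \<nu>. of_real pi * ((N \<mu> / (\<mu> - \<nu>)) / (sin (\<mu> * of_real pi) / (\<mu> - \<nu>))) = G_kernel_generic \<mu> (4 * X) w"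
    unfolding eventually_at_filter
    by (rule always_eventually) (auto simp: G_kernel_generic_eq[OF assms(1)] N_def kernel_numerator_def)
  ultimately have lim: "((\<lambda>\<mu>. G_kernel_generic \<mu> (4 * X) w) \<longlongrightarrow> l) (at \<nu>)"
    by (rule Lim_transform_eventually)
  then have "G_kernel \<nu> (4 * X) w = l"
    using assms(2) by (simp add: G_kernel_def tendsto_Lim)
  moreover have "((\<lambda>\<mu>. G_kernel \<mu> (4 * X) w) \<longlongrightarrow> l) (at \<nu>)"
  proof (rule Lim_transform_eventually[OF lim])
    \<comment> \<open>At the other integers \<open>G_kernel\<close> is again given by a limit
      instead of the formula, so a neighbourhood free of them is taken.\<close>
    have "open (- (\<int> - {\<nu>}))" by (intro open_Compl closed_subset_Ints) auto
    then have "\<forall>\<^sub>F \<mu> in nhds \<nu>. \<mu> \<in> - (\<int> - {\<nu>})" by (intro eventually_nhds_in_open) auto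
    then show "\<forall>\<^sub>F \<mu> in at \<nu>. G_kernel_generic \<mu> (4 * X) w = G_kernel \<mu> (4 * X) w"
      unfolding eventually_at_filter by eventually_elim (auto simp: G_kernel_def)
  qed
  ultimately show ?thesis by (simp add: isCont_def)
qed

lemma G_kernel_holomorphic:
  assumes "X > 0"
  shows "(\<lambda>\<mu>. G_kernel \<mu> (4 * X) w) holomorphic_on UNIV"
proof -
  have op: "open (- \<int> :: complex set)" by (intro open_Compl closed_subset_Ints) auto
  have "(\<lambda>\<mu>. of_real pi / sin (\<mu> * of_real pi) * kernel_numerator w X \<mu>) holomorphic_on - \<int>"
    by (intro holomorphic_intros holomorphic_on_subset[OF kernel_numerator_holomorphic[OF assms]]) (auto simp: sin_pi_nonzero)
  then have hol: "(\<lambda>\<mu>. G_kernel \<mu> (4 * X) w) holomorphic_on - \<int>"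
    by (rule holomorphic_transform) (simp add: G_kernel_eq[OF assms])
  have cont: "isCont (\<lambda>\<mu>. G_kernel \<mu> (4 * X) w) \<nu>" for \<nu>
  proof (cases "\<nu> \<in> \<int>")
    case False
    then show ?thesis using hol op by (meson ComplI continuous_on_eq_continuous_at holomorphic_on_imp_continuous_on)
  qed (rule G_kernel_isCont_Ints[OF assms])
  have "(\<lambda>\<mu>. G_kernel \<mu> (4 * X) w) analytic_on UNIV"
    unfolding analytic_on_def
  proof
    fix \<nu> :: complex
    have "open (- (\<int> - {\<nu>}))" by (intro open_Compl closed_subset_Ints) auto
    then obtain e where e: "e > 0" "ball \<nu> e \<subseteq> - (\<int> - {\<nu>})" by (metis ComplI DiffD2 insertI1 open_contains_ball)
    have "(\<lambda>\<mu>. G_kernel \<mu> (4 * X) w) holomorphic_on ball \<nu> e"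
      by (rule no_isolated_singularity[where K = "{\<nu>}"])
         (use e cont in \<open>auto intro!: continuous_at_imp_continuous_on holomorphic_on_subset[OF hol]\<close>)
    then show "\<exists>\<epsilon>>0. (\<lambda>\<mu>. G_kernel \<mu> (4 * X) w) holomorphic_on ball \<nu> \<epsilon>" using e by blast
  qed
  then show ?thesis by (rule analytic_imp_holomorphic)
qed

section \<open>Bounds uniform near a given order and the truncated transform of the kernel\<close>

lemma powr_le_on_interval:
  fixes X T a b K :: real
  assumes "0 < X" "X \<le> T" "b \<le> a" "a - b \<le> K"
  shows "X powr a \<le> X powr b * (max 1 T) powr K"
proof -
  have "X powr a = X powr b * X powr (a - b)" by (simp flip: powr_add)
  also have "X powr (a - b) \<le> (max 1 T) powr (a - b)" using assms by (intro powr_mono2) auto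
  also have "(max 1 T) powr (a - b) \<le> (max 1 T) powr K" using assms by (intro powr_mono) auto
  finally show ?thesis by (simp add: mult_left_mono)
qed

text \<open>Near an integral \<nu> the division by the sine cannot be estimated directly. The bound
  is proved on a circle around \<nu>, where the sine stays away from 0, and carried inside by the
  maximum modulus principle.\<close>

lemma G_kernel_local_bound:
  fixes \<nu> w :: complex
  assumes "\<delta> > 0" "T > 0"
  obtains r C where "0 < r" "r \<le> \<delta>" "r \<le> 1" "\<And>\<mu>. \<mu> \<in> ball \<nu> r \<Longrightarrow> \<mu> \<noteq> \<nu> \<Longrightarrow> \<mu> \<notin> \<int>" "C \<ge> 0"
    "\<And>\<mu> X. \<mu> \<in> ball \<nu> r \<Longrightarrow> 0 < X \<Longrightarrow> X \<le> T \<Longrightarrow> norm (G_kernel \<mu> (4 * X) w) \<le> C * X powr (Re w - \<bar>Re \<nu>\<bar> - \<delta>)"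
proof -
  have "open (- (\<int> - {\<nu>}))" by (intro open_Compl closed_subset_Ints) auto
  then obtain e where e: "e > 0" "ball \<nu> e \<subseteq> - (\<int> - {\<nu>})" by (metis ComplI DiffD2 insertI1 open_contains_ball)
  \<comment> \<open>The disc contains no integer except possibly \<nu>; r <= \<delta> limits the
    change of the exponent and r <= 1 that of the imaginary part.\<close>
  define r where "r = min (e / 2) (min \<delta> 1)"
  have r: "0 < r" "r \<le> \<delta>" "r \<le> 1" "r < e" using e assms by (auto simp: r_def)
  have nonint: "\<mu> \<notin> \<int>" if "\<mu> \<in> cball \<nu> r" "\<mu> \<noteq> \<nu>" for \<mu>
  proof -
    have "\<mu> \<in> ball \<nu> e" using that(1) r(4) by auto
    then show ?thesis using e(2) that(2) by auto
  qed
  have sph: "\<mu> \<notin> \<int>" if "\<mu> \<in> sphere \<nu> r" for \<mu> using nonint[of \<mu>] that r by auto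
  have "compact (sphere \<nu> r)" "sphere \<nu> r \<noteq> {}" using r by auto
  moreover have "continuous_on (sphere \<nu> r) (\<lambda>\<mu>. norm (sin (\<mu> * of_real pi)))" by (intro continuous_intros)
  ultimately obtain \<mu>0 where \<mu>0: "\<mu>0 \<in> sphere \<nu> r" "\<And>\<mu>. \<mu> \<in> sphere \<nu> r \<Longrightarrow> norm (sin (\<mu>0 * of_real pi)) \<le> norm (sin (\<mu> * of_real pi))"
    using continuous_attains_inf by metis
  define m where "m = norm (sin (\<mu>0 * of_real pi))"
  have m: "m > 0" using sin_pi_nonzero[OF sph[OF \<mu>0(1)]] by (simp add: m_def)
  define R where "R = norm w + norm \<nu> + r"
  obtain C where C: "C \<ge> 0" "\<And>p q X. norm p \<le> R \<Longrightarrow> norm q \<le> R \<Longrightarrow> X > 0 \<Longrightarrow>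
       norm (kernel_series p q X) \<le> C * X powr (2 * Re p) * exp (X\<^sup>2)"
    using kernel_series_bounds[of R] by metis
  define b where "b = Re w - \<bar>Re \<nu>\<bar> - \<delta>"
  \<comment> \<open>On the circle the exponents exceed \<open>b\<close> by at most 2 |Re \<nu>| + 2
    \<delta>; this factor absorbs the excess when X > 1.\<close>
  define M where "M = (max 1 T) powr (2 * \<bar>Re \<nu>\<bar> + 2 * \<delta>)"
  define C' where "C' = pi / m * (2 * (C * M * exp (T\<^sup>2)))"
  have C': "C' \<ge> 0" using C m by (simp add: C'_def M_def)
  have sb: "norm (G_kernel \<mu> (4 * X) w) \<le> C' * X powr b" if \<mu>: "\<mu> \<in> sphere \<nu> r" and X: "0 < X" "X \<le> T" for \<mu> X
  proof -
    have d: "norm (\<nu> - \<mu>) = r" using \<mu> by (simp add: dist_norm)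
    have n: "norm \<mu> \<le> norm \<nu> + r" using d norm_triangle_sub[of \<mu> \<nu>] by (simp add: norm_minus_commute)
    have pq: "norm ((w - \<mu>) / 2) \<le> R" "norm ((w + \<mu>) / 2) \<le> R"
      using n norm_triangle_ineq4[of w \<mu>] norm_triangle_ineq[of w \<mu>] norm_ge_zero[of w] norm_ge_zero[of \<nu>] r(1)
      unfolding norm_divide norm_numeral R_def by linarith+
    have re: "\<bar>Re \<mu> - Re \<nu>\<bar> \<le> r" using abs_Re_le_cmod[of "\<nu> - \<mu>"] d by simp
    have ks: "norm (kernel_series p q X) \<le> C * M * exp (T\<^sup>2) * X powr b"
      if "norm p \<le> R" "norm q \<le> R" "b \<le> 2 * Re p" "2 * Re p - b \<le> 2 * \<bar>Re \<nu>\<bar> + 2 * \<delta>" for p q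
    proof -
      have "norm (kernel_series p q X) \<le> C * X powr (2 * Re p) * exp (X\<^sup>2)" using that X by (intro C(2)) auto
      also have "\<dots> \<le> C * (X powr b * M) * exp (T\<^sup>2)"
        unfolding M_def using C(1) X that by (intro mult_mono powr_le_on_interval) (auto intro!: power_mono mult_nonneg_nonneg)
      finally show ?thesis by (simp add: mult_ac)
    qed
    have "norm (G_kernel \<mu> (4 * X) w) = pi / norm (sin (\<mu> * of_real pi)) * norm (kernel_numerator w X \<mu>)"
      using X sph[OF \<mu>] by (simp add: G_kernel_eq norm_mult norm_divide)
    also have "\<dots> \<le> pi / m * (2 * (C * M * exp (T\<^sup>2) * X powr b))"
    proof (rule mult_mono)
      show "pi / norm (sin (\<mu> * of_real pi)) \<le> pi / m" using \<mu>0(2)[OF \<mu>] m unfolding m_def by (intro divide_left_mono) (auto intro!: mult_pos_pos)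
      have "norm (kernel_numerator w X \<mu>) \<le> norm (kernel_series ((w - \<mu>) / 2) ((w + \<mu>) / 2) X) + norm (kernel_series ((w + \<mu>) / 2) ((w - \<mu>) / 2) X)"
        unfolding kernel_numerator_def by (rule norm_triangle_ineq4)
      also have "\<dots> \<le> C * M * exp (T\<^sup>2) * X powr b + C * M * exp (T\<^sup>2) * X powr b"
      proof -
        have rr: "2 * Re ((w - \<mu>) / 2) = Re w - Re \<mu>" "2 * Re ((w + \<mu>) / 2) = Re w + Re \<mu>"
          by (simp_all add: field_simps)
        show ?thesis by (intro add_mono ks pq; unfold rr b_def) (use re r in linarith)+
      qed
      finally show "norm (kernel_numerator w X \<mu>) \<le> 2 * (C * M * exp (T\<^sup>2) * X powr b)" by (simp only: mult_2)
    qed (use m in auto)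
    finally show ?thesis by (simp add: C'_def mult_ac)
  qed
  have "norm (G_kernel \<mu> (4 * X) w) \<le> C' * X powr b" if "\<mu> \<in> ball \<nu> r" "0 < X" "X \<le> T" for \<mu> X
  proof (rule maximum_modulus_frontier[where S = "cball \<nu> r" and f = "\<lambda>\<mu>. G_kernel \<mu> (4 * X) w"])
    note h = G_kernel_holomorphic[OF that(2), of w]
    show "(\<lambda>\<mu>. G_kernel \<mu> (4 * X) w) holomorphic_on interior (cball \<nu> r)" using h by (rule holomorphic_on_subset) auto
    show "continuous_on (closure (cball \<nu> r)) (\<lambda>\<mu>. G_kernel \<mu> (4 * X) w)"
      using holomorphic_on_imp_continuous_on[OF h] by (rule continuous_on_subset) auto
    show "norm (G_kernel z (4 * X) w) \<le> C' * X powr b" if "z \<in> frontier (cball \<nu> r)" for z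
      using that r \<open>0 < X\<close> \<open>X \<le> T\<close> by (intro sb) auto
  qed (use that in auto)
  then show ?thesis using that[of r C'] r C' nonint unfolding b_def by auto
qed

text \<open>Integrating the kernel termwise over (0, T) reproduces the two residue series at T^2.
  The residue expansion then identifies the deviation from half the symbol as a line integral at
  \<sigma>, of order T^(2 (Re S0 - \<sigma>)).\<close>

lemma G_kernel_truncated_mellin_generic:
  fixes \<mu> w :: complex
  assumes \<mu>: "\<mu> \<notin> \<int>" and T: "T > 0"
    and S0: "- Re ((w - \<mu>) / 2) < Re S0" "- Re ((w + \<mu>) / 2) < Re S0" "Re S0 < \<sigma>" "\<sigma> < 1/4"
    and B: "(LINT t|lborel. norm (mellin_symbol ((w - \<mu>) / 2) ((w + \<mu>) / 2) (Complex \<sigma> t) / (S0 - Complex \<sigma> t))) \<le> B"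
  shows "norm ((LBINT X:{0<..<T}. cpow X (2 * S0 - 1) * G_kernel \<mu> (4 * X) w) -
           mellin_symbol ((w - \<mu>) / 2) ((w + \<mu>) / 2) S0 / 2) \<le> B * T powr (2 * (Re S0 - \<sigma>))"
proof -
  define p where "p = (w - \<mu>) / 2"
  define q where "q = (w + \<mu>) / 2"
  have \<mu>pq: "\<mu> = q - p" by (simp add: p_def q_def field_simps)
  have pq: "p - q \<notin> \<int>" using \<mu> Ints_minus[of "p - q"] by (auto simp: \<mu>pq)
  have qp: "q - p \<notin> \<int>" using \<mu> by (simp add: \<mu>pq)
  define s where "s = of_real pi / sin (\<mu> * of_real pi)"
  have s': "of_real pi / sin ((p - q) * of_real pi) = - s"
  proof -
    have "(p - q) * of_real pi = - (\<mu> * of_real pi)" by (simp add: \<mu>pq algebra_simps)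
    then show ?thesis by (simp add: s_def)
  qed
  have p0: "Re (S0 + p) > 0" and q0: "Re (S0 + q) > 0" using S0 by (auto simp: p_def q_def)
  note KP = kernel_series_truncated_mellin[OF T p0, of q] and KQ = kernel_series_truncated_mellin[OF T q0, of p]
  define IP where "IP = (LBINT X:{0<..<T}. cpow X (2 * S0 - 1) * kernel_series p q X)"
  define IQ where "IQ = (LBINT X:{0<..<T}. cpow X (2 * S0 - 1) * kernel_series q p X)"
  have G: "(LBINT X:{0<..<T}. cpow X (2 * S0 - 1) * G_kernel \<mu> (4 * X) w) = s * (IP - IQ)"
  proof -
    have Gk: "G_kernel \<mu> (4 * X) w = s * (kernel_series p q X - kernel_series q p X)" if "X > 0" for X
      by (simp add: G_kernel_eq[OF that \<mu>] kernel_numerator_def s_def p_def q_def)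
    have "(LBINT X:{0<..<T}. cpow X (2 * S0 - 1) * G_kernel \<mu> (4 * X) w) =
      (LBINT X:{0<..<T}. s * (cpow X (2 * S0 - 1) * kernel_series p q X - cpow X (2 * S0 - 1) * kernel_series q p X))"
      by (intro set_lebesgue_integral_cong) (auto simp: Gk right_diff_distrib mult.left_commute)
    also have "\<dots> = s * (IP - IQ)"
      unfolding IP_def IQ_def set_integral_mult_right set_integral_diff(2)[OF KP(1) KQ(1)] ..
    finally show ?thesis .
  qed
  \<comment> \<open>The residue series carries T^(2 (r + k)) / (S0 + r + k), the integral T^(2 (S0 +
    r + k)) / (2 (S0 + r + k)); the first is 2 T^(-2 S0) times the second.\<close>
  have conv: "residue_coeff r r' k * cpow (T ^ 2) (r + of_nat k) / (S0 + r + of_nat k) =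
     2 * cpow T (- (2 * S0)) * u * (kernel_term r r' k * cpow T (2 * (S0 + r + of_nat k)) / (2 * (S0 + r + of_nat k)))"
    if "residue_coeff r r' k = u * kernel_term r r' k" for r r' k u
  proof -
    have "cpow (T ^ 2) (r + of_nat k) = cpow T (- (2 * S0) + 2 * (S0 + r + of_nat k))"
      using T by (simp add: cpow_power algebra_simps)
    then have c: "cpow (T ^ 2) (r + of_nat k) = cpow T (- (2 * S0)) * cpow T (2 * (S0 + r + of_nat k))"
      by (simp only: cpow_add)
    have g: "(u * t) * (a * b) / Y = 2 * a * u * (t * b / (2 * Y))" for t a b Y :: complex by simp
    show ?thesis unfolding that c by (rule g)
  qed
  have A1: "(\<lambda>k. residue_coeff p q k * cpow (T ^ 2) (p + of_nat k) / (S0 + p + of_nat k)) sums (2 * cpow T (- (2 * S0)) * s * IP)"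
  proof -
    have "residue_coeff p q k = s * kernel_term p q k" for k
      using residue_coeff_eq[OF pq, of k] by (simp add: s_def \<mu>pq)
    note c = conv[OF this]
    show ?thesis unfolding c IP_def by (intro sums_mult KP(2))
  qed
  have B1: "(\<lambda>k. residue_coeff q p k * cpow (T ^ 2) (q + of_nat k) / (S0 + q + of_nat k)) sums (2 * cpow T (- (2 * S0)) * (- s) * IQ)"
  proof -
    have "residue_coeff q p k = - s * kernel_term q p k" for k
      using residue_coeff_eq[OF qp, of k] unfolding s' .
    note c = conv[OF this]
    show ?thesis unfolding c IQ_def by (intro sums_mult KQ(2))
  qed
  have T2: "T ^ 2 > 0" using T by simp
  have bar: "2 * cpow T (- (2 * S0)) * s * IP + 2 * cpow T (- (2 * S0)) * (- s) * IQ - mellin_symbol p q S0 * cpow (T ^ 2) (- S0) =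
    1 / (2 * pi) * (LINT t|lborel. barnes_integrand p q (T ^ 2) S0 (Complex \<sigma> t))"
    by (rule barnes_integral_residue_expansion[OF T2 pq _ _ S0(3,4) A1 B1]) (use S0 in \<open>auto simp: p_def q_def\<close>)
  have cc: "cpow (T ^ 2) (- S0) = cpow T (- (2 * S0))" using T by (simp add: cpow_power)
  define E where "E = (LBINT X:{0<..<T}. cpow X (2 * S0 - 1) * G_kernel \<mu> (4 * X) w) - mellin_symbol p q S0 / 2"
  have E: "2 * cpow T (- (2 * S0)) * E = 1 / (2 * pi) * (LINT t|lborel. barnes_integrand p q (T ^ 2) S0 (Complex \<sigma> t))"
    unfolding bar[symmetric] cc E_def G by (simp add: algebra_simps)
  have "norm (LINT t|lborel. barnes_integrand p q (T ^ 2) S0 (Complex \<sigma> t)) \<le> (LINT t|lborel. norm (barnes_integrand p q (T ^ 2) S0 (Complex \<sigma> t)))"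
    by (rule integral_norm_bound)
  also have "\<dots> = (LINT t|lborel. T powr (- (2 * \<sigma>)) * norm (mellin_symbol p q (Complex \<sigma> t) / (S0 - Complex \<sigma> t)))"
  proof (intro Bochner_Integration.integral_cong refl)
    fix t
    have "norm (cpow (T ^ 2) (- Complex \<sigma> t)) = T powr (- (2 * \<sigma>))"
      using T by (simp add: cpow_power norm_cpow)
    then show "norm (barnes_integrand p q (T ^ 2) S0 (Complex \<sigma> t)) = T powr (- (2 * \<sigma>)) * norm (mellin_symbol p q (Complex \<sigma> t) / (S0 - Complex \<sigma> t))"
      by (simp add: barnes_integrand_def norm_mult norm_divide)
  qed
  also have "\<dots> \<le> T powr (- (2 * \<sigma>)) * B"
    unfolding integral_mult_right_zero using B by (intro mult_left_mono) (simp_all add: p_def q_def)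
  finally have b: "norm (LINT t|lborel. barnes_integrand p q (T ^ 2) S0 (Complex \<sigma> t)) \<le> T powr (- (2 * \<sigma>)) * B" .
  have nE: "2 * T powr (- (2 * Re S0)) * norm E = 1 / (2 * pi) * norm (LINT t|lborel. barnes_integrand p q (T ^ 2) S0 (Complex \<sigma> t))"
    using arg_cong[OF E, of norm] T by (simp add: norm_mult norm_divide norm_cpow)
  have "1 / (2 * pi) \<le> 1" using pi_gt3 by simp
  then have "1 / (2 * pi) * norm (LINT t|lborel. barnes_integrand p q (T ^ 2) S0 (Complex \<sigma> t)) \<le> 1 * (T powr (- (2 * \<sigma>)) * B)"
    using b by (intro mult_mono) auto
  with nE have "2 * T powr (- (2 * Re S0)) * norm E \<le> T powr (- (2 * \<sigma>)) * B" by simp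
  moreover have "0 \<le> T powr (- (2 * Re S0)) * norm E" by simp
  ultimately have "T powr (- (2 * Re S0)) * norm E \<le> T powr (- (2 * \<sigma>)) * B" by linarith
  then have "T powr (2 * Re S0) * (T powr (- (2 * Re S0)) * norm E) \<le> T powr (2 * Re S0) * (T powr (- (2 * \<sigma>)) * B)"
    by (intro mult_left_mono) auto
  moreover have "T powr (2 * Re S0) * (T powr (- (2 * Re S0)) * norm E) = norm E"
    using T by (simp add: mult.assoc[symmetric] flip: powr_add)
  moreover have "T powr (2 * Re S0) * (T powr (- (2 * \<sigma>)) * B) = B * T powr (2 * (Re S0 - \<sigma>))"
    using T by (simp add: mult_ac right_diff_distrib flip: powr_add)
  ultimately have "norm E \<le> B * T powr (2 * (Re S0 - \<sigma>))" by (simp only:)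
  then show ?thesis unfolding E_def p_def q_def .
qed

lemma nonint_sequence:
  fixes \<nu> :: complex
  assumes r: "r > 0" "\<And>\<mu>. \<mu> \<in> ball \<nu> r \<Longrightarrow> \<mu> \<noteq> \<nu> \<Longrightarrow> \<mu> \<notin> \<int>"
  obtains \<mu> :: "nat \<Rightarrow> complex" where "\<And>n. \<mu> n \<notin> \<int>" "\<And>n. \<mu> n \<in> ball \<nu> r" "\<mu> \<longlonglongrightarrow> \<nu>"
proof
  \<comment> \<open>The denominator n + 2 puts even the first point strictly inside the ball, and no
    point is its centre.\<close>
  define \<mu> where "\<mu> n = \<nu> + of_real (r / real (n + 2))" for n
  have pos: "r / real (n + 2) > 0" "r / real (n + 2) < r" for n
    using r(1) by (simp_all add: divide_less_eq)
  have d: "dist \<nu> (\<mu> n) = r / real (n + 2)" for n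
  proof -
    have "dist \<nu> (\<mu> n) = norm (complex_of_real (r / real (n + 2)))" unfolding \<mu>_def dist_norm by (simp add: norm_minus_commute)
    then show ?thesis using pos[of n] by (simp only: norm_of_real abs_of_pos)
  qed
  show b: "\<mu> n \<in> ball \<nu> r" for n using d[of n] pos[of n] by simp
  show "\<mu> n \<notin> \<int>" for n using r(2)[OF b[of n]] d[of n] pos[of n] by force
  have "(\<lambda>n. r / real (n + 2)) \<longlonglongrightarrow> 0" by (rule LIMSEQ_ignore_initial_segment[OF lim_const_over_n])
  then have "(\<lambda>n. \<nu> + of_real (r / real (n + 2))) \<longlonglongrightarrow> \<nu> + of_real 0" by (intro tendsto_intros)
  then show "\<mu> \<longlonglongrightarrow> \<nu>" by (simp add: \<mu>_def[abs_def])
qed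

text \<open>For non-integral orders the kernel is a combination of measurable series, and any order
  is a pointwise limit of these. The indicator is there because the series formula concerns X >
  0.\<close>

lemma G_kernel_measurable:
  fixes \<nu> w :: complex
  shows "(\<lambda>X. indicator {0<..} X *\<^sub>R G_kernel \<nu> (4 * X) w) \<in> borel_measurable borel"
proof -
  have "open (- (\<int> - {\<nu>}))" by (intro open_Compl closed_subset_Ints) auto
  then obtain r where r: "r > 0" "ball \<nu> r \<subseteq> - (\<int> - {\<nu>})" by (metis ComplI DiffD2 insertI1 open_contains_ball)
  obtain \<mu> where \<mu>: "\<And>n. \<mu> n \<notin> \<int>" and lim: "\<mu> \<longlonglongrightarrow> \<nu>"
    using nonint_sequence[of r \<nu>] r by (metis ComplD DiffI empty_iff insert_iff subsetD)
  show ?thesis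
  proof (rule borel_measurable_LIMSEQ_metric)
    fix n
    have e: "indicator {0<..} X *\<^sub>R G_kernel (\<mu> n) (4 * X) w = indicator {0<..} X *\<^sub>R (of_real pi / sin (\<mu> n * of_real pi) *
      (kernel_series ((w - \<mu> n) / 2) ((w + \<mu> n) / 2) X - kernel_series ((w + \<mu> n) / 2) ((w - \<mu> n) / 2) X))" for X
      by (auto simp: indicator_def G_kernel_eq[OF _ \<mu>] kernel_numerator_def)
    show "(\<lambda>X. indicator {0<..} X *\<^sub>R G_kernel (\<mu> n) (4 * X) w) \<in> borel_measurable borel"
      unfolding e by measurable
  next
    fix X
    show "(\<lambda>n. indicator {0<..} X *\<^sub>R G_kernel (\<mu> n) (4 * X) w) \<longlonglongrightarrow> indicator {0<..} X *\<^sub>R G_kernel \<nu> (4 * X) w"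
    proof (cases "X > 0")
      case True
      have "isCont (\<lambda>\<mu>. G_kernel \<mu> (4 * X) w) \<nu>"
        using holomorphic_on_imp_continuous_on[OF G_kernel_holomorphic[OF True]] by (simp add: continuous_on_eq_continuous_at)
      from isCont_tendsto_compose[OF this lim] show ?thesis by (intro tendsto_intros)
    qed simp
  qed
qed

lemma powr_integrable_0_T:
  fixes e T :: real
  shows "e > -1 \<Longrightarrow> T > 0 \<Longrightarrow> integrable lborel (\<lambda>X. indicator {0<..<T} X *\<^sub>R X powr e)"
proof -
  assume e: "e > -1" and T: "T > 0"
  have "Re (of_real (e + 1)) > 0" using e by simp
  from integrable_norm[OF cpow_integral_0_T(1)[OF this T, unfolded set_integrable_def]]
  show ?thesis
    by (rule Bochner_Integration.integrable_bound) (auto simp: indicator_def norm_cpow)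
qed

text \<open>Non-integral orders \<mu> n tend to \<nu> and their estimates pass to the limit, the
  integral by dominated convergence and the symbol by continuity. One \<open>B\<close> has to serve
  all n, all T and all s on the line.\<close>

theorem G_kernel_truncated_mellin:
  fixes \<nu> w :: complex
  assumes c0: "\<bar>Re \<nu>\<bar> - Re w < c0" "c0 < 2 * \<sigma>" and \<sigma>: "\<sigma> < 1/4"
  obtains B where "B \<ge> 0"
    "\<And>T s. T > 0 \<Longrightarrow> Re s = c0 \<Longrightarrow> set_integrable lborel {0<..<T} (\<lambda>X. cpow X (s - 1) * G_kernel \<nu> (4 * X) w)"
    "\<And>T s. T > 0 \<Longrightarrow> Re s = c0 \<Longrightarrow>
       norm ((LBINT X:{0<..<T}. cpow X (s - 1) * G_kernel \<nu> (4 * X) w) -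
         mellin_symbol ((w - \<nu>) / 2) ((w + \<nu>) / 2) (s / 2) / 2) \<le> B * T powr (c0 - 2 * \<sigma>)"
proof -
  \<comment> \<open>Half of the available gap: it allows Re \<mu> to move by \<delta> while the
    inequality with c0 stays strict.\<close>
  define \<delta> where "\<delta> = (c0 - (\<bar>Re \<nu>\<bar> - Re w)) / 2"
  have \<delta>: "\<delta> > 0" "\<bar>Re \<nu>\<bar> - Re w + \<delta> < c0" using c0 by (auto simp: \<delta>_def field_simps)
  \<comment> \<open>\<rho> and D bound the real and imaginary parts of (w - \<mu>) / 2 and (w +
    \<mu>) / 2 for every \<mu> that is close enough to \<nu>.\<close>
  define \<rho> where "\<rho> = (Re w - \<bar>Re \<nu>\<bar> - \<delta>) / 2"
  define D where "D = \<bar>Im w\<bar> + \<bar>Im \<nu>\<bar> + 1"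
  have b1: "\<sigma> + \<rho> > 0" "D \<ge> 0" "\<sigma> - c0 / 2 > 0" using \<delta> c0 by (auto simp: \<rho>_def D_def field_simps)
  obtain B where B: "B \<ge> 0"
   "\<And>p q S0. \<rho> \<le> Re p \<Longrightarrow> \<rho> \<le> Re q \<Longrightarrow> \<bar>Im p\<bar> \<le> D \<Longrightarrow> \<bar>Im q\<bar> \<le> D \<Longrightarrow> \<sigma> - c0 / 2 \<le> \<bar>Re S0 - \<sigma>\<bar> \<Longrightarrow>
      (LINT t|lborel. norm (mellin_symbol p q (Complex \<sigma> t) / (S0 - Complex \<sigma> t))) \<le> B"
    by (rule mellin_symbol_line_integral_bound[OF b1(1) \<sigma> b1(2,3)]) (rule that; assumption)
  have main: "set_integrable lborel {0<..<T} (\<lambda>X. cpow X (s - 1) * G_kernel \<nu> (4 * X) w) \<and>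
     norm ((LBINT X:{0<..<T}. cpow X (s - 1) * G_kernel \<nu> (4 * X) w) -
         mellin_symbol ((w - \<nu>) / 2) ((w + \<nu>) / 2) (s / 2) / 2) \<le> B * T powr (c0 - 2 * \<sigma>)"
    if T: "T > 0" and s: "Re s = c0" for T s
  proof -
    obtain r C where r: "0 < r" "r \<le> \<delta>" "r \<le> 1" "\<And>\<mu>. \<mu> \<in> ball \<nu> r \<Longrightarrow> \<mu> \<noteq> \<nu> \<Longrightarrow> \<mu> \<notin> \<int>" "C \<ge> 0"
      "\<And>\<mu> X. \<mu> \<in> ball \<nu> r \<Longrightarrow> 0 < X \<Longrightarrow> X \<le> T \<Longrightarrow> norm (G_kernel \<mu> (4 * X) w) \<le> C * X powr (Re w - \<bar>Re \<nu>\<bar> - \<delta>)"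
      by (rule G_kernel_local_bound[OF \<delta>(1) T, of \<nu> w]) (rule that; assumption)
    obtain \<mu> where \<mu>: "\<And>n. \<mu> n \<notin> \<int>" and \<mu>b: "\<And>n. \<mu> n \<in> ball \<nu> r" and lim: "\<mu> \<longlonglongrightarrow> \<nu>"
      using nonint_sequence[OF r(1,4)] by blast
    define S0 where "S0 = s / 2"
    have S0: "2 * S0 - 1 = s - 1" "Re S0 = c0 / 2" using s by (simp_all add: S0_def)
    have close: "Re (\<mu> n) - Re \<nu> < r" "Re \<nu> - Re (\<mu> n) < r" "Im (\<mu> n) - Im \<nu> < r" "Im \<nu> - Im (\<mu> n) < r" for n
      using abs_Re_le_cmod[of "\<nu> - \<mu> n"] abs_Im_le_cmod[of "\<nu> - \<mu> n"] \<mu>b[of n] by (auto simp: dist_norm abs_le_iff)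
    have bdp: "\<rho> \<le> Re ((w - \<mu> n) / 2)" "\<rho> \<le> Re ((w + \<mu> n) / 2)" "\<bar>Im ((w - \<mu> n) / 2)\<bar> \<le> D" "\<bar>Im ((w + \<mu> n) / 2)\<bar> \<le> D" for n
    proof -
      have e: "Re ((w - \<mu> n) / 2) = (Re w - Re (\<mu> n)) / 2" "Re ((w + \<mu> n) / 2) = (Re w + Re (\<mu> n)) / 2"
        "Im ((w - \<mu> n) / 2) = (Im w - Im (\<mu> n)) / 2" "Im ((w + \<mu> n) / 2) = (Im w + Im (\<mu> n)) / 2" by simp_all
      note abs = abs_ge_self[of "Re \<nu>"] abs_ge_minus_self[of "Re \<nu>"] abs_ge_self[of "Im \<nu>"] abs_ge_minus_self[of "Im \<nu>"]
        abs_ge_self[of "Im w"] abs_ge_minus_self[of "Im w"]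
      have m: "Re (\<mu> n) \<le> \<bar>Re \<nu>\<bar> + \<delta>" "- Re (\<mu> n) \<le> \<bar>Re \<nu>\<bar> + \<delta>"
        using close[of n] r(2) abs by simp_all
      show "\<rho> \<le> Re ((w - \<mu> n) / 2)" unfolding e \<rho>_def using m by (intro divide_right_mono) auto
      show "\<rho> \<le> Re ((w + \<mu> n) / 2)" unfolding e \<rho>_def using m by (intro divide_right_mono) auto
      have "Im w - Im (\<mu> n) \<le> 2 * D" "Im (\<mu> n) - Im w \<le> 2 * D" "Im w + Im (\<mu> n) \<le> 2 * D" "- (Im w + Im (\<mu> n)) \<le> 2 * D"
        unfolding D_def using close[of n] r(3) abs by simp_all
      then show "\<bar>Im ((w - \<mu> n) / 2)\<bar> \<le> D" "\<bar>Im ((w + \<mu> n) / 2)\<bar> \<le> D"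
        unfolding e by (simp_all add: abs_divide abs_le_iff)
    qed
    have est: "norm ((LBINT X:{0<..<T}. cpow X (s - 1) * G_kernel (\<mu> n) (4 * X) w) -
           mellin_symbol ((w - \<mu> n) / 2) ((w + \<mu> n) / 2) S0 / 2) \<le> B * T powr (c0 - 2 * \<sigma>)" for n
    proof -
      have "\<sigma> - c0 / 2 \<le> \<bar>Re S0 - \<sigma>\<bar>" using c0 by (simp add: S0)
      note Bn = B(2)[OF bdp[of n] this]
      have "norm ((LBINT X:{0<..<T}. cpow X (2 * S0 - 1) * G_kernel (\<mu> n) (4 * X) w) -
           mellin_symbol ((w - \<mu> n) / 2) ((w + \<mu> n) / 2) S0 / 2) \<le> B * T powr (2 * (Re S0 - \<sigma>))"
      proof (intro G_kernel_truncated_mellin_generic \<mu> T)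
        have "2 * \<rho> = Re w - \<bar>Re \<nu>\<bar> - \<delta>" by (simp add: \<rho>_def)
        then have "- \<rho> < Re S0" using \<delta>(2) unfolding S0(2) by linarith
        then show "- Re ((w - \<mu> n) / 2) < Re S0" "- Re ((w + \<mu> n) / 2) < Re S0"
          using bdp(1,2)[of n] by - (linarith+)
      qed (use c0 \<sigma> Bn in \<open>auto simp: S0(2)\<close>)
      then show ?thesis unfolding S0 by (simp add: right_diff_distrib)
    qed
    define g where "g n X = indicator {0<..<T} X *\<^sub>R (cpow X (s - 1) * G_kernel (\<mu> n) (4 * X) w)" for n X
    define h where "h X = indicator {0<..<T} X *\<^sub>R (cpow X (s - 1) * G_kernel \<nu> (4 * X) w)" for X
    \<comment> \<open>By the choice of \<delta> the exponent exceeds -1, so this majorant is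
      integrable at 0.\<close>
    define b where "b X = C * (indicator {0<..<T} X *\<^sub>R X powr (c0 - 1 + (Re w - \<bar>Re \<nu>\<bar> - \<delta>)))" for X
    have meas: "(\<lambda>X. indicator {0<..<T} X *\<^sub>R (cpow X (s - 1) * G_kernel m (4 * X) w)) \<in> borel_measurable lborel" for m
    proof -
      have e: "indicator {0<..<T} X *\<^sub>R (cpow X (s - 1) * G_kernel m (4 * X) w) =
        indicator {0<..<T} X *\<^sub>R (cpow X (s - 1) * (indicator {0<..} X *\<^sub>R G_kernel m (4 * X) w))" for X
        by (auto simp: indicator_def)
      note [measurable] = G_kernel_measurable[of m w]
      show ?thesis unfolding e by measurable
    qed
    have bi: "integrable lborel b"
      unfolding b_def using \<delta> T by (intro integrable_mult_right powr_integrable_0_T) auto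
    have bound: "norm (indicator {0<..<T} X *\<^sub>R (cpow X (s - 1) * G_kernel m (4 * X) w)) \<le> b X" if "m \<in> ball \<nu> r" for m X
    proof (cases "0 < X \<and> X < T")
      case True
      have "norm (cpow X (s - 1) * G_kernel m (4 * X) w) \<le> X powr (c0 - 1) * (C * X powr (Re w - \<bar>Re \<nu>\<bar> - \<delta>))"
        unfolding norm_mult using True s r(6)[OF that, of X] by (intro mult_mono) (auto simp: norm_cpow)
      also have "\<dots> = C * X powr (c0 - 1 + (Re w - \<bar>Re \<nu>\<bar> - \<delta>))" by (simp add: powr_add)
      finally show ?thesis using True by (simp add: b_def)
    qed (auto simp: b_def)
    have hi: "integrable lborel h"
      unfolding h_def using r(1) by (intro Bochner_Integration.integrable_bound[OF bi meas] AE_I2 order.trans[OF bound abs_ge_self[THEN order.trans]]) auto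
    have "(\<lambda>n. LINT X|lborel. g n X) \<longlonglongrightarrow> (LINT X|lborel. h X)"
    proof (rule integral_dominated_convergence[where w = b])
      show "AE X in lborel. (\<lambda>n. g n X) \<longlonglongrightarrow> h X"
      proof (rule AE_I2)
        fix X
        show "(\<lambda>n. g n X) \<longlonglongrightarrow> h X"
        proof (cases "X > 0")
          case True
          have "isCont (\<lambda>\<mu>. G_kernel \<mu> (4 * X) w) \<nu>"
            using holomorphic_on_imp_continuous_on[OF G_kernel_holomorphic[OF True]] by (simp add: continuous_on_eq_continuous_at)
          from isCont_tendsto_compose[OF this lim] show ?thesis unfolding g_def h_def by (intro tendsto_intros)
        qed (simp add: g_def h_def)
      qed
      show "AE X in lborel. norm (g n X) \<le> b X" for n
        unfolding g_def by (intro AE_I2 bound \<mu>b)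
    qed (use meas bi in \<open>auto simp: g_def[abs_def] h_def[abs_def]\<close>)
    moreover have "(\<lambda>n. mellin_symbol ((w - \<mu> n) / 2) ((w + \<mu> n) / 2) S0) \<longlonglongrightarrow> mellin_symbol ((w - \<nu>) / 2) ((w + \<nu>) / 2) S0"
    proof -
      have "Re (S0 + (w - \<nu>) / 2) > 0" "Re (S0 + (w + \<nu>) / 2) > 0" using c0 by (auto simp: S0(2) field_simps abs_if split: if_splits)
      from not_nonpos_Ints_right[OF this(1)] not_nonpos_Ints_right[OF this(2)]
      have "S0 + (w - \<nu>) / 2 \<notin> \<int>\<^sub>\<le>\<^sub>0" "S0 + (w + \<nu>) / 2 \<notin> \<int>\<^sub>\<le>\<^sub>0" .
      then show ?thesis unfolding mellin_symbol_def
        by (intro tendsto_mult tendsto_Gamma isCont_tendsto_compose[OF isCont_rGamma[OF continuous_ident]] tendsto_intros lim) auto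
    qed
    ultimately have "(\<lambda>n. norm ((LINT X|lborel. g n X) - mellin_symbol ((w - \<mu> n) / 2) ((w + \<mu> n) / 2) S0 / 2)) \<longlonglongrightarrow>
       norm ((LINT X|lborel. h X) - mellin_symbol ((w - \<nu>) / 2) ((w + \<nu>) / 2) S0 / 2)"
      by (intro tendsto_intros) auto
    then have "norm ((LINT X|lborel. h X) - mellin_symbol ((w - \<nu>) / 2) ((w + \<nu>) / 2) S0 / 2) \<le> B * T powr (c0 - 2 * \<sigma>)"
      by (rule LIMSEQ_le_const2) (use est in \<open>auto simp: g_def set_lebesgue_integral_def\<close>)
    then show ?thesis using hi by (simp add: h_def[abs_def] set_lebesgue_integral_def set_integrable_def S0_def)
  qed
  show ?thesis by (rule that[OF B(1)]) (use main in blast)+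
qed

section \<open>Integration by parts for the gauge integral\<close>

text \<open>The second mean value theorem for gauge integrals asks for a monotone factor. A
  Lipschitz \<eta> is the difference of the monotone functions \<eta> t + L t and L t, each of which
  contributes its increment times \<omega>.\<close>

lemma hk_product_increment_bound:
  fixes h \<eta> :: "real \<Rightarrow> real"
  assumes h: "h integrable_on {a..b}" and ab: "a \<le> b"
    and lip: "\<And>x y. a \<le> x \<Longrightarrow> x \<le> y \<Longrightarrow> y \<le> b \<Longrightarrow> \<bar>\<eta> y - \<eta> x\<bar> \<le> L * (y - x)"
    and w: "\<And>c. c \<in> {a..b} \<Longrightarrow> \<bar>integral {c..b} h\<bar> \<le> \<omega>"
  shows "(\<lambda>t. \<eta> t * h t) integrable_on {a..b}"
    and "\<bar>integral {a..b} (\<lambda>t. \<eta> t * h t) - \<eta> a * integral {a..b} h\<bar> \<le> 3 * L * (b - a) * \<omega>"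
proof -
  have mono1: "\<eta> x + L * x \<le> \<eta> y + L * y" if "a \<le> x" "x \<le> y" "y \<le> b" for x y
    using lip[OF that] by (simp add: algebra_simps abs_le_iff)
  have mono2: "L * x \<le> L * y" if "a \<le> x" "x \<le> y" "y \<le> b" for x y
    using lip[OF that] abs_ge_zero[of "\<eta> y - \<eta> x"] by (simp add: right_diff_distrib)
  have w0: "\<omega> \<ge> 0" using w[of a] ab by auto
  have piece: "\<exists>I. ((\<lambda>t. g t * h t) has_integral I) {a..b} \<and> \<bar>I - g a * integral {a..b} h\<bar> \<le> (g b - g a) * \<omega>"
    if mono: "\<And>x y. a \<le> x \<Longrightarrow> x \<le> y \<Longrightarrow> y \<le> b \<Longrightarrow> g x \<le> g y" for g
  proof -
    obtain c where c: "c \<in> {a..b}" "((\<lambda>x. g x * h x) has_integral (g a * integral {a..c} h + g b * integral {c..b} h)) {a..b}"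
      using second_mean_value_theorem_full[OF h ab, of g] mono by blast
    have "integral {a..c} h + integral {c..b} h = integral {a..b} h"
      using c(1) h by (intro Henstock_Kurzweil_Integration.integral_combine) auto
    then have "g a * integral {a..c} h + g b * integral {c..b} h - g a * integral {a..b} h = (g b - g a) * integral {c..b} h"
      by (simp add: algebra_simps flip: distrib_left)
    moreover have "\<bar>(g b - g a) * integral {c..b} h\<bar> \<le> (g b - g a) * \<omega>"
      using mono[of a b] ab w[OF c(1)] by (simp add: abs_mult mult_left_mono)
    ultimately show ?thesis using c(2) by metis
  qed
  obtain I1 where I1: "((\<lambda>t. (\<eta> t + L * t) * h t) has_integral I1) {a..b}" "\<bar>I1 - (\<eta> a + L * a) * integral {a..b} h\<bar> \<le> ((\<eta> b + L * b) - (\<eta> a + L * a)) * \<omega>"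
    using piece[of "\<lambda>t. \<eta> t + L * t"] mono1 by blast
  obtain I2 where I2: "((\<lambda>t. (L * t) * h t) has_integral I2) {a..b}" "\<bar>I2 - (L * a) * integral {a..b} h\<bar> \<le> (L * b - L * a) * \<omega>"
    using piece[of "\<lambda>t. L * t"] mono2 by blast
  have hi: "((\<lambda>t. \<eta> t * h t) has_integral (I1 - I2)) {a..b}"
    using has_integral_diff[OF I1(1) I2(1)] by (simp add: algebra_simps)
  then show "(\<lambda>t. \<eta> t * h t) integrable_on {a..b}" by blast
  have "\<bar>(I1 - I2) - \<eta> a * integral {a..b} h\<bar> \<le> \<bar>I1 - (\<eta> a + L * a) * integral {a..b} h\<bar> + \<bar>I2 - (L * a) * integral {a..b} h\<bar>"
    by (simp add: algebra_simps abs_le_iff) (smt (verit))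
  also have "\<dots> \<le> ((\<eta> b + L * b) - (\<eta> a + L * a)) * \<omega> + (L * b - L * a) * \<omega>"
    by (intro add_mono I1 I2)
  also have "\<dots> = ((\<eta> b - \<eta> a) + 2 * (L * (b - a))) * \<omega>" by (simp add: algebra_simps)
  also have "\<dots> \<le> (L * (b - a) + 2 * (L * (b - a))) * \<omega>"
    using lip[of a b] ab w0 by (intro mult_right_mono) auto
  finally show "\<bar>integral {a..b} (\<lambda>t. \<eta> t * h t) - \<eta> a * integral {a..b} h\<bar> \<le> 3 * L * (b - a) * \<omega>"
    using integral_unique[OF hi] by simp
qed

text \<open>\<open>h\<close> is only gauge integrable, so its primitive P may fail to be
  differentiable at some points. Instead the defect D of the identity is shown to have derivative 0:
  its increments are at most 4 L (y - x) times the oscillation of P, which is small by uniform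
  continuity.\<close>

lemma hk_integration_by_parts_real:
  fixes h \<eta> \<eta>' :: "real \<Rightarrow> real"
  assumes h: "h integrable_on {a..b}" and ab: "a \<le> b"
    and der: "\<And>t. t \<in> {a..b} \<Longrightarrow> (\<eta> has_real_derivative \<eta>' t) (at t within {a..b})"
    and cont: "continuous_on {a..b} \<eta>'"
  shows "((\<lambda>t. \<eta> t * h t) has_integral
           (\<eta> b * integral {a..b} h - integral {a..b} (\<lambda>t. \<eta>' t * integral {a..t} h))) {a..b}"
proof -
  define P where "P t = integral {a..t} h" for t
  have Pc: "continuous_on {a..b} P" unfolding P_def by (rule indefinite_integral_continuous_1[OF h])
  have ec: "continuous_on {a..b} \<eta>" using der by (rule DERIV_continuous_on)
  obtain L where L: "L > 0" "\<And>t. t \<in> {a..b} \<Longrightarrow> \<bar>\<eta>' t\<bar> \<le> L"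
  proof -
    have "bounded (\<eta>' ` {a..b})" by (intro compact_imp_bounded compact_continuous_image cont) auto
    then show ?thesis using that by (auto simp: bounded_pos)
  qed
  have sub: "h integrable_on {x..y}" if "a \<le> x" "y \<le> b" for x y
    using h by (rule integrable_on_subinterval) (use that in auto)
  have Pd: "integral {x..y} h = P y - P x" if "a \<le> x" "x \<le> y" "y \<le> b" for x y
  proof -
    have "integral {a..x} h + integral {x..y} h = integral {a..y} h"
      using that sub[of a y] by (intro Henstock_Kurzweil_Integration.integral_combine) auto
    then show ?thesis by (simp add: P_def)
  qed
  have lip: "\<bar>\<eta> y - \<eta> x\<bar> \<le> L * (y - x)" if "a \<le> x" "x \<le> y" "y \<le> b" for x y
  proof -
    have "norm (\<eta> y - \<eta> x) \<le> L * norm (y - x)"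
      using that by (intro field_differentiable_bound[of "{a..b}" \<eta> \<eta>'] der) (use L in auto)
    then show ?thesis using that by simp
  qed
  have ePint: "(\<lambda>t. \<eta>' t * P t) integrable_on {x..y}" if "a \<le> x" "y \<le> b" for x y
    by (rule integrable_continuous_real, rule continuous_on_subset[of "{a..b}"], intro continuous_intros cont Pc) (use that in auto)
  have int: "(\<lambda>t. \<eta> t * h t) integrable_on {x..y}"
    and inc: "\<bar>integral {x..y} (\<lambda>t. \<eta> t * h t) - \<eta> x * (P y - P x)\<bar> \<le> 3 * L * (y - x) * \<omega>"
    if xy: "a \<le> x" "x \<le> y" "y \<le> b" and w: "\<And>c. c \<in> {x..y} \<Longrightarrow> \<bar>P y - P c\<bar> \<le> \<omega>" for x y \<omega>
  proof -
    have w': "\<bar>integral {c..y} h\<bar> \<le> \<omega>" if "c \<in> {x..y}" for c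
      using w[OF that] Pd[of c y] that xy by auto
    have lip': "\<bar>\<eta> v - \<eta> u\<bar> \<le> L * (v - u)" if "x \<le> u" "u \<le> v" "v \<le> y" for u v
      using lip[of u v] that xy by auto
    note B = hk_product_increment_bound[OF sub[OF xy(1,3)] xy(2) lip' w']
    show "(\<lambda>t. \<eta> t * h t) integrable_on {x..y}" by (rule B(1))
    show "\<bar>integral {x..y} (\<lambda>t. \<eta> t * h t) - \<eta> x * (P y - P x)\<bar> \<le> 3 * L * (y - x) * \<omega>"
      using B(2) Pd[OF xy] by simp
  qed
  have "bounded (P ` {a..b})" by (intro compact_imp_bounded compact_continuous_image Pc) auto
  then obtain K where K: "\<And>t. t \<in> {a..b} \<Longrightarrow> \<bar>P t\<bar> \<le> K" by (metis bounded_iff imageI real_norm_def)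
  have intab: "(\<lambda>t. \<eta> t * h t) integrable_on {a..b}"
  proof (rule int[of a b "2 * K"])
    fix c assume "c \<in> {a..b}"
    moreover have "b \<in> {a..b}" using ab by simp
    ultimately show "\<bar>P b - P c\<bar> \<le> 2 * K" using K[of b] K[of c] by linarith
  qed (use ab in auto)
  define D where "D t = integral {a..t} (\<lambda>t. \<eta> t * h t) - \<eta> t * P t + integral {a..t} (\<lambda>t. \<eta>' t * P t)" for t
  have Dinc: "\<bar>D y - D x\<bar> \<le> 4 * L * (y - x) * \<omega>"
    if xy: "a \<le> x" "x \<le> y" "y \<le> b" and w: "\<And>c. c \<in> {x..y} \<Longrightarrow> \<bar>P y - P c\<bar> \<le> \<omega>" for x y \<omega>
  proof -
    have c1: "integral {a..y} (\<lambda>t. \<eta> t * h t) = integral {a..x} (\<lambda>t. \<eta> t * h t) + integral {x..y} (\<lambda>t. \<eta> t * h t)"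
      by (rule Henstock_Kurzweil_Integration.integral_combine[symmetric]) (use xy integrable_on_subinterval[OF intab] in auto)
    have c2: "integral {a..y} (\<lambda>t. \<eta>' t * P t) = integral {a..x} (\<lambda>t. \<eta>' t * P t) + integral {x..y} (\<lambda>t. \<eta>' t * P t)"
      by (rule Henstock_Kurzweil_Integration.integral_combine[symmetric]) (use xy ePint in auto)
    have ftc: "(\<eta>' has_integral (\<eta> y - \<eta> x)) {x..y}"
      using xy by (intro fundamental_theorem_of_calculus)
        (auto simp flip: has_real_derivative_iff_has_vector_derivative intro: DERIV_subset[OF der])
    have i: "((\<lambda>t. \<eta>' t * P t - \<eta>' t * P y) has_integral (integral {x..y} (\<lambda>t. \<eta>' t * P t) - (\<eta> y - \<eta> x) * P y)) {x..y}"
      by (intro has_integral_diff has_integral_mult_left ftc integrable_integral ePint xy)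
    have "norm (integral {x..y} (\<lambda>t. \<eta>' t * P t) - (\<eta> y - \<eta> x) * P y) \<le> (L * \<omega>) * measure lborel {x..y}"
    proof (rule has_integral_bound_real[OF _ finite.emptyI i])
      have "\<omega> \<ge> 0" using w[of y] xy by auto
      then show "0 \<le> L * \<omega>" using L by auto
      fix t assume "t \<in> {x..y} - {}"
      then have t: "t \<in> {x..y}" by simp
      have "\<bar>\<eta>' t * P t - \<eta>' t * P y\<bar> = \<bar>\<eta>' t\<bar> * \<bar>P y - P t\<bar>"
        by (simp add: abs_minus_commute flip: right_diff_distrib abs_mult)
      also have "\<dots> \<le> L * \<omega>" using L(2)[of t] w[OF t] t xy L(1) by (intro mult_mono) auto
      finally show "norm (\<eta>' t * P t - \<eta>' t * P y) \<le> L * \<omega>" by simp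
    qed
    then have b2: "\<bar>integral {x..y} (\<lambda>t. \<eta>' t * P t) - (\<eta> y - \<eta> x) * P y\<bar> \<le> L * \<omega> * (y - x)" using xy by simp
    have "D y - D x = (integral {x..y} (\<lambda>t. \<eta> t * h t) - \<eta> x * (P y - P x)) + (integral {x..y} (\<lambda>t. \<eta>' t * P t) - (\<eta> y - \<eta> x) * P y)"
      unfolding D_def c1 c2 by (simp add: algebra_simps)
    also have "\<bar>\<dots>\<bar> \<le> 3 * L * (y - x) * \<omega> + L * \<omega> * (y - x)"
      by (rule order.trans[OF abs_triangle_ineq]) (intro add_mono inc[OF xy w] b2)
    finally show ?thesis by (simp add: algebra_simps)
  qed
  have uc: "uniformly_continuous_on {a..b} P" using Pc by (intro compact_uniformly_continuous) auto
  have "\<exists>c. \<forall>x\<in>{a..b}. D x = c"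
  proof (rule has_derivative_zero_constant)
    fix x assume x: "x \<in> {a..b}"
    show "(D has_derivative (\<lambda>h. 0)) (at x within {a..b})"
      unfolding has_derivative_within'
    proof (intro conjI allI impI)
      fix e :: real assume e: "e > 0"
      \<comment> \<open>With 8 L the bound 4 L (v - u) \<omega> becomes (e / 2) (v - u), strictly
        below what the derivative test allows.\<close>
      define \<omega> where "\<omega> = e / (8 * L)"
      have \<omega>: "\<omega> > 0" using e L by (simp add: \<omega>_def)
      obtain d where d: "d > 0" "\<And>u v. u \<in> {a..b} \<Longrightarrow> v \<in> {a..b} \<Longrightarrow> dist v u < d \<Longrightarrow> dist (P v) (P u) < \<omega>"
        using uc \<omega> unfolding uniformly_continuous_on_def by metis
      have main: "\<bar>D v - D u\<bar> \<le> e / 2 * (v - u)" if "u \<in> {a..b}" "v \<in> {a..b}" "u \<le> v" "v - u < d" for u v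
      proof -
        have "\<bar>D v - D u\<bar> \<le> 4 * L * (v - u) * \<omega>"
        proof (rule Dinc)
          fix c assume "c \<in> {u..v}"
          then show "\<bar>P v - P c\<bar> \<le> \<omega>" using d(2)[of c v] that by (auto simp: dist_real_def)
        qed (use that in auto)
        also have "\<dots> = e / 2 * (v - u)" using L by (simp add: \<omega>_def)
        finally show ?thesis .
      qed
      show "\<exists>d>0. \<forall>x'\<in>{a..b}. 0 < norm (x' - x) \<and> norm (x' - x) < d \<longrightarrow> norm (D x' - D x - 0) / norm (x' - x) < e"
      proof (intro exI[of _ d] conjI ballI impI)
        fix y assume y: "y \<in> {a..b}" and n: "0 < norm (y - x) \<and> norm (y - x) < d"
        have "\<bar>D y - D x\<bar> \<le> e / 2 * \<bar>y - x\<bar>"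
        proof (cases "x \<le> y")
          case True
          then show ?thesis using main[of x y] x y n by simp
        next
          case False
          then show ?thesis using main[of y x] x y n by (simp add: abs_minus_commute)
        qed
        also have "\<dots> < e * \<bar>y - x\<bar>" using e n by simp
        finally show "norm (D y - D x - 0) / norm (y - x) < e" using n by (simp add: divide_less_eq)
      qed (use d in auto)
    qed auto
  qed auto
  then have "D b = D a" using ab by auto
  moreover have Pa: "P a = 0" by (simp add: P_def)
  moreover have "D a = 0" by (simp add: D_def Pa)
  ultimately have "integral {a..b} (\<lambda>t. \<eta> t * h t) = \<eta> b * P b - integral {a..b} (\<lambda>t. \<eta>' t * P t)"
    by (simp add: D_def)
  then show ?thesis using integrable_integral[OF intab] by (simp add: P_def)
qed

lemma hk_integration_by_parts:
  fixes h \<eta> \<eta>' :: "real \<Rightarrow> complex"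
  assumes h: "h integrable_on {a..b}" and ab: "a \<le> b"
    and der: "\<And>t. t \<in> {a..b} \<Longrightarrow> (\<eta> has_vector_derivative \<eta>' t) (at t within {a..b})"
    and cont: "continuous_on {a..b} \<eta>'"
  shows "((\<lambda>t. \<eta> t * h t) has_integral
           (\<eta> b * integral {a..b} h - integral {a..b} (\<lambda>t. \<eta>' t * integral {a..t} h))) {a..b}"
proof -
  define h1 where "h1 t = Re (h t)" for t
  define h2 where "h2 t = Im (h t)" for t
  define e1 where "e1 t = Re (\<eta> t)" for t
  define e2 where "e2 t = Im (\<eta> t)" for t
  define d1 where "d1 t = Re (\<eta>' t)" for t
  define d2 where "d2 t = Im (\<eta>' t)" for t
  have hi: "h1 integrable_on {a..b}" "h2 integrable_on {a..b}"
    using integrable_linear[OF h bounded_linear_Re] integrable_linear[OF h bounded_linear_Im]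
    by (simp_all add: o_def h1_def[abs_def] h2_def[abs_def])
  have de: "(e1 has_real_derivative d1 t) (at t within {a..b})" "(e2 has_real_derivative d2 t) (at t within {a..b})" if "t \<in> {a..b}" for t
    using bounded_linear.has_vector_derivative[OF bounded_linear_Re der[OF that]] bounded_linear.has_vector_derivative[OF bounded_linear_Im der[OF that]]
    by (simp_all add: has_real_derivative_iff_has_vector_derivative e1_def[abs_def] e2_def[abs_def] d1_def d2_def)
  have dc: "continuous_on {a..b} d1" "continuous_on {a..b} d2"
    using cont by (auto intro!: continuous_intros simp: d1_def[abs_def] d2_def[abs_def])
  define P1 where "P1 t = integral {a..t} h1" for t
  define P2 where "P2 t = integral {a..t} h2" for t
  have Pc: "continuous_on {a..b} P1" "continuous_on {a..b} P2"
    unfolding P1_def P2_def by (intro indefinite_integral_continuous_1 hi)+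
  have P: "integral {a..t} h = of_real (P1 t) + \<i> * of_real (P2 t)" if "t \<in> {a..b}" for t
  proof (rule integral_unique)
    have "((\<lambda>t. of_real (h1 t) + \<i> * of_real (h2 t)) has_integral (of_real (P1 t) + \<i> * of_real (P2 t))) {a..t}"
      unfolding P1_def P2_def
      by (intro has_integral_add has_integral_mult_right has_integral_of_real integrable_integral
           integrable_on_subinterval[OF hi(1)] integrable_on_subinterval[OF hi(2)]) (use that in auto)
    then show "(h has_integral (of_real (P1 t) + \<i> * of_real (P2 t))) {a..t}"
      by (simp add: h1_def h2_def complex_eq[symmetric] flip: complex_surj)
  qed
  note B11 = hk_integration_by_parts_real[OF hi(1) ab de(1) dc(1), folded P1_def]
  note B12 = hk_integration_by_parts_real[OF hi(2) ab de(1) dc(1), folded P2_def]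
  note B21 = hk_integration_by_parts_real[OF hi(1) ab de(2) dc(2), folded P1_def]
  note B22 = hk_integration_by_parts_real[OF hi(2) ab de(2) dc(2), folded P2_def]
  define I where "I d Q = integral {a..b} (\<lambda>t. d t * Q t)" for d Q :: "real \<Rightarrow> real"
  have Ii: "((\<lambda>t. d t * Q t) has_integral I d Q) {a..b}" if "continuous_on {a..b} d" "continuous_on {a..b} Q" for d Q
    unfolding I_def by (intro integrable_integral integrable_continuous_real continuous_intros that)
  have "((\<lambda>t. \<eta>' t * (of_real (P1 t) + \<i> * of_real (P2 t))) has_integral
     (of_real (I d1 P1) - of_real (I d2 P2) + \<i> * (of_real (I d1 P2) + of_real (I d2 P1)))) {a..b}"
  proof -
    have "((\<lambda>t. of_real (d1 t * P1 t) - of_real (d2 t * P2 t) + \<i> * (of_real (d1 t * P2 t) + of_real (d2 t * P1 t))) has_integral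
     (of_real (I d1 P1) - of_real (I d2 P2) + \<i> * (of_real (I d1 P2) + of_real (I d2 P1)))) {a..b}"
      by (intro has_integral_add has_integral_diff has_integral_mult_right has_integral_of_real Ii dc Pc)
    moreover have "of_real (d1 t * P1 t) - of_real (d2 t * P2 t) + \<i> * (of_real (d1 t * P2 t) + of_real (d2 t * P1 t)) = \<eta>' t * (of_real (P1 t) + \<i> * of_real (P2 t))" for t
      by (simp add: complex_eq_iff d1_def d2_def)
    ultimately show ?thesis by simp
  qed
  then have "((\<lambda>t. \<eta>' t * integral {a..t} h) has_integral
     (of_real (I d1 P1) - of_real (I d2 P2) + \<i> * (of_real (I d1 P2) + of_real (I d2 P1)))) {a..b}"
    by (rule has_integral_eq[rotated]) (simp add: P)
  then have J: "integral {a..b} (\<lambda>t. \<eta>' t * integral {a..t} h) = of_real (I d1 P1) - of_real (I d2 P2) + \<i> * (of_real (I d1 P2) + of_real (I d2 P1))"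
    by (rule integral_unique)
  have "((\<lambda>t. of_real (e1 t * h1 t) - of_real (e2 t * h2 t) + \<i> * (of_real (e1 t * h2 t) + of_real (e2 t * h1 t))) has_integral
     (of_real (e1 b * P1 b - I d1 P1) - of_real (e2 b * P2 b - I d2 P2) + \<i> * (of_real (e1 b * P2 b - I d1 P2) + of_real (e2 b * P1 b - I d2 P1)))) {a..b}"
    unfolding I_def
    by (intro has_integral_add has_integral_diff has_integral_mult_right has_integral_of_real B11 B12 B21 B22)
  moreover have "of_real (e1 t * h1 t) - of_real (e2 t * h2 t) + \<i> * (of_real (e1 t * h2 t) + of_real (e2 t * h1 t)) = \<eta> t * h t" for t
    by (simp add: complex_eq_iff e1_def e2_def h1_def h2_def)
  moreover have "of_real (e1 b * P1 b - I d1 P1) - of_real (e2 b * P2 b - I d2 P2) + \<i> * (of_real (e1 b * P2 b - I d1 P2) + of_real (e2 b * P1 b - I d2 P1))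
     = \<eta> b * integral {a..b} h - integral {a..b} (\<lambda>t. \<eta>' t * integral {a..t} h)"
    unfolding J using P[of b] ab by (simp add: complex_eq_iff e1_def e2_def)
  ultimately show ?thesis by simp
qed

text \<open>Conditional convergence on the half-line enters the later estimates through this
  primitive. Its limit at infinity exists because gauge integrals over large boxes approximate the
  integral over the line.\<close>

lemma hk_half_line_primitive:
  fixes g :: "real \<Rightarrow> complex"
  assumes g: "g integrable_on {0<..}"
  obtains P where "continuous_on {0..} P" "P 0 = 0" "(P \<longlongrightarrow> integral {0<..} g) at_top"
    "\<And>a b. 0 < a \<Longrightarrow> a \<le> b \<Longrightarrow> (g has_integral (P b - P a)) {a..b}"
    "\<And>b. b \<ge> 0 \<Longrightarrow> P b = integral {0..b} (\<lambda>t. if t \<in> {0<..} then g t else 0)"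
proof -
  define g0 where "g0 t = (if t \<in> {0<..} then g t else 0)" for t
  have g0: "(g0 has_integral integral {0<..} g) UNIV"
    unfolding g0_def using has_integral_restrict_UNIV[of "{0<..}" g] integrable_integral[OF g] by simp
  have sub: "g0 integrable_on {x..y}" for x y
    using integrable_on_subcbox[of g0 UNIV x y] g0 by auto
  define P where "P x = integral {0..x} g0" for x
  have "continuous_on {0..} P"
  proof -
    have "isCont (\<lambda>x. integral {-1..x} g0) x" if "x \<ge> 0" for x
    proof -
      have "continuous_on {-1..x+1} (\<lambda>x. integral {-1..x} g0)" by (rule indefinite_integral_continuous_1[OF sub])
      then show ?thesis using that
        by (intro continuous_on_interior[of "{-1..x+1}"]) (auto simp: interior_atLeastAtMost_real)
    qed
    then have c: "continuous_on {0..} (\<lambda>x. integral {-1..x} g0)" by (intro continuous_at_imp_continuous_on) auto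
    have "P x = integral {-1..x} g0 - integral {-1..0} g0" if "x \<ge> 0" for x
      unfolding P_def using Henstock_Kurzweil_Integration.integral_combine[of "-1" 0 x g0] sub that by (simp add: algebra_simps)
    then show ?thesis using c by (subst continuous_on_cong[OF refl, of _ _ "\<lambda>x. integral {-1..x} g0 - integral {-1..0} g0"]) (auto intro!: continuous_intros)
  qed
  moreover have "P 0 = 0" by (simp add: P_def)
  moreover have "(P \<longlongrightarrow> integral {0<..} g) at_top"
    unfolding tendsto_iff
  proof (intro allI impI)
    fix e :: real assume "e > 0"
    moreover have "\<nexists>a b. (UNIV::real set) = cbox a b" by (metis bounded_cbox not_bounded_UNIV)
    ultimately obtain B where B: "B > 0" "\<And>a b. ball 0 B \<subseteq> cbox a b \<Longrightarrow> \<exists>z. ((\<lambda>x. if x \<in> UNIV then g0 x else 0) has_integral z) (cbox a b) \<and> norm (z - integral {0<..} g) < e"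
      using has_integral_altD[OF g0] by blast
    show "\<forall>\<^sub>F x in at_top. dist (P x) (integral {0<..} g) < e"
      using eventually_ge_at_top[of B]
    proof eventually_elim
      case (elim x)
      have "ball 0 B \<subseteq> cbox (-B) x" using elim by (auto simp: dist_real_def)
      then obtain z where z: "(g0 has_integral z) {-B..x}" "norm (z - integral {0<..} g) < e"
        using B(2)[of "-B" x] by (auto simp: cbox_interval)
      have "integral {-B..0} g0 = 0"
        by (rule integral_unique[OF has_integral_is_0]) (simp add: g0_def)
      then have "z = P x"
        using integral_unique[OF z(1)] Henstock_Kurzweil_Integration.integral_combine[of "-B" 0 x g0] sub elim B(1) by (simp add: P_def)
      then show ?case using z(2) by (simp add: dist_norm)
    qed
  qed
  moreover have "(g has_integral (P b - P a)) {a..b}" if "0 < a" "a \<le> b" for a b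
  proof -
    have "integral {a..b} g0 = P b - P a"
      unfolding P_def using Henstock_Kurzweil_Integration.integral_combine[of 0 a b g0] sub that by (simp add: algebra_simps)
    then have "(g0 has_integral (P b - P a)) {a..b}" using integrable_integral[OF sub] by metis
    then show ?thesis by (rule has_integral_eq[rotated]) (use that in \<open>auto simp: g0_def\<close>)
  qed
  ultimately show ?thesis using that[of P] unfolding P_def g0_def by blast
qed

section \<open>Fourier and Mellin inversion\<close>

lemma integrable_exp_minus_square: "integrable lborel (\<lambda>x::real. exp (- x\<^sup>2 / 2))"
proof -
  have "integrable lborel (\<lambda>x. sqrt (2 * pi) * std_normal_density x)"
    by (intro integrable_mult_right integrable_normal_density) simp
  moreover have "(\<lambda>x. sqrt (2 * pi) * std_normal_density x) = (\<lambda>x::real. exp (- x\<^sup>2 / 2))"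
    by (auto simp: std_normal_density_def)
  ultimately show ?thesis by simp
qed

lemma integral_exp_minus_square: "(LINT x|lborel. exp (- (x::real)\<^sup>2 / 2)) = sqrt (2 * pi)"
proof -
  have "(LINT x|lborel. sqrt (2 * pi) * std_normal_density x) = sqrt (2 * pi)"
    by (simp add: integral_normal_density)
  moreover have "(\<lambda>x. sqrt (2 * pi) * std_normal_density x) = (\<lambda>x::real. exp (- x\<^sup>2 / 2))"
    by (auto simp: std_normal_density_def)
  ultimately show ?thesis by simp
qed

lemma integral_gaussian_fourier:
  "(CLINT x|lborel. exp (\<i> * of_real (s * x)) * of_real (exp (- x\<^sup>2 / 2))) = of_real (sqrt (2 * pi) * exp (- s\<^sup>2 / 2))"
proof -
  have "of_real (exp (- s\<^sup>2 / 2)) = char std_normal_distribution s"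
    by (simp add: char_std_normal_distribution)
  also have "\<dots> = (CLINT x|lborel. std_normal_density x *\<^sub>R iexp (s * x))"
    unfolding char_def by (subst integral_density) (auto simp: normal_density_nonneg)
  also have "\<dots> = (CLINT x|lborel. of_real (1 / sqrt (2 * pi)) * (exp (\<i> * of_real (s * x)) * of_real (exp (- x\<^sup>2 / 2))))"
    by (intro Bochner_Integration.integral_cong) (auto simp: std_normal_density_def scaleR_conv_of_real)
  also have "\<dots> = of_real (1 / sqrt (2 * pi)) * (CLINT x|lborel. exp (\<i> * of_real (s * x)) * of_real (exp (- x\<^sup>2 / 2)))"
    by (rule integral_mult_right_zero)
  finally show ?thesis by (simp add: field_simps)
qed

text \<open>A Gaussian factor exp (- (t / (n + 1))^2 / 2) is inserted in the inversion integral. As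
  n grows the factor disappears; on the other hand, by Fubini, the damped integral is 2 pi times an
  average of \<phi> over a Gaussian of width 1 / (n + 1) around v, which tends to \<phi> v by
  continuity.\<close>

lemma fourier_inversion:
  fixes \<phi> :: "real \<Rightarrow> complex"
  assumes int: "integrable lborel \<phi>"
    and cont: "continuous_on UNIV \<phi>"
    and bd: "\<And>u. norm (\<phi> u) \<le> B"
    and hat: "\<And>t. \<psi> t = (CLINT u|lborel. \<phi> u * exp (\<i> * of_real (t * u)))"
    and hat_int: "integrable lborel \<psi>"
  shows "\<phi> v = 1 / (2 * pi) * (CLINT t|lborel. \<psi> t * exp (- \<i> * of_real (t * v)))"
proof -
  have [measurable]: "\<phi> \<in> borel_measurable borel" "\<psi> \<in> borel_measurable borel"
    using int hat_int by (auto dest: borel_measurable_integrable)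
  define g where "g n t = exp (- (t / real (Suc n))\<^sup>2 / 2)" for n t
  have [measurable]: "g n \<in> borel_measurable borel" for n unfolding g_def by measurable
  have g1: "g n t \<le> 1" "g n t \<ge> 0" for n t unfolding g_def by auto
  have gint: "integrable lborel (g n)" for n
    unfolding g_def
    using lborel_integrable_real_affine[OF integrable_exp_minus_square, of "1 / real (Suc n)" 0]
    by (simp add: mult.commute)
  define J where "J n = (CLINT t|lborel. \<psi> t * exp (- \<i> * of_real (t * v)) * of_real (g n t))" for n
  have lim1: "J \<longlonglongrightarrow> (CLINT t|lborel. \<psi> t * exp (- \<i> * of_real (t * v)) * of_real 1)"
    unfolding J_def
  proof (rule integral_dominated_convergence[where w = "\<lambda>t. norm (\<psi> t)"])
    show "AE t in lborel. (\<lambda>n. \<psi> t * exp (- \<i> * of_real (t * v)) * of_real (g n t)) \<longlonglongrightarrow>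
       \<psi> t * exp (- \<i> * of_real (t * v)) * of_real 1"
    proof (rule AE_I2, intro tendsto_intros)
      fix t
      have "(\<lambda>n. t / real (Suc n)) \<longlonglongrightarrow> 0" by (rule LIMSEQ_Suc[OF lim_const_over_n])
      then have "(\<lambda>n. exp (- (t / real (Suc n))\<^sup>2 / 2)) \<longlonglongrightarrow> exp (- 0\<^sup>2 / 2)"
        by (intro tendsto_intros) auto
      then show "(\<lambda>n. g n t) \<longlonglongrightarrow> 1" unfolding g_def by simp
    qed
    show "AE t in lborel. norm (\<psi> t * exp (- \<i> * of_real (t * v)) * of_real (g n t)) \<le> norm (\<psi> t)" for n
      using g1[of n] by (intro AE_I2) (simp add: norm_mult mult_left_le)
  qed (use hat_int in auto)
  have Jeq: "J n = of_real (sqrt (2 * pi)) * (CLINT y|lborel. \<phi> (v + y / real (Suc n)) * of_real (exp (- y\<^sup>2 / 2)))" for n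
  proof -
    define N where "N = real (Suc n)"
    have N: "N > 0" unfolding N_def by simp
    have prodint: "integrable (lborel \<Otimes>\<^sub>M lborel) (\<lambda>(t, u). \<phi> u * exp (\<i> * of_real (t * (u - v))) * of_real (g n t))"
    proof (rule Bochner_Integration.integrable_bound)
      show "integrable (lborel \<Otimes>\<^sub>M lborel) (\<lambda>(t, u). g n t * norm (\<phi> u))"
        using gint[of n] int by (intro lborel_pair.Fubini_integrable) (auto simp: g1 norm_mult intro!: integrable_mult_left)
      show "AE x in lborel \<Otimes>\<^sub>M lborel. norm ((\<lambda>(t, u). \<phi> u * exp (\<i> * of_real (t * (u - v))) * of_real (g n t)) x)
          \<le> norm ((\<lambda>(t, u). g n t * norm (\<phi> u)) x)"
        by (intro AE_I2) (auto simp: norm_mult g1)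
    qed auto
    have "J n = (CLINT t|lborel. CLINT u|lborel. \<phi> u * exp (\<i> * of_real (t * (u - v))) * of_real (g n t))"
      unfolding J_def
    proof (intro Bochner_Integration.integral_cong refl)
      fix t
      have "(CLINT u|lborel. \<phi> u * exp (\<i> * of_real (t * (u - v))) * of_real (g n t)) =
        (CLINT u|lborel. \<phi> u * exp (\<i> * of_real (t * u)) * (exp (- \<i> * of_real (t * v)) * of_real (g n t)))"
        by (intro Bochner_Integration.integral_cong refl) (simp add: algebra_simps exp_diff exp_minus field_simps)
      also have "\<dots> = (CLINT u|lborel. \<phi> u * exp (\<i> * of_real (t * u))) * (exp (- \<i> * of_real (t * v)) * of_real (g n t))"
        by (rule integral_mult_left_zero)
      finally show "\<psi> t * exp (- \<i> * of_real (t * v)) * of_real (g n t) =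
        (CLINT u|lborel. \<phi> u * exp (\<i> * of_real (t * (u - v))) * of_real (g n t))"
        by (simp add: hat mult.assoc)
    qed
    also have "\<dots> = (CLINT u|lborel. CLINT t|lborel. \<phi> u * exp (\<i> * of_real (t * (u - v))) * of_real (g n t))"
      using lborel_pair.Fubini_integral[of "\<lambda>t u. \<phi> u * exp (\<i> * of_real (t * (u - v))) * of_real (g n t)"] prodint
      by (simp add: split_def)
    also have "\<dots> = (CLINT u|lborel. \<phi> u * (of_real (N * sqrt (2 * pi)) * of_real (exp (- (N * (u - v))\<^sup>2 / 2))))"
    proof (intro Bochner_Integration.integral_cong refl)
      fix u
      have "(CLINT t|lborel. exp (\<i> * of_real (t * (u - v))) * of_real (g n t)) =
        \<bar>N\<bar> *\<^sub>R (CLINT t|lborel. exp (\<i> * of_real ((0 + N * t) * (u - v))) * of_real (g n (0 + N * t)))"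
        by (rule lborel_integral_real_affine) (use N in auto)
      also have "(CLINT t|lborel. exp (\<i> * of_real ((0 + N * t) * (u - v))) * of_real (g n (0 + N * t)))
        = (CLINT t|lborel. exp (\<i> * of_real ((N * (u - v)) * t)) * of_real (exp (- t\<^sup>2 / 2)))"
        using N unfolding g_def N_def[symmetric]
        by (intro Bochner_Integration.integral_cong refl) (simp add: mult_ac)
      also have "\<dots> = of_real (sqrt (2 * pi) * exp (- (N * (u - v))\<^sup>2 / 2))" by (rule integral_gaussian_fourier)
      finally have "(CLINT t|lborel. exp (\<i> * of_real (t * (u - v))) * of_real (g n t)) =
         of_real (N * sqrt (2 * pi)) * of_real (exp (- (N * (u - v))\<^sup>2 / 2))"
        using N by (simp add: scaleR_conv_of_real)
      then show "(CLINT t|lborel. \<phi> u * exp (\<i> * of_real (t * (u - v))) * of_real (g n t)) =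
        \<phi> u * (of_real (N * sqrt (2 * pi)) * of_real (exp (- (N * (u - v))\<^sup>2 / 2)))"
        by (simp only: mult.assoc integral_mult_right_zero)
    qed
    also have "\<dots> = \<bar>1 / N\<bar> *\<^sub>R (CLINT y|lborel. \<phi> (v + 1 / N * y) * (of_real (N * sqrt (2 * pi)) * of_real (exp (- (N * ((v + 1 / N * y) - v))\<^sup>2 / 2))))"
      by (rule lborel_integral_real_affine) (use N in auto)
    also have "\<dots> = \<bar>1 / N\<bar> *\<^sub>R (CLINT y|lborel. of_real (N * sqrt (2 * pi)) * (\<phi> (v + y / N) * of_real (exp (- y\<^sup>2 / 2))))"
      using N by (intro arg_cong[of _ _ "scaleR _"] Bochner_Integration.integral_cong refl) (simp add: mult_ac)
    also have "\<dots> = of_real (sqrt (2 * pi)) * (CLINT y|lborel. \<phi> (v + y / N) * of_real (exp (- y\<^sup>2 / 2)))"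
      using N by (simp add: scaleR_conv_of_real)
    finally show ?thesis by (simp only: N_def)
  qed
  have lim2: "(\<lambda>n. CLINT y|lborel. \<phi> (v + y / real (Suc n)) * of_real (exp (- y\<^sup>2 / 2))) \<longlonglongrightarrow>
     (CLINT y|lborel. \<phi> v * of_real (exp (- y\<^sup>2 / 2)))"
  proof (rule integral_dominated_convergence[where w = "\<lambda>y. B * exp (- y\<^sup>2 / 2)"])
    show "AE y in lborel. (\<lambda>n. \<phi> (v + y / real (Suc n)) * of_real (exp (- y\<^sup>2 / 2))) \<longlonglongrightarrow> \<phi> v * of_real (exp (- y\<^sup>2 / 2))"
    proof (rule AE_I2, intro tendsto_intros)
      fix y
      have "(\<lambda>n. v + y / real (Suc n)) \<longlonglongrightarrow> v + 0" by (intro tendsto_intros LIMSEQ_Suc[OF lim_const_over_n])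
      then show "(\<lambda>n. \<phi> (v + y / real (Suc n))) \<longlonglongrightarrow> \<phi> v"
        using cont by (metis UNIV_I add.right_neutral continuous_on_eq_continuous_at isCont_tendsto_compose open_UNIV)
    qed
    show "AE y in lborel. norm (\<phi> (v + y / real (Suc n)) * of_real (exp (- y\<^sup>2 / 2))) \<le> B * exp (- y\<^sup>2 / 2)" for n
      by (intro AE_I2) (simp add: norm_mult bd mult_right_mono)
    show "integrable lborel (\<lambda>y. B * exp (- y\<^sup>2 / 2))"
      by (intro integrable_mult_right integrable_exp_minus_square)
  qed auto
  have gval: "(CLINT y|lborel. \<phi> v * of_real (exp (- y\<^sup>2 / 2))) = \<phi> v * of_real (sqrt (2 * pi))"
    by (simp only: integral_mult_right_zero integral_complex_of_real integral_exp_minus_square)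
  have "J \<longlonglongrightarrow> of_real (sqrt (2 * pi)) * (\<phi> v * of_real (sqrt (2 * pi)))"
    unfolding Jeq using tendsto_mult_left[OF lim2] unfolding gval .
  from LIMSEQ_unique[OF this lim1]
  have "of_real (sqrt (2 * pi)) * (\<phi> v * of_real (sqrt (2 * pi))) = (CLINT t|lborel. \<psi> t * exp (- \<i> * of_real (t * v)))"
    by simp
  moreover have "of_real (sqrt (2 * pi)) * (\<phi> v * of_real (sqrt (2 * pi))) = of_real (sqrt (2 * pi) * sqrt (2 * pi)) * \<phi> v"
    by (simp only: of_real_mult mult_ac)
  moreover have "sqrt (2 * pi) * sqrt (2 * pi) = 2 * pi" by simp
  ultimately show ?thesis by (simp add: field_simps)
qed

lemma fubini_product_bound:
  fixes N :: "real \<Rightarrow> real \<Rightarrow> complex" and m :: "real \<Rightarrow> complex" and \<kappa> :: "real \<Rightarrow> real"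
  assumes meas[measurable]: "(\<lambda>(u,\<tau>). N u \<tau>) \<in> borel_measurable (lborel \<Otimes>\<^sub>M lborel)"
    and m: "integrable lborel m" and k: "integrable lborel \<kappa>"
    and b: "\<And>u \<tau>. norm (N u \<tau>) \<le> \<kappa> u * norm (m \<tau>)"
  shows "(CLINT u|lborel. CLINT \<tau>|lborel. N u \<tau>) = (CLINT \<tau>|lborel. CLINT u|lborel. N u \<tau>)"
    and "integrable lborel (\<lambda>u. CLINT \<tau>|lborel. N u \<tau>)"
    and "integrable lborel (\<lambda>\<tau>. CLINT u|lborel. N u \<tau>)"
proof -
  have i1: "integrable lborel (\<lambda>\<tau>. N u \<tau>)" for u
  proof (rule Bochner_Integration.integrable_bound)
    show "integrable lborel (\<lambda>\<tau>. \<kappa> u * norm (m \<tau>))" using m by (intro integrable_mult_right integrable_norm)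
    show "(\<lambda>\<tau>. N u \<tau>) \<in> borel_measurable lborel" using measurable_compose[OF measurable_Pair1' meas, of u] by simp
    show "AE \<tau> in lborel. norm (N u \<tau>) \<le> norm (\<kappa> u * norm (m \<tau>))"
      using order.trans[OF b abs_ge_self] by (intro AE_I2) simp
  qed
  have pi: "integrable (lborel \<Otimes>\<^sub>M lborel) (\<lambda>(u,\<tau>). N u \<tau>)"
  proof (rule lborel_pair.Fubini_integrable)
    have "integrable lborel (\<lambda>u. LINT \<tau>|lborel. norm (N u \<tau>))"
    proof (rule Bochner_Integration.integrable_bound)
      show "integrable lborel (\<lambda>u. \<kappa> u * (LINT \<tau>|lborel. norm (m \<tau>)))" using k by (intro integrable_mult_left)
      have "(\<lambda>(u,\<tau>). norm (N u \<tau>)) \<in> borel_measurable (lborel \<Otimes>\<^sub>M lborel)"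
        using measurable_compose[OF meas borel_measurable_norm] by (simp add: case_prod_unfold)
      then show "(\<lambda>u. LINT \<tau>|lborel. norm (N u \<tau>)) \<in> borel_measurable lborel"
        by (rule sigma_finite_measure.borel_measurable_lebesgue_integral[OF lborel.sigma_finite_measure_axioms])
      show "AE u in lborel. norm (LINT \<tau>|lborel. norm (N u \<tau>)) \<le> norm (\<kappa> u * (LINT \<tau>|lborel. norm (m \<tau>)))"
      proof (rule AE_I2)
        fix u
        have "(LINT \<tau>|lborel. norm (N u \<tau>)) \<le> (LINT \<tau>|lborel. \<kappa> u * norm (m \<tau>))"
          by (intro integral_mono integrable_norm i1 integrable_mult_right m b)
        moreover have "(LINT \<tau>|lborel. norm (N u \<tau>)) \<ge> 0" by simp
        ultimately show "norm (LINT \<tau>|lborel. norm (N u \<tau>)) \<le> norm (\<kappa> u * (LINT \<tau>|lborel. norm (m \<tau>)))" by simp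
      qed
    qed
    then show "integrable lborel (\<lambda>u. LINT \<tau>|lborel. norm (case (u, \<tau>) of (u, \<tau>) \<Rightarrow> N u \<tau>))" by simp
  qed (use i1 in auto)
  show "(CLINT u|lborel. CLINT \<tau>|lborel. N u \<tau>) = (CLINT \<tau>|lborel. CLINT u|lborel. N u \<tau>)"
    using lborel_pair.Fubini_integral[OF pi] by simp
  show "integrable lborel (\<lambda>u. CLINT \<tau>|lborel. N u \<tau>)"
    using lborel_pair.integrable_fst[OF pi] by simp
  show "integrable lborel (\<lambda>\<tau>. CLINT u|lborel. N u \<tau>)"
    using lborel_pair.integrable_snd[OF pi] by simp
qed

section \<open>Mellin inversion for conditionally convergent transforms\<close>

lemma mellin_integrand_eq: "t > 0 \<Longrightarrow> mellin_integrand f s t = cpow t (s - 1) * f t"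
  by (simp add: mellin_integrand_def cpow_eq_powr)

lemma bounded_on_half_line:
  fixes P :: "real \<Rightarrow> complex"
  assumes c: "continuous_on {0..} P" and l: "(P \<longlongrightarrow> l) at_top"
  obtains K where "K > 0" "\<And>x. x \<ge> 0 \<Longrightarrow> norm (P x) \<le> K"
proof -
  have "\<forall>\<^sub>F x in at_top. norm (P x) < norm l + 1"
    by (rule order_tendstoD(2)[OF tendsto_norm[OF l]]) simp
  then obtain N where N: "\<And>x. x \<ge> N \<Longrightarrow> norm (P x) < norm l + 1" by (auto simp: eventually_at_top_linorder)
  have "compact (P ` {0..N})" by (intro compact_continuous_image continuous_on_subset[OF c]) auto
  then obtain B where B: "\<And>x. x \<in> {0..N} \<Longrightarrow> norm (P x) \<le> B"
    by (metis bounded_iff compact_imp_bounded imageI)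
  show ?thesis
  proof (rule that[of "max B (norm l + 1)"])
    show "max B (norm l + 1) > 0" using norm_ge_zero[of l] by linarith
    fix x :: real assume "x \<ge> 0"
    then show "norm (P x) \<le> max B (norm l + 1)" using N[of x] B[of x] by (cases "x \<ge> N") auto
  qed
qed

text \<open>t^(s - 1) f is t^(s - c) times the function with primitive P, so after integration by
  parts f survives only through the continuous P.\<close>

lemma mellin_shift_by_parts:
  assumes P: "\<And>a b. 0 < a \<Longrightarrow> a \<le> b \<Longrightarrow> (mellin_integrand f c has_integral (P b - P a)) {a..b}"
    and Pc: "continuous_on {0..} P" and ab: "0 < a" "a \<le> b"
  shows "(mellin_integrand f s has_integral (cpow b (s - c) * P b - cpow a (s - c) * P a -
           (s - c) * integral {a..b} (\<lambda>t. cpow t (s - c - 1) * P t))) {a..b}"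
proof -
  define \<eta> where "\<eta> t = cpow t (s - c)" for t
  define \<eta>' where "\<eta>' t = (s - c) * cpow t (s - c - 1)" for t
  have Pc': "continuous_on {a..b} P" by (rule continuous_on_subset[OF Pc]) (use ab in auto)
  have cc: "continuous_on {a..b} (\<lambda>t. cpow t (s - c - 1))" by (intro continuous_intros) (use ab in auto)
  have der: "(\<eta> has_vector_derivative \<eta>' t) (at t within {a..b})" if "t \<in> {a..b}" for t
    unfolding \<eta>_def \<eta>'_def using that ab by (intro cpow_has_vector_derivative) auto
  have Pint: "integral {a..t} (mellin_integrand f c) = P t - P a" if "t \<in> {a..b}" for t
    by (rule integral_unique[OF P]) (use that ab in auto)
  have "((\<lambda>t. \<eta> t * mellin_integrand f c t) has_integral (\<eta> b * integral {a..b} (mellin_integrand f c) -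
      integral {a..b} (\<lambda>t. \<eta>' t * integral {a..t} (mellin_integrand f c)))) {a..b}"
    using P[OF ab] ab(2) der by (intro hk_integration_by_parts) (auto simp: \<eta>'_def[abs_def] intro!: continuous_intros cc)
  moreover have "integral {a..b} (\<lambda>t. \<eta>' t * integral {a..t} (mellin_integrand f c)) =
      (s - c) * integral {a..b} (\<lambda>t. cpow t (s - c - 1) * P t) - (\<eta> b - \<eta> a) * P a"
  proof (rule integral_unique)
    have "(\<eta>' has_integral (\<eta> b - \<eta> a)) {a..b}" using ab(2) der by (rule fundamental_theorem_of_calculus)
    moreover have "((\<lambda>t. cpow t (s - c - 1) * P t) has_integral integral {a..b} (\<lambda>t. cpow t (s - c - 1) * P t)) {a..b}"
      by (intro integrable_integral integrable_continuous_real continuous_on_mult cc Pc')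
    ultimately have "((\<lambda>t. (s - c) * (cpow t (s - c - 1) * P t) - \<eta>' t * P a) has_integral
       ((s - c) * integral {a..b} (\<lambda>t. cpow t (s - c - 1) * P t) - (\<eta> b - \<eta> a) * P a)) {a..b}"
      by (intro has_integral_diff has_integral_mult_right has_integral_mult_left)
    then show "((\<lambda>t. \<eta>' t * integral {a..t} (mellin_integrand f c)) has_integral
       ((s - c) * integral {a..b} (\<lambda>t. cpow t (s - c - 1) * P t) - (\<eta> b - \<eta> a) * P a)) {a..b}"
      by (rule has_integral_eq[rotated]) (simp add: Pint \<eta>'_def algebra_simps)
  qed
  moreover have "\<eta> t * mellin_integrand f c t = mellin_integrand f s t" if "t \<in> {a..b}" for t
    using that ab cpow_add[of t "s - c" "c - 1"] by (simp add: mellin_integrand_eq \<eta>_def)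
  ultimately have "(mellin_integrand f s has_integral (\<eta> b * (P b - P a) -
      ((s - c) * integral {a..b} (\<lambda>t. cpow t (s - c - 1) * P t) - (\<eta> b - \<eta> a) * P a))) {a..b}"
    using Pint[of b] ab has_integral_cong[of "{a..b}" "\<lambda>t. \<eta> t * mellin_integrand f c t" "mellin_integrand f s"] by simp
  then show ?thesis by (simp add: \<eta>_def algebra_simps)
qed

text \<open>Convergence at the smaller exponent c2 controls f near 0. The primitive Q belonging to
  c2 is bounded, and expressing P through Q by parts gives increments of size b^(c1 - c2); letting a
  tend to 0 removes P a.\<close>

lemma mellin_primitive_growth:
  assumes c: "c2 < c1"
    and i2: "mellin_integrand f (of_real c2) integrable_on {0<..}"
    and P: "\<And>a b. 0 < a \<Longrightarrow> a \<le> b \<Longrightarrow> (mellin_integrand f (of_real c1) has_integral (P b - P a)) {a..b}"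
    and Pc: "continuous_on {0..} P" and P0: "P 0 = 0"
  obtains C where "C > 0" "\<And>x. x > 0 \<Longrightarrow> norm (P x) \<le> C * x powr (c1 - c2)"
proof -
  obtain Q where Q: "continuous_on {0..} Q" "(Q \<longlongrightarrow> integral {0<..} (mellin_integrand f (of_real c2))) at_top"
    "\<And>a b. 0 < a \<Longrightarrow> a \<le> b \<Longrightarrow> (mellin_integrand f (of_real c2) has_integral (Q b - Q a)) {a..b}"
    by (rule hk_half_line_primitive[OF i2]) (rule that; assumption)
  obtain K where K: "K > 0" "\<And>x. x \<ge> 0 \<Longrightarrow> norm (Q x) \<le> K"
    by (rule bounded_on_half_line[OF Q(1,2)]) (rule that; assumption)
  define d where "d = c1 - c2"
  have d: "d > 0" "complex_of_real c1 - of_real c2 = of_real d" using c by (auto simp: d_def)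
  \<comment> \<open>The contributions K b^d and K a^d of the boundary terms and K (b^d - a^d) of the
    integral add up to 2 K b^d.\<close>
  have inc: "norm (P b - P a) \<le> 2 * K * b powr d" if ab: "0 < a" "a \<le> b" for a b
  proof -
    have eq: "P b - P a = cpow b (of_real d) * Q b - cpow a (of_real d) * Q a -
           of_real d * integral {a..b} (\<lambda>t. cpow t (of_real d - 1) * Q t)"
      using has_integral_unique[OF P[OF ab] mellin_shift_by_parts[OF Q(3,1) ab, of "of_real c1"]] unfolding d(2) by simp
    have pw: "((\<lambda>t. K * (d * t powr (d - 1))) has_integral (K * (b powr d - a powr d))) {a..b}"
    proof (intro has_integral_mult_right fundamental_theorem_of_calculus ab)
      fix t assume "t \<in> {a..b}"
      then have "((\<lambda>t. t powr d) has_real_derivative d * t powr (d - 1)) (at t within {a..b})"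
        using ab by (auto intro!: derivative_eq_intros simp: powr_diff field_simps)
      then show "((\<lambda>t. t powr d) has_vector_derivative d * t powr (d - 1)) (at t within {a..b})"
        by (simp add: has_real_derivative_iff_has_vector_derivative)
    qed
    have "norm (integral {a..b} (\<lambda>t. of_real d * (cpow t (of_real d - 1) * Q t))) \<le> integral {a..b} (\<lambda>t. K * (d * t powr (d - 1)))"
    proof (rule integral_norm_bound_integral)
      show "(\<lambda>t. of_real d * (cpow t (of_real d - 1) * Q t)) integrable_on {a..b}"
        by (intro integrable_continuous_real continuous_intros continuous_on_subset[OF Q(1)]) (use ab in auto)
      fix t assume t: "t \<in> {a..b}"
      then have "norm (of_real d * (cpow t (of_real d - 1) * Q t)) = d * t powr (d - 1) * norm (Q t)"
        using ab d by (simp add: norm_mult norm_cpow)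
      also have "\<dots> \<le> d * t powr (d - 1) * K" using K(2)[of t] t ab d by (intro mult_left_mono) auto
      finally show "norm (of_real d * (cpow t (of_real d - 1) * Q t)) \<le> K * (d * t powr (d - 1))" by (simp add: mult_ac)
    qed (use pw in blast)
    also have "\<dots> = K * (b powr d - a powr d)" by (rule integral_unique[OF pw])
    finally have n3: "norm (of_real d * integral {a..b} (\<lambda>t. cpow t (of_real d - 1) * Q t)) \<le> K * (b powr d - a powr d)" by simp
    have n1: "norm (cpow b (of_real d) * Q b) \<le> K * b powr d" and n2: "norm (cpow a (of_real d) * Q a) \<le> K * a powr d"
      using K(2)[of a] K(2)[of b] ab by (auto simp: norm_mult norm_cpow mult.commute intro!: mult_left_mono)
    have "norm (P b - P a) \<le> norm (cpow b (of_real d) * Q b) + norm (cpow a (of_real d) * Q a) +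
           norm (of_real d * integral {a..b} (\<lambda>t. cpow t (of_real d - 1) * Q t))"
      unfolding eq by (meson add_right_mono norm_triangle_ineq4 order_trans)
    also have "\<dots> \<le> K * b powr d + K * a powr d + K * (b powr d - a powr d)" using n1 n2 n3 by linarith
    also have "\<dots> = 2 * K * b powr d" by (simp add: algebra_simps)
    finally show ?thesis .
  qed
  have "norm (P b) \<le> 2 * K * b powr d" if b: "b > 0" for b
  proof (rule tendsto_upperbound)
    have "(P \<longlongrightarrow> P 0) (at 0 within {0..})" using Pc by (auto simp: continuous_on_def)
    then have "(P \<longlongrightarrow> 0) (at_right 0)" unfolding P0 by (rule tendsto_within_subset) auto
    then have "((\<lambda>a. norm (P b - P a)) \<longlongrightarrow> norm (P b - 0)) (at_right 0)" by (intro tendsto_intros)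
    then show "((\<lambda>a. norm (P b - P a)) \<longlongrightarrow> norm (P b)) (at_right 0)" by simp
    show "\<forall>\<^sub>F a in at_right 0. norm (P b - P a) \<le> 2 * K * b powr d"
      unfolding eventually_at_right_field using b by (intro exI[of _ b]) (auto intro!: inc)
  qed auto
  then show ?thesis using K by (intro that[of "2 * K"]) (auto simp: d_def)
qed

lemma exp_neg_abs_integrable:
  assumes "(\<epsilon>::real) > 0" shows "integrable lborel (\<lambda>v::real. exp (- \<epsilon> * \<bar>v\<bar>))"
proof -
  \<comment> \<open>With this choice m (1 + |v|) <= 1 + \<epsilon> |v| / 2 <= e^(\<epsilon> |v| /
    2); squaring compares the exponential with (1 + |v|)^(-2).\<close>
  define m where "m = min 1 (\<epsilon> / 2)"
  have m: "m > 0" "m \<le> 1" "m \<le> \<epsilon> / 2" using assms by (auto simp: m_def)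
  show ?thesis
  proof (rule Bochner_Integration.integrable_bound)
    show "integrable lborel (\<lambda>v. (1 / m\<^sup>2) * (1 + \<bar>v\<bar>) powr (- 2))"
      by (intro integrable_mult_right integrable_one_plus_abs_powr) auto
    show "AE v in lborel. norm (exp (- \<epsilon> * \<bar>v\<bar>)) \<le> norm ((1 / m\<^sup>2) * (1 + \<bar>v\<bar>) powr (- 2))"
    proof (rule AE_I2)
      fix v :: real
      have "m * (1 + \<bar>v\<bar>) \<le> 1 + \<epsilon> / 2 * \<bar>v\<bar>" using m mult_right_mono[OF m(3), of "\<bar>v\<bar>"] by (simp add: distrib_left)
      also have "\<dots> \<le> exp (\<epsilon> / 2 * \<bar>v\<bar>)" by (rule exp_ge_add_one_self)
      finally have "(m * (1 + \<bar>v\<bar>))\<^sup>2 \<le> (exp (\<epsilon> / 2 * \<bar>v\<bar>))\<^sup>2" using m by (intro power_mono) auto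
      also have "\<dots> = exp (\<epsilon> * \<bar>v\<bar>)" by (simp flip: exp_double)
      finally have "exp (- (\<epsilon> * \<bar>v\<bar>)) \<le> 1 / (m * (1 + \<bar>v\<bar>))\<^sup>2"
        unfolding exp_minus inverse_eq_divide using m by (intro divide_left_mono mult_pos_pos zero_less_power) auto
      also have "\<dots> = (1 / m\<^sup>2) * (1 + \<bar>v\<bar>) powr (- 2)" by (simp add: powr_minus power_mult_distrib powr_numeral divide_simps)
      finally show "norm (exp (- \<epsilon> * \<bar>v\<bar>)) \<le> norm ((1 / m\<^sup>2) * (1 + \<bar>v\<bar>) powr (- 2))" by simp
    qed
  qed measurable
qed

text \<open>Integration by parts against P, then t = e^v. The boundary terms vanish: for v to
  infinity boundedness of P suffices because Re s < c1, for v to minus infinity its growth rate at 0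
  suffices because Re s > c2.\<close>

lemma mellin_as_fourier_transform:
  assumes c: "c2 < Re s" "Re s < c1"
    and ics: "mellin_integrand f s integrable_on {0<..}"
    and P: "\<And>a b. 0 < a \<Longrightarrow> a \<le> b \<Longrightarrow> (mellin_integrand f (of_real c1) has_integral (P b - P a)) {a..b}"
    and Pc: "continuous_on {0..} P" and K: "\<And>x. x \<ge> 0 \<Longrightarrow> norm (P x) \<le> K"
    and C: "\<And>x. x > 0 \<Longrightarrow> norm (P x) \<le> C * x powr (c1 - c2)"
    and int: "integrable lborel (\<lambda>v. exp ((s - of_real c1) * of_real v) * P (exp v))"
  shows "mellin f s = (of_real c1 - s) * (CLINT v|lborel. exp ((s - of_real c1) * of_real v) * P (exp v))"
proof -
  obtain R where R: "continuous_on {0..} R" "R 0 = 0" "(R \<longlongrightarrow> integral {0<..} (mellin_integrand f s)) at_top"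
    "\<And>a b. 0 < a \<Longrightarrow> a \<le> b \<Longrightarrow> (mellin_integrand f s has_integral (R b - R a)) {a..b}"
    by (rule hk_half_line_primitive[OF ics]) (rule that; assumption)
  define g where "g v = exp ((s - of_real c1) * of_real v) * P (exp v)" for v
  have eq: "R (exp (real n)) - R (exp (- real n)) = g (real n) - g (- real n) - (s - of_real c1) * integral {- real n..real n} g" for n
  proof -
    have Pc': "continuous_on {exp (- real n)..exp (real n)} P" by (rule continuous_on_subset[OF Pc]) (auto intro: order.trans[OF exp_ge_zero])
    have "((\<lambda>v. exp v *\<^sub>R (cpow (exp v) (s - of_real c1 - 1) * P (exp v))) has_integral
        integral {exp (- real n)..exp (real n)} (\<lambda>t. cpow t (s - of_real c1 - 1) * P t)) {- real n..real n}"
      by (rule has_integral_substitution[where c = "exp (- real n)" and d = "exp (real n)"])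
         (auto intro!: derivative_eq_intros continuous_intros Pc' intro: less_le_trans[OF exp_gt_zero])
    moreover have "exp v *\<^sub>R (cpow (exp v) (s - of_real c1 - 1) * P (exp v)) = g v" for v
    proof -
      have "exp v *\<^sub>R (cpow (exp v) (s - of_real c1 - 1) * P (exp v)) = cpow (exp v) (s - of_real c1) * P (exp v)"
        by (simp only: scaleR_conv_of_real mult.assoc[symmetric] cpow_minus_1[OF exp_gt_zero])
      then show ?thesis by (simp add: g_def cpow_def)
    qed
    ultimately have e: "integral {exp (- real n)..exp (real n)} (\<lambda>t. cpow t (s - of_real c1 - 1) * P t) = integral {- real n..real n} g"
      by (simp add: integral_unique)
    have e2: "cpow (exp v) (s - of_real c1) * P (exp v) = g v" for v by (simp add: g_def cpow_def)
    have ab: "0 < exp (- real n)" "exp (- real n) \<le> exp (real n)" by auto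
    show ?thesis
      using has_integral_unique[OF R(4)[OF ab] mellin_shift_by_parts[OF P Pc ab, of s]] unfolding e e2 by simp
  qed
  have gn: "norm (g v) \<le> K * exp ((Re s - c1) * v)" "norm (g v) \<le> C * exp ((Re s - c2) * v)" for v
  proof -
    have n: "norm (g v) = exp ((Re s - c1) * v) * norm (P (exp v))" by (simp add: g_def norm_mult)
    show "norm (g v) \<le> K * exp ((Re s - c1) * v)" unfolding n using K[of "exp v"] by simp
    have "norm (g v) \<le> exp ((Re s - c1) * v) * (C * exp v powr (c1 - c2))"
      unfolding n using C[of "exp v"] by (intro mult_left_mono) auto
    also have "\<dots> = C * exp ((Re s - c1) * v + (c1 - c2) * v)" by (simp add: powr_def exp_add)
    also have "(Re s - c1) * v + (c1 - c2) * v = (Re s - c2) * v" by (simp add: algebra_simps)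
    finally show "norm (g v) \<le> C * exp ((Re s - c2) * v)" .
  qed
  have ex0: "(\<lambda>n. exp (- d * real n)) \<longlonglongrightarrow> 0" if "d > 0" for d :: real
    using that by real_asymp
  have l1: "(\<lambda>n. g (real n)) \<longlonglongrightarrow> 0"
  proof (rule Lim_null_comparison)
    show "\<forall>\<^sub>F n in sequentially. norm (g (real n)) \<le> K * exp (- (c1 - Re s) * real n)"
      by (intro always_eventually allI order.trans[OF gn(1)]) (simp add: algebra_simps)
    show "(\<lambda>n. K * exp (- (c1 - Re s) * real n)) \<longlonglongrightarrow> 0"
      using tendsto_mult_right_zero[OF ex0[of "c1 - Re s"]] c by simp
  qed
  have l2: "(\<lambda>n. g (- real n)) \<longlonglongrightarrow> 0"
  proof (rule Lim_null_comparison)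
    show "\<forall>\<^sub>F n in sequentially. norm (g (- real n)) \<le> C * exp (- (Re s - c2) * real n)"
      by (intro always_eventually allI order.trans[OF gn(2)]) (simp add: algebra_simps)
    show "(\<lambda>n. C * exp (- (Re s - c2) * real n)) \<longlonglongrightarrow> 0"
      using tendsto_mult_right_zero[OF ex0[of "Re s - c2"]] c by simp
  qed
  have "(\<lambda>n. g (real n) - g (- real n) - (s - of_real c1) * integral {- real n..real n} g) \<longlonglongrightarrow> 0 - 0 - (s - of_real c1) * (CLINT v|lborel. g v)"
    using int by (intro tendsto_intros l1 l2 vertical_line_integral_limit) (simp add: g_def[abs_def])
  moreover have "(\<lambda>n. R (exp (real n)) - R (exp (- real n))) \<longlonglongrightarrow> mellin f s - 0"
  proof (intro tendsto_diff)
    have "filterlim (\<lambda>n. exp (real n)) at_top sequentially" by real_asymp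
    from filterlim_compose[OF R(3) this] show "(\<lambda>n. R (exp (real n))) \<longlonglongrightarrow> mellin f s" by (simp add: mellin_def)
    have "(R \<longlongrightarrow> R 0) (at 0 within {0..})" using R(1) by (auto simp: continuous_on_def)
    then have "(R \<longlongrightarrow> 0) (at_right 0)" unfolding R(2) by (rule tendsto_within_subset) auto
    moreover have "filterlim (\<lambda>n. exp (- real n)) (at_right 0) sequentially" by real_asymp
    ultimately show "(\<lambda>n. R (exp (- real n))) \<longlonglongrightarrow> 0" by (rule filterlim_compose)
  qed
  ultimately have "mellin f s - 0 = 0 - 0 - (s - of_real c1) * (CLINT v|lborel. g v)"
    unfolding eq[symmetric] by (intro LIMSEQ_unique)
  then show ?thesis by (simp add: g_def[abs_def] algebra_simps)
qed

definition mellin_inverse :: "(real \<Rightarrow> complex) \<Rightarrow> real \<Rightarrow> real \<Rightarrow> complex" where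
  "mellin_inverse f \<sigma> x = 1 / (2 * pi) * (CLINT \<tau>|lborel. mellin f (of_real \<sigma> + \<i> * of_real \<tau>) * cpow x (- (of_real \<sigma> + \<i> * of_real \<tau>)))"

lemma mellin_inverse_continuous:
  assumes L1: "integrable lborel (\<lambda>\<tau>. mellin f (of_real \<sigma> + \<i> * of_real \<tau>))"
  shows "continuous_on {0<..} (mellin_inverse f \<sigma>)"
  unfolding continuous_on_sequentially
proof (intro allI ballI impI, elim conjE)
  fix X :: "nat \<Rightarrow> real" and x assume x: "x \<in> {0<..}" and X: "\<forall>n. X n \<in> {0<..}" "X \<longlonglongrightarrow> x"
  note [measurable] = borel_measurable_integrable[OF L1]
  have "(\<lambda>n. CLINT \<tau>|lborel. mellin f (of_real \<sigma> + \<i> * of_real \<tau>) * cpow (X n) (- (\<i> * of_real \<tau>))) \<longlonglongrightarrow>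
     (CLINT \<tau>|lborel. mellin f (of_real \<sigma> + \<i> * of_real \<tau>) * cpow x (- (\<i> * of_real \<tau>)))"
  proof (rule integral_dominated_convergence[where w = "\<lambda>\<tau>. norm (mellin f (of_real \<sigma> + \<i> * of_real \<tau>))"])
    show "AE \<tau> in lborel. norm (mellin f (of_real \<sigma> + \<i> * of_real \<tau>) * cpow (X n) (- (\<i> * of_real \<tau>))) \<le> norm (mellin f (of_real \<sigma> + \<i> * of_real \<tau>))" for n
      using X(1) by (intro AE_I2) (simp add: norm_mult norm_cpow)
    show "AE \<tau> in lborel. (\<lambda>n. mellin f (of_real \<sigma> + \<i> * of_real \<tau>) * cpow (X n) (- (\<i> * of_real \<tau>))) \<longlonglongrightarrow> mellin f (of_real \<sigma> + \<i> * of_real \<tau>) * cpow x (- (\<i> * of_real \<tau>))"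
      using x X(2) unfolding cpow_def by (intro AE_I2 tendsto_intros) auto
  qed (use L1 in auto)
  moreover have "(\<lambda>n. cpow (X n) (- of_real \<sigma>)) \<longlonglongrightarrow> cpow x (- of_real \<sigma>)"
    using x X(2) unfolding cpow_def by (intro tendsto_intros) auto
  ultimately have "(\<lambda>n. 1 / (2 * pi) * (cpow (X n) (- of_real \<sigma>) * (CLINT \<tau>|lborel. mellin f (of_real \<sigma> + \<i> * of_real \<tau>) * cpow (X n) (- (\<i> * of_real \<tau>))))) \<longlonglongrightarrow>
     1 / (2 * pi) * (cpow x (- of_real \<sigma>) * (CLINT \<tau>|lborel. mellin f (of_real \<sigma> + \<i> * of_real \<tau>) * cpow x (- (\<i> * of_real \<tau>))))"
    by (intro tendsto_intros)
  moreover have "mellin_inverse f \<sigma> y = 1 / (2 * pi) * (cpow y (- of_real \<sigma>) * (CLINT \<tau>|lborel. mellin f (of_real \<sigma> + \<i> * of_real \<tau>) * cpow y (- (\<i> * of_real \<tau>))))" for y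
  proof -
    have "mellin f (of_real \<sigma> + \<i> * of_real \<tau>) * cpow y (- (of_real \<sigma> + \<i> * of_real \<tau>)) =
        cpow y (- of_real \<sigma>) * (mellin f (of_real \<sigma> + \<i> * of_real \<tau>) * cpow y (- (\<i> * of_real \<tau>)))" for \<tau>
      using cpow_add[of y "- of_real \<sigma>" "- (\<i> * of_real \<tau>)"] by simp
    then show ?thesis unfolding mellin_inverse_def by (simp only: integral_mult_right_zero)
  qed
  ultimately show "(mellin_inverse f \<sigma> \<circ> X) \<longlonglongrightarrow> mellin_inverse f \<sigma> x" unfolding o_def by presburger
qed

text \<open>Over [a, b] both x^(c1 - 1) f and x^(c1 - 1) times the inverse transform have integral P
  b - P a: the first because P is its primitive, the second by Fubini and the inversion formula for
  P.\<close>

lemma mellin_inverse_primitive: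
  assumes c: "c2 < \<sigma>" "\<sigma> < c1"
    and i1: "mellin_integrand f (of_real c1) integrable_on {0<..}"
    and i2: "mellin_integrand f (of_real c2) integrable_on {0<..}"
    and ics: "\<And>\<tau>. mellin_integrand f (of_real \<sigma> + \<i> * of_real \<tau>) integrable_on {0<..}"
    and L1: "integrable lborel (\<lambda>\<tau>. mellin f (of_real \<sigma> + \<i> * of_real \<tau>))"
    and ab: "0 < a" "a \<le> b"
  shows "mellin_integrand f (of_real c1) integrable_on {a..b}"
    and "((\<lambda>u. cpow u (of_real c1 - 1) * mellin_inverse f \<sigma> u) has_integral integral {a..b} (mellin_integrand f (of_real c1))) {a..b}"
proof -
  obtain P where Pc: "continuous_on {0..} P" and P0: "P 0 = 0"
    and Pl: "(P \<longlongrightarrow> integral {0<..} (mellin_integrand f (of_real c1))) at_top"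
    and P: "\<And>a b. 0 < a \<Longrightarrow> a \<le> b \<Longrightarrow> (mellin_integrand f (of_real c1) has_integral (P b - P a)) {a..b}"
    by (rule hk_half_line_primitive[OF i1]) (rule that; assumption)
  show "mellin_integrand f (of_real c1) integrable_on {a..b}" using P[OF ab] by blast
  obtain K where K: "K > 0" "\<And>x. x \<ge> 0 \<Longrightarrow> norm (P x) \<le> K"
    by (rule bounded_on_half_line[OF Pc Pl]) (rule that; assumption)
  have c12: "c2 < c1" using c by simp
  obtain C where C: "C > 0" "\<And>x. x > 0 \<Longrightarrow> norm (P x) \<le> C * x powr (c1 - c2)"
    by (rule mellin_primitive_growth[OF c12 i2 _ Pc P0]) (rule P, assumption, assumption, (rule that; assumption))
  \<comment> \<open>In the variable v = ln x this weight makes P decay at both ends, by boundedness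
    for v > 0 and by the growth rate at 0 for v < 0.\<close>
  define \<phi> where "\<phi> v = exp (of_real ((\<sigma> - c1) * v)) * P (exp v)" for v
  define \<epsilon> where "\<epsilon> = min (c1 - \<sigma>) (\<sigma> - c2)"
  have \<epsilon>: "\<epsilon> > 0" "\<epsilon> \<le> c1 - \<sigma>" "\<epsilon> \<le> \<sigma> - c2" using c by (auto simp: \<epsilon>_def)
  have \<phi>b: "norm (\<phi> v) \<le> (K + C) * exp (- \<epsilon> * \<bar>v\<bar>)" for v
  proof -
    have n: "norm (\<phi> v) = exp ((\<sigma> - c1) * v) * norm (P (exp v))" by (simp add: \<phi>_def norm_mult)
    show ?thesis
    proof (cases "v \<ge> 0")
      case True
      have "norm (\<phi> v) \<le> exp ((\<sigma> - c1) * v) * K" unfolding n using K(2)[of "exp v"] by simp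
      also have "\<dots> \<le> exp (- \<epsilon> * \<bar>v\<bar>) * (K + C)"
        using True \<epsilon> K(1) C(1) mult_right_mono[OF \<epsilon>(2) True] by (intro mult_mono) (auto simp: algebra_simps)
      finally show ?thesis by (simp add: mult.commute)
    next
      case False
      have "norm (\<phi> v) \<le> exp ((\<sigma> - c1) * v) * (C * exp v powr (c1 - c2))"
        unfolding n using C(2)[of "exp v"] by (intro mult_left_mono) auto
      also have "\<dots> = exp ((\<sigma> - c1) * v + (c1 - c2) * v) * C" by (simp add: powr_def exp_add)
      also have "(\<sigma> - c1) * v + (c1 - c2) * v = (\<sigma> - c2) * v" by (simp add: algebra_simps)
      also have "exp ((\<sigma> - c2) * v) * C \<le> exp (- \<epsilon> * \<bar>v\<bar>) * (K + C)"
        using False \<epsilon> K(1) C(1) mult_right_mono[OF \<epsilon>(3), of "- v"] by (intro mult_mono) (auto simp: algebra_simps)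
      finally show ?thesis by (simp add: mult.commute)
    qed
  qed
  have \<phi>c: "continuous_on UNIV \<phi>"
    unfolding \<phi>_def by (intro continuous_intros continuous_on_compose2[OF Pc]) auto
  have \<phi>i: "integrable lborel \<phi>"
  proof (rule Bochner_Integration.integrable_bound)
    show "integrable lborel (\<lambda>v. (K + C) * exp (- \<epsilon> * \<bar>v\<bar>))"
      by (intro integrable_mult_right exp_neg_abs_integrable \<epsilon>)
    show "\<phi> \<in> borel_measurable lborel" using borel_measurable_continuous_onI[OF \<phi>c] by simp
    show "AE v in lborel. norm (\<phi> v) \<le> norm ((K + C) * exp (- \<epsilon> * \<bar>v\<bar>))"
      using \<phi>b by (intro AE_I2 order.trans[OF \<phi>b]) (use K C in auto)
  qed
  define s where "s \<tau> = complex_of_real \<sigma> + \<i> * of_real \<tau>" for \<tau>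
  have sr: "Re (s \<tau>) = \<sigma>" for \<tau> by (simp add: s_def)
  \<comment> \<open>Passing from f to P divides the transform by c1 - s. On Re s = \<sigma> this
    divisor has norm at least c1 - \<sigma>, so integrability is inherited from the transform of
    f.\<close>
  define \<psi> where "\<psi> \<tau> = mellin f (s \<tau>) / (of_real c1 - s \<tau>)" for \<tau>
  have snz: "of_real c1 - s \<tau> \<noteq> 0" for \<tau> using c by (auto simp: s_def complex_eq_iff)
  have hat: "\<psi> \<tau> = (CLINT u|lborel. \<phi> u * exp (\<i> * of_real (\<tau> * u)))" for \<tau>
  proof -
    have e: "exp ((s \<tau> - of_real c1) * of_real u) * P (exp u) = \<phi> u * exp (\<i> * of_real (\<tau> * u))" for u
      by (simp add: s_def \<phi>_def algebra_simps flip: exp_add)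
    have "integrable lborel (\<lambda>u. \<phi> u * exp (\<i> * of_real (\<tau> * u)))"
    proof (rule Bochner_Integration.integrable_bound[OF \<phi>i])
      show "(\<lambda>u. \<phi> u * exp (\<i> * of_real (\<tau> * u))) \<in> borel_measurable lborel"
        using borel_measurable_continuous_onI[OF \<phi>c] by measurable
    qed (auto simp: norm_mult)
    then have "mellin f (s \<tau>) = (of_real c1 - s \<tau>) * (CLINT u|lborel. \<phi> u * exp (\<i> * of_real (\<tau> * u)))"
      unfolding e[symmetric] using c ics by (intro mellin_as_fourier_transform[OF _ _ _ P Pc K(2) C(2)]) (auto simp: s_def)
    then show ?thesis using snz[of \<tau>] by (simp add: \<psi>_def)
  qed
  have mM: "(\<lambda>\<tau>. mellin f (s \<tau>)) \<in> borel_measurable borel" using borel_measurable_integrable[OF L1] by (simp add: s_def[abs_def])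
  have \<psi>m: "\<psi> \<in> borel_measurable borel"
  proof -
    have [measurable]: "(\<lambda>\<tau>. of_real c1 - s \<tau>) \<in> borel_measurable borel" unfolding s_def by measurable
    note [measurable] = mM
    show ?thesis unfolding \<psi>_def[abs_def] by measurable
  qed
  have nd: "c1 - \<sigma> \<le> norm (of_real c1 - s \<tau>)" for \<tau>
    using complex_Re_le_cmod[of "of_real c1 - s \<tau>"] by (simp add: s_def)
  have \<psi>b: "norm (\<psi> \<tau>) \<le> 1 / (c1 - \<sigma>) * norm (mellin f (s \<tau>))" for \<tau>
    using nd[of \<tau>] c snz[of \<tau>] by (simp add: \<psi>_def norm_divide frac_le)
  have \<psi>i: "integrable lborel \<psi>"
  proof (rule Bochner_Integration.integrable_bound)
    show "integrable lborel (\<lambda>\<tau>. 1 / (c1 - \<sigma>) * norm (mellin f (s \<tau>)))"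
      using L1 by (intro integrable_mult_right integrable_norm) (simp add: s_def)
    show "AE \<tau> in lborel. norm (\<psi> \<tau>) \<le> norm (1 / (c1 - \<sigma>) * norm (mellin f (s \<tau>)))"
      by (intro AE_I2 order.trans[OF \<psi>b]) (use c in simp)
  qed (use \<psi>m in simp)
  have Peq: "P x = 1 / (2 * pi) * (CLINT \<tau>|lborel. \<psi> \<tau> * cpow x (of_real c1 - s \<tau>))" if x: "x > 0" for x
  proof -
    have bd: "norm (\<phi> v) \<le> K + C" for v
    proof -
      have "exp (- \<epsilon> * \<bar>v\<bar>) \<le> 1" using \<epsilon> by simp
      then have "(K + C) * exp (- \<epsilon> * \<bar>v\<bar>) \<le> (K + C) * 1" using K C by (intro mult_left_mono) auto
      then show ?thesis using \<phi>b[of v] by simp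
    qed
    have "P x = exp (of_real ((c1 - \<sigma>) * ln x)) * \<phi> (ln x)"
      using x by (simp add: \<phi>_def algebra_simps flip: exp_add mult.assoc)
    also have "\<phi> (ln x) = 1 / (2 * pi) * (CLINT t|lborel. \<psi> t * exp (- \<i> * of_real (t * ln x)))"
      by (rule fourier_inversion[OF \<phi>i \<phi>c bd hat \<psi>i])
    also have "exp (of_real ((c1 - \<sigma>) * ln x)) * (1 / (2 * pi) * (CLINT t|lborel. \<psi> t * exp (- \<i> * of_real (t * ln x)))) =
       1 / (2 * pi) * (CLINT t|lborel. exp (of_real ((c1 - \<sigma>) * ln x)) * (\<psi> t * exp (- \<i> * of_real (t * ln x))))"
      by simp
    also have "(\<lambda>t. exp (of_real ((c1 - \<sigma>) * ln x)) * (\<psi> t * exp (- \<i> * of_real (t * ln x)))) = (\<lambda>\<tau>. \<psi> \<tau> * cpow x (of_real c1 - s \<tau>))"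
      by (simp add: cpow_def s_def algebra_simps flip: exp_add)
    finally show ?thesis .
  qed
  define N where "N u \<tau> = indicator {a..b} u *\<^sub>R (mellin f (s \<tau>) * cpow u (of_real c1 - s \<tau> - 1))" for u \<tau>
  have cb: "\<exists>\<kappa>. integrable lborel \<kappa> \<and> (\<forall>u \<tau>. norm (N u \<tau>) \<le> \<kappa> u * norm (mellin f (s \<tau>)))"
  proof (intro exI[of _ "\<lambda>u. indicator {a..b} u *\<^sub>R (u powr (c1 - \<sigma> - 1))"] conjI allI)
    show "integrable lborel (\<lambda>u. indicator {a..b} u *\<^sub>R (u powr (c1 - \<sigma> - 1)))"
      by (rule borel_integrable_compact) (use ab in \<open>auto intro!: continuous_intros\<close>)
    show "norm (N u \<tau>) \<le> indicator {a..b} u *\<^sub>R (u powr (c1 - \<sigma> - 1)) * norm (mellin f (s \<tau>))" for u \<tau>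
      using ab by (auto simp: N_def norm_mult norm_cpow sr indicator_def mult.commute)
  qed
  then obtain \<kappa> where \<kappa>: "integrable lborel \<kappa>" "\<And>u \<tau>. norm (N u \<tau>) \<le> \<kappa> u * norm (mellin f (s \<tau>))" by blast
  have Nm: "(\<lambda>(u,\<tau>). N u \<tau>) \<in> borel_measurable (lborel \<Otimes>\<^sub>M lborel)"
  proof -
    note [measurable] = mM
    have [measurable]: "s \<in> borel_measurable borel" unfolding s_def by measurable
    show ?thesis unfolding N_def by measurable
  qed
  have L1': "integrable lborel (\<lambda>\<tau>. mellin f (s \<tau>))" using L1 by (simp add: s_def)
  note fub = fubini_product_bound[OF Nm L1' \<kappa>]
  have in1: "(CLINT u|lborel. N u \<tau>) = \<psi> \<tau> * cpow b (of_real c1 - s \<tau>) - \<psi> \<tau> * cpow a (of_real c1 - s \<tau>)" for \<tau>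
  proof -
    have "((\<lambda>u. \<psi> \<tau> * ((of_real c1 - s \<tau>) * cpow u (of_real c1 - s \<tau> - 1))) has_integral \<psi> \<tau> * (cpow b (of_real c1 - s \<tau>) - cpow a (of_real c1 - s \<tau>))) {a..b}"
      by (intro has_integral_mult_right fundamental_theorem_of_calculus ab cpow_has_vector_derivative) (use ab in auto)
    moreover have "\<psi> \<tau> * ((of_real c1 - s \<tau>) * cpow u (of_real c1 - s \<tau> - 1)) = mellin f (s \<tau>) * cpow u (of_real c1 - s \<tau> - 1)" for u
      using snz[of \<tau>] by (simp add: \<psi>_def)
    ultimately have hi: "((\<lambda>u. mellin f (s \<tau>) * cpow u (of_real c1 - s \<tau> - 1)) has_integral \<psi> \<tau> * (cpow b (of_real c1 - s \<tau>) - cpow a (of_real c1 - s \<tau>))) {a..b}"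
      by simp
    have "set_integrable lborel {a..b} (\<lambda>u. mellin f (s \<tau>) * cpow u (of_real c1 - s \<tau> - 1))"
      unfolding set_integrable_def by (rule borel_integrable_compact) (use ab in \<open>auto intro!: continuous_intros\<close>)
    from set_borel_integral_eq_integral(2)[OF this]
    have "(CLINT u|lborel. N u \<tau>) = integral {a..b} (\<lambda>u. mellin f (s \<tau>) * cpow u (of_real c1 - s \<tau> - 1))"
      by (simp only: N_def set_lebesgue_integral_def)
    then show ?thesis unfolding integral_unique[OF hi] by (simp only: right_diff_distrib)
  qed
  have ci: "integrable lborel (\<lambda>\<tau>. \<psi> \<tau> * cpow x (of_real c1 - s \<tau>))" if "x > 0" for x
  proof (rule Bochner_Integration.integrable_bound)
    show "integrable lborel (\<lambda>\<tau>. x powr (c1 - \<sigma>) * norm (\<psi> \<tau>))" by (intro integrable_mult_right integrable_norm \<psi>i)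
    note [measurable] = \<psi>m
    have [measurable]: "s \<in> borel_measurable borel" unfolding s_def by measurable
    show "(\<lambda>\<tau>. \<psi> \<tau> * cpow x (of_real c1 - s \<tau>)) \<in> borel_measurable lborel" by measurable
  qed (use that in \<open>auto simp: norm_mult norm_cpow sr\<close>)
  have b0: "b > 0" using ab by simp
  have out: "(CLINT \<tau>|lborel. N u \<tau>) = indicator {a..b} u *\<^sub>R (2 * pi * (cpow u (of_real c1 - 1) * mellin_inverse f \<sigma> u))" for u
  proof -
    have "cpow u (of_real c1 - s \<tau> - 1) = cpow u (of_real c1 - 1) * cpow u (- s \<tau>)" for \<tau>
      by (simp add: algebra_simps flip: cpow_add)
    then have "N u \<tau> = indicator {a..b} u *\<^sub>R (cpow u (of_real c1 - 1) * (mellin f (s \<tau>) * cpow u (- s \<tau>)))" for \<tau>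
      by (simp add: N_def mult_ac)
    then show ?thesis by (simp add: mellin_inverse_def s_def)
  qed
  have si: "set_integrable lborel {a..b} (\<lambda>u. 2 * pi * (cpow u (of_real c1 - 1) * mellin_inverse f \<sigma> u))"
    using fub(2) unfolding out set_integrable_def .
  have "(LBINT u:{a..b}. 2 * pi * (cpow u (of_real c1 - 1) * mellin_inverse f \<sigma> u)) = 2 * pi * (P b - P a)"
    using fub(1) unfolding out in1 set_lebesgue_integral_def Peq[OF ab(1)] Peq[OF b0]
    by (simp add: Bochner_Integration.integral_diff ci ab b0 algebra_simps)
  then have "integral {a..b} (\<lambda>u. 2 * pi * (cpow u (of_real c1 - 1) * mellin_inverse f \<sigma> u)) = 2 * pi * (P b - P a)"
    using set_borel_integral_eq_integral(2)[OF si] by simp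
  then have "((\<lambda>u. 2 * pi * (cpow u (of_real c1 - 1) * mellin_inverse f \<sigma> u)) has_integral 2 * pi * (P b - P a)) {a..b}"
    using set_borel_integral_eq_integral(1)[OF si] integrable_integral by metis
  from has_integral_mult_right[OF this, of "1 / (2 * pi)"]
  have "((\<lambda>u. cpow u (of_real c1 - 1) * mellin_inverse f \<sigma> u) has_integral (P b - P a)) {a..b}" by simp
  then show "((\<lambda>u. cpow u (of_real c1 - 1) * mellin_inverse f \<sigma> u) has_integral integral {a..b} (mellin_integrand f (of_real c1))) {a..b}"
    using integral_unique[OF P[OF ab]] by simp
qed

text \<open>The primitive of D is identically 0, and at a continuity point its derivative is D
  x.\<close>

lemma null_integrals_imp_zero_at_continuity_point:
  fixes D :: "real \<Rightarrow> complex"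
  assumes D: "\<And>a b. 0 < a \<Longrightarrow> a \<le> b \<Longrightarrow> (D has_integral 0) {a..b}" and x: "x > 0" and c: "isCont D x"
  shows "D x = 0"
proof -
  have xx: "x \<in> {x/2..x+1}" "x \<in> {x/2<..<x+1}" using x by auto
  have "((\<lambda>u. integral {x/2..u} D) has_vector_derivative D x) (at x within {x/2..x+1} - {})"
    using D[of "x/2" "x+1"] x c by (intro integral_has_vector_derivative_continuous_at) (auto intro: continuous_at_imp_continuous_at_within)
  then have "((\<lambda>u. integral {x/2..u} D) has_vector_derivative D x) (at x within {x/2..x+1})" by simp
  then have "((\<lambda>u. 0) has_vector_derivative D x) (at x within {x/2..x+1})"
    by (rule has_vector_derivative_transform_within[where d = 1]) (use x D[THEN integral_unique] in auto)
  then have "((\<lambda>u. 0) has_vector_derivative D x) (at x)"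
    by (rule has_vector_derivative_within_subset[of _ _ _ "{x/2..x+1}" "{x/2<..<x+1}", THEN has_vector_derivative_within_open[OF xx(2) open_greaterThanLessThan, THEN iffD1]]) auto
  then show ?thesis using vector_derivative_unique_at[OF _ has_vector_derivative_const] by blast
qed

text \<open>Gauge integrals can be differentiated almost everywhere: off a negligible set a function
  is the limit of its averages over short intervals, and here all averages are 0. D is cut off below
  a because its integrals are given only away from 0.\<close>

lemma null_integrals_imp_AE_zero:
  fixes D :: "real \<Rightarrow> complex"
  assumes D: "\<And>a b. 0 < a \<Longrightarrow> a \<le> b \<Longrightarrow> (D has_integral 0) {a..b}"
  shows "AE x in lborel. x > 0 \<longrightarrow> D x = 0"
proof -
  have one: "AE x in lborel. x \<ge> a \<longrightarrow> D x = 0" if a: "a > 0" for a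
  proof -
    define E where "E x = (if x \<in> {a..} then D x else 0)" for x
    have E: "(E has_integral 0) {p..q}" for p q
    proof (cases "max a p \<le> q")
      case True
      have "(D has_integral 0) {max a p..q}" using True a by (intro D) auto
      then have "((\<lambda>x. if x \<in> {max a p..q} then D x else 0) has_integral 0) {p..q}"
        by (subst has_integral_restrict) auto
      then show ?thesis by (rule has_integral_eq[rotated]) (auto simp: E_def)
    next
      case False
      then show ?thesis by (intro has_integral_is_0) (auto simp: E_def)
    qed
    obtain N where N: "negligible N" "\<And>x e. x \<notin> N \<Longrightarrow> 0 < e \<Longrightarrow> \<exists>d>0. \<forall>h. 0 < h \<and> h < d \<longrightarrow>
        norm (integral (cbox x (x + h *\<^sub>R One)) E /\<^sub>R h ^ DIM(real) - E x) < e"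
    proof (rule integrable_ccontinuous_explicit[of E])
      show "E integrable_on cbox p q" for p q using E by auto
    qed blast
    have "E x = 0" if x: "x \<notin> N" for x
    proof (rule ccontr)
      assume "E x \<noteq> 0"
      then obtain d where d: "d > 0" "\<And>h. 0 < h \<Longrightarrow> h < d \<Longrightarrow> norm (integral (cbox x (x + h *\<^sub>R One)) E /\<^sub>R h ^ DIM(real) - E x) < norm (E x)"
        using N(2)[OF x, of "norm (E x)"] by auto
      have "integral (cbox x (x + (d / 2) *\<^sub>R One)) E = 0" using integral_unique[OF E] by simp
      then show False using d(2)[of "d / 2"] d(1) by simp
    qed
    then have "D x = 0" if "x \<notin> N" "x \<ge> a" for x using that unfolding E_def by fastforce
    then have "{x. \<not> (x \<ge> a \<longrightarrow> D x = 0)} \<subseteq> N" by blast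
    then have "{x. \<not> (x \<ge> a \<longrightarrow> D x = 0)} \<in> null_sets lebesgue"
      using N(1) negligible_subset negligible_iff_null_sets by blast
    then have "AE x in lebesgue. x \<ge> a \<longrightarrow> D x = 0" by (intro AE_I'[of "{x. \<not> (x \<ge> a \<longrightarrow> D x = 0)}"]) auto
    then show ?thesis by (simp add: AE_completion_iff)
  qed
  have "AE x in lborel. \<forall>n::nat. x \<ge> 1 / Suc n \<longrightarrow> D x = 0" unfolding AE_all_countable by (intro allI one) simp
  then show ?thesis
  proof eventually_elim
    case (elim x)
    show ?case
    proof
      assume "x > 0"
      then obtain n where "1 / real (Suc n) < x" using nat_approx_posE by blast
      then show "D x = 0" using elim by (meson less_imp_le)
    qed
  qed
qed

context
  fixes f :: "real \<Rightarrow> complex" and \<alpha> \<beta> :: real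
  assumes strip: "\<And>s. \<alpha> < Re s \<Longrightarrow> Re s < \<beta> \<Longrightarrow> mellin_integrand f s integrable_on {0<..}"
    and L1: "\<And>\<sigma>. \<alpha> < \<sigma> \<Longrightarrow> \<sigma> < \<beta> \<Longrightarrow> integrable lborel (\<lambda>\<tau>. mellin f (of_real \<sigma> + \<i> * of_real \<tau>))"
begin

text \<open>D is f minus its inverse transform, weighted by the nonvanishing power u^(c1 - 1). All
  its integrals over compact intervals of the half-line vanish, and the two conclusions are two ways
  of reading off D = 0.\<close>

lemma mellin_inversion:
  assumes s: "\<alpha> < \<sigma>" "\<sigma> < \<beta>"
  shows "x > 0 \<Longrightarrow> isCont f x \<Longrightarrow> f x = mellin_inverse f \<sigma> x"
    and "AE x in lborel. x > 0 \<longrightarrow> f x = mellin_inverse f \<sigma> x"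
proof -
  obtain c1 where c1: "\<sigma> < c1" "c1 < \<beta>" using dense[OF s(2)] by auto
  obtain c2 where c2: "\<alpha> < c2" "c2 < \<sigma>" using dense[OF s(1)] by auto
  define D where "D u = cpow u (of_real c1 - 1) * (f u - mellin_inverse f \<sigma> u)" for u
  have D: "(D has_integral 0) {a..b}" if ab: "0 < a" "a \<le> b" for a b
  proof -
    note prim = mellin_inverse_primitive[where ?c2.0 = c2 and ?c1.0 = c1 and \<sigma> = \<sigma> and f = f, OF c2(2) c1(1) strip strip strip L1 ab]
    have "((\<lambda>u. mellin_integrand f (of_real c1) u - cpow u (of_real c1 - 1) * mellin_inverse f \<sigma> u) has_integral
        integral {a..b} (mellin_integrand f (of_real c1)) - integral {a..b} (mellin_integrand f (of_real c1))) {a..b}"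
      using c1 c2 s by (intro has_integral_diff integrable_integral prim) auto
    then have "((\<lambda>u. mellin_integrand f (of_real c1) u - cpow u (of_real c1 - 1) * mellin_inverse f \<sigma> u) has_integral 0) {a..b}" by simp
    then show ?thesis by (rule has_integral_eq[rotated]) (use ab in \<open>auto simp: D_def mellin_integrand_eq algebra_simps\<close>)
  qed
  have "AE x in lborel. x > 0 \<longrightarrow> D x = 0" by (rule null_integrals_imp_AE_zero[OF D])
  then show "AE x in lborel. x > 0 \<longrightarrow> f x = mellin_inverse f \<sigma> x" by (simp add: D_def cpow_nz)
  assume x: "x > 0" and c: "isCont f x"
  have "isCont (mellin_inverse f \<sigma>) x" using mellin_inverse_continuous[OF L1[OF s]] x by (simp add: continuous_on_eq_continuous_at open_greaterThan)
  moreover have "isCont (\<lambda>u. cpow u (of_real c1 - 1)) x" using x unfolding cpow_def by (intro continuous_intros) auto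
  ultimately have "isCont D x" unfolding D_def using c by (intro continuous_intros)
  with D x have "D x = 0" by (intro null_integrals_imp_zero_at_continuity_point[of D x])
  then show "f x = mellin_inverse f \<sigma> x" by (simp add: D_def cpow_nz)
qed

end

section \<open>The functional equation on the Mellin side\<close>

lemma Re_notin_Ints:
  assumes "Re z \<notin> \<int>" shows "z \<notin> \<int>" "z \<notin> \<int>\<^sub>\<le>\<^sub>0"
proof -
  show "z \<notin> \<int>" using assms by (auto elim!: Ints_cases)
  then show "z \<notin> \<int>\<^sub>\<le>\<^sub>0" using nonpos_Ints_Int by blast
qed

lemma half_notin_Ints:
  assumes "Re (2 * y) \<notin> \<int>"
  shows "y \<notin> \<int>" "y \<notin> \<int>\<^sub>\<le>\<^sub>0" "y + 1/2 \<notin> \<int>" "y + 1/2 \<notin> \<int>\<^sub>\<le>\<^sub>0"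
proof -
  have "Re y \<notin> \<int>"
  proof
    assume "Re y \<in> \<int>"
    then have "2 * Re y \<in> \<int>" by (intro Ints_mult) auto
    then show False using assms by simp
  qed
  from Re_notin_Ints[OF this] show "y \<notin> \<int>" "y \<notin> \<int>\<^sub>\<le>\<^sub>0" .
  have "Re (y + 1/2) \<notin> \<int>"
  proof
    assume "Re (y + 1/2) \<in> \<int>"
    then have "2 * Re (y + 1/2) - 1 \<in> \<int>" by (intro Ints_mult Ints_diff) auto
    then show False using assms by (simp add: algebra_simps)
  qed
  from Re_notin_Ints[OF this] show "y + 1/2 \<notin> \<int>" "y + 1/2 \<notin> \<int>\<^sub>\<le>\<^sub>0" .
qed

lemma sin_pi_times_nonzero:
  assumes "y \<notin> \<int>" shows "sin (of_real pi * y :: complex) \<noteq> 0"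
proof
  assume "sin (of_real pi * y) = 0"
  then obtain n :: int where "of_real pi * y = of_real (of_int n * pi)" by (auto simp: sin_eq_0)
  then have "of_real pi * y = of_real pi * of_int n" by (simp add: mult.commute)
  then have "y = of_int n" by simp
  then show False using assms by simp
qed

text \<open>The functional equation at 1 - 2 y, solved by means of Gamma y rGamma y = 1. Half the
  zeta argument is taken as variable because the Gamma factors of the symbol have such
  arguments.\<close>

lemma riemann_zeta_reflect:
  assumes "Re (2 * y) \<notin> \<int>"
  shows "riemann_zeta (1 - 2 * y) = riemann_zeta (2 * y) * (Gamma y * rGamma (1/2 - y) * cpow pi (1/2 - 2 * y))"
proof -
  have nz: "1 - 2 * y \<noteq> 0" "1 - 2 * y \<noteq> 1" using assms by (auto simp: complex_eq_iff)
  have g: "Gamma y * rGamma y = 1"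
    using half_notin_Ints(2)[OF assms] by (simp add: rGamma_inverse_Gamma Gamma_eq_zero_iff)
  have "riemann_zeta (1 - 2 * y) * (rGamma y * cpow pi y) = riemann_zeta (2 * y) * (rGamma (1/2 - y) * cpow pi (1/2 - y))"
    using riemann_zeta_functional_equation[OF nz] by (simp add: diff_divide_distrib)
  note fe = this
  have e: "cpow pi y * cpow pi (- y) = 1" "cpow pi (1/2 - y) * cpow pi (- y) = cpow pi (1/2 - 2 * y)"
    by (simp_all flip: cpow_add)
  have "riemann_zeta (1 - 2 * y) = riemann_zeta (1 - 2 * y) * (Gamma y * rGamma y) * (cpow pi y * cpow pi (- y))"
    unfolding g e by simp
  also have "\<dots> = (riemann_zeta (1 - 2 * y) * (rGamma y * cpow pi y)) * (Gamma y * cpow pi (- y))" by (simp only: mult_ac)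
  also have "\<dots> = riemann_zeta (2 * y) * (Gamma y * rGamma (1/2 - y) * (cpow pi (1/2 - y) * cpow pi (- y)))"
    unfolding fe by (simp only: mult_ac)
  finally show ?thesis unfolding e .
qed

text \<open>By reflection both sides equal Gamma y Gamma (y + 1/2) / pi. For odd w this exchanges
  the cosines in the denominator at s for the sines at 1 - s, together with a half shift of the
  Gamma arguments.\<close>

lemma Gamma_rGamma_half_shift:
  assumes "Re (2 * y) \<notin> \<int>"
  shows "Gamma y * rGamma (1/2 - y) / cos (of_real pi * y) = Gamma (y + 1/2) * rGamma (1 - y) / sin (of_real pi * y)"
proof -
  note n = half_notin_Ints[OF assms]
  have s: "sin (of_real pi * y) \<noteq> 0" by (rule sin_pi_times_nonzero[OF n(1)])
  have sc: "sin (of_real pi * (y + 1/2)) = cos (of_real pi * y)"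
  proof -
    have "of_real pi * (y + 1/2) = of_real pi * y + of_real pi / 2" by (simp add: algebra_simps)
    then show ?thesis by (simp add: sin_add)
  qed
  have c: "cos (of_real pi * y) \<noteq> 0" using sin_pi_times_nonzero[OF n(3)] unfolding sc .
  have g: "Gamma y * rGamma y = 1" "Gamma (y + 1/2) * rGamma (y + 1/2) = 1"
    using n by (simp_all add: rGamma_inverse_Gamma Gamma_eq_zero_iff)
  have r1: "rGamma y * rGamma (1 - y) = sin (of_real pi * y) / of_real pi" by (rule rGamma_reflection_complex)
  have r2: "rGamma (y + 1/2) * rGamma (1/2 - y) = cos (of_real pi * y) / of_real pi"
    using rGamma_reflection_complex[of "y + 1/2"] by (simp add: sc)
  have h1: "rGamma (1 - y) = Gamma y * (sin (of_real pi * y) / of_real pi)"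
    unfolding r1[symmetric] mult.assoc[symmetric] g by simp
  have h2: "rGamma (1/2 - y) = Gamma (y + 1/2) * (cos (of_real pi * y) / of_real pi)"
    unfolding r2[symmetric] mult.assoc[symmetric] g by simp
  show ?thesis unfolding h1 h2 using s c by (simp add: divide_simps)
qed

lemma Gamma_shift_nat: "y \<notin> \<int>\<^sub>\<le>\<^sub>0 \<Longrightarrow> Gamma (y + of_nat k) = Gamma y * pochhammer (y::complex) k"
  by (simp add: pochhammer_Gamma Gamma_eq_zero_iff)

text \<open>In terms of a = (s + \<nu>) / 2 and b = (s - \<nu>) / 2 each zeta factor contributes one
  reflection, and the Pochhammer symbols account for the shift by k in the Gamma factors of the
  symbol.\<close>

lemma even_symbol_identity:
  assumes p: "Re (s + \<nu>) \<notin> \<int>" and m: "Re (s - \<nu>) \<notin> \<int>"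
  shows "riemann_zeta (1 - s - \<nu>) * riemann_zeta (1 - s + \<nu>) * pochhammer (s / 2 - \<nu> / 2) k * pochhammer (s / 2 + \<nu> / 2) k =
    cpow pi (1 - 2 * s) * mellin_symbol ((of_nat (2 * k) - \<nu>) / 2) ((of_nat (2 * k) + \<nu>) / 2) (s / 2) *
    (riemann_zeta (s - \<nu>) * riemann_zeta (s + \<nu>) * pochhammer ((1 - s) / 2 - \<nu> / 2) k * pochhammer ((1 - s) / 2 + \<nu> / 2) k)"
proof -
  define a where "a = s / 2 + \<nu> / 2"
  define b where "b = s / 2 - \<nu> / 2"
  have a2: "2 * a = s + \<nu>" and b2: "2 * b = s - \<nu>" by (simp_all add: a_def b_def)
  have pa: "Re (2 * a) \<notin> \<int>" and pb: "Re (2 * b) \<notin> \<int>" using p m unfolding a2 b2 .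
  have e: "1 - s - \<nu> = 1 - 2 * a" "1 - s + \<nu> = 1 - 2 * b" "(1 - s) / 2 - \<nu> / 2 = 1/2 - a" "(1 - s) / 2 + \<nu> / 2 = 1/2 - b"
    unfolding a2 b2 by (simp_all add: a_def b_def diff_divide_distrib)
  have g: "s / 2 + (of_nat (2 * k) - \<nu>) / 2 = b + of_nat k" "s / 2 + (of_nat (2 * k) + \<nu>) / 2 = a + of_nat k"
    "1 / 2 + (of_nat (2 * k) - \<nu>) / 2 - s / 2 = (1/2 - a) + of_nat k" "1 / 2 + (of_nat (2 * k) + \<nu>) / 2 - s / 2 = (1/2 - b) + of_nat k"
    by (simp_all add: a_def b_def field_simps)
  have c: "cpow pi (1 - 2 * s) = cpow pi (1/2 - 2 * a) * cpow pi (1/2 - 2 * b)"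
    unfolding a2 b2 cpow_add[symmetric] by (rule arg_cong[where f = "cpow pi"]) simp
  show ?thesis
    unfolding a_def[symmetric] b_def[symmetric] e a2[symmetric] b2[symmetric] mellin_symbol_def g c
      riemann_zeta_reflect[OF pa] riemann_zeta_reflect[OF pb]
      Gamma_shift_nat[OF half_notin_Ints(2)[OF pa]] Gamma_shift_nat[OF half_notin_Ints(2)[OF pb]]
      pochhammer_rGamma[of "1/2 - a" k] pochhammer_rGamma[of "1/2 - b" k]
    by (simp only: pochhammer_rGamma[of "1/2 - a" k] pochhammer_rGamma[of "1/2 - b" k] mult_ac)
qed

text \<open>The sum of cosines is 2 cos (pi a) cos (pi b) at s and 2 sin (pi a) sin (pi b) at 1 - s.
  Distributed over a and b, these factors reduce the identity to the reflections of zeta and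
  \<open>Gamma_rGamma_half_shift\<close>.\<close>

lemma odd_symbol_identity:
  assumes p: "Re (s + \<nu>) \<notin> \<int>" and m: "Re (s - \<nu>) \<notin> \<int>"
  shows "riemann_zeta (1 - s - \<nu>) * riemann_zeta (1 - s + \<nu>) * pochhammer (s / 2 - \<nu> / 2 + 1 / 2) k * pochhammer (s / 2 + \<nu> / 2 + 1 / 2) k
      / (2 * (cos (of_real pi * \<nu>) + cos (of_real pi * s))) =
    cpow pi (1 - 2 * s) * mellin_symbol ((of_nat (2 * k + 1) - \<nu>) / 2) ((of_nat (2 * k + 1) + \<nu>) / 2) (s / 2) *
    (riemann_zeta (s - \<nu>) * riemann_zeta (s + \<nu>) * pochhammer ((1 - s) / 2 - \<nu> / 2 + 1 / 2) k * pochhammer ((1 - s) / 2 + \<nu> / 2 + 1 / 2) k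
      / (2 * (cos (of_real pi * \<nu>) + cos (of_real pi * (1 - s)))))"
    and "cos (of_real pi * \<nu>) + cos (of_real pi * s) \<noteq> 0"
    and "cos (of_real pi * \<nu>) + cos (of_real pi * (1 - s)) \<noteq> 0"
proof -
  define a where "a = s / 2 + \<nu> / 2"
  define b where "b = s / 2 - \<nu> / 2"
  have a2: "2 * a = s + \<nu>" and b2: "2 * b = s - \<nu>" by (simp_all add: a_def b_def)
  have sab: "s = a + b" "\<nu> = a - b" by (simp_all add: a_def b_def)
  have pa: "Re (2 * a) \<notin> \<int>" and pb: "Re (2 * b) \<notin> \<int>" using p m unfolding a2 b2 .
  have e: "1 - s - \<nu> = 1 - 2 * a" "1 - s + \<nu> = 1 - 2 * b" "(1 - s) / 2 - \<nu> / 2 + 1 / 2 = 1 - a" "(1 - s) / 2 + \<nu> / 2 + 1 / 2 = 1 - b"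
    by (simp_all add: a_def b_def diff_divide_distrib)
  have g: "s / 2 + (of_nat (2 * k + 1) - \<nu>) / 2 = (b + 1/2) + of_nat k" "s / 2 + (of_nat (2 * k + 1) + \<nu>) / 2 = (a + 1/2) + of_nat k"
    "1 / 2 + (of_nat (2 * k + 1) - \<nu>) / 2 - s / 2 = (1 - a) + of_nat k" "1 / 2 + (of_nat (2 * k + 1) + \<nu>) / 2 - s / 2 = (1 - b) + of_nat k"
    by (simp_all add: a_def b_def field_simps)
  have c: "cpow pi (1 - 2 * s) = cpow pi (1/2 - 2 * a) * cpow pi (1/2 - 2 * b)"
    unfolding a2 b2 cpow_add[symmetric] by (rule arg_cong[where f = "cpow pi"]) simp
  have k1: "cos (of_real pi * \<nu>) + cos (of_real pi * s) = 2 * (cos (of_real pi * a) * cos (of_real pi * b))"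
    unfolding sab right_diff_distrib distrib_left cos_add cos_diff by simp
  have "cos (of_real pi * (1 - s)) = - cos (of_real pi * s)" by (simp add: right_diff_distrib cos_diff)
  then have k2: "cos (of_real pi * \<nu>) + cos (of_real pi * (1 - s)) = 2 * (sin (of_real pi * a) * sin (of_real pi * b))"
    unfolding sab right_diff_distrib distrib_left cos_add cos_diff by simp
  have sn: "sin (of_real pi * a) \<noteq> 0" "sin (of_real pi * b) \<noteq> 0"
    using sin_pi_times_nonzero half_notin_Ints(1) pa pb by blast+
  have cn: "cos (of_real pi * y) \<noteq> 0" if "Re (2 * y) \<notin> \<int>" for y
  proof -
    have "of_real pi * (y + 1/2) = of_real pi * y + of_real pi / 2" by (simp add: algebra_simps)
    then show ?thesis using sin_pi_times_nonzero[OF half_notin_Ints(3)[OF that]] by (simp add: sin_add)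
  qed
  show "cos (of_real pi * \<nu>) + cos (of_real pi * s) \<noteq> 0" unfolding k1 using cn pa pb by simp
  show "cos (of_real pi * \<nu>) + cos (of_real pi * (1 - s)) \<noteq> 0" unfolding k2 using sn by simp
  \<comment> \<open>In their cosine form \<open>A\<close> and \<open>B\<close> occur on the left
    side of the identity, in their sine form on the right.\<close>
  define A where "A = Gamma a * rGamma (1/2 - a) / cos (of_real pi * a)"
  define B where "B = Gamma b * rGamma (1/2 - b) / cos (of_real pi * b)"
  have A': "A = Gamma (a + 1/2) * rGamma (1 - a) / sin (of_real pi * a)" unfolding A_def by (rule Gamma_rGamma_half_shift[OF pa])
  have B': "B = Gamma (b + 1/2) * rGamma (1 - b) / sin (of_real pi * b)" unfolding B_def by (rule Gamma_rGamma_half_shift[OF pb])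
  define Z where "Z = riemann_zeta (2 * a) * riemann_zeta (2 * b) * cpow pi (1/2 - 2 * a) * cpow pi (1/2 - 2 * b) * pochhammer (a + 1/2) k * pochhammer (b + 1/2) k"
  have L: "riemann_zeta (1 - s - \<nu>) * riemann_zeta (1 - s + \<nu>) * pochhammer (s / 2 - \<nu> / 2 + 1 / 2) k * pochhammer (s / 2 + \<nu> / 2 + 1 / 2) k
      / (2 * (cos (of_real pi * \<nu>) + cos (of_real pi * s))) = Z * A * B / 4"
    unfolding a_def[symmetric] b_def[symmetric] e k1 riemann_zeta_reflect[OF pa] riemann_zeta_reflect[OF pb] A_def B_def Z_def
    by (simp add: mult_ac)
  have poch: "rGamma ((1 - a) + of_nat k) * pochhammer (1 - a) k = rGamma (1 - a)" "rGamma ((1 - b) + of_nat k) * pochhammer (1 - b) k = rGamma (1 - b)"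
    by (simp_all add: pochhammer_rGamma[of "1 - a" k] pochhammer_rGamma[of "1 - b" k] mult.commute)
  have R: "cpow pi (1 - 2 * s) * mellin_symbol ((of_nat (2 * k + 1) - \<nu>) / 2) ((of_nat (2 * k + 1) + \<nu>) / 2) (s / 2) *
    (riemann_zeta (s - \<nu>) * riemann_zeta (s + \<nu>) * pochhammer ((1 - s) / 2 - \<nu> / 2 + 1 / 2) k * pochhammer ((1 - s) / 2 + \<nu> / 2 + 1 / 2) k
      / (2 * (cos (of_real pi * \<nu>) + cos (of_real pi * (1 - s))))) = Z * A * B / 4"
    unfolding e a2[symmetric] b2[symmetric] k2 mellin_symbol_def g c
      Gamma_shift_nat[OF half_notin_Ints(4)[OF pa]] Gamma_shift_nat[OF half_notin_Ints(4)[OF pb]] A' B' Z_def poch[symmetric]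
    by (simp add: mult_ac)
  show "riemann_zeta (1 - s - \<nu>) * riemann_zeta (1 - s + \<nu>) * pochhammer (s / 2 - \<nu> / 2 + 1 / 2) k * pochhammer (s / 2 + \<nu> / 2 + 1 / 2) k
      / (2 * (cos (of_real pi * \<nu>) + cos (of_real pi * s))) =
    cpow pi (1 - 2 * s) * mellin_symbol ((of_nat (2 * k + 1) - \<nu>) / 2) ((of_nat (2 * k + 1) + \<nu>) / 2) (s / 2) *
    (riemann_zeta (s - \<nu>) * riemann_zeta (s + \<nu>) * pochhammer ((1 - s) / 2 - \<nu> / 2 + 1 / 2) k * pochhammer ((1 - s) / 2 + \<nu> / 2 + 1 / 2) k
      / (2 * (cos (of_real pi * \<nu>) + cos (of_real pi * (1 - s)))))"
    unfolding L R ..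
qed

section \<open>The kernel transform\<close>

text \<open>Hake's theorem: a gauge integral over the half-line may be computed as an improper one,
  so convergence at infinity may be conditional.\<close>

lemma has_integral_half_line_limit:
  fixes k :: "real \<Rightarrow> complex"
  assumes k: "\<And>b. b > 0 \<Longrightarrow> (k has_integral H b) {0<..<b}" and H: "(H \<longlongrightarrow> l) at_top"
  shows "(k has_integral l) {0<..}"
proof -
  define k0 where "k0 t = (if t \<in> {0<..} then k t else 0)" for t
  have box: "(k0 has_integral H b) {a..b}" if "a \<le> 0" "b > 0" for a b
  proof -
    have "((\<lambda>t. if t \<in> {0<..<b} then k t else 0) has_integral H b) {a..b}"
      by (subst has_integral_restrict) (use that k in auto)
    then show ?thesis by (rule has_integral_spike_finite[of "{b}", rotated 2]) (auto simp: k0_def)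
  qed
  show ?thesis
    unfolding has_integral_alt'[of k] k0_def[symmetric]
  proof (intro conjI allI impI)
    fix a b :: real
    have "min a 0 \<le> 0" "max b 1 > 0" by auto
    from box[OF this] have "k0 integrable_on {min a 0..max b 1}" by blast
    then show "k0 integrable_on cbox a b"
      unfolding cbox_interval by (rule integrable_on_subinterval) auto
  next
    fix e :: real assume "e > 0"
    then have "\<forall>\<^sub>F b in at_top. dist (H b) l < e" using H by (auto simp: tendsto_iff)
    then obtain B where B: "\<And>b. b \<ge> B \<Longrightarrow> dist (H b) l < e" by (auto simp: eventually_at_top_linorder)
    show "\<exists>B>0. \<forall>a b. ball 0 B \<subseteq> cbox a b \<longrightarrow> norm (integral (cbox a b) k0 - l) < e"
    proof (intro exI[of _ "max B 1"] conjI allI impI)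
      fix a b :: real assume "ball 0 (max B 1) \<subseteq> cbox a b"
      then have "{- max B 1<..<max B 1} \<subseteq> {a..b}" by (simp add: ball_eq_greaterThanLessThan)
      then have "a \<le> - max B 1" "max B 1 \<le> b" by (auto simp: greaterThanLessThan_subseteq_atLeastAtMost_iff)
      then have "a \<le> 0" "b > 0" "b \<ge> B" by auto
      then show "norm (integral (cbox a b) k0 - l) < e"
        using integral_unique[OF box[of a b]] B[of b] by (simp add: dist_norm)
    qed auto
  qed
qed

lemma kernel_truncated_mellin_scaled:
  fixes \<nu> w :: complex
  assumes c0: "\<bar>Re \<nu>\<bar> - Re w < c0" "c0 < 2 * \<sigma>" and \<sigma>: "\<sigma> < 1/4" and a: "a > 0"
  obtains B where "B \<ge> 0"
    "\<And>b s. b > 0 \<Longrightarrow> Re s = c0 \<Longrightarrow> set_integrable lborel {0<..<b} (\<lambda>t. cpow t (s - 1) * G_kernel \<nu> (4 * (a * t)) w)"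
    "\<And>b s. b > 0 \<Longrightarrow> Re s = c0 \<Longrightarrow>
       norm ((LBINT t:{0<..<b}. cpow t (s - 1) * G_kernel \<nu> (4 * (a * t)) w) -
         cpow a (- s) * (mellin_symbol ((w - \<nu>) / 2) ((w + \<nu>) / 2) (s / 2) / 2)) \<le> B * b powr (c0 - 2 * \<sigma>)"
proof -
  obtain B where B: "B \<ge> 0"
    "\<And>T s. T > 0 \<Longrightarrow> Re s = c0 \<Longrightarrow> set_integrable lborel {0<..<T} (\<lambda>X. cpow X (s - 1) * G_kernel \<nu> (4 * X) w)"
    "\<And>T s. T > 0 \<Longrightarrow> Re s = c0 \<Longrightarrow>
       norm ((LBINT X:{0<..<T}. cpow X (s - 1) * G_kernel \<nu> (4 * X) w) -
         mellin_symbol ((w - \<nu>) / 2) ((w + \<nu>) / 2) (s / 2) / 2) \<le> B * T powr (c0 - 2 * \<sigma>)"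
    by (rule G_kernel_truncated_mellin[OF c0 \<sigma>]) (rule that; assumption)
  have main: "set_integrable lborel {0<..<b} (\<lambda>t. cpow t (s - 1) * G_kernel \<nu> (4 * (a * t)) w) \<and>
      (LBINT t:{0<..<b}. cpow t (s - 1) * G_kernel \<nu> (4 * (a * t)) w) =
      cpow a (- s) * (LBINT X:{0<..<a * b}. cpow X (s - 1) * G_kernel \<nu> (4 * X) w)"
    if b: "b > 0" and s: "Re s = c0" for b s
  proof -
    define \<psi> where "\<psi> X = indicator {0<..<a * b} X *\<^sub>R G_kernel \<nu> (4 * X) w" for X
    have e1: "indicator {0<..} X *\<^sub>R (cpow X (s - 1) * \<psi> X) = indicator {0<..<a * b} X *\<^sub>R (cpow X (s - 1) * G_kernel \<nu> (4 * X) w)" for X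
      by (auto simp: \<psi>_def indicator_def)
    have e2: "indicator {0<..} t *\<^sub>R (cpow t (s - 1) * \<psi> (a * t)) = indicator {0<..<b} t *\<^sub>R (cpow t (s - 1) * G_kernel \<nu> (4 * (a * t)) w)" for t
      using a by (auto simp: \<psi>_def indicator_def zero_less_mult_iff)
    have "set_integrable lborel {0<..} (\<lambda>x. cpow x (s - 1) * \<psi> x)"
      using B(2)[of "a * b" s] a b s unfolding set_integrable_def e1 by simp
    from set_integrable_mellin_scale[OF a this] show ?thesis
      unfolding set_integrable_def set_lebesgue_integral_def e1 e2 by blast
  qed
  show ?thesis
  proof (rule that[of "a powr (- c0) * (B * a powr (c0 - 2 * \<sigma>))"])
    fix b :: real and s :: complex assume b: "b > 0" and s: "Re s = c0"
    show "set_integrable lborel {0<..<b} (\<lambda>t. cpow t (s - 1) * G_kernel \<nu> (4 * (a * t)) w)" using main[OF b s] by blast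
    have "norm (cpow a (- s) * ((LBINT X:{0<..<a * b}. cpow X (s - 1) * G_kernel \<nu> (4 * X) w) -
         mellin_symbol ((w - \<nu>) / 2) ((w + \<nu>) / 2) (s / 2) / 2)) \<le> a powr (- c0) * (B * (a * b) powr (c0 - 2 * \<sigma>))"
      unfolding norm_mult using a b s B(3)[of "a * b" s] by (simp add: norm_cpow)
    then show "norm ((LBINT t:{0<..<b}. cpow t (s - 1) * G_kernel \<nu> (4 * (a * t)) w) -
         cpow a (- s) * (mellin_symbol ((w - \<nu>) / 2) ((w + \<nu>) / 2) (s / 2) / 2)) \<le> a powr (- c0) * (B * a powr (c0 - 2 * \<sigma>)) * b powr (c0 - 2 * \<sigma>)"
      using main[OF b s] a b by (simp add: right_diff_distrib powr_mult mult_ac)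
  qed (use B in auto)
qed

lemma mellin_inverse_reflected:
  "mellin_inverse f (1 - c) t = 1 / (2 * pi) * (CLINT \<tau>|lborel. mellin f (1 - (of_real c + \<i> * of_real \<tau>)) * cpow t (of_real c + \<i> * of_real \<tau> - 1))"
  unfolding mellin_inverse_def
  by (subst lborel_integral_real_affine[where c = "-1" and t = 0]) (simp_all add: algebra_simps)

lemma integrable_reflect:
  fixes g :: "real \<Rightarrow> complex"
  assumes "integrable lborel g" shows "integrable lborel (\<lambda>t. g (- t))"
  using lborel_integrable_real_affine[OF assms, of "-1" 0] by simp

theorem kernel_transform_of_mellin_inverse:
  fixes \<nu> w :: complex and f :: "real \<Rightarrow> complex"
  assumes c0: "\<bar>Re \<nu>\<bar> - Re w < c0" "c0 < 1/2"
    and L: "integrable lborel (\<lambda>\<tau>. mellin f (of_real c0 + \<i> * of_real \<tau>))"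
    and L': "integrable lborel (\<lambda>\<tau>. mellin f (1 - (of_real c0 + \<i> * of_real \<tau>)))"
    and fe: "\<And>s. Re s = c0 \<Longrightarrow> mellin f s = cpow pi (1 - 2 * s) * mellin_symbol ((w - \<nu>) / 2) ((w + \<nu>) / 2) (s / 2) * mellin f (1 - s)"
    and x: "x > 0"
  shows "((\<lambda>t. mellin_inverse f (1 - c0) t * G_kernel \<nu> (4 * pi\<^sup>2 * x * t) w) has_integral mellin_inverse f c0 x / (2 * pi)) {0<..}"
proof -
  \<comment> \<open>The midpoint of c0 / 2 and 1/4, so that the truncation error b^(c0 - 2 \<sigma>)
    tends to 0.\<close>
  define \<sigma> where "\<sigma> = (c0 / 2 + 1/4) / 2"
  have \<sigma>: "c0 < 2 * \<sigma>" "\<sigma> < 1/4" using c0 by (auto simp: \<sigma>_def)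
  \<comment> \<open>4 a t is the kernel argument 4 pi^2 x t, in the normalisation 4 X of the kernel
    estimates.\<close>
  define a where "a = pi\<^sup>2 * x"
  have a: "a > 0" using x by (simp add: a_def)
  obtain B where B: "B \<ge> 0"
    "\<And>b s. b > 0 \<Longrightarrow> Re s = c0 \<Longrightarrow> set_integrable lborel {0<..<b} (\<lambda>t. cpow t (s - 1) * G_kernel \<nu> (4 * (a * t)) w)"
    "\<And>b s. b > 0 \<Longrightarrow> Re s = c0 \<Longrightarrow>
       norm ((LBINT t:{0<..<b}. cpow t (s - 1) * G_kernel \<nu> (4 * (a * t)) w) -
         cpow a (- s) * (mellin_symbol ((w - \<nu>) / 2) ((w + \<nu>) / 2) (s / 2) / 2)) \<le> B * b powr (c0 - 2 * \<sigma>)"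
    by (rule kernel_truncated_mellin_scaled[OF c0(1) \<sigma> a]) (rule that; assumption)
  define s where "s \<tau> = complex_of_real c0 + \<i> * of_real \<tau>" for \<tau>
  have sr: "Re (s \<tau>) = c0" for \<tau> by (simp add: s_def)
  have sm [measurable]: "s \<in> borel_measurable borel" unfolding s_def by measurable
  define m where "m \<tau> = mellin f (1 - s \<tau>)" for \<tau>
  have mi: "integrable lborel m" using L' by (simp add: m_def[abs_def] s_def)
  have mm [measurable]: "m \<in> borel_measurable borel" using borel_measurable_integrable[OF mi] by simp
  define J where "J b \<tau> = (LBINT t:{0<..<b}. cpow t (s \<tau> - 1) * G_kernel \<nu> (4 * (a * t)) w)" for b \<tau>
  define K where "K \<tau> = cpow a (- s \<tau>) * (mellin_symbol ((w - \<nu>) / 2) ((w + \<nu>) / 2) (s \<tau> / 2) / 2)" for \<tau>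
  define H where "H b = 1 / (2 * pi) * (CLINT \<tau>|lborel. m \<tau> * J b \<tau>)" for b
  \<comment> \<open>The powers of pi in a^(-s) and in the functional equation cancel up to a single
    pi, and \<open>K\<close> carries 1/2: together the factor 1 / (2 pi).\<close>
  have mK: "m \<tau> * K \<tau> = 1 / (2 * pi) * (mellin f (s \<tau>) * cpow x (- s \<tau>))" for \<tau>
  proof -
    have "cpow a (- s \<tau>) = cpow pi (- (2 * s \<tau>)) * cpow x (- s \<tau>)"
      unfolding a_def using x cpow_power[of pi 2 "- s \<tau>"] by (simp add: cpow_mult)
    moreover have "cpow pi (1 - 2 * s \<tau>) = of_real pi * cpow pi (- (2 * s \<tau>))"
      using cpow_add[of pi 1 "- (2 * s \<tau>)"] by simp
    ultimately show ?thesis using fe[OF sr[of \<tau>]] by (simp add: m_def K_def mult_ac)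
  qed
  have mKi: "integrable lborel (\<lambda>\<tau>. m \<tau> * K \<tau>)"
  proof -
    have "integrable lborel (\<lambda>\<tau>. mellin f (s \<tau>) * cpow x (- s \<tau>))"
    proof (rule Bochner_Integration.integrable_bound)
      show "integrable lborel (\<lambda>\<tau>. x powr (- c0) * norm (mellin f (s \<tau>)))"
        using L by (intro integrable_mult_right integrable_norm) (simp add: s_def)
      have [measurable]: "(\<lambda>\<tau>. mellin f (s \<tau>)) \<in> borel_measurable borel"
        using borel_measurable_integrable[OF L] by (simp add: s_def)
      show "(\<lambda>\<tau>. mellin f (s \<tau>) * cpow x (- s \<tau>)) \<in> borel_measurable lborel" by measurable
    qed (use x in \<open>auto simp: norm_mult norm_cpow sr mult.commute\<close>)
    then show ?thesis unfolding mK by (intro integrable_mult_right)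
  qed
  have fub: "(\<lambda>t. mellin_inverse f (1 - c0) t * G_kernel \<nu> (4 * pi\<^sup>2 * x * t) w) integrable_on {0<..<b} \<and>
      integral {0<..<b} (\<lambda>t. mellin_inverse f (1 - c0) t * G_kernel \<nu> (4 * pi\<^sup>2 * x * t) w) = H b \<and>
      integrable lborel (\<lambda>\<tau>. m \<tau> * J b \<tau>)" if b: "b > 0" for b
  proof -
    define N where "N t \<tau> = indicator {0<..<b} t *\<^sub>R (m \<tau> * (cpow t (s \<tau> - 1) * G_kernel \<nu> (4 * (a * t)) w))" for t \<tau>
    \<comment> \<open>On Re s = c0 the norm of t^(s - 1) is the same for all \<tau>, so one function
      of t dominates the kernel part.\<close>
    define \<kappa> where "\<kappa> t = norm (indicator {0<..<b} t *\<^sub>R (cpow t (of_real c0 - 1) * G_kernel \<nu> (4 * (a * t)) w))" for t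
    have ki: "integrable lborel \<kappa>"
      unfolding \<kappa>_def using B(2)[OF b, of "of_real c0"] unfolding set_integrable_def by (intro integrable_norm) simp
    have Nb: "norm (N t \<tau>) \<le> \<kappa> t * norm (m \<tau>)" for t \<tau>
      by (auto simp: N_def \<kappa>_def indicator_def norm_mult norm_cpow sr)
    have Nm: "(\<lambda>(t,\<tau>). N t \<tau>) \<in> borel_measurable (lborel \<Otimes>\<^sub>M lborel)"
    proof -
      define g where "g X = indicator {0<..} X *\<^sub>R G_kernel \<nu> (4 * X) w" for X
      have [measurable]: "g \<in> borel_measurable borel" unfolding g_def by (rule G_kernel_measurable)
      have e: "N t \<tau> = indicator {0<..<b} t *\<^sub>R (m \<tau> * (cpow t (s \<tau> - 1) * g (a * t)))" for t \<tau>
        using a by (auto simp: N_def g_def indicator_def)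
      show ?thesis unfolding e by measurable
    qed
    note F = fubini_product_bound[OF Nm mi ki Nb]
    have NJ: "(CLINT t|lborel. N t \<tau>) = m \<tau> * J b \<tau>" for \<tau>
    proof -
      have "N t \<tau> = m \<tau> * (indicator {0<..<b} t *\<^sub>R (cpow t (s \<tau> - 1) * G_kernel \<nu> (4 * (a * t)) w))" for t
        by (simp add: N_def)
      then show ?thesis unfolding J_def set_lebesgue_integral_def by (simp only: integral_mult_right_zero)
    qed
    have Ng: "(CLINT \<tau>|lborel. N t \<tau>) = indicator {0<..<b} t *\<^sub>R (2 * pi * (mellin_inverse f (1 - c0) t * G_kernel \<nu> (4 * pi\<^sup>2 * x * t) w))" for t
    proof -
      have "N t \<tau> = (indicator {0<..<b} t *\<^sub>R G_kernel \<nu> (4 * (a * t)) w) * (mellin f (1 - s \<tau>) * cpow t (s \<tau> - 1))" for \<tau>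
        by (simp add: N_def m_def mult_ac)
      then have "(CLINT \<tau>|lborel. N t \<tau>) = (indicator {0<..<b} t *\<^sub>R G_kernel \<nu> (4 * (a * t)) w) * (CLINT \<tau>|lborel. mellin f (1 - s \<tau>) * cpow t (s \<tau> - 1))"
        by (simp only: integral_mult_right_zero)
      also have "(CLINT \<tau>|lborel. mellin f (1 - s \<tau>) * cpow t (s \<tau> - 1)) = 2 * pi * mellin_inverse f (1 - c0) t"
        unfolding mellin_inverse_reflected s_def by simp
      finally show ?thesis by (simp add: a_def mult_ac)
    qed
    have si: "set_integrable lborel {0<..<b} (\<lambda>t. 2 * pi * (mellin_inverse f (1 - c0) t * G_kernel \<nu> (4 * pi\<^sup>2 * x * t) w))"
      using F(2) unfolding Ng set_integrable_def .
    note bi = set_borel_integral_eq_integral[OF si]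
    have "((\<lambda>t. 2 * pi * (mellin_inverse f (1 - c0) t * G_kernel \<nu> (4 * pi\<^sup>2 * x * t) w)) has_integral (CLINT \<tau>|lborel. m \<tau> * J b \<tau>)) {0<..<b}"
      using integrable_integral[OF bi(1)] bi(2) F(1) unfolding Ng NJ set_lebesgue_integral_def by simp
    from has_integral_mult_right[OF this, of "1 / (2 * pi)"]
    have "((\<lambda>t. mellin_inverse f (1 - c0) t * G_kernel \<nu> (4 * pi\<^sup>2 * x * t) w) has_integral H b) {0<..<b}"
      by (simp add: H_def)
    then show ?thesis using F(3) unfolding NJ by (auto simp: integral_unique)
  qed
  have "(H \<longlongrightarrow> mellin_inverse f c0 x / (2 * pi)) at_top"
  proof -
    have lim: "1 / (2 * pi) * (CLINT \<tau>|lborel. m \<tau> * K \<tau>) = mellin_inverse f c0 x / (2 * pi)"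
      unfolding mK mellin_inverse_def s_def by simp
    have "((\<lambda>b. H b - mellin_inverse f c0 x / (2 * pi)) \<longlongrightarrow> 0) at_top"
    proof (rule Lim_null_comparison)
      show "\<forall>\<^sub>F b in at_top. norm (H b - mellin_inverse f c0 x / (2 * pi)) \<le> 1 / (2 * pi) * ((LINT \<tau>|lborel. norm (m \<tau>)) * B) * b powr (c0 - 2 * \<sigma>)"
        using eventually_gt_at_top[of 0]
      proof eventually_elim
        case (elim b)
        have i: "integrable lborel (\<lambda>\<tau>. m \<tau> * J b \<tau>)" using fub[OF elim] by blast
        have "norm ((CLINT \<tau>|lborel. m \<tau> * J b \<tau>) - (CLINT \<tau>|lborel. m \<tau> * K \<tau>)) = norm (CLINT \<tau>|lborel. m \<tau> * J b \<tau> - m \<tau> * K \<tau>)"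
          using i mKi by (simp add: Bochner_Integration.integral_diff)
        also have "\<dots> \<le> (LINT \<tau>|lborel. norm (m \<tau> * J b \<tau> - m \<tau> * K \<tau>))" by (rule integral_norm_bound)
        also have "\<dots> \<le> (LINT \<tau>|lborel. norm (m \<tau>) * (B * b powr (c0 - 2 * \<sigma>)))"
        proof (intro integral_mono integrable_norm Bochner_Integration.integrable_diff i mKi integrable_mult_left mi)
          fix \<tau>
          show "norm (m \<tau> * J b \<tau> - m \<tau> * K \<tau>) \<le> norm (m \<tau>) * (B * b powr (c0 - 2 * \<sigma>))"
            using B(3)[OF elim sr[of \<tau>]] unfolding J_def K_def right_diff_distrib[symmetric] norm_mult by (intro mult_left_mono) auto
        qed
        also have "\<dots> = (LINT \<tau>|lborel. norm (m \<tau>)) * (B * b powr (c0 - 2 * \<sigma>))" by simp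
        finally have *: "norm ((CLINT \<tau>|lborel. m \<tau> * J b \<tau>) - (CLINT \<tau>|lborel. m \<tau> * K \<tau>)) \<le> (LINT \<tau>|lborel. norm (m \<tau>)) * (B * b powr (c0 - 2 * \<sigma>))" .
        have "norm (H b - mellin_inverse f c0 x / (2 * pi)) = 1 / (2 * pi) * norm ((CLINT \<tau>|lborel. m \<tau> * J b \<tau>) - (CLINT \<tau>|lborel. m \<tau> * K \<tau>))"
          unfolding lim[symmetric] H_def right_diff_distrib[symmetric] norm_mult by (simp add: norm_divide)
        also have "\<dots> \<le> 1 / (2 * pi) * ((LINT \<tau>|lborel. norm (m \<tau>)) * (B * b powr (c0 - 2 * \<sigma>)))"
          by (intro mult_left_mono *) auto
        finally show ?case by (simp only: mult.assoc)
      qed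
      have "((\<lambda>b. b powr (c0 - 2 * \<sigma>)) \<longlongrightarrow> 0) at_top" using \<sigma> by (intro tendsto_neg_powr filterlim_ident) auto
      then show "((\<lambda>b. 1 / (2 * pi) * ((LINT \<tau>|lborel. norm (m \<tau>)) * B) * b powr (c0 - 2 * \<sigma>)) \<longlongrightarrow> 0) at_top"
        by (rule tendsto_mult_right_zero)
    qed
    then show ?thesis by (simp add: LIM_zero_iff)
  qed
  moreover have "((\<lambda>t. mellin_inverse f (1 - c0) t * G_kernel \<nu> (4 * pi\<^sup>2 * x * t) w) has_integral H b) {0<..<b}" if "b > 0" for b
    using fub[OF that] by (metis integrable_integral)
  ultimately show ?thesis by (intro has_integral_half_line_limit)
qed

text \<open>A Mellin transform determines f only up to a null set, so the identity is asserted at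
  continuity points and almost everywhere. \<open>mellin_even\<close> and \<open>mellin_odd\<close>
  leave out the points where a zeta factor has its pole or the denominator vanishes; the proof uses
  a line that avoids them.\<close>

theorem theorem6p1:
  fixes w :: nat and z :: complex
    and f :: "real \<Rightarrow> complex" and F :: "complex \<Rightarrow> complex"
  assumes z: "\<bar>Re z\<bar> < 2 * real w + 1"
    and F_sym: "\<And>s. F s = F (1 - s)"
    and mellin_converges:
      "\<And>s. s \<in> mellin_strip w z \<Longrightarrow> mellin_integrand f s integrable_on {0<..}"
    and mellin_even:
      "\<And>s. even w \<Longrightarrow> s \<in> mellin_strip w z \<Longrightarrow> s \<noteq> z / 2 \<Longrightarrow> s \<noteq> - (z / 2) \<Longrightarrow>
        mellin f s =
          F s * riemann_zeta (1 - s - z / 2) * riemann_zeta (1 - s + z / 2) *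
          pochhammer (s / 2 - z / 4) (w div 2) * pochhammer (s / 2 + z / 4) (w div 2)"
    and mellin_odd:
      "\<And>s. odd w \<Longrightarrow> s \<in> mellin_strip w z \<Longrightarrow> s \<noteq> z / 2 \<Longrightarrow> s \<noteq> - (z / 2) \<Longrightarrow>
        cos (of_real pi * z / 2) + cos (of_real pi * s) \<noteq> 0 \<Longrightarrow>
        mellin f s =
          F s / (2 * (cos (of_real pi * z / 2) + cos (of_real pi * s))) *
          riemann_zeta (1 - s - z / 2) * riemann_zeta (1 - s + z / 2) *
          pochhammer (s / 2 - z / 4 + 1 / 2) ((w - 1) div 2) *
          pochhammer (s / 2 + z / 4 + 1 / 2) ((w - 1) div 2)"
    and mellin_L1:
      "\<And>c. complex_of_real c \<in> mellin_strip w z \<Longrightarrow>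
        integrable lborel (\<lambda>t. mellin f (1 - of_real c - \<i> * of_real t))"
  shows
    "(\<forall>x>0. (\<lambda>t. f t * G_kernel (z / 2) (4 * pi\<^sup>2 * x * t) (of_nat w)) integrable_on {0<..}) \<and>
     (\<forall>x>0. isCont f x \<longrightarrow>
        f x = 2 * of_real pi *
          integral {0<..} (\<lambda>t. f t * G_kernel (z / 2) (4 * pi\<^sup>2 * x * t) (of_nat w))) \<and>
     (AE x in lborel. x > 0 \<longrightarrow>
        f x = 2 * of_real pi *
          integral {0<..} (\<lambda>t. f t * G_kernel (z / 2) (4 * pi\<^sup>2 * x * t) (of_nat w)))"
proof -
  define \<nu> where "\<nu> = z / 2"
  \<comment> \<open>The strip of the hypotheses is \<alpha> < Re s < 1 - \<alpha>, and the bound on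
    Re z says that \<alpha> < 1/2.\<close>
  define \<alpha> where "\<alpha> = \<bar>Re \<nu>\<bar> - real w"
  have \<alpha>: "\<alpha> < 1/2" using z by (simp add: \<alpha>_def \<nu>_def)
  have strip: "s \<in> mellin_strip w z \<longleftrightarrow> \<alpha> < Re s \<and> Re s < 1 - \<alpha>" for s
    by (auto simp: mellin_strip_def \<alpha>_def \<nu>_def)
  \<comment> \<open>The hypothesis concerns 1 - c - i t; taking c = 1 - \<sigma> and reversing the
    sign of t reaches every line of the strip.\<close>
  have L1: "integrable lborel (\<lambda>\<tau>. mellin f (of_real \<sigma> + \<i> * of_real \<tau>))" if "\<alpha> < \<sigma>" "\<sigma> < 1 - \<alpha>" for \<sigma>
  proof -
    have "integrable lborel (\<lambda>t. mellin f (1 - of_real (1 - \<sigma>) - \<i> * of_real t))"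
      by (rule mellin_L1) (use that in \<open>simp add: strip\<close>)
    from integrable_reflect[OF this] show ?thesis by simp
  qed
  \<comment> \<open>Off these countably many abscissae neither s + \<nu> nor s - \<nu> has an
    integral real part, which keeps s and 1 - s away from the poles of the zeta factors and the
    zeros of the cosine sum.\<close>
  obtain c0 where c0: "\<alpha> < c0" "c0 < 1/2" "c0 \<notin> {c. c + Re \<nu> \<in> \<int>} \<union> {c. c + (- Re \<nu>) \<in> \<int>}"
    using interval_avoid_countable[OF \<alpha> countable_Un[OF countable_add_in_Ints countable_add_in_Ints]] by metis
  have fe: "mellin f s = cpow pi (1 - 2 * s) * mellin_symbol ((of_nat w - \<nu>) / 2) ((of_nat w + \<nu>) / 2) (s / 2) * mellin f (1 - s)"
    if s: "Re s = c0" for s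
  proof -
    have ni: "Re (s + \<nu>) \<notin> \<int>" "Re (s - \<nu>) \<notin> \<int>" using c0 s by auto
    have strips: "s \<in> mellin_strip w z" "1 - s \<in> mellin_strip w z" using c0 s by (auto simp: strip)
    have ne: "s \<noteq> z / 2" "s \<noteq> - (z / 2)" "1 - s \<noteq> z / 2" "1 - s \<noteq> - (z / 2)"
    proof -
      have "Re (s + \<nu>) \<noteq> 0" "Re (s - \<nu>) \<noteq> 0" "Re (s + \<nu>) \<noteq> 1" "Re (s - \<nu>) \<noteq> 1"
        using ni Ints_0 Ints_1 by metis+
      then show "s \<noteq> z / 2" "s \<noteq> - (z / 2)" "1 - s \<noteq> z / 2" "1 - s \<noteq> - (z / 2)"
        unfolding \<nu>_def[symmetric] by (auto simp: algebra_simps complex_eq_iff)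
    qed
    show ?thesis
    proof (cases "even w")
      case True
      then obtain k where k: "w = 2 * k" by blast
      have z4: "z / 4 = \<nu> / 2" "z / 2 = \<nu>" by (simp_all add: \<nu>_def)
      have "mellin f (1 - s) = F s * (riemann_zeta (s - \<nu>) * riemann_zeta (s + \<nu>) * pochhammer ((1 - s) / 2 - \<nu> / 2) k * pochhammer ((1 - s) / 2 + \<nu> / 2) k)"
        using mellin_even[OF True strips(2) ne(3,4)] F_sym[of s] by (simp add: z4 k mult.assoc)
      moreover have "mellin f s = F s * (riemann_zeta (1 - s - \<nu>) * riemann_zeta (1 - s + \<nu>) * pochhammer (s / 2 - \<nu> / 2) k * pochhammer (s / 2 + \<nu> / 2) k)"
        using mellin_even[OF True strips(1) ne(1,2)] by (simp add: z4 k mult.assoc)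
      ultimately show ?thesis unfolding even_symbol_identity[OF ni] k by (simp only: mult_ac)
    next
      case False
      then obtain k where k: "w = 2 * k + 1" using oddE by blast
      have kd: "(w - 1) div 2 = k" by (simp add: k)
      have z4: "z / 4 = \<nu> / 2" "z / 2 = \<nu>" "of_real pi * z / 2 = of_real pi * \<nu>" by (simp_all add: \<nu>_def)
      note odd = mellin_odd[OF False, unfolded kd z4]
      note id = odd_symbol_identity(1)[OF ni, of k] odd_symbol_identity(2,3)[OF ni]
      have "mellin f (1 - s) = F s / (2 * (cos (of_real pi * \<nu>) + cos (of_real pi * (1 - s)))) * riemann_zeta (s - \<nu>) * riemann_zeta (s + \<nu>) *
          pochhammer ((1 - s) / 2 - \<nu> / 2 + 1 / 2) k * pochhammer ((1 - s) / 2 + \<nu> / 2 + 1 / 2) k"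
        using odd[OF strips(2) ne(3,4)[unfolded z4] id(3)] F_sym[of s] by simp
      then have M': "mellin f (1 - s) = F s * (riemann_zeta (s - \<nu>) * riemann_zeta (s + \<nu>) * pochhammer ((1 - s) / 2 - \<nu> / 2 + 1 / 2) k * pochhammer ((1 - s) / 2 + \<nu> / 2 + 1 / 2) k
          / (2 * (cos (of_real pi * \<nu>) + cos (of_real pi * (1 - s)))))" by simp
      have M: "mellin f s = F s * (riemann_zeta (1 - s - \<nu>) * riemann_zeta (1 - s + \<nu>) * pochhammer (s / 2 - \<nu> / 2 + 1 / 2) k * pochhammer (s / 2 + \<nu> / 2 + 1 / 2) k
          / (2 * (cos (of_real pi * \<nu>) + cos (of_real pi * s))))"
        using odd[OF strips(1) ne(1,2)[unfolded z4] id(2)] by simp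
      show ?thesis unfolding M M' id(1) k by (simp only: mult_ac)
    qed
  qed
  have L': "integrable lborel (\<lambda>\<tau>. mellin f (1 - (of_real c0 + \<i> * of_real \<tau>)))"
    using integrable_reflect[OF L1[of "1 - c0"]] c0 by (simp add: algebra_simps)
  have cw: "\<bar>Re \<nu>\<bar> - Re (of_nat w) < c0" using c0 by (simp add: \<alpha>_def)
  have conv: "mellin_integrand f s integrable_on {0<..}" if "\<alpha> < Re s" "Re s < 1 - \<alpha>" for s
    using mellin_converges that by (simp add: strip)
  have c0': "c0 < 1 - \<alpha>" "\<alpha> < 1 - c0" "1 - c0 < 1 - \<alpha>" using c0 by auto
  \<comment> \<open>Inversion holds on every line of the strip. It is used at c0 for the value f x
    and at 1 - c0 for f under the integral, so no contour is shifted between the two lines.\<close>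
  have inv1: "f x = mellin_inverse f c0 x" if "x > 0" "isCont f x" for x
    using that c0(1) c0'(1) by (intro mellin_inversion(1)[of \<alpha> "1 - \<alpha>"] conv L1)
  have inv2: "AE x in lborel. x > 0 \<longrightarrow> f x = mellin_inverse f c0 x"
    using c0(1) c0'(1) by (intro mellin_inversion(2)[of \<alpha> "1 - \<alpha>"] conv L1)
  have inv3: "AE x in lborel. x > 0 \<longrightarrow> f x = mellin_inverse f (1 - c0) x"
    using c0' by (intro mellin_inversion(2)[of \<alpha> "1 - \<alpha>"] conv L1)
  \<comment> \<open>Changing the integrand on this null set does not affect a gauge integral, so f
    may replace its inverse transform there.\<close>
  have neg: "negligible {t. \<not> (t > 0 \<longrightarrow> f t = mellin_inverse f (1 - c0) t)}"
  proof -
    obtain N where N: "N \<in> null_sets lebesgue" "{t. \<not> (t > 0 \<longrightarrow> f t = mellin_inverse f (1 - c0) t)} \<subseteq> N"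
      using AE_completion[OF inv3] by (auto simp: eventually_ae_filter)
    then show ?thesis using negligible_subset negligible_iff_null_sets by blast
  qed
  have main: "((\<lambda>t. f t * G_kernel (z / 2) (4 * pi\<^sup>2 * x * t) (of_nat w)) has_integral mellin_inverse f c0 x / (2 * pi)) {0<..}" if "x > 0" for x
  proof (rule has_integral_spike[OF neg])
    show "((\<lambda>t. mellin_inverse f (1 - c0) t * G_kernel (z / 2) (4 * pi\<^sup>2 * x * t) (of_nat w)) has_integral mellin_inverse f c0 x / (2 * pi)) {0<..}"
      using kernel_transform_of_mellin_inverse[OF cw c0(2) L1[OF c0(1) c0'(1)] L' fe that] by (simp add: \<nu>_def)
  qed auto
  have val: "2 * of_real pi * integral {0<..} (\<lambda>t. f t * G_kernel (z / 2) (4 * pi\<^sup>2 * x * t) (of_nat w)) = mellin_inverse f c0 x" if "x > 0" for x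
    unfolding integral_unique[OF main[OF that]] by simp
  show ?thesis
  proof (intro conjI allI impI)
    show "(\<lambda>t. f t * G_kernel (z / 2) (4 * pi\<^sup>2 * x * t) (of_nat w)) integrable_on {0<..}" if "x > 0" for x
      using main[OF that] by blast
    show "f x = 2 * of_real pi * integral {0<..} (\<lambda>t. f t * G_kernel (z / 2) (4 * pi\<^sup>2 * x * t) (of_nat w))" if "x > 0" "isCont f x" for x
      using inv1[OF that] val[OF that(1)] by simp
    show "AE x in lborel. x > 0 \<longrightarrow> f x = 2 * of_real pi * integral {0<..} (\<lambda>t. f t * G_kernel (z / 2) (4 * pi\<^sup>2 * x * t) (of_nat w))"
      using inv2 by eventually_elim (simp add: val)
  qed
qed

end
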